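(* Let $p$ be a prime number, let $(R,\mathfrak{m},k)$ be a noetherian local ring and let $A$ be an $R$-algebra with $\mathfrak{m}A\ne A$. Assume that $A$ is perfectoid (and thus $k$ has characteristic $p$). Set $n = \dim R$. If $M$ is an $R$-module with $\operatorname{Tor}^{R}_{i}(A,M)=0$ for all $i$ with $s\le i\le s+n+1$, for some integer $s\ge 0$, then $$\operatorname{Tor}_{s+n+1}^{R}(k,M)=0.$$ In particular, if $\operatorname{Tor}^{R}_{j}(A,M)=0$ for all $j\gg 0$, then $\operatorname{Tor}^{R}_{j}(k,M)=0$ for all $j\gg 0$.
   Context: All rings are commutative. $(R,\mathfrak m,k)$ local means $R$ has unique maximal ideal $\mathfrak m$ and residue field $k=R/\mathfrak m$. Fix a prime $p$; perfectoid is with respect to $p$. A ring of characteristic $p$ is perfect if its Frobenius endomorphism is bijective. For a ring $A$, the tilt is $A^\flat := \varprojlim_{x\mapsto x^p} A/p$, a perfect ring of characteristic $p$, and $A_{\inf}(A) := W(A^\flat)$ is its ring of ($p$-typical) Witt vectors. When $A$ is $p$-adically complete, Fontaine's map $\theta\colon A_{\inf}(A)\to A$ is the unique ring map lifting the projection $A^\flat\to A/p$ (i.e. its composite with $A\to A/p$ is $W(A^\flat)\to A^\flat\to A/p$). A ring $A$ is perfectoid if: (1) $A$ is $p$-adically complete (i.e. $A\to\varprojlim_n A/p^n$ is an isomorphism); (2) the Frobenius $A/p\to A/p$ is surjective; (3) the kernel of $\theta\colon A_{\inf}(A)\to A$ is principal; (4) there exists $\varpi\in A$ with $\varpi^p =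 pu$ for a unit $u\in A$. *)

theory Defs
  imports "HOL-Algebra.Algebra" "HOL-Library.Poly_Mapping" "HOL-Library.Extended_Nat"
begin

section \<open>Local rings and Krull dimension\<close>

definition local_ring :: "('r, 'q) ring_scheme \<Rightarrow> 'r set \<Rightarrow> bool" where
  "local_ring R \<mm> \<longleftrightarrow> cring R \<and> maximalideal \<mm> R \<and> (\<forall>J. maximalideal J R \<longrightarrow> J = \<mm>)"

definition krull_dim :: "('r, 'q) ring_scheme \<Rightarrow> enat" where
  "krull_dim R = Sup {enat n | n. \<exists>P :: nat \<Rightarrow> 'r set.
     (\<forall>i\<le>n. primeideal (P i) R) \<and> (\<forall>i<n. P i \<subset> P (Suc i))}"


section \<open>Modules and tensor products\<close>

text \<open>The module record of HOL-Algebra extends the ring record; for a plain module the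
  multiplicative fields play no role and are left undefined.\<close>

definition mk_module ::
  "'b set \<Rightarrow> 'b \<Rightarrow> ('b \<Rightarrow> 'b \<Rightarrow> 'b) \<Rightarrow> ('r \<Rightarrow> 'b \<Rightarrow> 'b) \<Rightarrow> ('r, 'b) module" where
  "mk_module C z a s =
     \<lparr>carrier = C, monoid.mult = undefined, one = undefined, ring.zero = z, ring.add = a, smult = s\<rparr>"

definition regular_module :: "('r, 'q) ring_scheme \<Rightarrow> ('r, 'r) module" where
  "regular_module R = mk_module (carrier R) \<zero>\<^bsub>R\<^esub> (ring.add R) (monoid.mult R)"

definition quot_module :: "('r, 'b, 'q) module_scheme \<Rightarrow> 'b set \<Rightarrow> ('r, 'b set) module" where
  "quot_module M N = mk_module (a_rcosets\<^bsub>M\<^esub> N) N (set_add M)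
     (\<lambda>r U. \<Union>x\<in>U. N +>\<^bsub>M\<^esub> (r \<odot>\<^bsub>M\<^esub> x))"

definition submodule_gen ::
  "('r, 'q) ring_scheme \<Rightarrow> ('r, 'b, 'q1) module_scheme \<Rightarrow> 'b set \<Rightarrow> 'b set" where
  "submodule_gen R M U = \<Inter>{H. submodule H R M \<and> U \<subseteq> H}"

text \<open>Elements of the free module on \<open>S\<close> are finitely supported functions, vanishing outside \<open>S\<close>.\<close>

definition free_module :: "('r, 'q) ring_scheme \<Rightarrow> 's set \<Rightarrow> ('r, 's \<Rightarrow> 'r) module" where
  "free_module R S = mk_module
     {x. (\<forall>s\<in>S. x s \<in> carrier R) \<and> (\<forall>s. s \<notin> S \<longrightarrow> x s = \<zero>\<^bsub>R\<^esub>) \<and> finite {s. x s \<noteq> \<zero>\<^bsub>R\<^esub>}}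
     (\<lambda>s. \<zero>\<^bsub>R\<^esub>) (\<lambda>x y s. x s \<oplus>\<^bsub>R\<^esub> y s) (\<lambda>r x s. r \<otimes>\<^bsub>R\<^esub> x s)"

definition free_basis :: "('r, 'q) ring_scheme \<Rightarrow> 's \<Rightarrow> 's \<Rightarrow> 'r" where
  "free_basis R s = (\<lambda>t. if t = s then \<one>\<^bsub>R\<^esub> else \<zero>\<^bsub>R\<^esub>)"

text \<open>The linear map from a free module to \<open>M\<close> sending each basis vector \<open>s\<close> to \<open>g s\<close>.\<close>

definition lin_extend ::
  "('r, 'q) ring_scheme \<Rightarrow> ('r, 'b, 'q1) module_scheme \<Rightarrow> ('s \<Rightarrow> 'b) \<Rightarrow> ('s \<Rightarrow> 'r) \<Rightarrow> 'b" where
  "lin_extend R M g x = (\<Oplus>\<^bsub>M\<^esub> s \<in> {s. x s \<noteq> \<zero>\<^bsub>R\<^esub>}. x s \<odot>\<^bsub>M\<^esub> g s)"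

definition tensor_free ::
  "('r, 'q) ring_scheme \<Rightarrow> ('r, 'a, 'q1) module_scheme \<Rightarrow> ('r, 'b, 'q2) module_scheme
     \<Rightarrow> ('r, 'a \<times> 'b \<Rightarrow> 'r) module" where
  "tensor_free R M N = free_module R (carrier M \<times> carrier N)"

definition tensor_rel ::
  "('r, 'q) ring_scheme \<Rightarrow> ('r, 'a, 'q1) module_scheme \<Rightarrow> ('r, 'b, 'q2) module_scheme
     \<Rightarrow> ('a \<times> 'b \<Rightarrow> 'r) set" where
  "tensor_rel R M N = (let F = tensor_free R M N; e = (\<lambda>x y. free_basis R (x, y)) in
     submodule_gen R F
      ({e (x \<oplus>\<^bsub>M\<^esub> x') y \<ominus>\<^bsub>F\<^esub> (e x y \<oplus>\<^bsub>F\<^esub> e x' y) | x x' y.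
          x \<in> carrier M \<and> x' \<in> carrier M \<and> y \<in> carrier N}
     \<union> {e x (y \<oplus>\<^bsub>N\<^esub> y') \<ominus>\<^bsub>F\<^esub> (e x y \<oplus>\<^bsub>F\<^esub> e x y') | x y y'.
          x \<in> carrier M \<and> y \<in> carrier N \<and> y' \<in> carrier N}
     \<union> {e (r \<odot>\<^bsub>M\<^esub> x) y \<ominus>\<^bsub>F\<^esub> (r \<odot>\<^bsub>F\<^esub> e x y) | r x y.
          r \<in> carrier R \<and> x \<in> carrier M \<and> y \<in> carrier N}
     \<union> {e x (r \<odot>\<^bsub>N\<^esub> y) \<ominus>\<^bsub>F\<^esub> (r \<odot>\<^bsub>F\<^esub> e x y) | r x y.
          r \<in> carrier R \<and> x \<in> carrier M \<and> y \<in> carrier N}))"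

definition tensor ::
  "('r, 'q) ring_scheme \<Rightarrow> ('r, 'a, 'q1) module_scheme \<Rightarrow> ('r, 'b, 'q2) module_scheme
     \<Rightarrow> ('r, ('a \<times> 'b \<Rightarrow> 'r) set) module" where
  "tensor R M N = quot_module (tensor_free R M N) (tensor_rel R M N)"

definition pure_tensor ::
  "('r, 'q) ring_scheme \<Rightarrow> ('r, 'a, 'q1) module_scheme \<Rightarrow> ('r, 'b, 'q2) module_scheme
     \<Rightarrow> 'a \<Rightarrow> 'b \<Rightarrow> ('a \<times> 'b \<Rightarrow> 'r) set" where
  "pure_tensor R M N x y = tensor_rel R M N +>\<^bsub>tensor_free R M N\<^esub> free_basis R (x, y)"

text \<open>The map \<open>id \<otimes> f\<close> from \<open>M \<otimes> N\<close> to \<open>M \<otimes> N'\<close> induced by a linear map \<open>f\<close> from \<open>N\<close> to \<open>N'\<close>;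
  an element of \<open>M \<otimes> N\<close> is a coset of formal sums, all of which have the same image.\<close>

definition tensor_map ::
  "('r, 'q) ring_scheme \<Rightarrow> ('r, 'a, 'q1) module_scheme \<Rightarrow> ('r, 'b, 'q2) module_scheme
     \<Rightarrow> ('b1 \<Rightarrow> 'b) \<Rightarrow> ('a \<times> 'b1 \<Rightarrow> 'r) set \<Rightarrow> ('a \<times> 'b \<Rightarrow> 'r) set" where
  "tensor_map R M N' f U =
     the_elem (lin_extend R (tensor R M N') (\<lambda>(x, y). pure_tensor R M N' x (f y)) ` U)"


section \<open>Tor\<close>

text \<open>Tor is computed from an explicit free resolution of \<open>M\<close>:
  \<open>F\<^sub>0\<close> is free on the elements of \<open>M\<close>, and \<open>F\<^sub>n\<^sub>+\<^sub>1\<close> is free on the syzygies of \<open>F\<^sub>n\<close>, i.e. on the lists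
  \<open>[(r\<^sub>1, g\<^sub>1), \<dots>, (r\<^sub>k, g\<^sub>k)]\<close> of coefficients and generators \<open>g\<^sub>j\<close> of \<open>F\<^sub>n\<close> for which
  \<open>r\<^sub>1 g\<^sub>1 + \<dots> + r\<^sub>k g\<^sub>k\<close> is mapped to zero in \<open>F\<^sub>n\<^sub>-\<^sub>1\<close> (in \<open>M\<close>, if \<open>n = 0\<close>).
  The recursive type lets the generators of all the \<open>F\<^sub>n\<close> live in a single type.\<close>

datatype ('r, 'm) gen = Elt (gen_elt: 'm) | Syz (gen_syz: "('r \<times> ('r, 'm) gen) list")

definition list_comb ::
  "('r, 'b, 'q) module_scheme \<Rightarrow> ('s \<Rightarrow> 'b) \<Rightarrow> ('r \<times> 's) list \<Rightarrow> 'b" where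
  "list_comb M g l = foldr (\<lambda>(r, s) x. (r \<odot>\<^bsub>M\<^esub> g s) \<oplus>\<^bsub>M\<^esub> x) l \<zero>\<^bsub>M\<^esub>"

text \<open>The image in \<open>F\<^sub>n\<close> of a generator of \<open>F\<^sub>n\<^sub>+\<^sub>1\<close>. The operations of \<open>free_module R S\<close> do not
  depend on \<open>S\<close>, so the index \<open>n\<close> is not needed.\<close>

definition gen_boundary :: "('r, 'q) ring_scheme \<Rightarrow> ('r, 'm) gen \<Rightarrow> ('r, 'm) gen \<Rightarrow> 'r" where
  "gen_boundary R g = list_comb (free_module R UNIV) (free_basis R) (gen_syz g)"

fun res_gens :: "('r, 'q) ring_scheme \<Rightarrow> ('r, 'm, 'q1) module_scheme \<Rightarrow> nat \<Rightarrow> ('r, 'm) gen set"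
where
  "res_gens R M 0 = Elt ` carrier M"
| "res_gens R M (Suc 0) = Syz ` {l. set l \<subseteq> carrier R \<times> res_gens R M 0 \<and>
     list_comb M gen_elt l = \<zero>\<^bsub>M\<^esub>}"
| "res_gens R M (Suc (Suc n)) = Syz ` {l. set l \<subseteq> carrier R \<times> res_gens R M (Suc n) \<and>
     list_comb (free_module R UNIV) (gen_boundary R) l = \<zero>\<^bsub>free_module R (UNIV :: ('r, 'm) gen set)\<^esub>}"

definition res ::
  "('r, 'q) ring_scheme \<Rightarrow> ('r, 'm, 'q1) module_scheme \<Rightarrow> nat \<Rightarrow> ('r, ('r, 'm) gen \<Rightarrow> 'r) module" where
  "res R M n = free_module R (res_gens R M n)"

definition res_aug ::
  "('r, 'q) ring_scheme \<Rightarrow> ('r, 'm, 'q1) module_scheme \<Rightarrow> (('r, 'm) gen \<Rightarrow> 'r) \<Rightarrow> 'm" where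
  "res_aug R M = lin_extend R M gen_elt"

definition res_diff ::
  "('r, 'q) ring_scheme \<Rightarrow> ('r, 'm, 'q1) module_scheme \<Rightarrow> nat
     \<Rightarrow> (('r, 'm) gen \<Rightarrow> 'r) \<Rightarrow> (('r, 'm) gen \<Rightarrow> 'r)" where
  "res_diff R M n = lin_extend R (res R M n) (gen_boundary R)"
  \<comment> \<open>the differential from degree \<open>n + 1\<close> to degree \<open>n\<close>\<close>

definition tor_complex ::
  "('r, 'q) ring_scheme \<Rightarrow> ('r, 'a, 'q1) module_scheme \<Rightarrow> ('r, 'm, 'q2) module_scheme \<Rightarrow> nat
     \<Rightarrow> ('r, ('a \<times> (('r, 'm) gen \<Rightarrow> 'r) \<Rightarrow> 'r) set) module" where
  "tor_complex R N M n = tensor R N (res R M n)"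

definition tor_diff ::
  "('r, 'q) ring_scheme \<Rightarrow> ('r, 'a, 'q1) module_scheme \<Rightarrow> ('r, 'm, 'q2) module_scheme \<Rightarrow> nat
     \<Rightarrow> ('a \<times> (('r, 'm) gen \<Rightarrow> 'r) \<Rightarrow> 'r) set \<Rightarrow> ('a \<times> (('r, 'm) gen \<Rightarrow> 'r) \<Rightarrow> 'r) set" where
  "tor_diff R N M n = tensor_map R N (res R M n) (res_diff R M n)"

fun tor_cycles ::
  "('r, 'q) ring_scheme \<Rightarrow> ('r, 'a, 'q1) module_scheme \<Rightarrow> ('r, 'm, 'q2) module_scheme \<Rightarrow> nat
     \<Rightarrow> ('a \<times> (('r, 'm) gen \<Rightarrow> 'r) \<Rightarrow> 'r) set set" where
  "tor_cycles R N M 0 = carrier (tor_complex R N M 0)"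
| "tor_cycles R N M (Suc n) =
     a_kernel (tor_complex R N M (Suc n)) (tor_complex R N M n) (tor_diff R N M n)"

definition tor_boundaries ::
  "('r, 'q) ring_scheme \<Rightarrow> ('r, 'a, 'q1) module_scheme \<Rightarrow> ('r, 'm, 'q2) module_scheme \<Rightarrow> nat
     \<Rightarrow> ('a \<times> (('r, 'm) gen \<Rightarrow> 'r) \<Rightarrow> 'r) set set" where
  "tor_boundaries R N M n = tor_diff R N M n ` carrier (tor_complex R N M (Suc n))"

definition Tor ::
  "nat \<Rightarrow> ('r, 'q) ring_scheme \<Rightarrow> ('r, 'a, 'q1) module_scheme \<Rightarrow> ('r, 'm, 'q2) module_scheme
     \<Rightarrow> ('r, ('a \<times> (('r, 'm) gen \<Rightarrow> 'r) \<Rightarrow> 'r) set set) module" where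
  "Tor i R N M = quot_module ((tor_complex R N M i)\<lparr>carrier := tor_cycles R N M i\<rparr>)
     (tor_boundaries R N M i)"

definition is_zero_module :: "('r, 'b, 'q) module_scheme \<Rightarrow> bool" where
  "is_zero_module M \<longleftrightarrow> carrier M = {\<zero>\<^bsub>M\<^esub>}"


section \<open>Witt vectors\<close>

text \<open>Integer polynomials in the variables \<open>X\<^sub>i\<close> (encoded as \<open>Inl i\<close>) and \<open>Y\<^sub>i\<close> (encoded as \<open>Inr i\<close>):
  finitely supported maps from exponent vectors to coefficients, with the convolution product.\<close>

type_synonym witt_poly = "((nat + nat) \<Rightarrow>\<^sub>0 nat) \<Rightarrow>\<^sub>0 int"

definition poly_var :: "nat + nat \<Rightarrow> witt_poly" where
  "poly_var v = Poly_Mapping.single (Poly_Mapping.single v 1) 1"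

definition poly_eval :: "('b, 'q) ring_scheme \<Rightarrow> witt_poly \<Rightarrow> (nat + nat \<Rightarrow> 'b) \<Rightarrow> 'b" where
  "poly_eval B P f = (\<Oplus>\<^bsub>B\<^esub> m \<in> Poly_Mapping.keys P. [Poly_Mapping.lookup P m] \<cdot>\<^bsub>B\<^esub>
     (\<Otimes>\<^bsub>B\<^esub> v \<in> Poly_Mapping.keys m. f v [^]\<^bsub>B\<^esub> Poly_Mapping.lookup m v))"

definition ghost :: "nat \<Rightarrow> nat \<Rightarrow> (nat \<Rightarrow> 'c) \<Rightarrow> 'c :: comm_ring_1" where
  "ghost p n x = (\<Sum>i\<le>n. of_nat p ^ i * x i ^ (p ^ (n - i)))"

definition witt_sum_poly :: "nat \<Rightarrow> nat \<Rightarrow> witt_poly" where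
  "witt_sum_poly p = (THE S. \<forall>n. ghost p n S =
     ghost p n (\<lambda>i. poly_var (Inl i)) + ghost p n (\<lambda>i. poly_var (Inr i)))"

definition witt_prod_poly :: "nat \<Rightarrow> nat \<Rightarrow> witt_poly" where
  "witt_prod_poly p = (THE P. \<forall>n. ghost p n P =
     ghost p n (\<lambda>i. poly_var (Inl i)) * ghost p n (\<lambda>i. poly_var (Inr i)))"

definition witt_ring :: "nat \<Rightarrow> ('b, 'q) ring_scheme \<Rightarrow> (nat \<Rightarrow> 'b) ring" where
  "witt_ring p B =
     \<lparr>carrier = {x. \<forall>n. x n \<in> carrier B},
      monoid.mult = (\<lambda>x y n. poly_eval B (witt_prod_poly p n) (case_sum x y)),
      one = (\<lambda>n. if n = 0 then \<one>\<^bsub>B\<^esub> else \<zero>\<^bsub>B\<^esub>),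
      ring.zero = (\<lambda>n. \<zero>\<^bsub>B\<^esub>),
      ring.add = (\<lambda>x y n. poly_eval B (witt_sum_poly p n) (case_sum x y))\<rparr>"


section \<open>Perfectoid rings\<close>

text \<open>The limit of the tower of rings \<open>\<dots> \<rightarrow> B 2 \<rightarrow> B 1 \<rightarrow> B 0\<close> with transition maps
  \<open>t n\<close> from \<open>B (n + 1)\<close> to \<open>B n\<close>.\<close>

definition inv_lim_ring :: "(nat \<Rightarrow> ('b, 'q) ring_scheme) \<Rightarrow> (nat \<Rightarrow> 'b \<Rightarrow> 'b) \<Rightarrow> (nat \<Rightarrow> 'b) ring" where
  "inv_lim_ring B t =
     \<lparr>carrier = {x. \<forall>n. x n \<in> carrier (B n) \<and> t n (x (Suc n)) = x n},
      monoid.mult = (\<lambda>x y n. x n \<otimes>\<^bsub>B n\<^esub> y n),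
      one = (\<lambda>n. \<one>\<^bsub>B n\<^esub>),
      ring.zero = (\<lambda>n. \<zero>\<^bsub>B n\<^esub>),
      ring.add = (\<lambda>x y n. x n \<oplus>\<^bsub>B n\<^esub> y n)\<rparr>"

definition p_elem :: "nat \<Rightarrow> ('a, 'q) ring_scheme \<Rightarrow> 'a" where
  "p_elem p A = [p] \<cdot>\<^bsub>A\<^esub> \<one>\<^bsub>A\<^esub>"

definition p_ideal :: "nat \<Rightarrow> ('a, 'q) ring_scheme \<Rightarrow> nat \<Rightarrow> 'a set" where
  "p_ideal p A n = PIdl\<^bsub>A\<^esub> (p_elem p A [^]\<^bsub>A\<^esub> n)"

text \<open>The natural map from \<open>A/p\<^sup>n\<^sup>+\<^sup>1\<close> to \<open>A/p\<^sup>n\<close> sends a coset \<open>U\<close> to \<open>p\<^sup>nA + U\<close>.\<close>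

definition p_completion :: "nat \<Rightarrow> ('a, 'q) ring_scheme \<Rightarrow> (nat \<Rightarrow> 'a set) ring" where
  "p_completion p A = inv_lim_ring (\<lambda>n. A Quot (p_ideal p A n)) (\<lambda>n U. p_ideal p A n <+>\<^bsub>A\<^esub> U)"

definition p_complete :: "nat \<Rightarrow> ('a, 'q) ring_scheme \<Rightarrow> bool" where
  "p_complete p A \<longleftrightarrow> (\<lambda>a n. p_ideal p A n +>\<^bsub>A\<^esub> a) \<in> ring_iso A (p_completion p A)"

definition mod_p :: "nat \<Rightarrow> ('a, 'q) ring_scheme \<Rightarrow> 'a set ring" where
  "mod_p p A = A Quot (PIdl\<^bsub>A\<^esub> (p_elem p A))"

definition tilt :: "nat \<Rightarrow> ('a, 'q) ring_scheme \<Rightarrow> (nat \<Rightarrow> 'a set) ring" where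
  "tilt p A = inv_lim_ring (\<lambda>_. mod_p p A) (\<lambda>_ x. x [^]\<^bsub>mod_p p A\<^esub> p)"

definition A_inf :: "nat \<Rightarrow> ('a, 'q) ring_scheme \<Rightarrow> (nat \<Rightarrow> nat \<Rightarrow> 'a set) ring" where
  "A_inf p A = witt_ring p (tilt p A)"

text \<open>The composite \<open>W(A\<^sup>\<flat>) \<rightarrow> A\<^sup>\<flat> \<rightarrow> A/p\<close> of the zeroth Witt component and the zeroth projection
  is \<open>w \<mapsto> w 0 0\<close>. Extensionality pins down the values outside the carrier.\<close>

definition fontaine_theta :: "nat \<Rightarrow> ('a, 'q) ring_scheme \<Rightarrow> (nat \<Rightarrow> nat \<Rightarrow> 'a set) \<Rightarrow> 'a" where
  "fontaine_theta p A = (THE h. h \<in> ring_hom (A_inf p A) A \<and> h \<in> extensional (carrier (A_inf p A)) \<and>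
     (\<forall>w \<in> carrier (A_inf p A). PIdl\<^bsub>A\<^esub> (p_elem p A) +>\<^bsub>A\<^esub> h w = w 0 0))"

definition perfectoid :: "nat \<Rightarrow> ('a, 'q) ring_scheme \<Rightarrow> bool" where
  "perfectoid p A \<longleftrightarrow> cring A \<and> p_complete p A \<and>
     (\<lambda>x. x [^]\<^bsub>mod_p p A\<^esub> p) ` carrier (mod_p p A) = carrier (mod_p p A) \<and>
     principalideal (a_kernel (A_inf p A) A (fontaine_theta p A)) (A_inf p A) \<and>
     (\<exists>\<omega> \<in> carrier A. \<exists>u \<in> Units A. \<omega> [^]\<^bsub>A\<^esub> p = p_elem p A \<otimes>\<^bsub>A\<^esub> u)"

end

theory Submission
  imports Defs
begin

text \<open>
  Let \<open>F\<close> be the given free resolution of \<open>M\<close>, with \<open>F\<^sub>i\<close> free on \<open>S\<^sub>i\<close>. For an \<open>R\<close>-module \<open>N\<close> the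
  complex \<open>N \<otimes> F\<close> consists of finitely supported functions \<open>S\<^sub>i \<rightarrow> N\<close>; its exactness in degree \<open>i\<close>
  after dividing \<open>N\<close> by a submodule is a statement about such functions, so no derived functors occur.

  Since \<open>A\<close> is perfectoid, it contains elements \<open>\<omega>\<^sub>m\<close> with \<open>\<omega>\<^sub>m\<^sub>+\<^sub>1\<^sup>p = \<omega>\<^sub>m\<close>, \<open>\<omega>\<^sub>0\<close> a unit multiple of \<open>p\<close>, such
  that \<open>\<omega>\<^sub>m\<close>-torsion is killed by \<open>\<omega>\<^sub>m\<^sub>+\<^sub>1\<close> and the ideal \<open>J\<^sub>0\<close> of all multiples of the \<open>\<omega>\<^sub>m\<close> is radical. So \<open>A/J\<^sub>0\<close> is
  perfect, and \<open>J\<^sub>0\<close> is a filtered colimit of copies of \<open>A\<close>: exactness in two consecutive degrees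
  for \<open>A\<close> gives exactness in the upper one for \<open>A/J\<^sub>0\<close>. The same step applies to a perfect quotient of \<open>A\<close>
  and the \<open>p\<close>-power roots of an element. Doing this for \<open>n\<close> parameters of \<open>R\<close> leads after \<open>n + 1\<close> steps
  to a nonzero quotient of \<open>A\<close> that is a \<open>k\<close>-algebra, and \<open>k\<close> is a direct summand of it over \<open>R\<close>.
\<close>

section \<open>Congruences modulo powers of \<open>p\<close>\<close>

text \<open>Why a step costs one degree: modulo \<open>I\<close>, the root ideal of \<open>f\<close>
  is the union of the principal ideals of the \<open>f m\<close>, and \<open>f m\<close> is
  \<open>f (m + 1)\<close> times the power of \<open>f (m + 1)\<close> of exponent p - 1.
  Multiplication by these powers makes copies of A/I into a direct system. What \<open>f m\<close>
  kills is killed by \<open>f (m + 1)\<close>, hence by the next transition map, so the colimit maps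
  injectively onto the root ideal. Exactness for A/I in degrees i and i + 1 thus gives exactness in
  degree i for the ideal and, as in the long exact sequence, in degree i + 1 for its quotient. One
  step for p and n for the parameters explain the shift n + 1.

  Perfect quotients of A control torsion by themselves, since Frobenius is bijective on them. A
  itself may have p-torsion, and there the control must be extracted from the principal kernel of
  \<theta>: its generator is shown to be distinguished, and torsion is read off from Teichmueller
  expansions.

  Nothing collapses on the way because all ideals stay in the p-power radical of \<mm>A, which is
  proper.\<close>

lemma dvd_power_diff:
  fixes a b c :: "'c :: comm_ring_1"
  assumes "c dvd a - b" shows "c dvd a ^ n - b ^ n"
proof (induction n)
  case (Suc n)
  have "a ^ Suc n - b ^ Suc n = a * (a ^ n - b ^ n) + (a - b) * b ^ n"
    by (simp add: algebra_simps)
  then show ?case using Suc assms by (metis dvd_add dvd_mult dvd_mult2)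
qed simp

text \<open>The cofactor of a - b in a^p - b^p is a sum of p terms, each congruent to b^(p-1) modulo
  p. The sum is therefore divisible by p and contributes one more factor.\<close>

lemma dvd_power_prime_diff:
  fixes a b :: "'c :: comm_ring_1"
  assumes "of_nat p ^ Suc j dvd a - b" shows "of_nat p ^ Suc (Suc j) dvd a ^ p - b ^ p"
proof -
  let ?s = "\<Sum>i<p. b ^ (p - Suc i) * a ^ i"
  have p: "of_nat p dvd a - b" using assms dvd_trans[of "of_nat p" "of_nat p ^ Suc j"] by simp
  have "of_nat p dvd (\<Sum>i<p. b ^ (p - Suc i) * (a ^ i - b ^ i))"
    by (intro dvd_sum dvd_mult dvd_power_diff p)
  also have "\<dots> = ?s - (\<Sum>i<p. b ^ (p - Suc i) * b ^ i)"
    by (simp add: algebra_simps sum_subtractf)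
  also have "(\<Sum>i<p. b ^ (p - Suc i) * b ^ i) = (\<Sum>i<p. b ^ (p - 1))"
    by (rule sum.cong) (auto simp flip: power_add)
  finally have "of_nat p dvd ?s - of_nat p * b ^ (p - 1)" by simp
  then have "of_nat p dvd ?s - of_nat p * b ^ (p - 1) + of_nat p * b ^ (p - 1)"
    by (rule dvd_add) simp
  then have "of_nat p dvd ?s" by simp
  then have "of_nat p ^ Suc j * of_nat p dvd (a - b) * ?s" using assms by (rule mult_dvd_mono[rotated])
  moreover have "(a - b) * ?s = a ^ p - b ^ p"
    by (simp add: power_diff_sumr2 mult.commute)
  ultimately show ?thesis by (simp add: mult.commute)
qed

lemma dvd_power_prime_power_diff:
  fixes a b :: "'c :: comm_ring_1"
  assumes "of_nat p ^ Suc j dvd a - b" shows "of_nat p ^ Suc (j + k) dvd a ^ (p ^ k) - b ^ (p ^ k)"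
proof (induction k)
  case 0 then show ?case using assms by simp
next
  case (Suc k)
  from dvd_power_prime_diff[OF Suc] show ?case by (simp add: power_mult[symmetric] mult.commute)
qed

lemma prime_dvd_power_add:
  fixes a b :: "'c :: comm_ring_1"
  assumes p: "Factorial_Ring.prime p"
  shows "of_nat p dvd (a + b) ^ p - a ^ p - b ^ p"
proof -
  have p1: "p > 1" using p prime_gt_1_nat by blast
  have "(a + b) ^ p = (\<Sum>k\<le>p. of_nat (p choose k) * a ^ k * b ^ (p - k))" by (rule binomial_ring)
  also have "{..p} = insert 0 (insert p {1..<p})" using p1 by auto
  also have "(\<Sum>k\<in>\<dots>. of_nat (p choose k) * a ^ k * b ^ (p - k)) =
      b ^ p + (a ^ p + (\<Sum>k\<in>{1..<p}. of_nat (p choose k) * a ^ k * b ^ (p - k)))"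
    using p1 by simp
  finally have eq: "(a + b) ^ p - a ^ p - b ^ p = (\<Sum>k\<in>{1..<p}. of_nat (p choose k) * a ^ k * b ^ (p - k))"
    by simp
  have "of_nat p dvd (of_nat (p choose k) :: 'c)" if "k \<in> {1..<p}" for k
    using dvd_choose_prime[of k p] that p by (auto elim!: dvdE simp: of_nat_mult)
  then show ?thesis unfolding eq by (intro dvd_sum) (simp add: mult.assoc)
qed

section \<open>Evaluation of polynomials\<close>

definition monom_eval :: "('b, 'q) ring_scheme \<Rightarrow> ((nat + nat) \<Rightarrow>\<^sub>0 nat) \<Rightarrow> (nat + nat \<Rightarrow> 'b) \<Rightarrow> 'b" where
  "monom_eval B m f = (\<Otimes>\<^bsub>B\<^esub> v \<in> Poly_Mapping.keys m. f v [^]\<^bsub>B\<^esub> Poly_Mapping.lookup m v)"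

context cring
begin

lemma monom_eval_closed [simp, intro]:
  "f \<in> UNIV \<rightarrow> carrier R \<Longrightarrow> monom_eval R m f \<in> carrier R"
  unfolding monom_eval_def by (intro finprod_closed) auto

lemma monom_eval_superset:
  assumes f: "f \<in> UNIV \<rightarrow> carrier R" and "Poly_Mapping.keys m \<subseteq> K" "finite K"
  shows "monom_eval R m f = (\<Otimes>v\<in>K. f v [^] Poly_Mapping.lookup m v)"
  unfolding monom_eval_def
proof (rule finprod_mono_neutral_cong_left)
  show "\<And>i. i \<in> K - Poly_Mapping.keys m \<Longrightarrow> f i [^] Poly_Mapping.lookup m i = \<one>"
    by (simp add: in_keys_iff)
qed (use assms in auto)

lemma monom_eval_add:
  assumes f: "f \<in> UNIV \<rightarrow> carrier R"
  shows "monom_eval R (m + m') f = monom_eval R m f \<otimes> monom_eval R m' f"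
proof -
  let ?K = "Poly_Mapping.keys m \<union> Poly_Mapping.keys m'"
  have fc: "f v \<in> carrier R" for v using f by auto
  have "monom_eval R (m + m') f = (\<Otimes>v\<in>?K. f v [^] Poly_Mapping.lookup (m + m') v)"
    by (rule monom_eval_superset[OF f]) (use keys_add[of m m'] in auto)
  also have "\<dots> = (\<Otimes>v\<in>?K. f v [^] Poly_Mapping.lookup m v \<otimes> f v [^] Poly_Mapping.lookup m' v)"
    by (rule finprod_cong') (use fc in \<open>auto simp: lookup_add nat_pow_mult\<close>)
  also have "\<dots> = (\<Otimes>v\<in>?K. f v [^] Poly_Mapping.lookup m v) \<otimes> (\<Otimes>v\<in>?K. f v [^] Poly_Mapping.lookup m' v)"
    by (rule finprod_multf) (use fc in auto)
  also have "\<dots> = monom_eval R m f \<otimes> monom_eval R m' f"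
    by (simp add: monom_eval_superset[OF f, of _ ?K])
  finally show ?thesis .
qed

lemma monom_eval_0 [simp]: "monom_eval R 0 f = \<one>"
  by (simp add: monom_eval_def)

lemma poly_eval_superset:
  assumes f: "f \<in> UNIV \<rightarrow> carrier R" and "Poly_Mapping.keys P \<subseteq> K" "finite K"
  shows "poly_eval R P f = (\<Oplus>m\<in>K. [Poly_Mapping.lookup P m] \<cdot> monom_eval R m f)"
  unfolding poly_eval_def monom_eval_def[symmetric]
proof (rule add.finprod_mono_neutral_cong_left)
  show "\<And>i. i \<in> K - Poly_Mapping.keys P \<Longrightarrow> [Poly_Mapping.lookup P i] \<cdot> monom_eval R i f = \<zero>"
    by (simp add: in_keys_iff add_pow_def)
qed (use assms in auto)

lemma poly_eval_closed [simp, intro]: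
  "f \<in> UNIV \<rightarrow> carrier R \<Longrightarrow> poly_eval R P f \<in> carrier R"
  unfolding poly_eval_def monom_eval_def[symmetric] by (intro finsum_closed) auto

lemma poly_eval_0 [simp]: "poly_eval R 0 f = \<zero>"
  by (simp add: poly_eval_def)

lemma poly_eval_frag_of:
  assumes f: "f \<in> UNIV \<rightarrow> carrier R"
  shows "poly_eval R (frag_of m) f = monom_eval R m f"
  using poly_eval_superset[OF f, of "frag_of m" "{m}"] f by (simp add: keys_frag_of)

lemma poly_eval_add:
  assumes f: "f \<in> UNIV \<rightarrow> carrier R"
  shows "poly_eval R (P + Q) f = poly_eval R P f \<oplus> poly_eval R Q f"
proof -
  let ?K = "Poly_Mapping.keys P \<union> Poly_Mapping.keys Q"
  have "poly_eval R (P + Q) f = (\<Oplus>m\<in>?K. [Poly_Mapping.lookup (P + Q) m] \<cdot> monom_eval R m f)"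
    by (rule poly_eval_superset[OF f]) (use keys_add[of P Q] in auto)
  also have "\<dots> = (\<Oplus>m\<in>?K. [Poly_Mapping.lookup P m] \<cdot> monom_eval R m f \<oplus> [Poly_Mapping.lookup Q m] \<cdot> monom_eval R m f)"
    by (rule add.finprod_cong') (use f in \<open>auto simp: lookup_add add.int_pow_mult\<close>)
  also have "\<dots> = (\<Oplus>m\<in>?K. [Poly_Mapping.lookup P m] \<cdot> monom_eval R m f) \<oplus> (\<Oplus>m\<in>?K. [Poly_Mapping.lookup Q m] \<cdot> monom_eval R m f)"
    by (rule finsum_addf) (use f in auto)
  also have "\<dots> = poly_eval R P f \<oplus> poly_eval R Q f"
    by (simp add: poly_eval_superset[OF f, of _ ?K])
  finally show ?thesis .
qed

lemma poly_eval_diff: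
  assumes f: "f \<in> UNIV \<rightarrow> carrier R"
  shows "poly_eval R (P - Q) f = poly_eval R P f \<ominus> poly_eval R Q f"
  using poly_eval_add[OF f, of "P - Q" Q] f
  by (metis add_diff_cancel_right' diff_add_cancel minus_eq add.inv_solve_right poly_eval_closed)

lemma poly_eval_mult:
  assumes f: "f \<in> UNIV \<rightarrow> carrier R"
  shows "poly_eval R (P * Q) f = poly_eval R P f \<otimes> poly_eval R Q f"
proof -
  \<comment> \<open>A polynomial is an integer combination of exponent vectors, so
    \<open>frag_induction\<close> applies. By bilinearity the claim is reduced first to a monomial
    on the left, then to monomials on both sides.\<close>
  have 1: "poly_eval R (frag_of m * Q) f = poly_eval R (frag_of m) f \<otimes> poly_eval R Q f" for m Q
  proof (induction Q rule: frag_induction[OF subset_UNIV])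
    case (2 m')
    have "frag_of m * frag_of m' = frag_of (m + m')" by (simp add: mult_single)
    then show ?case by (simp add: poly_eval_frag_of f monom_eval_add del: mult_single)
  qed (use f in \<open>auto simp: right_diff_distrib poly_eval_diff r_distr r_minus minus_eq\<close>)
  show ?thesis
  proof (induction P rule: frag_induction[OF subset_UNIV])
    case (3 a b)
    then show ?case using f by (simp add: left_diff_distrib poly_eval_diff l_distr l_minus minus_eq)
  qed (use f 1 in auto)
qed

lemma poly_eval_1: "f \<in> UNIV \<rightarrow> carrier R \<Longrightarrow> poly_eval R 1 f = \<one>"
  using poly_eval_frag_of[of f 0] by simp

lemma poly_eval_var:
  assumes f: "f \<in> UNIV \<rightarrow> carrier R"
  shows "poly_eval R (poly_var v) f = f v"
proof -
  have [simp]: "f v \<in> carrier R" using f by auto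
  have "poly_eval R (poly_var v) f = monom_eval R (Poly_Mapping.single v 1) f"
    unfolding poly_var_def by (rule poly_eval_frag_of[OF f])
  also have "\<dots> = f v" by (simp add: monom_eval_def Pi_def)
  finally show ?thesis .
qed

lemma poly_eval_power:
  assumes f: "f \<in> UNIV \<rightarrow> carrier R"
  shows "poly_eval R (P ^ n) f = poly_eval R P f [^] n"
  by (induction n) (use f in \<open>auto simp: poly_eval_1 poly_eval_mult m_comm\<close>)

lemma poly_eval_of_nat:
  assumes f: "f \<in> UNIV \<rightarrow> carrier R"
  shows "poly_eval R (of_nat n) f = [n] \<cdot> \<one>"
  by (induction n) (use f in \<open>auto simp: poly_eval_1 poly_eval_add add.m_comm\<close>)

end

text \<open>The constant 1 and the variables generate the polynomial ring under difference and
  product; differences also produce zero and sums. Every monomial is built as a product of powers of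
  variables, and \<open>frag_induction\<close> supplies the additive part.\<close>

lemma witt_poly_induct [case_names one var diff mult]:
  fixes P :: witt_poly
  assumes "Q 1" "\<And>v. Q (poly_var v)" "\<And>a b. Q a \<Longrightarrow> Q b \<Longrightarrow> Q (a - b)" "\<And>a b. Q a \<Longrightarrow> Q b \<Longrightarrow> Q (a * b)"
  shows "Q P"
proof -
  have single: "Q (frag_of (Poly_Mapping.single v n))" for v n
  proof (induction n)
    case 0 then show ?case using assms(1) by simp
  next
    case (Suc n)
    have "frag_of (Poly_Mapping.single v (Suc n)) = poly_var v * frag_of (Poly_Mapping.single v n)"
      by (simp add: poly_var_def mult_single single_add[symmetric])
    then show ?case using assms Suc by simp
  qed
  have sum: "Q (frag_of (\<Sum>v\<in>K. Poly_Mapping.single v (g v)))" if "finite K" for K g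
    using that
  proof induction
    case empty then show ?case using assms(1) by simp
  next
    case (insert x F)
    have "frag_of (\<Sum>v\<in>insert x F. Poly_Mapping.single v (g v)) =
        frag_of (Poly_Mapping.single x (g x)) * frag_of (\<Sum>v\<in>F. Poly_Mapping.single v (g v))"
      using insert by (simp add: mult_single)
    then show ?case using insert single assms(4) by metis
  qed
  have "m = (\<Sum>v\<in>Poly_Mapping.keys m. Poly_Mapping.single v (Poly_Mapping.lookup m v))"
    for m :: "(nat + nat) \<Rightarrow>\<^sub>0 nat"
    by (rule poly_mapping_eqI)
      (auto simp: lookup_sum lookup_single when_def in_keys_iff sum.delta)
  then have frag: "Q (frag_of m)" for m using sum by (metis finite_keys)
  show ?thesis
  proof (induction P rule: frag_induction[OF subset_UNIV])
    case 1
    then show ?case using assms(3)[of 1 1] assms(1) by simp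
  qed (use frag assms in auto)
qed

section \<open>Substitution of polynomials as evaluation in the polynomial ring\<close>

definition univ_ring :: "'c :: comm_ring_1 ring" where
  "univ_ring = \<lparr>carrier = UNIV, monoid.mult = (*), one = 1, ring.zero = 0, ring.add = (+)\<rparr>"

lemma univ_ring_simps [simp]:
  "carrier univ_ring = UNIV" "x \<otimes>\<^bsub>univ_ring\<^esub> y = x * y" "\<one>\<^bsub>univ_ring\<^esub> = 1"
  "\<zero>\<^bsub>univ_ring\<^esub> = 0" "x \<oplus>\<^bsub>univ_ring\<^esub> y = x + y"
  by (simp_all add: univ_ring_def)

lemma cring_univ_ring: "cring (univ_ring :: 'c :: comm_ring_1 ring)"
proof (rule cringI)
  show "abelian_group (univ_ring :: 'c ring)"
    by (rule abelian_groupI) (auto simp: algebra_simps intro: exI[of _ "- x" for x])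
  show "comm_monoid (univ_ring :: 'c ring)"
    by (rule comm_monoidI) (auto simp: algebra_simps)
qed (simp add: algebra_simps)

lemma univ_ring_minus [simp]: "x \<ominus>\<^bsub>univ_ring\<^esub> y = x - y"
proof -
  interpret cring "univ_ring :: 'a ring" by (rule cring_univ_ring)
  show ?thesis using add.inv_solve_right[of "x \<ominus>\<^bsub>univ_ring\<^esub> y" x y] by (simp add: minus_eq algebra_simps)
qed

lemma univ_ring_pow [simp]: "x [^]\<^bsub>univ_ring\<^esub> (n :: nat) = x ^ n"
proof -
  interpret cring "univ_ring :: 'a ring" by (rule cring_univ_ring)
  show ?thesis by (induction n) (auto simp: mult.commute)
qed

abbreviation poly_subst :: "witt_poly \<Rightarrow> (nat + nat \<Rightarrow> witt_poly) \<Rightarrow> witt_poly" where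
  "poly_subst \<equiv> poly_eval univ_ring"

lemmas poly_subst_simps =
  cring.poly_eval_add[OF cring_univ_ring, simplified]
  cring.poly_eval_diff[OF cring_univ_ring, simplified]
  cring.poly_eval_mult[OF cring_univ_ring, simplified]
  cring.poly_eval_power[OF cring_univ_ring, simplified]
  cring.poly_eval_1[OF cring_univ_ring, simplified]
  cring.poly_eval_0[OF cring_univ_ring, simplified]
  cring.poly_eval_var[OF cring_univ_ring, simplified]

lemma poly_subst_of_nat [simp]: "poly_subst (of_nat n) g = of_nat n"
  by (induction n) (auto simp: poly_subst_simps)

lemma poly_subst_sum: "poly_subst (sum h K) g = (\<Sum>i\<in>K. poly_subst (h i) g)"
  by (induction K rule: infinite_finite_induct) (auto simp: poly_subst_simps)

lemma (in cring) poly_eval_subst: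
  assumes f: "f \<in> UNIV \<rightarrow> carrier R"
  shows "poly_eval R (poly_subst P g) f = poly_eval R P (\<lambda>v. poly_eval R (g v) f)"
proof -
  have f': "(\<lambda>v. poly_eval R (g v) f) \<in> UNIV \<rightarrow> carrier R" using f by auto
  show ?thesis
    by (induction P rule: witt_poly_induct)
      (auto simp: poly_subst_simps poly_eval_diff poly_eval_mult poly_eval_1 poly_eval_var f f')
qed

lemma ghost_subst: "poly_subst (ghost p n F) g = ghost p n (\<lambda>i. poly_subst (F i) g)"
  unfolding ghost_def by (simp add: poly_subst_sum poly_subst_simps flip: of_nat_power)

section \<open>Witt polynomials\<close>

lemma ghost_split: "ghost p n F = of_nat p ^ n * F n + (\<Sum>i<n. of_nat p ^ i * F i ^ (p ^ (n - i)))"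
  unfolding ghost_def by (simp add: lessThan_Suc_atMost[symmetric])

lemma ghost_Suc: "ghost p (Suc n) F = of_nat p ^ Suc n * F (Suc n) + ghost p n (\<lambda>i. F i ^ p)"
proof -
  have "(F i ^ p) ^ p ^ (n - i) = F i ^ p ^ (Suc n - i)" if "i \<le> n" for i
    using that by (simp add: Suc_diff_le flip: power_mult)
  then show ?thesis unfolding ghost_split[of p "Suc n"] lessThan_Suc_atMost
    by (auto simp: ghost_def intro!: arg_cong2[where f="(+)"] sum.cong)
qed

lemma of_nat_mult_cancel_witt_poly:
  fixes a b :: witt_poly
  assumes "p > 0" "of_nat p * a = of_nat p * b" shows "a = b"
proof (rule poly_mapping_eqI)
  have l: "Poly_Mapping.lookup (of_nat n * c) k = of_nat n * Poly_Mapping.lookup c k" for c :: witt_poly and k n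
    by (induction n) (auto simp: lookup_add algebra_simps)
  show "Poly_Mapping.lookup a k = Poly_Mapping.lookup b k" for k
    using l[of p a k] l[of p b k] assms by simp
qed

lemma of_nat_power_dvd_cancel_witt_poly:
  fixes a :: witt_poly
  assumes "p > 0" "of_nat p ^ Suc n dvd of_nat p ^ n * a" shows "of_nat p dvd a"
proof -
  obtain c where "of_nat p ^ n * a = of_nat p ^ n * (of_nat p * c)"
    using assms(2) by (auto elim!: dvdE simp: algebra_simps)
  then have "a = of_nat p * c"
    using of_nat_mult_cancel_witt_poly[of "p ^ n"] assms(1) by simp
  then show ?thesis by simp
qed

text \<open>In the summand with index i, the power with exponent p^(n-i) turns a congruence modulo p
  into one modulo p^(n-i+1), and the prefactor p^i supplies the rest.\<close>

lemma ghost_cong_dvd: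
  fixes F G :: "nat \<Rightarrow> 'c :: comm_ring_1"
  assumes "\<And>i. i \<le> n \<Longrightarrow> of_nat p dvd F i - G i"
  shows "of_nat p ^ Suc n dvd ghost p n F - ghost p n G"
  unfolding ghost_def sum_subtractf[symmetric] right_diff_distrib[symmetric]
proof (rule dvd_sum)
  fix i assume i: "i \<in> {..n}"
  have "of_nat p ^ i * of_nat p ^ Suc (n - i) dvd of_nat p ^ i * (F i ^ p ^ (n - i) - G i ^ p ^ (n - i))"
    using dvd_power_prime_power_diff[of p 0 "F i" "G i" "n - i"] assms[of i] i
    by (intro mult_dvd_mono) auto
  moreover have "of_nat p ^ i * of_nat p ^ Suc (n - i) = (of_nat p ^ Suc n :: 'c)"
    using i by (simp only: power_add[symmetric] atMost_iff add_Suc_right le_add_diff_inverse)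
  ultimately show "of_nat p ^ Suc n dvd of_nat p ^ i * (F i ^ p ^ (n - i) - G i ^ p ^ (n - i))"
    by simp
qed

text \<open>By induction the entries below n agree modulo p, so their summands agree modulo p^(n+1):
  each is a p-th power raised to p^(m-i) with n = m + 1, one power of p more than the entry alone
  would give. What remains is p^n times \<open>F n - G n\<close>, and p^n can be cancelled because
  the coefficients are integers.\<close>

lemma dvd_of_ghost_dvd:
  fixes F G :: "nat \<Rightarrow> witt_poly"
  assumes "p > 0" "\<And>n. of_nat p ^ Suc n dvd ghost p n F - ghost p n G"
  shows "of_nat p dvd F n - G n"
proof (induction n rule: less_induct)
  case (less n)
  let ?r = "\<lambda>F. (\<Sum>i<n. of_nat p ^ i * F i ^ (p ^ (n - i))) :: witt_poly"
  have "of_nat p ^ Suc n dvd ?r F - ?r G"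
  proof (cases n)
    case (Suc m)
    have r: "?r F = ghost p m (\<lambda>i. F i ^ p)" for F
      using ghost_split[of p n F] ghost_Suc[of p m F] Suc by simp
    have "of_nat p ^ Suc (Suc m) dvd ghost p m (\<lambda>i. F i ^ p) - ghost p m (\<lambda>i. G i ^ p)"
      unfolding ghost_def sum_subtractf[symmetric] right_diff_distrib[symmetric]
    proof (rule dvd_sum)
      fix i assume i: "i \<in> {..m}"
      have "of_nat p ^ i * of_nat p ^ Suc (Suc (m - i)) dvd
          of_nat p ^ i * ((F i ^ p) ^ p ^ (m - i) - (G i ^ p) ^ p ^ (m - i))"
        using dvd_power_prime_power_diff[of p 0 "F i" "G i" "Suc (m - i)"] less.IH[of i] i Suc
        by (intro mult_dvd_mono) (auto simp: power_mult)
      moreover have "of_nat p ^ i * of_nat p ^ Suc (Suc (m - i)) = (of_nat p ^ Suc (Suc m) :: witt_poly)"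
        using i by (simp only: power_add[symmetric] atMost_iff add_Suc_right le_add_diff_inverse)
      ultimately show "of_nat p ^ Suc (Suc m) dvd of_nat p ^ i * ((F i ^ p) ^ p ^ (m - i) - (G i ^ p) ^ p ^ (m - i))"
        by simp
    qed
    then show ?thesis unfolding r by (simp only: Suc)
  qed simp
  then have "of_nat p ^ Suc n dvd (ghost p n F - ghost p n G) - (?r F - ?r G)"
    using assms(2)[of n] by (rule dvd_diff[rotated])
  then have "of_nat p ^ Suc n dvd of_nat p ^ n * (F n - G n)"
    unfolding ghost_split by (simp add: algebra_simps)
  then show ?case using of_nat_power_dvd_cancel_witt_poly assms(1) by blast
qed

text \<open>The uniqueness behind the \<open>THE\<close> in \<open>witt_sum_poly\<close> and
  \<open>witt_prod_poly\<close>.\<close>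

lemma ghost_inject:
  fixes F G :: "nat \<Rightarrow> witt_poly"
  assumes "p > 0" "\<And>n. ghost p n F = ghost p n G"
  shows "F = G"
proof
  show "F n = G n" for n
  proof (induction n rule: less_induct)
    case (less n)
    have "of_nat p ^ n * F n = of_nat p ^ n * G n"
      using assms(2)[of n] less unfolding ghost_split by simp
    then show ?case using of_nat_mult_cancel_witt_poly[of "p ^ n"] assms(1) by simp
  qed
qed

text \<open>Modulo p both the substitution of v^p for every variable v and the p-th power are ring
  homomorphisms, and they agree on the variables.\<close>

lemma frobenius_lift_dvd:
  assumes p: "Factorial_Ring.prime p"
  shows "of_nat p dvd poly_subst P (\<lambda>v. poly_var v ^ p) - P ^ p"
proof (induction P rule: witt_poly_induct)
  case (diff a b)
  let ?\<phi> = "\<lambda>P. poly_subst P (\<lambda>v. poly_var v ^ p)"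
  have "of_nat p dvd (?\<phi> a - a ^ p) - (?\<phi> b - b ^ p) + (((a - b) + b) ^ p - (a - b) ^ p - b ^ p)"
    by (intro dvd_add dvd_diff diff prime_dvd_power_add p)
  also have "\<dots> = ?\<phi> (a - b) - (a - b) ^ p" by (simp add: poly_subst_simps)
  finally show ?case .
next
  case (mult a b)
  let ?\<phi> = "\<lambda>P. poly_subst P (\<lambda>v. poly_var v ^ p)"
  have "of_nat p dvd (?\<phi> a - a ^ p) * ?\<phi> b + a ^ p * (?\<phi> b - b ^ p)"
    by (intro dvd_add dvd_mult dvd_mult2 mult)
  also have "\<dots> = ?\<phi> (a * b) - (a * b) ^ p" by (simp add: poly_subst_simps algebra_simps)
  finally show ?case .
qed (auto simp: poly_subst_simps)

text \<open>Dwork's lemma: a sequence of polynomials compatible with the lift of Frobenius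
  consists of the ghost components of an integral Witt vector.\<close>

fun dwork :: "nat \<Rightarrow> (nat \<Rightarrow> witt_poly) \<Rightarrow> nat \<Rightarrow> witt_poly" where
  "dwork p G n =
    (SOME q. of_nat p ^ n * q = G n - (\<Sum>i<n. of_nat p ^ i * dwork p G i ^ (p ^ (n - i))))"

declare dwork.simps [simp del]

lemma ghost_dwork:
  assumes p: "Factorial_Ring.prime p"
    and G: "\<And>n. of_nat p ^ Suc n dvd G (Suc n) - poly_subst (G n) (\<lambda>v. poly_var v ^ p)"
  shows "ghost p n (dwork p G) = G n"
proof (induction n)
  case 0
  have "\<exists>q. of_nat p ^ 0 * q = G 0 - (\<Sum>i<0. of_nat p ^ i * dwork p G i ^ (p ^ (0 - i)))" by simp
  from someI_ex[OF this] show ?case by (simp add: ghost_def dwork.simps[of p G 0])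
next
  case (Suc m)
  let ?F = "dwork p G"
  have r: "(\<Sum>i<Suc m. of_nat p ^ i * ?F i ^ (p ^ (Suc m - i))) = ghost p m (\<lambda>i. ?F i ^ p)"
    using ghost_split[of p "Suc m" ?F] ghost_Suc[of p m ?F] by simp
  \<comment> \<open>Applying the lift of Frobenius \<phi> to the ghost equation in degree m replaces
    every entry F_i by \<phi>(F_i), which is congruent to F_i^p modulo p. Hence \<phi>(G m) agrees
    with ghost component m of the p-th powers modulo p^(m+1), and the division that defines entry m
    + 1 is possible.\<close>
  have "poly_subst (G m) (\<lambda>v. poly_var v ^ p) = ghost p m (\<lambda>i. poly_subst (?F i) (\<lambda>v. poly_var v ^ p))"
    unfolding Suc[symmetric] ghost_subst ..
  moreover have "of_nat p ^ Suc m dvd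
      ghost p m (\<lambda>i. poly_subst (?F i) (\<lambda>v. poly_var v ^ p)) - ghost p m (\<lambda>i. ?F i ^ p)"
    by (intro ghost_cong_dvd frobenius_lift_dvd p)
  ultimately have "of_nat p ^ Suc m dvd (G (Suc m) - poly_subst (G m) (\<lambda>v. poly_var v ^ p)) +
      (poly_subst (G m) (\<lambda>v. poly_var v ^ p) - ghost p m (\<lambda>i. ?F i ^ p))"
    using G[of m] by (intro dvd_add) auto
  then have "\<exists>q. of_nat p ^ Suc m * q = G (Suc m) - (\<Sum>i<Suc m. of_nat p ^ i * ?F i ^ (p ^ (Suc m - i)))"
    unfolding r by (auto elim!: dvdE)
  from someI_ex[OF this]
  have "of_nat p ^ Suc m * ?F (Suc m) = G (Suc m) - (\<Sum>i<Suc m. of_nat p ^ i * ?F i ^ (p ^ (Suc m - i)))"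
    unfolding dwork.simps[of p G "Suc m", symmetric] .
  then show ?case unfolding ghost_split[of p "Suc m"] by simp
qed

lemma ghost_var_frobenius:
  "of_nat p ^ Suc n dvd ghost p (Suc n) (\<lambda>i. poly_var (c i)) -
     poly_subst (ghost p n (\<lambda>i. poly_var (c i))) (\<lambda>v. poly_var v ^ p)"
  unfolding ghost_subst ghost_Suc by (simp add: poly_subst_simps)

lemma ghost_witt_sum_poly:
  assumes p: "Factorial_Ring.prime p"
  shows "ghost p n (witt_sum_poly p) = ghost p n (\<lambda>i. poly_var (Inl i)) + ghost p n (\<lambda>i. poly_var (Inr i))"
proof -
  let ?G = "\<lambda>n. ghost p n (\<lambda>i. poly_var (Inl i)) + ghost p n (\<lambda>i. poly_var (Inr i)) :: witt_poly"
  have "of_nat p ^ Suc n dvd ?G (Suc n) - poly_subst (?G n) (\<lambda>v. poly_var v ^ p)" for n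
    using dvd_add[OF ghost_var_frobenius[of p n Inl] ghost_var_frobenius[of p n Inr]]
    by (simp add: poly_subst_simps algebra_simps)
  from ghost_dwork[OF p this]
  have "\<exists>!S. \<forall>n. ghost p n S = ?G n"
    using ghost_inject[of p] p prime_gt_0_nat by (intro ex1I[of _ "dwork p ?G"]) auto
  from theI'[OF this] show ?thesis unfolding witt_sum_poly_def by blast
qed

lemma ghost_witt_prod_poly:
  assumes p: "Factorial_Ring.prime p"
  shows "ghost p n (witt_prod_poly p) = ghost p n (\<lambda>i. poly_var (Inl i)) * ghost p n (\<lambda>i. poly_var (Inr i))"
proof -
  let ?X = "\<lambda>n. ghost p n (\<lambda>i. poly_var (Inl i)) :: witt_poly"
  let ?Y = "\<lambda>n. ghost p n (\<lambda>i. poly_var (Inr i)) :: witt_poly"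
  let ?\<phi> = "\<lambda>P. poly_subst P (\<lambda>v. poly_var v ^ p)"
  \<comment> \<open>A difference of two products, split as (X - X')Y + X'(Y - Y'), so that the two
    sets of variables can be treated separately.\<close>
  have "of_nat p ^ Suc n dvd (?X (Suc n) - ?\<phi> (?X n)) * ?Y (Suc n) + ?\<phi> (?X n) * (?Y (Suc n) - ?\<phi> (?Y n))" for n
    by (intro dvd_add dvd_mult dvd_mult2 ghost_var_frobenius)
  then have "of_nat p ^ Suc n dvd (?X (Suc n) * ?Y (Suc n)) - ?\<phi> (?X n * ?Y n)" for n
    by (simp add: poly_subst_simps algebra_simps)
  from ghost_dwork[OF p this]
  have "\<exists>!S. \<forall>n. ghost p n S = ?X n * ?Y n"
    using ghost_inject[of p] p prime_gt_0_nat by (intro ex1I[of _ "dwork p (\<lambda>n. ?X n * ?Y n)"]) auto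
  from theI'[OF this] show ?thesis unfolding witt_prod_poly_def by blast
qed

lemma ghost_witt_sum_subst:
  assumes p: "Factorial_Ring.prime p"
  shows "ghost p n (\<lambda>i. poly_subst (witt_sum_poly p i) (case_sum F G)) = ghost p n F + ghost p n G"
  unfolding ghost_subst[symmetric] ghost_witt_sum_poly[OF p]
  by (simp add: poly_subst_simps ghost_subst)

lemma ghost_witt_prod_subst:
  assumes p: "Factorial_Ring.prime p"
  shows "ghost p n (\<lambda>i. poly_subst (witt_prod_poly p i) (case_sum F G)) = ghost p n F * ghost p n G"
  unfolding ghost_subst[symmetric] ghost_witt_prod_poly[OF p]
  by (simp add: poly_subst_simps ghost_subst)

section \<open>Witt vectors over rings of characteristic \<open>p\<close>\<close>

lemma witt_ring_simps [simp]:
  "carrier (witt_ring p B) = {x. \<forall>n. x n \<in> carrier B}"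
  "\<one>\<^bsub>witt_ring p B\<^esub> = (\<lambda>n. if n = 0 then \<one>\<^bsub>B\<^esub> else \<zero>\<^bsub>B\<^esub>)"
  "\<zero>\<^bsub>witt_ring p B\<^esub> = (\<lambda>n. \<zero>\<^bsub>B\<^esub>)"
  by (simp_all add: witt_ring_def)

lemma witt_ring_add: "x \<oplus>\<^bsub>witt_ring p B\<^esub> y = (\<lambda>n. poly_eval B (witt_sum_poly p n) (case_sum x y))"
  by (simp add: witt_ring_def)

lemma witt_ring_mult: "x \<otimes>\<^bsub>witt_ring p B\<^esub> y = (\<lambda>n. poly_eval B (witt_prod_poly p n) (case_sum x y))"
  by (simp add: witt_ring_def)

text \<open>The Teichmueller representative [b].\<close>

definition teich :: "('b, 'q) ring_scheme \<Rightarrow> 'b \<Rightarrow> nat \<Rightarrow> 'b" where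
  "teich B b = (\<lambda>n. if n = 0 then b else \<zero>\<^bsub>B\<^esub>)"

lemma teich_0 [simp]: "teich B b 0 = b" by (simp add: teich_def)

lemma zero_power_prime_power [simp]:
  "p > 0 \<Longrightarrow> (0 :: 'c :: comm_ring_1) ^ (p ^ n) = 0" "p > 0 \<Longrightarrow> (0 :: 'c :: comm_ring_1) ^ (p * p ^ n) = 0"
  by (simp_all add: zero_power)

lemma ghost_teich:
  assumes "p > 0"
  shows "ghost p n (\<lambda>i. if i = 0 then g else 0) = g ^ (p ^ n)"
proof -
  have "ghost p n (\<lambda>i. if i = 0 then g else 0) = (\<Sum>i\<le>n. if i = 0 then g ^ (p ^ n) else 0)"
    unfolding ghost_def by (rule sum.cong) (use assms in auto)
  then show ?thesis by simp
qed

lemma ghost_tail: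
  assumes "p > 0"
  shows "ghost p n (\<lambda>i. if i = 0 then 0 else F i) = ghost p n F - F 0 ^ (p ^ n)"
proof -
  have "ghost p n (\<lambda>i. if i = 0 then 0 else F i) + F 0 ^ (p ^ n) =
      (\<Sum>i\<le>n. (of_nat p ^ i * (if i = 0 then 0 else F i) ^ (p ^ (n - i))) + (if i = 0 then F 0 ^ (p ^ n) else 0))"
    by (simp add: ghost_def sum.distrib)
  also have "\<dots> = ghost p n F"
    unfolding ghost_def by (rule sum.cong) (use assms in auto)
  finally show ?thesis by (simp add: algebra_simps)
qed

lemma ghost_scale: "ghost p n (\<lambda>i. g ^ (p ^ i) * F i) = g ^ (p ^ n) * ghost p n F"
  unfolding ghost_def sum_distrib_left
proof (rule sum.cong)
  fix i assume "i \<in> {..n}"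
  then have "(g ^ p ^ i) ^ p ^ (n - i) = g ^ p ^ n" by (simp flip: power_mult power_add)
  then show "of_nat p ^ i * (g ^ p ^ i * F i) ^ p ^ (n - i) = g ^ p ^ n * (of_nat p ^ i * F i ^ p ^ (n - i))"
    by (simp add: power_mult_distrib)
qed simp

text \<open>This is the identity p = VF in ghost form. The error term p^(n+1) F_n is exactly what
  \<open>dvd_of_ghost_dvd\<close> tolerates, so in characteristic p the identity becomes
  exact.\<close>

lemma ghost_frobenius_verschiebung:
  assumes "p > 0"
  shows "ghost p n (case_nat 0 (\<lambda>i. F i ^ p)) = of_nat p * ghost p n F - of_nat p ^ Suc n * F n"
proof -
  have "ghost p n (case_nat 0 (\<lambda>i. F i ^ p)) = of_nat p * (\<Sum>i<n. of_nat p ^ i * F i ^ (p ^ (n - i)))"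
  proof (cases n)
    case 0 then show ?thesis using assms by (simp add: ghost_def)
  next
    case (Suc m)
    have "(F i ^ p) ^ p ^ (m - i) = F i ^ p ^ (Suc m - i)" if "i \<le> m" for i
      using that by (simp add: Suc_diff_le flip: power_mult)
    then show ?thesis unfolding ghost_def Suc sum.atMost_Suc_shift lessThan_Suc_atMost
      using assms by (auto simp: sum_distrib_left algebra_simps intro!: sum.cong)
  qed
  then show ?thesis by (simp add: ghost_split[of p n F] algebra_simps)
qed

locale char_p_ring = cring +
  fixes p :: nat
  assumes p_prime: "Factorial_Ring.prime p"
    and p_char: "[p] \<cdot> \<one> = \<zero>"
begin

lemma p_pos: "p > 0" using p_prime prime_gt_0_nat by blast

lemma poly_eval_cong_mod_p:
  assumes f: "f \<in> UNIV \<rightarrow> carrier R" and d: "of_nat p dvd P - Q"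
  shows "poly_eval R P f = poly_eval R Q f"
proof -
  obtain C where "P - Q = of_nat p * C" using d by (auto elim: dvdE)
  then have "P = Q + of_nat p * C" by (simp add: algebra_simps)
  then show ?thesis using f p_char by (simp add: poly_eval_add poly_eval_mult poly_eval_of_nat)
qed

lemma freshman:
  assumes "x \<in> carrier R" "y \<in> carrier R"
  shows "(x \<oplus> y) [^] p = x [^] p \<oplus> y [^] p"
proof -
  let ?f = "case_sum (\<lambda>_. x) (\<lambda>_. y) :: nat + nat \<Rightarrow> _"
  let ?X = "poly_var (Inl 0)" and ?Y = "poly_var (Inr 0)"
  have f: "?f \<in> UNIV \<rightarrow> carrier R" using assms by (auto split: sum.split)
  have "poly_eval R ((?X + ?Y) ^ p) ?f = poly_eval R (?X ^ p + ?Y ^ p) ?f"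
    by (rule poly_eval_cong_mod_p[OF f]) (use prime_dvd_power_add[OF p_prime, of ?X ?Y] in \<open>simp add: algebra_simps\<close>)
  then show ?thesis by (simp add: poly_eval_add poly_eval_power poly_eval_var f)
qed

abbreviation W where "W \<equiv> witt_ring p R"

text \<open>In characteristic p integer polynomials matter only modulo p, and by
  \<open>dvd_of_ghost_dvd\<close> congruence modulo p can be tested on ghost components modulo
  p^(n+1). An identity of Witt vectors is thus verified by writing all components as values of
  integer polynomials at one point \<open>f\<close>.\<close>

lemma witt_add_eqI:
  assumes f: "f \<in> UNIV \<rightarrow> carrier R"
    and x: "\<And>n. x n = poly_eval R (F n) f" and y: "\<And>n. y n = poly_eval R (G n) f"
    and z: "\<And>n. z n = poly_eval R (H n) f"
    and d: "\<And>n. of_nat p ^ Suc n dvd ghost p n F + ghost p n G - ghost p n H"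
  shows "x \<oplus>\<^bsub>W\<^esub> y = z"
proof
  fix n
  let ?S = "\<lambda>i. poly_subst (witt_sum_poly p i) (case_sum F G)"
  have "of_nat p dvd ?S n - H n"
    by (rule dvd_of_ghost_dvd[OF p_pos]) (use d in \<open>simp add: ghost_witt_sum_subst[OF p_prime]\<close>)
  then have "poly_eval R (?S n) f = z n" unfolding z by (rule poly_eval_cong_mod_p[OF f])
  moreover have "poly_eval R (?S n) f = (x \<oplus>\<^bsub>W\<^esub> y) n"
    unfolding poly_eval_subst[OF f] witt_ring_add
    by (rule arg_cong[where f = "poly_eval R (witt_sum_poly p n)"]) (auto simp: x y split: sum.split)
  ultimately show "(x \<oplus>\<^bsub>W\<^esub> y) n = z n" by simp
qed

lemma witt_mult_eqI:
  assumes f: "f \<in> UNIV \<rightarrow> carrier R"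
    and x: "\<And>n. x n = poly_eval R (F n) f" and y: "\<And>n. y n = poly_eval R (G n) f"
    and z: "\<And>n. z n = poly_eval R (H n) f"
    and d: "\<And>n. of_nat p ^ Suc n dvd ghost p n F * ghost p n G - ghost p n H"
  shows "x \<otimes>\<^bsub>W\<^esub> y = z"
proof
  fix n
  let ?S = "\<lambda>i. poly_subst (witt_prod_poly p i) (case_sum F G)"
  have "of_nat p dvd ?S n - H n"
    by (rule dvd_of_ghost_dvd[OF p_pos]) (use d in \<open>simp add: ghost_witt_prod_subst[OF p_prime]\<close>)
  then have "poly_eval R (?S n) f = z n" unfolding z by (rule poly_eval_cong_mod_p[OF f])
  moreover have "poly_eval R (?S n) f = (x \<otimes>\<^bsub>W\<^esub> y) n"
    unfolding poly_eval_subst[OF f] witt_ring_mult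
    by (rule arg_cong[where f = "poly_eval R (witt_prod_poly p n)"]) (auto simp: x y split: sum.split)
  ultimately show "(x \<otimes>\<^bsub>W\<^esub> y) n = z n" by simp
qed

lemma teich_closed [simp]: "b \<in> carrier R \<Longrightarrow> teich R b \<in> carrier W"
  by (simp add: teich_def)

text \<open>Scaling component i by g^(p^i) multiplies ghost component n by g^(p^n), which is the
  ghost component of [g].\<close>

lemma teich_mult_left:
  assumes g: "g \<in> carrier R" and w: "w \<in> carrier W"
  shows "teich R g \<otimes>\<^bsub>W\<^esub> w = (\<lambda>n. g [^] (p ^ n) \<otimes> w n)"
proof -
  let ?f = "case_sum (\<lambda>_. g) w"
  have f: "?f \<in> UNIV \<rightarrow> carrier R" using g w by (auto split: sum.split)
  show ?thesis
    by (rule witt_mult_eqI[OF f, of _ "\<lambda>i. if i = 0 then poly_var (Inl 0) else 0" _ "\<lambda>i. poly_var (Inr i)"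
          _ "\<lambda>i. poly_var (Inl 0) ^ (p ^ i) * poly_var (Inr i)"])
      (auto simp: teich_def poly_eval_var f poly_eval_mult poly_eval_power ghost_scale ghost_teich[OF p_pos])
qed

lemma teich_mult:
  assumes "g \<in> carrier R" "h \<in> carrier R"
  shows "teich R g \<otimes>\<^bsub>W\<^esub> teich R h = teich R (g \<otimes> h)"
  unfolding teich_mult_left[OF assms(1) teich_closed[OF assms(2)]]
  using assms by (auto simp: teich_def)

text \<open>Deleting the first component w_0 subtracts w_0^(p^n) from ghost component n, and this is
  the ghost component of [w_0].\<close>

lemma teich_split:
  assumes w: "w \<in> carrier W"
  shows "teich R (w 0) \<oplus>\<^bsub>W\<^esub> (\<lambda>n. if n = 0 then \<zero> else w n) = w"
proof -
  let ?f = "case_sum (\<lambda>_. \<zero>) w"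
  have f: "?f \<in> UNIV \<rightarrow> carrier R" using w by (auto split: sum.split)
  show ?thesis
    by (rule witt_add_eqI[OF f, of _ "\<lambda>i. if i = 0 then poly_var (Inr 0) else 0" _
          "\<lambda>i. if i = 0 then 0 else poly_var (Inr i)" _ "\<lambda>i. poly_var (Inr i)"])
      (auto simp: teich_def poly_eval_var f ghost_tail[OF p_pos] ghost_teich[OF p_pos])
qed

lemma witt_nat_mult_p:
  assumes w: "w \<in> carrier W"
  shows "[p] \<cdot>\<^bsub>W\<^esub> w = case_nat \<zero> (\<lambda>n. w n [^] p)"
proof -
  let ?f = "case_sum (\<lambda>_. \<zero>) w"
  have f: "?f \<in> UNIV \<rightarrow> carrier R" using w by (auto split: sum.split)
  \<comment> \<open>The k-fold sum is followed at the level of integer polynomials, where its ghost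
    components are k times those of the variables. Only for k = p is the result compared with
    VF.\<close>
  have "\<exists>Q. (\<forall>n. ([k] \<cdot>\<^bsub>W\<^esub> w) n = poly_eval R (Q n) ?f) \<and>
      (\<forall>n. ghost p n Q = of_nat k * ghost p n (\<lambda>i. poly_var (Inr i)))" for k :: nat
  proof (induction k)
    case 0
    show ?case
      by (rule exI[of _ "\<lambda>_. 0"]) (use p_pos in \<open>auto simp: add_pow_def nat_pow_def ghost_def\<close>)
  next
    case (Suc k)
    then obtain Q where Q: "\<And>n. ([k] \<cdot>\<^bsub>W\<^esub> w) n = poly_eval R (Q n) ?f"
      "\<And>n. ghost p n Q = of_nat k * ghost p n (\<lambda>i. poly_var (Inr i))" by blast
    let ?S = "\<lambda>i. poly_subst (witt_sum_poly p i) (case_sum Q (\<lambda>i. poly_var (Inr i)))"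
    have "[Suc k] \<cdot>\<^bsub>W\<^esub> w = ([k] \<cdot>\<^bsub>W\<^esub> w) \<oplus>\<^bsub>W\<^esub> w" by (simp add: add_pow_def nat_pow_def)
    also have "\<dots> = (\<lambda>n. poly_eval R (?S n) ?f)"
      by (rule witt_add_eqI[OF f, of _ Q _ "\<lambda>i. poly_var (Inr i)" _ ?S])
        (auto simp: Q(1) poly_eval_var[OF f] ghost_witt_sum_subst[OF p_prime])
    finally show ?case
      by (intro exI[of _ ?S]) (auto simp: ghost_witt_sum_subst[OF p_prime] Q(2) algebra_simps)
  qed
  then obtain Q where Q: "\<And>n. ([p] \<cdot>\<^bsub>W\<^esub> w) n = poly_eval R (Q n) ?f"
    "\<And>n. ghost p n Q = of_nat p * ghost p n (\<lambda>i. poly_var (Inr i))" by blast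
  have "of_nat p dvd Q n - case_nat 0 (\<lambda>i. poly_var (Inr i) ^ p) n" for n
    by (rule dvd_of_ghost_dvd[OF p_pos]) (simp add: Q(2) ghost_frobenius_verschiebung[OF p_pos])
  then have "([p] \<cdot>\<^bsub>W\<^esub> w) n = poly_eval R (case_nat 0 (\<lambda>i. poly_var (Inr i) ^ p) n) ?f" for n
    unfolding Q(1) by (rule poly_eval_cong_mod_p[OF f])
  then show ?thesis
    by (auto simp: poly_eval_power poly_eval_var f split: nat.split)
qed

lemma witt_mult_comm:
  assumes x: "x \<in> carrier W" and y: "y \<in> carrier W"
  shows "x \<otimes>\<^bsub>W\<^esub> y = y \<otimes>\<^bsub>W\<^esub> x"
proof -
  let ?f = "case_sum x y"
  have f: "?f \<in> UNIV \<rightarrow> carrier R" using x y by (auto split: sum.split)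
  show ?thesis
    by (rule witt_mult_eqI[OF f, of _ "\<lambda>i. poly_var (Inl i)" _ "\<lambda>i. poly_var (Inr i)" _
      "\<lambda>i. poly_subst (witt_prod_poly p i) (case_sum (\<lambda>i. poly_var (Inr i)) (\<lambda>i. poly_var (Inl i)))"])
    (auto simp: poly_eval_var f ghost_witt_prod_subst[OF p_prime] poly_eval_subst[OF f] witt_ring_mult mult.commute
      intro!: arg_cong[where f = "poly_eval R (witt_prod_poly p n)" for n] split: sum.split)
qed

lemma witt_add_0:
  assumes "x \<in> carrier W" "y \<in> carrier W"
  shows "(x \<oplus>\<^bsub>W\<^esub> y) 0 = x 0 \<oplus> y 0"
proof -
  have f: "case_sum x y \<in> UNIV \<rightarrow> carrier R" using assms by (auto split: sum.split)
  have "witt_sum_poly p 0 = poly_var (Inl 0) + poly_var (Inr 0)"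
    using ghost_witt_sum_poly[OF p_prime, of 0] by (simp add: ghost_def)
  then show ?thesis by (simp add: witt_ring_add poly_eval_add poly_eval_var f)
qed

lemma witt_mult_0:
  assumes "x \<in> carrier W" "y \<in> carrier W"
  shows "(x \<otimes>\<^bsub>W\<^esub> y) 0 = x 0 \<otimes> y 0"
proof -
  have f: "case_sum x y \<in> UNIV \<rightarrow> carrier R" using assms by (auto split: sum.split)
  have "witt_prod_poly p 0 = poly_var (Inl 0) * poly_var (Inr 0)"
    using ghost_witt_prod_poly[OF p_prime, of 0] by (simp add: ghost_def)
  then show ?thesis by (simp add: witt_ring_mult poly_eval_mult poly_eval_var f)
qed

text \<open>Follows from 0 + 0 = 0 in \<open>W\<close>. It serves to see that a Witt sum has
  vanishing components after a projection that kills all components of both summands.\<close>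

lemma witt_sum_poly_zero: "poly_eval R (witt_sum_poly p n) (\<lambda>_. \<zero>) = \<zero>"
proof -
  let ?z = "\<lambda>_. \<zero> :: 'a"
  have "?z \<oplus>\<^bsub>W\<^esub> ?z = ?z"
    by (rule witt_add_eqI[of ?z _ "\<lambda>_. 0" _ "\<lambda>_. 0" _ "\<lambda>_. 0"])
      (use p_pos in \<open>auto simp: ghost_def\<close>)
  then have "(?z \<oplus>\<^bsub>W\<^esub> ?z) n = \<zero>" by simp
  moreover have "case_sum ?z ?z = ?z" by (auto split: sum.split)
  ultimately show ?thesis by (simp add: witt_ring_add)
qed

end

lemma poly_eval_ring_hom:
  assumes "cring B" "cring C" and h: "h \<in> ring_hom B C" and f: "f \<in> UNIV \<rightarrow> carrier B"
  shows "h (poly_eval B P f) = poly_eval C P (\<lambda>v. h (f v))"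
proof -
  interpret B: cring B by fact
  interpret C: cring C by fact
  interpret ring_hom_cring B C h by unfold_locales (rule h)
  have f': "(\<lambda>v. h (f v)) \<in> UNIV \<rightarrow> carrier C" using f by auto
  show ?thesis
    by (induction P rule: witt_poly_induct)
      (use f f' in \<open>auto simp: B.poly_eval_diff C.poly_eval_diff B.poly_eval_mult C.poly_eval_mult
        B.poly_eval_1 C.poly_eval_1 B.poly_eval_var C.poly_eval_var a_minus_def\<close>)
qed


declare witt_ring_simps [simp del]

section \<open>Witt vectors of perfect rings as p-adic series of Teichmueller elements\<close>

locale perfect_char_p_ring = char_p_ring +
  assumes frobenius_bij: "bij_betw (\<lambda>x. x [^] p) (carrier R) (carrier R)"
begin

definition p_root :: "'a \<Rightarrow> 'a" where
  "p_root = inv_into (carrier R) (\<lambda>x. x [^] p)"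

lemma p_root_closed [simp, intro]: "x \<in> carrier R \<Longrightarrow> p_root x \<in> carrier R"
  unfolding p_root_def using frobenius_bij by (metis bij_betw_imp_surj_on inv_into_into)

lemma p_root_pow [simp]: "x \<in> carrier R \<Longrightarrow> p_root x [^] p = x"
  unfolding p_root_def using frobenius_bij
  by (metis (no_types, lifting) bij_betw_imp_surj_on f_inv_into_f)

lemma pow_p_inject:
  "x \<in> carrier R \<Longrightarrow> y \<in> carrier R \<Longrightarrow> x [^] p = y [^] p \<Longrightarrow> x = y"
  using frobenius_bij by (auto simp: bij_betw_def dest: inj_onD)

lemma p_root_unique: "x \<in> carrier R \<Longrightarrow> p_root (x [^] p) = x"
  by (rule pow_p_inject) auto

lemma zero_pow_p [simp]: "\<zero> [^] p = \<zero>"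
  using p_pos by (cases p) auto

text \<open>The quotient of w - [w_0] by p: multiplication by p shifts the components and raises
  them to the p-th power, so its inverse drops the first component and takes p-th roots.\<close>

definition witt_div :: "(nat \<Rightarrow> 'a) \<Rightarrow> nat \<Rightarrow> 'a" where
  "witt_div w = (\<lambda>n. p_root (w (Suc n)))"

lemma witt_nth_closed: "w \<in> carrier W \<Longrightarrow> w n \<in> carrier R"
  by (simp add: witt_ring_simps)

lemma witt_div_closed [simp, intro]: "w \<in> carrier W \<Longrightarrow> witt_div w \<in> carrier W"
  by (auto simp: witt_ring_simps witt_div_def)

lemma witt_decomp:
  assumes w: "w \<in> carrier W"
  shows "teich R (w 0) \<oplus>\<^bsub>W\<^esub> [p] \<cdot>\<^bsub>W\<^esub> witt_div w = w"
proof -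
  have "[p] \<cdot>\<^bsub>W\<^esub> witt_div w = (\<lambda>n. if n = 0 then \<zero> else w n)"
    by (subst witt_nat_mult_p[OF witt_div_closed[OF w]])
      (use w in \<open>auto simp: witt_div_def witt_ring_simps split: nat.split\<close>)
  then show ?thesis using teich_split[OF w] by simp
qed

end

text \<open>The ring axioms enter as an assumption. In the application they are contained in the
  hypothesis that the kernel of \<theta> is a principal ideal of \<open>A_inf p A\<close>;
  commutativity is added from \<open>witt_mult_comm\<close>.\<close>

locale witt_perfect = perfect_char_p_ring +
  assumes witt_ring: "ring (witt_ring p R)"

sublocale witt_perfect \<subseteq> W: cring "witt_ring p R"
proof -
  interpret W: ring "witt_ring p R" by (rule witt_ring)
  show "cring (witt_ring p R)"
    by (rule cring.intro[OF witt_ring W.monoid_comm_monoidI]) (rule witt_mult_comm)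
qed

context witt_perfect
begin

lemma teich_closed' [simp, intro]: "b \<in> carrier R \<Longrightarrow> teich R b \<in> carrier W"
  by (rule teich_closed)

lemma witt_diff_0:
  assumes "x \<in> carrier W" "y \<in> carrier W"
  shows "(x \<ominus>\<^bsub>W\<^esub> y) 0 = x 0 \<ominus> y 0"
proof -
  have "(x \<ominus>\<^bsub>W\<^esub> y) \<oplus>\<^bsub>W\<^esub> y = x" using assms by (simp add: W.minus_eq W.a_assoc W.l_neg)
  then have "(x \<ominus>\<^bsub>W\<^esub> y) 0 \<oplus> y 0 = x 0"
    using witt_add_0[of "x \<ominus>\<^bsub>W\<^esub> y" y] assms by simp
  then show ?thesis using assms witt_nth_closed[of _ 0]
    by (metis W.minus_closed add.inv_solve_right minus_eq)
qed

lemma witt_eq_p_mult: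
  assumes "w \<in> carrier W" "w 0 = \<zero>"
  shows "w = [p] \<cdot>\<^bsub>W\<^esub> witt_div w"
proof -
  have "teich R \<zero> = \<zero>\<^bsub>W\<^esub>" by (auto simp: teich_def witt_ring_simps)
  then show ?thesis using witt_decomp[OF assms(1)] assms by simp
qed

text \<open>The inverse y is found by long division of 1 by z in powers of p. The remainder r_k is
  cancelled modulo p by z[c_k] with c_k = r_k(0)/z(0), and r_(k+1) is the rest divided by p; the
  quotient y is the series of all p^k [c_k].\<close>

lemma witt_unit:
  assumes z: "z \<in> carrier W" and z0: "z 0 \<in> Units R"
  shows "z \<in> Units W"
proof -
  define r where "r = rec_nat \<one>\<^bsub>W\<^esub> (\<lambda>_ x. witt_div (x \<ominus>\<^bsub>W\<^esub> z \<otimes>\<^bsub>W\<^esub> teich R (x 0 \<otimes> inv (z 0))))"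
  define c where "c k = r k 0 \<otimes> inv (z 0)" for k
  \<comment> \<open>The components of the series of all p^n [c_(k+n)]: n multiplications by p move
    the entry of [c_(k+n)] to place n and raise it to the power p^n.\<close>
  define y where "y k = (\<lambda>n. c (k + n) [^] (p ^ n))" for k
  define d where "d k = r k \<ominus>\<^bsub>W\<^esub> z \<otimes>\<^bsub>W\<^esub> y k" for k
  have r0: "r 0 = \<one>\<^bsub>W\<^esub>" and rS: "r (Suc k) = witt_div (r k \<ominus>\<^bsub>W\<^esub> z \<otimes>\<^bsub>W\<^esub> teich R (c k))" for k
    by (simp_all add: r_def c_def)
  have iz: "inv (z 0) \<in> carrier R" using z0 by simp
  have rc: "r k \<in> carrier W" for k
    by (induction k) (use z iz witt_nth_closed in \<open>auto simp: r0 rS c_def\<close>)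
  have cc: "c k \<in> carrier R" for k using rc iz witt_nth_closed by (auto simp: c_def)
  have yc: "y k \<in> carrier W" for k using cc by (auto simp: y_def witt_ring_simps)
  have dc: "d k \<in> carrier W" for k using rc yc z by (auto simp: d_def)
  have y_rec: "y k = teich R (c k) \<oplus>\<^bsub>W\<^esub> [p] \<cdot>\<^bsub>W\<^esub> y (Suc k)" for k
  proof -
    have "p_root (c (k + Suc n) [^] (p ^ Suc n)) = c (Suc k + n) [^] (p ^ n)" for n
      using p_root_unique[of "c (Suc k + n) [^] (p ^ n)"] cc by (simp add: nat_pow_pow mult.commute)
    then have "witt_div (y k) = y (Suc k)" unfolding witt_div_def by (auto simp: y_def)
    moreover have "y k 0 = c k" using cc by (simp add: y_def)
    ultimately show ?thesis using witt_decomp[OF yc[of k]] by simp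
  qed
  have d_rec: "d k = [p] \<cdot>\<^bsub>W\<^esub> d (Suc k)" for k
  proof -
    let ?e = "r k \<ominus>\<^bsub>W\<^esub> z \<otimes>\<^bsub>W\<^esub> teich R (c k)"
    have ec: "?e \<in> carrier W" using rc z cc by auto
    have "z 0 \<otimes> c k = r k 0"
      using z0 rc[of k] witt_nth_closed[of "r k" 0] iz m_lcomm[of "z 0" "r k 0" "inv (z 0)"]
      by (simp add: c_def Units_closed)
    then have "?e 0 = \<zero>"
      using rc z cc witt_nth_closed[of "r k" 0] witt_nth_closed[of z 0]
      by (simp add: witt_diff_0 witt_mult_0 r_neg minus_eq)
    then have e: "?e = [p] \<cdot>\<^bsub>W\<^esub> r (Suc k)" using witt_eq_p_mult[OF ec] rS by simp
    have "d k = ?e \<ominus>\<^bsub>W\<^esub> z \<otimes>\<^bsub>W\<^esub> ([p] \<cdot>\<^bsub>W\<^esub> y (Suc k))"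
      unfolding d_def y_rec[of k] using rc z cc yc
      by (simp add: W.r_distr W.minus_eq W.minus_add W.a_ac)
    also have "\<dots> = [p] \<cdot>\<^bsub>W\<^esub> d (Suc k)"
      unfolding e d_def using rc z yc
      by (simp add: W.add_pow_rdistr W.minus_eq W.add.nat_pow_distrib W.add.nat_pow_inv)
    finally show ?thesis .
  qed
  \<comment> \<open>Each \<open>d k\<close> is divisible by p arbitrarily often. Its component 0
    vanishes, and component n + 1 is the p-th power of component n of
    \<open>d (Suc k)\<close>.\<close>
  have "d k n = \<zero>" for k n
  proof (induction n arbitrary: k)
    case 0 then show ?case using d_rec[of k] witt_nat_mult_p[OF dc[of "Suc k"]] by simp
  next
    case (Suc n) then show ?case using d_rec[of k] witt_nat_mult_p[OF dc[of "Suc k"]] by simp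
  qed
  then have "d 0 = \<zero>\<^bsub>W\<^esub>" by (auto simp: witt_ring_simps)
  then have "\<one>\<^bsub>W\<^esub> = z \<otimes>\<^bsub>W\<^esub> y 0"
    unfolding d_def r0 using z yc by (metis W.m_closed W.one_closed W.r_right_minus_eq)
  then show ?thesis using z yc by (metis W.Units_one_closed W.prod_unit_l W.unit_factor)
qed

text \<open>Multiplication by a Teichmueller element acts on Teichmueller coefficients one by one,
  so torsion with respect to \<open>[g]\<close> modulo \<open>xi\<close> comes from torsion with respect to \<open>g\<close>.\<close>

lemma teich_torsion:
  assumes g: "g \<in> carrier R" and h: "h \<in> carrier R" and z: "z \<in> Units W"
    and a: "a \<in> carrier W" and b: "b \<in> carrier W"
    and xi: "xi = teich R (g \<otimes> h) \<oplus>\<^bsub>W\<^esub> [p] \<cdot>\<^bsub>W\<^esub> z"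
    and eq: "teich R g \<otimes>\<^bsub>W\<^esub> a = xi \<otimes>\<^bsub>W\<^esub> b"
  shows "\<exists>c\<in>carrier R. \<exists>d\<in>carrier W. g \<otimes> c = \<zero> \<and> a = teich R c \<oplus>\<^bsub>W\<^esub> xi \<otimes>\<^bsub>W\<^esub> d"
proof -
  let ?g = "teich R g" and ?h = "teich R h"
  \<comment> \<open>Subtracting [h]b from a removes the Teichmueller part of xi from the relation
    and leaves [g]\<gamma> = p z b.\<close>
  define \<gamma> where "\<gamma> = a \<ominus>\<^bsub>W\<^esub> ?h \<otimes>\<^bsub>W\<^esub> b"
  have zc: "z \<in> carrier W" using z by auto
  have \<gamma>: "\<gamma> \<in> carrier W" using a b h by (auto simp: \<gamma>_def)
  have gh: "teich R (g \<otimes> h) = ?g \<otimes>\<^bsub>W\<^esub> ?h" using teich_mult g h by simp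
  have "?g \<otimes>\<^bsub>W\<^esub> \<gamma> = ?g \<otimes>\<^bsub>W\<^esub> a \<ominus>\<^bsub>W\<^esub> ?g \<otimes>\<^bsub>W\<^esub> ?h \<otimes>\<^bsub>W\<^esub> b"
    using g h a b by (simp add: \<gamma>_def W.minus_eq W.r_distr W.r_minus W.m_assoc)
  also have "\<dots> = [p] \<cdot>\<^bsub>W\<^esub> (z \<otimes>\<^bsub>W\<^esub> b)"
    unfolding eq xi gh using g h b zc
    by (simp add: W.l_distr W.minus_eq W.add_pow_ldistr W.a_ac W.r_neg W.r_neg1 W.r_neg2)
  finally have \<gamma>_eq: "?g \<otimes>\<^bsub>W\<^esub> \<gamma> = [p] \<cdot>\<^bsub>W\<^esub> (z \<otimes>\<^bsub>W\<^esub> b)" .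
  have zb: "z \<otimes>\<^bsub>W\<^esub> b \<in> carrier W" using zc b by auto
  \<comment> \<open>Both sides are known componentwise: component 0 says that g kills \<gamma>_0,
    and the p-th roots of the higher ones say that z b is [g] times
    \<open>witt_div \<gamma>\<close>.\<close>
  have comp: "g [^] (p ^ n) \<otimes> \<gamma> n = case_nat \<zero> (\<lambda>n. (z \<otimes>\<^bsub>W\<^esub> b) n [^] p) n" for n
    using \<gamma>_eq unfolding teich_mult_left[OF g \<gamma>] witt_nat_mult_p[OF zb] by (rule fun_cong)
  have g0: "g \<otimes> \<gamma> 0 = \<zero>" using comp[of 0] g by simp
  have "z \<otimes>\<^bsub>W\<^esub> b = ?g \<otimes>\<^bsub>W\<^esub> witt_div \<gamma>"
  proof
    fix n
    have "(z \<otimes>\<^bsub>W\<^esub> b) n [^] p = (g [^] (p ^ n) \<otimes> p_root (\<gamma> (Suc n))) [^] p"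
      using comp[of "Suc n"] g witt_nth_closed[OF \<gamma>] by (simp add: nat_pow_distrib nat_pow_pow mult.commute)
    then have "(z \<otimes>\<^bsub>W\<^esub> b) n = g [^] (p ^ n) \<otimes> p_root (\<gamma> (Suc n))"
      by (rule pow_p_inject[rotated 2]) (use g witt_nth_closed[OF \<gamma>] witt_nth_closed[OF zb] in auto)
    then show "(z \<otimes>\<^bsub>W\<^esub> b) n = (?g \<otimes>\<^bsub>W\<^esub> witt_div \<gamma>) n"
      unfolding teich_mult_left[OF g witt_div_closed[OF \<gamma>]] by (simp add: witt_div_def)
  qed
  then have b_eq: "b = inv\<^bsub>W\<^esub> z \<otimes>\<^bsub>W\<^esub> (?g \<otimes>\<^bsub>W\<^esub> witt_div \<gamma>)"
    using z zc b by (metis W.Units_inv_closed W.Units_l_inv W.l_one W.m_assoc)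
  define d where "d = inv\<^bsub>W\<^esub> z \<otimes>\<^bsub>W\<^esub> witt_div \<gamma>"
  have dc: "d \<in> carrier W" using z \<gamma> by (auto simp: d_def)
  have zd: "z \<otimes>\<^bsub>W\<^esub> d = witt_div \<gamma>"
    using z zc \<gamma> by (simp add: d_def W.m_assoc[symmetric])
  have hb: "?h \<otimes>\<^bsub>W\<^esub> b = ?g \<otimes>\<^bsub>W\<^esub> ?h \<otimes>\<^bsub>W\<^esub> d"
    unfolding b_eq d_def using z g h \<gamma> by (simp add: W.m_ac)
  have "a = \<gamma> \<oplus>\<^bsub>W\<^esub> ?h \<otimes>\<^bsub>W\<^esub> b"
    using a b h by (simp add: \<gamma>_def W.minus_eq W.a_assoc W.l_neg)
  also have "\<gamma> = teich R (\<gamma> 0) \<oplus>\<^bsub>W\<^esub> [p] \<cdot>\<^bsub>W\<^esub> (z \<otimes>\<^bsub>W\<^esub> d)"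
    using witt_decomp[OF \<gamma>] zd by simp
  \<comment> \<open>Since [h]b = [gh]d, the last two terms add up to xi d.\<close>
  also have "teich R (\<gamma> 0) \<oplus>\<^bsub>W\<^esub> [p] \<cdot>\<^bsub>W\<^esub> (z \<otimes>\<^bsub>W\<^esub> d) \<oplus>\<^bsub>W\<^esub> ?h \<otimes>\<^bsub>W\<^esub> b = teich R (\<gamma> 0) \<oplus>\<^bsub>W\<^esub> xi \<otimes>\<^bsub>W\<^esub> d"
    unfolding hb xi gh using g h dc zc witt_nth_closed[OF \<gamma>, of 0]
    by (simp add: W.l_distr W.add_pow_ldistr W.a_ac)
  finally show ?thesis using g0 dc witt_nth_closed[OF \<gamma>, of 0] by blast
qed

end

section \<open>Inverse limits and the tilt\<close>

lemma inv_lim_ring_simps: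
  "carrier (inv_lim_ring B t) = {x. \<forall>n. x n \<in> carrier (B n) \<and> t n (x (Suc n)) = x n}"
  "x \<otimes>\<^bsub>inv_lim_ring B t\<^esub> y = (\<lambda>n. x n \<otimes>\<^bsub>B n\<^esub> y n)"
  "\<one>\<^bsub>inv_lim_ring B t\<^esub> = (\<lambda>n. \<one>\<^bsub>B n\<^esub>)"
  "\<zero>\<^bsub>inv_lim_ring B t\<^esub> = (\<lambda>n. \<zero>\<^bsub>B n\<^esub>)"
  "x \<oplus>\<^bsub>inv_lim_ring B t\<^esub> y = (\<lambda>n. x n \<oplus>\<^bsub>B n\<^esub> y n)"
  by (simp_all add: inv_lim_ring_def)

lemma cring_inv_lim_ring:
  assumes B: "\<And>n. cring (B n)" and t: "\<And>n. t n \<in> ring_hom (B (Suc n)) (B n)"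
  shows "cring (inv_lim_ring B t)"
proof -
  interpret B: cring "B n" for n by (rule B)
  note h = ring_hom_mult[OF t] ring_hom_add[OF t] ring_hom_one[OF t]
  have z: "t n \<zero>\<^bsub>B (Suc n)\<^esub> = \<zero>\<^bsub>B n\<^esub>" for n
    by (rule ring_hom_zero[OF t B.ring_axioms B.ring_axioms])
  show ?thesis
  proof (rule cringI)
    show "abelian_group (inv_lim_ring B t)"
    proof (rule abelian_groupI)
      fix x assume x: "x \<in> carrier (inv_lim_ring B t)"
      have "t n (\<ominus>\<^bsub>B (Suc n)\<^esub> x (Suc n)) = \<ominus>\<^bsub>B n\<^esub> x n" for n
      proof -
        interpret ring_hom_cring "B (Suc n)" "B n" "t n" by unfold_locales (rule t)
        show ?thesis using x by (simp add: inv_lim_ring_simps)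
      qed
      then show "\<exists>y\<in>carrier (inv_lim_ring B t). y \<oplus>\<^bsub>inv_lim_ring B t\<^esub> x = \<zero>\<^bsub>inv_lim_ring B t\<^esub>"
        using x by (intro bexI[of _ "\<lambda>n. \<ominus>\<^bsub>B n\<^esub> x n"]) (auto simp: inv_lim_ring_simps B.l_neg)
    qed (auto simp: inv_lim_ring_simps h z B.a_ac)
    show "comm_monoid (inv_lim_ring B t)"
      by (rule comm_monoidI) (auto simp: inv_lim_ring_simps h B.m_ac)
  qed (auto simp: inv_lim_ring_simps B.l_distr)
qed

lemma inv_lim_ring_proj: "(\<lambda>x. x n) \<in> ring_hom (inv_lim_ring B t) (B n)"
  by (rule ring_hom_memI) (auto simp: inv_lim_ring_simps)

section \<open>The \<open>p\<close>-adic topology\<close>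

locale p_base = cring A for A (structure) +
  fixes p :: nat
  assumes p_prime: "Factorial_Ring.prime p"
begin

lemma p_pos: "p > 0" using p_prime prime_gt_0_nat by blast

abbreviation \<pi> where "\<pi> \<equiv> p_elem p A"

lemma p_elem_closed [simp, intro]: "\<pi> \<in> carrier A"
  by (simp add: p_elem_def)

lemma p_ideal_ideal: "ideal (p_ideal p A n) A"
  unfolding p_ideal_def by (rule cgenideal_ideal) simp

lemma p_ideal_iff: "a \<in> p_ideal p A n \<longleftrightarrow> (\<exists>c\<in>carrier A. a = \<pi> [^] n \<otimes> c)"
  unfolding p_ideal_def cgenideal_def by (auto simp: m_comm)

lemma p_ideal_0 [simp]: "p_ideal p A 0 = carrier A"
  by (auto simp: p_ideal_iff)

lemma p_ideal_1: "p_ideal p A (Suc 0) = PIdl \<pi>"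
  by (simp add: p_ideal_def)

definition pcong :: "nat \<Rightarrow> 'a \<Rightarrow> 'a \<Rightarrow> bool" where
  "pcong n a b \<longleftrightarrow> a \<in> carrier A \<and> b \<in> carrier A \<and> a \<ominus> b \<in> p_ideal p A n"

lemma pcong_iff: "pcong n a b \<longleftrightarrow> a \<in> carrier A \<and> b \<in> carrier A \<and> (\<exists>c\<in>carrier A. a = b \<oplus> \<pi> [^] n \<otimes> c)"
proof -
  have "a \<ominus> b = \<pi> [^] n \<otimes> c \<longleftrightarrow> a = b \<oplus> \<pi> [^] n \<otimes> c"
    if "a \<in> carrier A" "b \<in> carrier A" "c \<in> carrier A" for c
    using that by (metis a_comm add.inv_solve_right m_closed minus_eq nat_pow_closed p_elem_closed)
  then show ?thesis unfolding pcong_def p_ideal_iff by blast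
qed

lemma pcong_closed: "pcong n a b \<Longrightarrow> a \<in> carrier A" "pcong n a b \<Longrightarrow> b \<in> carrier A"
  by (auto simp: pcong_def)

lemma pcong_coset:
  assumes "a \<in> carrier A" "b \<in> carrier A"
  shows "pcong n a b \<longleftrightarrow> p_ideal p A n +> a = p_ideal p A n +> b"
proof -
  interpret I: ideal "p_ideal p A n" A by (rule p_ideal_ideal)
  show ?thesis using assms
    by (simp add: pcong_def quotient_eq_iff_same_a_r_cos[OF p_ideal_ideal])
qed

lemma pcong_refl [simp]: "a \<in> carrier A \<Longrightarrow> pcong n a a"
  by (simp add: pcong_coset)

lemma pcong_sym: "pcong n a b \<Longrightarrow> pcong n b a"
  using pcong_coset pcong_closed by metis

lemma pcong_trans [trans]: "pcong n a b \<Longrightarrow> pcong n b c \<Longrightarrow> pcong n a c"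
  using pcong_coset pcong_closed by metis

lemma pcong_add:
  assumes "pcong n a b" "pcong n a' b'" shows "pcong n (a \<oplus> a') (b \<oplus> b')"
proof -
  obtain c c' where "a = b \<oplus> \<pi> [^] n \<otimes> c" "a' = b' \<oplus> \<pi> [^] n \<otimes> c'" "c \<in> carrier A" "c' \<in> carrier A"
    using assms by (auto simp: pcong_iff)
  then show ?thesis using assms unfolding pcong_iff
    by (intro conjI bexI[of _ "c \<oplus> c'"]) (auto simp: r_distr a_ac)
qed

lemma pcong_mult:
  assumes "pcong n a b" "pcong n a' b'" shows "pcong n (a \<otimes> a') (b \<otimes> b')"
proof -
  obtain c c' where c: "a = b \<oplus> \<pi> [^] n \<otimes> c" "a' = b' \<oplus> \<pi> [^] n \<otimes> c'" "c \<in> carrier A" "c' \<in> carrier A"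
    using assms by (auto simp: pcong_iff)
  have b: "b \<in> carrier A" "b' \<in> carrier A" using assms by (auto simp: pcong_def)
  have "a \<otimes> a' = b \<otimes> b' \<oplus> \<pi> [^] n \<otimes> (b \<otimes> c' \<oplus> c \<otimes> b' \<oplus> c \<otimes> (\<pi> [^] n \<otimes> c'))"
    unfolding c using b c(3,4) by (simp add: l_distr r_distr m_ac a_ac)
  then show ?thesis using assms b c(3,4) unfolding pcong_iff by blast
qed

lemma pcong_minus:
  assumes "pcong n a b" "pcong n a' b'" shows "pcong n (a \<ominus> a') (b \<ominus> b')"
proof -
  have c: "a \<in> carrier A" "b \<in> carrier A" "a' \<in> carrier A" "b' \<in> carrier A" using assms by (auto simp: pcong_def)
  have "pcong n (\<ominus> \<one> \<otimes> a') (\<ominus> \<one> \<otimes> b')" using assms(2) by (intro pcong_mult) auto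
  then show ?thesis using pcong_add[OF assms(1)] c by (simp add: minus_eq l_minus)
qed

lemma p_ideal_mono:
  assumes "m \<le> n" shows "p_ideal p A n \<subseteq> p_ideal p A m"
proof
  fix a assume "a \<in> p_ideal p A n"
  then obtain c where c: "c \<in> carrier A" "a = \<pi> [^] n \<otimes> c" by (auto simp: p_ideal_iff)
  have "\<pi> [^] n = \<pi> [^] m \<otimes> \<pi> [^] (n - m)" using assms by (simp add: nat_pow_mult)
  then have "a = \<pi> [^] m \<otimes> (\<pi> [^] (n - m) \<otimes> c)" using c by (simp add: m_assoc)
  then show "a \<in> p_ideal p A m" unfolding p_ideal_iff using c by blast
qed

lemma pcong_mono: "pcong n a b \<Longrightarrow> m \<le> n \<Longrightarrow> pcong m a b"
  using p_ideal_mono by (auto simp: pcong_def)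

lemma pcong_0 [simp]: "pcong 0 a b \<longleftrightarrow> a \<in> carrier A \<and> b \<in> carrier A"
  by (auto simp: pcong_def)

lemma pcong_mult_p:
  assumes "pcong n a b" shows "pcong (Suc n) (\<pi> \<otimes> a) (\<pi> \<otimes> b)"
proof -
  obtain c where c: "c \<in> carrier A" "a = b \<oplus> \<pi> [^] n \<otimes> c" and b: "b \<in> carrier A"
    using assms by (auto simp: pcong_iff)
  have "\<pi> \<otimes> a = \<pi> \<otimes> b \<oplus> \<pi> [^] Suc n \<otimes> c"
    unfolding c using b c(1) by (simp add: r_distr m_ac)
  then show ?thesis unfolding pcong_iff using assms b c(1) by (auto simp: pcong_def)
qed

lemma pcong_poly_eval:
  assumes f: "f \<in> UNIV \<rightarrow> carrier A" and d: "of_nat p ^ n dvd P - Q"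
  shows "pcong n (poly_eval A P f) (poly_eval A Q f)"
proof -
  obtain C where "P - Q = of_nat p ^ n * C" using d by (auto elim: dvdE)
  then have "P = Q + of_nat p ^ n * C" by (simp add: algebra_simps)
  then have "poly_eval A P f = poly_eval A Q f \<oplus> \<pi> [^] n \<otimes> poly_eval A C f"
    using f by (simp add: poly_eval_add poly_eval_mult poly_eval_power poly_eval_of_nat p_elem_def)
  then show ?thesis unfolding pcong_iff using f by blast
qed

text \<open>Ghost component n of a sequence in A. It is a value of a universal polynomial (the
  variables \<open>Inl i\<close> receive the entries, the \<open>Inr i\<close> zero), so that
  identities and congruences of integer polynomials carry over.\<close>

definition gh :: "nat \<Rightarrow> (nat \<Rightarrow> 'a) \<Rightarrow> 'a" where
  "gh n f = poly_eval A (ghost p n (\<lambda>i. poly_var (Inl i))) (case_sum f (\<lambda>_. \<zero>))"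

lemma gh_closed [simp, intro]: "(\<And>i. f i \<in> carrier A) \<Longrightarrow> gh n f \<in> carrier A"
  unfolding gh_def by (intro poly_eval_closed) (auto split: sum.split)

lemma gh_poly_eval:
  assumes k: "k \<in> UNIV \<rightarrow> carrier A"
  shows "gh n (\<lambda>i. poly_eval A (F i) k) = poly_eval A (ghost p n F) k"
proof -
  have "poly_eval A (ghost p n F) k = poly_eval A (poly_subst (ghost p n (\<lambda>i. poly_var (Inl i))) (case_sum F (\<lambda>_. 0))) k"
    unfolding ghost_subst by (simp add: poly_subst_simps)
  also have "\<dots> = gh n (\<lambda>i. poly_eval A (F i) k)"
    unfolding gh_def poly_eval_subst[OF k]
    by (rule arg_cong[where f = "poly_eval A (ghost p n (\<lambda>i. poly_var (Inl i)))"]) (auto split: sum.split)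
  finally show ?thesis by simp
qed

lemma gh_cong:
  assumes "\<And>i. pcong 1 (f i) (g i)" shows "pcong (Suc n) (gh n f) (gh n g)"
proof -
  obtain c where c: "\<And>i. c i \<in> carrier A" "\<And>i. f i = g i \<oplus> \<pi> \<otimes> c i" and g: "\<And>i. g i \<in> carrier A"
    using assms by (simp add: pcong_iff) metis
  \<comment> \<open>With f_i = g_i + p c_i, the two sequences are values of the generic polynomials
    X_i + pY_i and X_i, for which \<open>ghost_cong_dvd\<close> holds.\<close>
  let ?k = "case_sum g c"
  have k: "?k \<in> UNIV \<rightarrow> carrier A" using c g by (auto split: sum.split)
  let ?F = "\<lambda>i. poly_var (Inl i) + of_nat p * poly_var (Inr i)" and ?G = "\<lambda>i. poly_var (Inl i)"
  have eqf: "f = (\<lambda>i. poly_eval A (?F i) ?k)"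
    using c g by (simp add: fun_eq_iff poly_eval_add poly_eval_mult poly_eval_of_nat poly_eval_var k p_elem_def[symmetric])
  have "g = (\<lambda>i. poly_eval A (?G i) ?k)" by (simp add: poly_eval_var k)
  then have "gh n g = gh n (\<lambda>i. poly_eval A (?G i) ?k)" by (rule arg_cong)
  also have "\<dots> = poly_eval A (ghost p n ?G) ?k" by (rule gh_poly_eval[OF k])
  finally have g_eq: "gh n g = poly_eval A (ghost p n ?G) ?k" .
  have f_eq: "gh n f = poly_eval A (ghost p n ?F) ?k"
    by (subst eqf) (rule gh_poly_eval[OF k])
  have "of_nat p ^ Suc n dvd ghost p n ?F - ghost p n ?G" by (rule ghost_cong_dvd) simp
  then show ?thesis unfolding f_eq g_eq by (rule pcong_poly_eval[OF k])
qed

lemma gh_sum: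
  assumes "\<And>i. x i \<in> carrier A" "\<And>i. y i \<in> carrier A"
  shows "gh n (\<lambda>i. poly_eval A (witt_sum_poly p i) (case_sum x y)) = gh n x \<oplus> gh n y"
proof -
  let ?k = "case_sum x y"
  have k: "?k \<in> UNIV \<rightarrow> carrier A" using assms by (auto split: sum.split)
  show ?thesis
    using gh_poly_eval[OF k, of n "\<lambda>i. poly_var (Inl i)"] gh_poly_eval[OF k, of n "\<lambda>i. poly_var (Inr i)"]
    by (simp add: gh_poly_eval[OF k] ghost_witt_sum_poly[OF p_prime] poly_eval_add k poly_eval_var)
qed

lemma gh_prod:
  assumes "\<And>i. x i \<in> carrier A" "\<And>i. y i \<in> carrier A"
  shows "gh n (\<lambda>i. poly_eval A (witt_prod_poly p i) (case_sum x y)) = gh n x \<otimes> gh n y"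
proof -
  let ?k = "case_sum x y"
  have k: "?k \<in> UNIV \<rightarrow> carrier A" using assms by (auto split: sum.split)
  show ?thesis
    using gh_poly_eval[OF k, of n "\<lambda>i. poly_var (Inl i)"] gh_poly_eval[OF k, of n "\<lambda>i. poly_var (Inr i)"]
    by (simp add: gh_poly_eval[OF k] ghost_witt_prod_poly[OF p_prime] poly_eval_mult k poly_eval_var)
qed

lemma gh_0: "(\<And>i. f i \<in> carrier A) \<Longrightarrow> gh 0 f = f 0"
  unfolding gh_def ghost_def by (simp add: poly_eval_var Pi_def split: sum.split)

text \<open>The only term lost is the last one, a multiple of p^(n+1). This congruence is what makes
  the approximations to Fontaine's map compatible.\<close>

lemma gh_Suc:
  assumes f: "\<And>i. f i \<in> carrier A"
  shows "pcong (Suc n) (gh (Suc n) f) (gh n (\<lambda>i. f i [^] p))"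
proof -
  let ?k = "case_sum f (\<lambda>_. \<zero>)"
  have k: "?k \<in> UNIV \<rightarrow> carrier A" using f by (auto split: sum.split)
  have "gh (Suc n) f = poly_eval A (ghost p (Suc n) (\<lambda>i. poly_var (Inl i))) ?k"
    using gh_poly_eval[OF k, of "Suc n" "\<lambda>i. poly_var (Inl i)"] by (simp add: poly_eval_var k)
  moreover have "gh n (\<lambda>i. f i [^] p) = poly_eval A (ghost p n (\<lambda>i. poly_var (Inl i) ^ p)) ?k"
    using gh_poly_eval[OF k, of n "\<lambda>i. poly_var (Inl i) ^ p"] by (simp add: poly_eval_var poly_eval_power k)
  ultimately show ?thesis using pcong_poly_eval[OF k] by (simp add: ghost_Suc)
qed

lemma gh_one: "gh n (\<lambda>i. if i = 0 then \<one> else \<zero>) = \<one>"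
proof -
  let ?k = "\<lambda>_. \<zero> :: 'a"
  have k: "?k \<in> UNIV \<rightarrow> carrier A" by auto
  have "(\<lambda>i. if i = 0 then \<one> else \<zero>) = (\<lambda>i :: nat. poly_eval A (if i = 0 then 1 else 0) ?k)"
    by (auto simp: poly_eval_1)
  then show ?thesis using gh_poly_eval[OF k, of n "\<lambda>i. if i = 0 then 1 else 0"]
    by (simp add: ghost_teich[OF p_pos] poly_eval_1)
qed

section \<open>Reduction modulo p and the tilt\<close>

abbreviation Ap where "Ap \<equiv> mod_p p A"
abbreviation cls where "cls a \<equiv> PIdl \<pi> +> a"

lemma mod_p_cring: "cring Ap"
  unfolding mod_p_def by (rule ideal.quotient_is_cring[OF cgenideal_ideal cring_axioms]) simp

lemma cls_hom: "cls \<in> ring_hom A Ap"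
  unfolding mod_p_def by (rule ideal.rcos_ring_hom[OF cgenideal_ideal]) simp

lemma cls_eq: "a \<in> carrier A \<Longrightarrow> b \<in> carrier A \<Longrightarrow> cls a = cls b \<longleftrightarrow> pcong 1 a b"
  by (simp add: pcong_coset p_ideal_1)

lemma mod_p_carrier: "carrier Ap = cls ` carrier A"
  unfolding mod_p_def FactRing_def A_RCOSETS_def' by auto

lemma ring_hom_cls: "ring_hom_cring A Ap cls"
  using mod_p_cring cls_hom by (intro ring_hom_cringI) (auto intro: cring_axioms)

lemma mod_p_char: "char_p_ring Ap p"
proof -
  interpret Ap: cring Ap by (rule mod_p_cring)
  interpret h: ring_hom_cring A Ap cls by (rule ring_hom_cls)
  have k: "cls ([k] \<cdot> \<one>) = [k] \<cdot>\<^bsub>Ap\<^esub> \<one>\<^bsub>Ap\<^esub>" for k :: nat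
    by (induction k) auto
  have "pcong 1 \<pi> \<zero>" by (auto simp: pcong_iff intro!: bexI[of _ \<one>])
  then have "cls \<pi> = \<zero>\<^bsub>Ap\<^esub>" using cls_eq[of \<pi> \<zero>] by simp
  then show ?thesis using k[of p] p_prime by unfold_locales (simp_all add: p_elem_def)
qed

abbreviation Tilt where "Tilt \<equiv> tilt p A"

lemma frobenius_hom: "(\<lambda>x. x [^]\<^bsub>Ap\<^esub> p) \<in> ring_hom Ap Ap"
proof -
  interpret Ap: char_p_ring Ap p by (rule mod_p_char)
  show ?thesis by (rule ring_hom_memI) (auto simp: Ap.freshman Ap.nat_pow_distrib)
qed

lemma tilt_cring: "cring Tilt"
  unfolding tilt_def by (rule cring_inv_lim_ring[OF mod_p_cring frobenius_hom])

lemma tilt_proj: "(\<lambda>x. x n) \<in> ring_hom Tilt Ap"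
  unfolding tilt_def by (rule inv_lim_ring_proj)

lemma tilt_proj_hom: "ring_hom_cring Tilt Ap (\<lambda>x. x n)"
  using tilt_cring mod_p_cring tilt_proj by (intro ring_hom_cringI) auto

lemma tilt_carrier: "x \<in> carrier Tilt \<longleftrightarrow> (\<forall>n. x n \<in> carrier Ap \<and> x (Suc n) [^]\<^bsub>Ap\<^esub> p = x n)"
  by (simp add: tilt_def inv_lim_ring_simps)

lemma tilt_pow:
  assumes "x \<in> carrier Tilt" shows "(x [^]\<^bsub>Tilt\<^esub> (k :: nat)) n = x n [^]\<^bsub>Ap\<^esub> k"
proof -
  interpret h: ring_hom_cring Tilt Ap "\<lambda>x. x n" by (rule tilt_proj_hom)
  show ?thesis using assms by (induction k) auto
qed

lemma tilt_perfect: "perfect_char_p_ring Tilt p"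
proof -
  interpret T: cring Tilt by (rule tilt_cring)
  interpret Ap: char_p_ring Ap p by (rule mod_p_char)
  have "[k] \<cdot>\<^bsub>Tilt\<^esub> \<one>\<^bsub>Tilt\<^esub> = (\<lambda>n. [k] \<cdot>\<^bsub>Ap\<^esub> \<one>\<^bsub>Ap\<^esub>)" for k :: nat
    by (induction k) (auto simp: add_pow_def nat_pow_def tilt_def inv_lim_ring_simps)
  then have char: "[p] \<cdot>\<^bsub>Tilt\<^esub> \<one>\<^bsub>Tilt\<^esub> = \<zero>\<^bsub>Tilt\<^esub>"
    using Ap.p_char by (simp add: tilt_def inv_lim_ring_simps)
  have s: "(\<lambda>n. x (Suc n)) \<in> carrier Tilt" if "x \<in> carrier Tilt" for x
    using that unfolding tilt_carrier by blast
  have bij: "bij_betw (\<lambda>x. x [^]\<^bsub>Tilt\<^esub> p) (carrier Tilt) (carrier Tilt)"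
  \<comment> \<open>Frobenius on the tilt is inverse to the shift of sequences, because each
    coordinate is the p-th power of the next.\<close>
  proof (rule bij_betw_byWitness[where f' = "\<lambda>x n. x (Suc n)"])
    show "\<forall>x\<in>carrier Tilt. (\<lambda>n. (x [^]\<^bsub>Tilt\<^esub> p) (Suc n)) = x"
    proof (intro ballI ext)
      fix x n assume x: "x \<in> carrier Tilt"
      have "(x [^]\<^bsub>Tilt\<^esub> p) (Suc n) = x (Suc n) [^]\<^bsub>Ap\<^esub> p" by (rule tilt_pow[OF x])
      also have "\<dots> = x n" using x unfolding tilt_carrier by blast
      finally show "(x [^]\<^bsub>Tilt\<^esub> p) (Suc n) = x n" .
    qed
    show "(\<lambda>x n. x (Suc n)) ` carrier Tilt \<subseteq> carrier Tilt" using s by blast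
    show "\<forall>x\<in>carrier Tilt. (\<lambda>n. x (Suc n)) [^]\<^bsub>Tilt\<^esub> p = x"
    proof (intro ballI ext)
      fix x n assume x: "x \<in> carrier Tilt"
      have "((\<lambda>n. x (Suc n)) [^]\<^bsub>Tilt\<^esub> p) n = x (Suc n) [^]\<^bsub>Ap\<^esub> p" by (rule tilt_pow[OF s[OF x]])
      also have "\<dots> = x n" using x unfolding tilt_carrier by blast
      finally show "((\<lambda>n. x (Suc n)) [^]\<^bsub>Tilt\<^esub> p) n = x n" .
    qed
  qed (auto intro: T.nat_pow_closed)
  show ?thesis
    by (intro perfect_char_p_ring.intro char_p_ring.intro tilt_cring char_p_ring_axioms.intro
      perfect_char_p_ring_axioms.intro p_prime char bij)
qed

end

section \<open>Fontaine's map\<close>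

lemma (in p_base) pcong_power_p:
  assumes "pcong (Suc 0) a b" shows "pcong (Suc k) (a [^] (p ^ k)) (b [^] (p ^ k))"
proof -
  obtain c where c: "c \<in> carrier A" "a = b \<oplus> \<pi> \<otimes> c" and b: "b \<in> carrier A"
    using assms by (auto simp: pcong_iff)
  let ?k = "case_sum (\<lambda>_. b) (\<lambda>_. c) :: nat + nat \<Rightarrow> _"
  have k: "?k \<in> UNIV \<rightarrow> carrier A" using c b by (auto split: sum.split)
  let ?X = "poly_var (Inl 0)" and ?Y = "poly_var (Inr 0)"
  have "pcong (Suc k) (poly_eval A ((?X + of_nat p * ?Y) ^ (p ^ k)) ?k) (poly_eval A (?X ^ (p ^ k)) ?k)"
    by (rule pcong_poly_eval[OF k]) (use dvd_power_prime_power_diff[of p 0 "?X + of_nat p * ?Y" ?X k] in simp)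
  then show ?thesis unfolding c
    by (simp add: poly_eval_power poly_eval_add poly_eval_mult poly_eval_of_nat poly_eval_var k p_elem_def)
qed

locale p_complete_ring = p_base +
  assumes complete: "p_complete p A"
begin

lemma pcong_separated:
  assumes "\<And>n. pcong n a b" shows "a = b"
proof -
  have ab: "a \<in> carrier A" "b \<in> carrier A" using assms[of 0] by auto
  have "inj_on (\<lambda>a n. p_ideal p A n +> a) (carrier A)"
    using complete by (auto simp: p_complete_def ring_iso_def bij_betw_def)
  moreover have "(\<lambda>n. p_ideal p A n +> a) = (\<lambda>n. p_ideal p A n +> b)"
    using assms pcong_coset[OF ab] by auto
  ultimately show ?thesis using ab by (auto dest!: inj_onD)
qed

lemma p_ideal_add_coset:
  assumes "s \<in> carrier A" "m \<le> n"
  shows "p_ideal p A m <+>\<^bsub>A\<^esub> (p_ideal p A n +> s) = p_ideal p A m +> s"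
proof -
  interpret I: ideal "p_ideal p A m" A by (rule p_ideal_ideal)
  interpret J: ideal "p_ideal p A n" A by (rule p_ideal_ideal)
  note sub = p_ideal_mono[OF assms(2)]
  show ?thesis
  proof (intro equalityI subsetI)
    fix x assume "x \<in> p_ideal p A m <+>\<^bsub>A\<^esub> (p_ideal p A n +> s)"
    then obtain i j where ij: "i \<in> p_ideal p A m" "j \<in> p_ideal p A n" "x = i \<oplus> (j \<oplus> s)"
      by (auto simp: set_add_def' a_r_coset_def')
    then have "x = (i \<oplus> j) \<oplus> s" using assms(1) sub I.Icarr by (auto simp: a_assoc)
    then show "x \<in> p_ideal p A m +> s" using ij sub by (auto simp: a_r_coset_def')
  next
    fix x assume "x \<in> p_ideal p A m +> s"
    then obtain i where i: "i \<in> p_ideal p A m" "x = i \<oplus> s" by (auto simp: a_r_coset_def')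
    then have "x = i \<oplus> (\<zero> \<oplus> s)" using assms(1) by simp
    then show "x \<in> p_ideal p A m <+>\<^bsub>A\<^esub> (p_ideal p A n +> s)"
      using i J.zero_closed unfolding set_add_def' a_r_coset_def' by blast
  qed
qed

lemma pcong_limit:
  assumes s: "\<And>n. pcong n (s (Suc n)) (s n)"
  obtains a where "a \<in> carrier A" "\<And>n. pcong n a (s n)"
proof -
  have sc: "s n \<in> carrier A" for n using s[of n] by (auto simp: pcong_def)
  let ?U = "\<lambda>n. p_ideal p A n +> s n"
  have "p_ideal p A n <+>\<^bsub>A\<^esub> ?U (Suc n) = ?U n" for n
    using p_ideal_add_coset[of "s (Suc n)" n "Suc n"] sc s[of n] pcong_coset by simp
  moreover have "?U n \<in> carrier (A Quot p_ideal p A n)" for n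
    using sc by (auto simp: FactRing_def A_RCOSETS_def')
  ultimately have "?U \<in> carrier (p_completion p A)"
    by (simp add: p_completion_def inv_lim_ring_simps)
  moreover have "(\<lambda>a n. p_ideal p A n +> a) ` carrier A = carrier (p_completion p A)"
    using complete by (auto simp: p_complete_def ring_iso_def bij_betw_def)
  ultimately have "?U \<in> (\<lambda>a n. p_ideal p A n +> a) ` carrier A" by simp
  then obtain a where a: "a \<in> carrier A" "(\<lambda>n. p_ideal p A n +> a) = ?U"
    by (metis (no_types, lifting) imageE)
  then have "pcong n a (s n)" for n using pcong_coset[OF a(1) sc[of n]] fun_cong[OF a(2)] by auto
  then show ?thesis using that a by blast
qed

text \<open>The inverse is the geometric series in -pe, obtained as the limit of the iteration x
  \<mapsto> 1 - pex started at 1.\<close>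

lemma one_plus_p_unit:
  assumes e: "e \<in> carrier A" shows "\<one> \<oplus> \<pi> \<otimes> e \<in> Units A"
proof -
  let ?u = "\<one> \<oplus> \<pi> \<otimes> e"
  define s where "s = rec_nat \<one> (\<lambda>_ x. \<one> \<ominus> \<pi> \<otimes> (e \<otimes> x))"
  have sS: "s (Suc n) = \<one> \<ominus> \<pi> \<otimes> (e \<otimes> s n)" for n by (simp add: s_def)
  have sc: "s n \<in> carrier A" for n by (induction n) (use e in \<open>auto simp: s_def\<close>)
  have ss: "pcong n (s (Suc n)) (s n)" for n
  proof (induction n)
    case 0 then show ?case using sc by simp
  next
    case (Suc n)
    have "pcong n (e \<otimes> s (Suc n)) (e \<otimes> s n)" using Suc e by (intro pcong_mult) auto
    then have "pcong (Suc n) (\<pi> \<otimes> (e \<otimes> s (Suc n))) (\<pi> \<otimes> (e \<otimes> s n))" by (rule pcong_mult_p)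
    then show ?case unfolding sS[of "Suc n"] by (subst (2) sS) (intro pcong_minus pcong_refl; simp)
  qed
  obtain a where a: "a \<in> carrier A" "\<And>n. pcong n a (s n)" using pcong_limit[OF ss] by blast
  have "?u \<otimes> a = \<one>"
  proof (rule pcong_separated)
    fix n
    have "pcong n (?u \<otimes> a) (s (Suc n) \<oplus> \<pi> \<otimes> (e \<otimes> s n))"
    proof -
      have "?u \<otimes> a = a \<oplus> \<pi> \<otimes> (e \<otimes> a)" using a(1) e by (simp add: l_distr m_assoc)
      moreover have "pcong n a (s (Suc n))" using a(2)[of "Suc n"] pcong_mono by simp
      moreover have "pcong n (\<pi> \<otimes> (e \<otimes> a)) (\<pi> \<otimes> (e \<otimes> s n))" using a e by (intro pcong_mult) auto
      ultimately show ?thesis using pcong_add by simp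
    qed
    moreover have "s (Suc n) \<oplus> \<pi> \<otimes> (e \<otimes> s n) = \<one>"
      unfolding sS using e sc by (simp add: minus_eq a_assoc l_neg)
    ultimately show "pcong n (?u \<otimes> a) \<one>" by simp
  qed
  then show ?thesis using a(1) e by (intro unit_factor[of ?u a]) auto
qed

section \<open>Fontaine's map as a limit of ghost components\<close>

definition lift :: "'a set \<Rightarrow> 'a" where
  "lift U = (SOME a. a \<in> carrier A \<and> cls a = U)"

lemma lift: assumes "U \<in> carrier Ap" shows "lift U \<in> carrier A" "cls (lift U) = U"
proof -
  have "\<exists>a. a \<in> carrier A \<and> cls a = U" using assms by (auto simp: mod_p_carrier)
  from someI_ex[OF this] show "lift U \<in> carrier A" "cls (lift U) = U" by (auto simp: lift_def)
qed

abbreviation W where "W \<equiv> witt_ring p Tilt"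

text \<open>Entry w_i of the Witt vector has in its coordinate n a p^n-th root modulo p of its
  coordinate 0. The ghost component of arbitrary lifts of these roots is well defined modulo p^(n+1)
  by \<open>gh_cong\<close>, and \<theta>(w) is its limit.\<close>

definition theta_approx :: "nat \<Rightarrow> (nat \<Rightarrow> nat \<Rightarrow> 'a set) \<Rightarrow> 'a" where
  "theta_approx n w = gh n (\<lambda>i. lift (w i n))"

lemma witt_tilt_nth: "w \<in> carrier W \<Longrightarrow> w i n \<in> carrier Ap" "w \<in> carrier W \<Longrightarrow> w i \<in> carrier Tilt"
  by (auto simp: witt_ring_simps tilt_carrier)

lemma theta_approx_eqI:
  assumes "w \<in> carrier W" "\<And>i. f i \<in> carrier A" "\<And>i. cls (f i) = w i n"
  shows "pcong (Suc n) (theta_approx n w) (gh n f)"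
  unfolding theta_approx_def
proof (rule gh_cong)
  have "w i n \<in> carrier Ap" for i using witt_tilt_nth assms(1) by blast
  then show "pcong 1 (lift (w i n)) (f i)" for i
    using cls_eq[of "lift (w i n)" "f i"] lift[of "w i n"] assms(2,3) by simp
qed

text \<open>The p-th powers of lifts of the coordinates n + 1 are lifts of the coordinates n, and by
  \<open>gh_Suc\<close> this trades one ghost level for one coordinate.\<close>

lemma theta_approx_Suc:
  assumes w: "w \<in> carrier W"
  shows "pcong (Suc n) (theta_approx (Suc n) w) (theta_approx n w)"
proof -
  interpret Ap: cring Ap by (rule mod_p_cring)
  interpret h: ring_hom_cring A Ap cls by (rule ring_hom_cls)
  let ?l = "\<lambda>i. lift (w i (Suc n))"
  have l: "?l i \<in> carrier A" "cls (?l i) = w i (Suc n)" for i using lift witt_tilt_nth w by auto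
  have "cls (?l i [^] p) = w i n" for i
    using l[of i] witt_tilt_nth(2)[OF w, of i] by (simp add: tilt_carrier)
  then have "pcong (Suc n) (theta_approx n w) (gh n (\<lambda>i. ?l i [^] p))"
    by (intro theta_approx_eqI w) (use l in auto)
  moreover have "pcong (Suc n) (theta_approx (Suc n) w) (gh n (\<lambda>i. ?l i [^] p))"
    unfolding theta_approx_def by (rule gh_Suc) (rule l)
  ultimately show ?thesis using pcong_sym pcong_trans by blast
qed

lemma poly_eval_tilt:
  assumes f: "f \<in> UNIV \<rightarrow> carrier Tilt" and g: "g \<in> UNIV \<rightarrow> carrier A" and fg: "\<And>v. cls (g v) = f v n"
  shows "cls (poly_eval A P g) = poly_eval Tilt P f n"
proof -
  have "cls (poly_eval A P g) = poly_eval Ap P (\<lambda>v. cls (g v))"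
    by (rule poly_eval_ring_hom[OF cring_axioms mod_p_cring cls_hom g])
  also have "\<dots> = poly_eval Tilt P f n"
    unfolding fg by (rule poly_eval_ring_hom[OF tilt_cring mod_p_cring tilt_proj f, symmetric])
  finally show ?thesis .
qed

text \<open>Evaluating the Witt sum polynomials at lifts of the components yields lifts of the
  components of x + y, and on A ghost components are additive. Closure of the sum is a hypothesis
  because the ring structure of \<open>W\<close> is introduced only later.\<close>

lemma theta_approx_add:
  assumes x: "x \<in> carrier W" and y: "y \<in> carrier W" and xy: "x \<oplus>\<^bsub>W\<^esub> y \<in> carrier W"
  shows "pcong (Suc n) (theta_approx n (x \<oplus>\<^bsub>W\<^esub> y)) (theta_approx n x \<oplus> theta_approx n y)"
proof -
  let ?g = "case_sum (\<lambda>i. lift (x i n)) (\<lambda>i. lift (y i n))"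
  have lx: "lift (x i n) \<in> carrier A" "cls (lift (x i n)) = x i n" for i using lift witt_tilt_nth x by auto
  have ly: "lift (y i n) \<in> carrier A" "cls (lift (y i n)) = y i n" for i using lift witt_tilt_nth y by auto
  have g: "?g \<in> UNIV \<rightarrow> carrier A" using lx ly by (auto split: sum.split)
  have "cls (poly_eval A (witt_sum_poly p i) ?g) = (x \<oplus>\<^bsub>W\<^esub> y) i n" for i
    unfolding witt_ring_add
    by (rule poly_eval_tilt) (use x y lx ly witt_tilt_nth(2) in \<open>auto split: sum.split\<close>)
  then have "pcong (Suc n) (theta_approx n (x \<oplus>\<^bsub>W\<^esub> y)) (gh n (\<lambda>i. poly_eval A (witt_sum_poly p i) ?g))"
    using g by (intro theta_approx_eqI xy) auto
  then show ?thesis unfolding theta_approx_def using gh_sum[OF lx(1) ly(1), of n] by simp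
qed

lemma theta_approx_mult:
  assumes x: "x \<in> carrier W" and y: "y \<in> carrier W" and xy: "x \<otimes>\<^bsub>W\<^esub> y \<in> carrier W"
  shows "pcong (Suc n) (theta_approx n (x \<otimes>\<^bsub>W\<^esub> y)) (theta_approx n x \<otimes> theta_approx n y)"
proof -
  let ?g = "case_sum (\<lambda>i. lift (x i n)) (\<lambda>i. lift (y i n))"
  have lx: "lift (x i n) \<in> carrier A" "cls (lift (x i n)) = x i n" for i using lift witt_tilt_nth x by auto
  have ly: "lift (y i n) \<in> carrier A" "cls (lift (y i n)) = y i n" for i using lift witt_tilt_nth y by auto
  have g: "?g \<in> UNIV \<rightarrow> carrier A" using lx ly by (auto split: sum.split)
  have "cls (poly_eval A (witt_prod_poly p i) ?g) = (x \<otimes>\<^bsub>W\<^esub> y) i n" for i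
    unfolding witt_ring_mult
    by (rule poly_eval_tilt) (use x y lx ly witt_tilt_nth(2) in \<open>auto split: sum.split\<close>)
  then have "pcong (Suc n) (theta_approx n (x \<otimes>\<^bsub>W\<^esub> y)) (gh n (\<lambda>i. poly_eval A (witt_prod_poly p i) ?g))"
    using g by (intro theta_approx_eqI xy) auto
  then show ?thesis unfolding theta_approx_def using gh_prod[OF lx(1) ly(1), of n] by simp
qed

lemma theta_approx_one:
  assumes "\<one>\<^bsub>W\<^esub> \<in> carrier W"
  shows "pcong (Suc n) (theta_approx n \<one>\<^bsub>W\<^esub>) \<one>"
proof -
  interpret h: ring_hom_cring A Ap cls by (rule ring_hom_cls)
  have "\<one>\<^bsub>Tilt\<^esub> n = \<one>\<^bsub>Ap\<^esub>" "\<zero>\<^bsub>Tilt\<^esub> n = \<zero>\<^bsub>Ap\<^esub>" by (simp_all add: tilt_def inv_lim_ring_simps)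
  then have "pcong (Suc n) (theta_approx n \<one>\<^bsub>W\<^esub>) (gh n (\<lambda>i. if i = 0 then \<one> else \<zero>))"
    by (intro theta_approx_eqI assms) (auto simp: witt_ring_simps)
  then show ?thesis by (simp add: gh_one)
qed

definition theta :: "(nat \<Rightarrow> nat \<Rightarrow> 'a set) \<Rightarrow> 'a" where
  "theta w = (SOME a. a \<in> carrier A \<and> (\<forall>n. pcong n a (theta_approx n w)))"

lemma theta:
  assumes w: "w \<in> carrier W"
  shows "theta w \<in> carrier A" "pcong (Suc n) (theta w) (theta_approx n w)"
proof -
  have s: "pcong n (theta_approx (Suc n) w) (theta_approx n w)" for n
    using pcong_mono[OF theta_approx_Suc[OF w, of n], of n] by simp
  obtain a where "a \<in> carrier A" "\<And>n. pcong n a (theta_approx n w)" using pcong_limit[OF s] by blast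
  then have "\<exists>a. a \<in> carrier A \<and> (\<forall>n. pcong n a (theta_approx n w))" by blast
  note t = someI_ex[OF this, folded theta_def]
  have th: "theta w \<in> carrier A" "pcong n (theta w) (theta_approx n w)" for n
    using t by blast+
  then show "theta w \<in> carrier A" by simp
  \<comment> \<open>The defining limit gives only modulus p^n at index n; the gain of one power
    comes from using index n + 1 and \<open>theta_approx_Suc\<close>.\<close>
  show "pcong (Suc n) (theta w) (theta_approx n w)"
    by (rule pcong_trans[OF th(2)[of "Suc n"] theta_approx_Suc[OF w, of n]])
qed

lemma theta_eqI:
  assumes w: "w \<in> carrier W" and "\<And>n. pcong (Suc n) a (theta_approx n w)"
  shows "theta w = a"
proof (rule pcong_separated)
  fix n
  have "pcong (Suc n) (theta w) a" by (rule pcong_trans[OF theta(2)[OF w] pcong_sym[OF assms(2)]])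
  then show "pcong n (theta w) a" using pcong_mono by simp
qed

end

section \<open>Uniqueness and surjectivity of Fontaine's map\<close>

locale perfectoid_base = p_complete_ring +
  assumes frobenius_surj: "(\<lambda>x. x [^]\<^bsub>mod_p p A\<^esub> p) ` carrier (mod_p p A) = carrier (mod_p p A)"
    and A_inf_ring: "ring (witt_ring p (tilt p A))"

sublocale perfectoid_base \<subseteq> T: witt_perfect "tilt p A" p
  by (intro witt_perfect.intro tilt_perfect witt_perfect_axioms.intro A_inf_ring)

context perfectoid_base
begin

lemma theta_hom: "theta \<in> ring_hom W A"
proof (rule ring_hom_memI)
  fix x y assume x: "x \<in> carrier W" and y: "y \<in> carrier W"
  show "theta x \<in> carrier A" by (rule theta(1)[OF x])
  show "theta (x \<otimes>\<^bsub>W\<^esub> y) = theta x \<otimes> theta y"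
    by (rule theta_eqI) (use x y in \<open>auto intro: pcong_trans[OF _ pcong_sym[OF theta_approx_mult]] pcong_mult theta\<close>)
  show "theta (x \<oplus>\<^bsub>W\<^esub> y) = theta x \<oplus> theta y"
    by (rule theta_eqI) (use x y in \<open>auto intro: pcong_trans[OF _ pcong_sym[OF theta_approx_add]] pcong_add theta\<close>)
next
  show "theta \<one>\<^bsub>W\<^esub> = \<one>"
    by (rule theta_eqI) (auto intro: pcong_sym theta_approx_one)
qed

lemma theta_mod_p:
  assumes w: "w \<in> carrier W" shows "cls (theta w) = w 0 0"
proof -
  have l: "lift (w i n) \<in> carrier A" "cls (lift (w i n)) = w i n" for i n using lift witt_tilt_nth w by auto
  have "pcong 1 (theta w) (lift (w 0 0))"
    using theta(2)[OF w, of 0] by (simp add: theta_approx_def gh_0 l)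
  then show ?thesis using cls_eq[OF theta(1)[OF w] l(1)] l(2) by simp
qed

lemma teich_power:
  assumes "c \<in> carrier Tilt"
  shows "teich Tilt c [^]\<^bsub>W\<^esub> k = teich Tilt (c [^]\<^bsub>Tilt\<^esub> (k :: nat))"
proof (induction k)
  case 0 then show ?case by (simp add: teich_def witt_ring_simps)
next
  case (Suc k) then show ?case using assms T.teich_mult by simp
qed

lemma p_power_root:
  assumes "c \<in> carrier Tilt"
  shows "\<exists>d\<in>carrier Tilt. d [^]\<^bsub>Tilt\<^esub> (p ^ n) = c"
proof (induction n)
  case 0 then show ?case using assms by (intro bexI[of _ c]) auto
next
  case (Suc n)
  then obtain d where d: "d \<in> carrier Tilt" "d [^]\<^bsub>Tilt\<^esub> (p ^ n) = c" by blast
  have "T.p_root d [^]\<^bsub>Tilt\<^esub> (p ^ Suc n) = (T.p_root d [^]\<^bsub>Tilt\<^esub> p) [^]\<^bsub>Tilt\<^esub> (p ^ n)"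
    using T.nat_pow_pow[of "T.p_root d" p "p ^ n"] d(1) by simp
  then show ?case using d by (intro bexI[of _ "T.p_root d"]) auto
qed

lemma hom_nat_mult:
  assumes h: "h \<in> ring_hom W A" and w: "w \<in> carrier W"
  shows "h ([p] \<cdot>\<^bsub>W\<^esub> w) = \<pi> \<otimes> h w"
proof -
  interpret h: ring_hom_cring W A h by unfold_locales (rule h)
  have "h ([k] \<cdot>\<^bsub>W\<^esub> w) = ([k] \<cdot> \<one>) \<otimes> h w" for k :: nat
    by (induction k) (use w in \<open>auto simp: l_distr\<close>)
  then show ?thesis by (simp add: p_elem_def)
qed

text \<open>On [c] the tilt supplies d with c = d^(p^n); two values at [d] that agree modulo p have
  p^n-th powers that agree modulo p^(n+1). On a multiple p w' the precision grows by one from the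
  induction hypothesis. Every Witt vector is the sum of two such elements.\<close>

lemma theta_unique_pcong:
  assumes h: "h \<in> ring_hom W A" "\<And>w. w \<in> carrier W \<Longrightarrow> cls (h w) = w 0 0"
    and h': "h' \<in> ring_hom W A" "\<And>w. w \<in> carrier W \<Longrightarrow> cls (h' w) = w 0 0"
    and w: "w \<in> carrier W"
  shows "pcong n (h w) (h' w)"
  using w
proof (induction n arbitrary: w)
  case 0
  then show ?case using ring_hom_closed[OF h(1)] ring_hom_closed[OF h'(1)] by simp
next
  case (Suc n)
  interpret h: ring_hom_cring W A h by unfold_locales (rule h)
  interpret h': ring_hom_cring W A h' by unfold_locales (rule h')
  obtain d where d: "d \<in> carrier Tilt" "d [^]\<^bsub>Tilt\<^esub> (p ^ n) = w 0"
    using p_power_root[of "w 0"] witt_tilt_nth Suc.prems by blast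
  have td: "teich Tilt d \<in> carrier W" using d by simp
  have tw: "teich Tilt (w 0) = teich Tilt d [^]\<^bsub>W\<^esub> (p ^ n)" using teich_power d by simp
  have "pcong 1 (h (teich Tilt d)) (h' (teich Tilt d))"
    using cls_eq[of "h (teich Tilt d)" "h' (teich Tilt d)"] h(2) h'(2) td by simp
  then have 1: "pcong (Suc n) (h (teich Tilt (w 0))) (h' (teich Tilt (w 0)))"
    unfolding tw using pcong_power_p td by simp
  have dw: "T.witt_div w \<in> carrier W" using Suc.prems by simp
  have 2: "pcong (Suc n) (h ([p] \<cdot>\<^bsub>W\<^esub> T.witt_div w)) (h' ([p] \<cdot>\<^bsub>W\<^esub> T.witt_div w))"
    unfolding hom_nat_mult[OF h(1) dw] hom_nat_mult[OF h'(1) dw] using Suc.IH[OF dw] by (rule pcong_mult_p)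
  have tc: "teich Tilt (w 0) \<in> carrier W" using tw td by simp
  have pw: "[p] \<cdot>\<^bsub>W\<^esub> T.witt_div w \<in> carrier W" using dw by simp
  show ?case
    using pcong_add[OF 1 2] unfolding h.hom_add[OF tc pw, symmetric] h'.hom_add[OF tc pw, symmetric]
      T.witt_decomp[OF Suc.prems] .
qed

text \<open>The restriction is needed because the defining description requires extensionality,
  whereas \<open>theta\<close> is an arbitrary choice outside the carrier.\<close>

lemma fontaine_theta_eq: "fontaine_theta p A = restrict theta (carrier W)"
  unfolding fontaine_theta_def A_inf_def
proof (rule the_equality)
  have "restrict theta (carrier W) \<in> ring_hom W A"
    by (rule T.W.ring_hom_restrict[OF theta_hom]) simp
  then show "restrict theta (carrier W) \<in> ring_hom W A \<and> restrict theta (carrier W) \<in> extensional (carrier W) \<and>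
    (\<forall>w\<in>carrier W. cls (restrict theta (carrier W) w) = w 0 0)"
    using theta_mod_p by auto
next
  fix h assume h: "h \<in> ring_hom W A \<and> h \<in> extensional (carrier W) \<and> (\<forall>w\<in>carrier W. cls (h w) = w 0 0)"
  have "h w = theta w" if "w \<in> carrier W" for w
    using h by (intro pcong_separated theta_unique_pcong theta_hom theta_mod_p that) blast+
  then show "h = restrict theta (carrier W)"
    using h by (intro extensionalityI[of _ "carrier W"]) auto
qed

lemma tilt_proj_surj:
  assumes "U \<in> carrier Ap" shows "\<exists>c\<in>carrier Tilt. c 0 = U"
proof -
  have "\<exists>V. V \<in> carrier Ap \<and> V [^]\<^bsub>Ap\<^esub> p = U" if "U \<in> carrier Ap" for U
    using that frobenius_surj by (metis (no_types, lifting) imageE)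
  then obtain r where r: "\<And>U. U \<in> carrier Ap \<Longrightarrow> r U \<in> carrier Ap \<and> r U [^]\<^bsub>Ap\<^esub> p = U" by metis
  define c where "c n = (r ^^ n) U" for n
  have "c n \<in> carrier Ap" for n unfolding c_def by (induction n) (use r assms in auto)
  then have "c \<in> carrier Tilt" unfolding tilt_carrier using r by (simp add: c_def)
  moreover have "c 0 = U" by (simp add: c_def)
  ultimately show ?thesis by blast
qed

text \<open>Every a has the form \<theta>([c]) + p b, since the tilt maps onto A/p. Iterating on b
  yields coefficients c_n, and the series of all p^n [c_n], with components c_n^(p^n), is a preimage
  by separatedness.\<close>

lemma theta_surj:
  assumes a: "a \<in> carrier A" shows "\<exists>w\<in>carrier W. theta w = a"
proof -
  interpret h: ring_hom_cring W A theta by unfold_locales (rule theta_hom)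
  interpret q: ring_hom_cring A Ap cls by (rule ring_hom_cls)
  have "\<exists>c b. c \<in> carrier Tilt \<and> b \<in> carrier A \<and> a = theta (teich Tilt c) \<oplus> \<pi> \<otimes> b" if a: "a \<in> carrier A" for a
  proof -
    obtain c where c: "c \<in> carrier Tilt" "c 0 = cls a" using tilt_proj_surj[of "cls a"] a by auto
    then have "pcong 1 a (theta (teich Tilt c))"
      using theta_mod_p[of "teich Tilt c"] a cls_eq[of a "theta (teich Tilt c)"] by simp
    then show ?thesis using c by (auto simp: pcong_iff)
  qed
  then obtain fc fb where f: "\<And>a. a \<in> carrier A \<Longrightarrow>
      fc a \<in> carrier Tilt \<and> fb a \<in> carrier A \<and> a = theta (teich Tilt (fc a)) \<oplus> \<pi> \<otimes> fb a" by metis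
  define s where "s k = (fb ^^ k) a" for k
  have s: "s k \<in> carrier A" for k unfolding s_def by (induction k) (use f a in auto)
  define y where "y k = (\<lambda>n. fc (s (k + n)) [^]\<^bsub>Tilt\<^esub> (p ^ n))" for k
  have yc: "y k \<in> carrier W" for k using f s by (auto simp: y_def witt_ring_simps)
  have y_rec: "y k = teich Tilt (fc (s k)) \<oplus>\<^bsub>W\<^esub> [p] \<cdot>\<^bsub>W\<^esub> y (Suc k)" for k
  proof -
    have "T.p_root (fc (s (k + Suc n)) [^]\<^bsub>Tilt\<^esub> (p ^ Suc n)) = fc (s (Suc k + n)) [^]\<^bsub>Tilt\<^esub> (p ^ n)" for n
      using T.p_root_unique[of "fc (s (Suc k + n)) [^]\<^bsub>Tilt\<^esub> (p ^ n)"] f s by (simp add: T.nat_pow_pow mult.commute)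
    then have "T.witt_div (y k) = y (Suc k)" unfolding T.witt_div_def by (auto simp: y_def)
    moreover have "y k 0 = fc (s k)" using f s by (simp add: y_def)
    ultimately show ?thesis using T.witt_decomp[OF yc[of k]] by simp
  qed
  have "pcong n (s k) (theta (y k))" for n k
  proof (induction n arbitrary: k)
    case 0 then show ?case using s yc by simp
  next
    case (Suc n)
    have t: "teich Tilt (fc (s k)) \<in> carrier W" using f s by simp
    have e1: "theta (y k) = theta (teich Tilt (fc (s k))) \<oplus> \<pi> \<otimes> theta (y (Suc k))"
      by (subst y_rec) (use t yc in \<open>simp add: hom_nat_mult[OF theta_hom]\<close>)
    have e2: "s k = theta (teich Tilt (fc (s k))) \<oplus> \<pi> \<otimes> s (Suc k)"
      using f[OF s[of k]] by (simp add: s_def)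
    have "pcong (Suc n) (\<pi> \<otimes> s (Suc k)) (\<pi> \<otimes> theta (y (Suc k)))" by (rule pcong_mult_p[OF Suc])
    moreover have "pcong (Suc n) (theta (teich Tilt (fc (s k)))) (theta (teich Tilt (fc (s k))))"
      using t by simp
    ultimately show ?case unfolding e1 by (subst e2) (rule pcong_add)
  qed
  then have "theta (y 0) = s 0" using pcong_separated by metis
  then show ?thesis using yc by (auto simp: s_def)
qed

end

section \<open>Roots of \<open>p\<close> in a perfectoid ring\<close>

lemma (in monoid) nat_pow_pred:
  "x \<in> carrier G \<Longrightarrow> n > 0 \<Longrightarrow> x [^] n = x \<otimes> x [^] (n - 1 :: nat)"
  using nat_pow_Suc2[of x "n - 1"] by simp

lemma (in abelian_group) add_minus_cancel_left:
  "x \<in> carrier G \<Longrightarrow> y \<in> carrier G \<Longrightarrow> (x \<oplus> y) \<ominus> x = y"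
  by (simp add: minus_eq a_comm[of x y] a_assoc r_neg)

lemma (in p_base) tilt_unitI:
  assumes c: "c \<in> carrier Tilt" and c0: "c 0 \<in> Units Ap"
  shows "c \<in> Units Tilt"
proof -
  interpret T: cring Tilt by (rule tilt_cring)
  interpret Ap: char_p_ring Ap p by (rule mod_p_char)
  have cn: "c n \<in> carrier Ap" "c (Suc n) [^]\<^bsub>Ap\<^esub> p = c n" for n
    using c unfolding tilt_carrier by blast+
  have u: "c n \<in> Units Ap" for n
  proof (induction n)
    case 0 then show ?case by (rule c0)
  next
    case (Suc n)
    have "c (Suc n) \<otimes>\<^bsub>Ap\<^esub> c (Suc n) [^]\<^bsub>Ap\<^esub> (p - 1) = c (Suc n) [^]\<^bsub>Ap\<^esub> p"
      using Ap.nat_pow_pred[OF cn(1)[of "Suc n"] p_pos] by simp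
    then have "c (Suc n) \<otimes>\<^bsub>Ap\<^esub> c (Suc n) [^]\<^bsub>Ap\<^esub> (p - 1) \<in> Units Ap"
      using Suc cn(2)[of n] by simp
    then show ?case by (rule Ap.unit_factor) (use cn(1)[of "Suc n"] in auto)
  qed
  let ?d = "\<lambda>n. inv\<^bsub>Ap\<^esub> (c n)"
  have "?d (Suc n) [^]\<^bsub>Ap\<^esub> p = ?d n" for n
  proof -
    have "?d (Suc n) [^]\<^bsub>Ap\<^esub> p \<otimes>\<^bsub>Ap\<^esub> c n = (?d (Suc n) \<otimes>\<^bsub>Ap\<^esub> c (Suc n)) [^]\<^bsub>Ap\<^esub> p"
      unfolding cn(2)[of n, symmetric]
      by (rule Ap.nat_pow_distrib[symmetric]) (use u[of "Suc n"] cn(1)[of "Suc n"] in auto)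
    also have "\<dots> = \<one>\<^bsub>Ap\<^esub>" using u[of "Suc n"] by (simp add: Ap.nat_pow_one)
    finally have "?d (Suc n) [^]\<^bsub>Ap\<^esub> p \<otimes>\<^bsub>Ap\<^esub> c n = \<one>\<^bsub>Ap\<^esub>" .
    then show ?thesis
      using Ap.inv_unique[of "?d (Suc n) [^]\<^bsub>Ap\<^esub> p" "c n" "?d n"] u[of n] u[of "Suc n"] cn(1) by simp
  qed
  then have d: "?d \<in> carrier Tilt" unfolding tilt_carrier using u by blast
  have "c \<otimes>\<^bsub>Tilt\<^esub> ?d = \<one>\<^bsub>Tilt\<^esub>"
    using u by (simp add: tilt_def inv_lim_ring_simps)
  then show ?thesis using c d by (intro T.unit_factor[of c ?d]) auto
qed

section \<open>The generator of the kernel and the roots of p\<close>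

locale perfectoid_gen = perfectoid_base +
  fixes xi and varpi u :: 'a
  assumes xi: "xi \<in> carrier (witt_ring p (tilt p A))" "theta xi = \<zero>"
    and xi_gen: "\<And>w. w \<in> carrier (witt_ring p (tilt p A)) \<Longrightarrow> theta w = \<zero> \<Longrightarrow>
      \<exists>b\<in>carrier (witt_ring p (tilt p A)). w = xi \<otimes>\<^bsub>witt_ring p (tilt p A)\<^esub> b"
    and varpi: "varpi \<in> carrier A" "u \<in> Units A" "varpi [^] p = p_elem p A \<otimes> u"

sublocale perfectoid_gen \<subseteq> th: ring_hom_cring "witt_ring p (tilt p A)" A theta
  by unfold_locales (rule theta_hom)

context perfectoid_gen
begin

text \<open>Take f = f_1^p where f_1 lifts the class of \<open>varpi\<close>. From \<theta>([f_1])
  congruent to \<open>varpi\<close> modulo p it follows that \<theta>([f]) is congruent to pu modulo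
  p^2, hence is pu times an element 1 + pe, a unit by completeness.\<close>

lemma exists_f:
  "\<exists>f\<in>carrier Tilt. f 0 = \<zero>\<^bsub>Ap\<^esub> \<and> (\<exists>v\<in>Units A. theta (teich Tilt f) = \<pi> \<otimes> v)"
proof -
  interpret q: ring_hom_cring A Ap cls by (rule ring_hom_cls)
  obtain f1 where f1: "f1 \<in> carrier Tilt" "f1 0 = cls varpi"
    using tilt_proj_surj[of "cls varpi"] varpi by auto
  define f where "f = f1 [^]\<^bsub>Tilt\<^esub> p"
  have fc: "f \<in> carrier Tilt" using f1 by (simp add: f_def)
  have tf1: "teich Tilt f1 \<in> carrier W" using f1 by simp
  have "pcong 1 (theta (teich Tilt f1)) varpi"
    using theta_mod_p[OF tf1] cls_eq[of "theta (teich Tilt f1)" varpi] f1 varpi tf1 by simp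
  then have "pcong (Suc 1) (theta (teich Tilt f1) [^] (p ^ 1)) (varpi [^] (p ^ 1))"
    by (intro pcong_power_p) simp
  moreover have "theta (teich Tilt f) = theta (teich Tilt f1) [^] p"
    using teich_power[OF f1(1), of p] tf1 by (metis f_def th.hom_pow)
  ultimately have "pcong 2 (theta (teich Tilt f)) (\<pi> \<otimes> u)" using varpi by (simp add: numeral_2_eq_2)
  then obtain c where c: "c \<in> carrier A" "theta (teich Tilt f) = \<pi> \<otimes> u \<oplus> \<pi> [^] (2::nat) \<otimes> c"
    by (auto simp: pcong_iff)
  have uc: "u \<in> carrier A" using varpi by auto
  let ?e = "inv u \<otimes> c"
  have ec: "?e \<in> carrier A" using varpi c by auto
  have "u \<otimes> ?e = c" using varpi uc c(1) m_assoc[of u "inv u" c] by simp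
  then have v: "u \<otimes> (\<one> \<oplus> \<pi> \<otimes> ?e) = u \<oplus> \<pi> \<otimes> c"
    using uc ec by (simp add: r_distr m_lcomm[of u \<pi>])
  have "theta (teich Tilt f) = \<pi> \<otimes> (u \<otimes> (\<one> \<oplus> \<pi> \<otimes> ?e))"
    unfolding v c(2) using uc c(1) by (simp add: numeral_2_eq_2 r_distr m_ac)
  moreover have "u \<otimes> (\<one> \<oplus> \<pi> \<otimes> ?e) \<in> Units A" using varpi one_plus_p_unit[OF ec] by simp
  moreover have "f 0 = \<zero>\<^bsub>Ap\<^esub>"
  proof -
    interpret Ap: char_p_ring Ap p by (rule mod_p_char)
    have "f 0 = f1 0 [^]\<^bsub>Ap\<^esub> p" unfolding f_def by (rule tilt_pow[OF f1(1)])
    also have "\<dots> = cls (varpi [^] p)"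
      unfolding f1(2) by (rule q.hom_pow[OF varpi(1), symmetric])
    also have "\<dots> = cls \<zero>"
      using cls_eq[of "varpi [^] p" \<zero>] uc varpi by (auto simp: pcong_iff)
    finally show ?thesis by simp
  qed
  ultimately show ?thesis using fc by blast
qed

text \<open>Comparing \<open>xi\<close> with an element \<open>p - [f]x\<close> of the kernel shows that \<open>xi\<close> is distinguished.\<close>

lemma xi_distinguished:
  assumes f: "f \<in> carrier Tilt" "f 0 = \<zero>\<^bsub>Ap\<^esub>" and v: "v \<in> Units A" "theta (teich Tilt f) = \<pi> \<otimes> v"
  shows "T.witt_div xi \<in> Units W" "\<exists>h\<in>carrier Tilt. xi 0 = f \<otimes>\<^bsub>Tilt\<^esub> h"
proof -
  interpret Ap: char_p_ring Ap p by (rule mod_p_char)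
  interpret pr: ring_hom_cring Tilt Ap "\<lambda>x. x 0" by (rule tilt_proj_hom)
  have vi: "inv v \<in> carrier A" "v \<in> carrier A" using v by auto
  obtain x where x: "x \<in> carrier W" "theta x = inv v" using theta_surj[OF vi(1)] by blast
  let ?t = "teich Tilt f"
  have tc: "?t \<in> carrier W" using f by simp
  let ?P = "[p] \<cdot>\<^bsub>W\<^esub> \<one>\<^bsub>W\<^esub>"
  have Pc: "?P \<in> carrier W" by simp
  have "theta (?P \<ominus>\<^bsub>W\<^esub> ?t \<otimes>\<^bsub>W\<^esub> x) = \<pi> \<ominus> \<pi> \<otimes> (v \<otimes> inv v)"
    using tc x vi v hom_nat_mult[OF theta_hom T.W.one_closed] by (simp add: T.W.minus_eq minus_eq m_assoc)
  also have "\<dots> = \<zero>" using v by (simp add: minus_eq r_neg)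
  \<comment> \<open>With \<theta>(x) the inverse of v, the element p - [f]x lies in the kernel.
    Writing xi = [xi_0] + pz, the equation becomes p(1 - z\<eta>) = [xi_0]\<eta> + [f]x, the
    relation \<open>main\<close> below.\<close>
  finally obtain \<eta> where \<eta>: "\<eta> \<in> carrier W" "?P \<ominus>\<^bsub>W\<^esub> ?t \<otimes>\<^bsub>W\<^esub> x = xi \<otimes>\<^bsub>W\<^esub> \<eta>"
    using xi_gen[of "?P \<ominus>\<^bsub>W\<^esub> ?t \<otimes>\<^bsub>W\<^esub> x"] tc x by auto
  let ?x0 = "xi 0" and ?z = "T.witt_div xi"
  have x0: "?x0 \<in> carrier Tilt" by (rule witt_tilt_nth[OF xi(1)])
  have zc: "?z \<in> carrier W" using xi by simp
  have x00: "?x0 0 = \<zero>\<^bsub>Ap\<^esub>"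
  proof -
    interpret q: ring_hom_cring A Ap cls by (rule ring_hom_cls)
    show ?thesis using theta_mod_p[OF xi(1)] xi(2) by simp
  qed
  have txc: "teich Tilt ?x0 \<in> carrier W" using x0 by simp
  have P_eq: "?P = xi \<otimes>\<^bsub>W\<^esub> \<eta> \<oplus>\<^bsub>W\<^esub> ?t \<otimes>\<^bsub>W\<^esub> x"
    unfolding \<eta>(2)[symmetric] using tc x Pc by (simp add: T.W.minus_eq T.W.a_assoc T.W.l_neg)
  have "[p] \<cdot>\<^bsub>W\<^esub> (?z \<otimes>\<^bsub>W\<^esub> \<eta>) \<oplus>\<^bsub>W\<^esub> (teich Tilt ?x0 \<otimes>\<^bsub>W\<^esub> \<eta> \<oplus>\<^bsub>W\<^esub> ?t \<otimes>\<^bsub>W\<^esub> x) = ?P"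
    unfolding P_eq using txc zc \<eta>(1) tc x
    by (subst (2) T.witt_decomp[OF xi(1), symmetric]) (simp add: T.W.l_distr T.W.add_pow_ldistr T.W.a_ac)
  moreover have "[p] \<cdot>\<^bsub>W\<^esub> (\<one>\<^bsub>W\<^esub> \<ominus>\<^bsub>W\<^esub> ?z \<otimes>\<^bsub>W\<^esub> \<eta>) = ?P \<ominus>\<^bsub>W\<^esub> [p] \<cdot>\<^bsub>W\<^esub> (?z \<otimes>\<^bsub>W\<^esub> \<eta>)"
    using zc \<eta>(1) by (simp add: T.W.minus_eq T.W.add.nat_pow_distrib T.W.add.nat_pow_inv)
  moreover have "[p] \<cdot>\<^bsub>W\<^esub> (?z \<otimes>\<^bsub>W\<^esub> \<eta>) \<in> carrier W"
    "teich Tilt ?x0 \<otimes>\<^bsub>W\<^esub> \<eta> \<oplus>\<^bsub>W\<^esub> ?t \<otimes>\<^bsub>W\<^esub> x \<in> carrier W"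
    using zc \<eta>(1) txc tc x by auto
  ultimately have main: "[p] \<cdot>\<^bsub>W\<^esub> (\<one>\<^bsub>W\<^esub> \<ominus>\<^bsub>W\<^esub> ?z \<otimes>\<^bsub>W\<^esub> \<eta>) = teich Tilt ?x0 \<otimes>\<^bsub>W\<^esub> \<eta> \<oplus>\<^bsub>W\<^esub> ?t \<otimes>\<^bsub>W\<^esub> x"
    using T.W.add_minus_cancel_left by metis
  let ?w = "\<one>\<^bsub>W\<^esub> \<ominus>\<^bsub>W\<^esub> ?z \<otimes>\<^bsub>W\<^esub> \<eta>"
  have wc: "?w \<in> carrier W" using zc \<eta>(1) by simp
  let ?y = "?z 0 \<otimes>\<^bsub>Tilt\<^esub> \<eta> 0"
  have z0: "?z 0 \<in> carrier Tilt" and e0: "\<eta> 0 \<in> carrier Tilt" using witt_tilt_nth zc \<eta>(1) by auto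
  have w0: "?w 0 = \<one>\<^bsub>Tilt\<^esub> \<ominus>\<^bsub>Tilt\<^esub> ?y"
    using zc \<eta>(1) by (simp add: T.witt_diff_0 T.witt_mult_0) (simp add: witt_ring_simps)
  \<comment> \<open>Component i of [g]r is g^(p^i) r_i, so if coordinate 0 of g vanishes, then it
    vanishes in every component of the product.\<close>
  have comp: "s i 0 = \<zero>\<^bsub>Ap\<^esub>" if "s = teich Tilt g \<otimes>\<^bsub>W\<^esub> r" "g \<in> carrier Tilt" "g 0 = \<zero>\<^bsub>Ap\<^esub>" "r \<in> carrier W"
    for s g r i
  proof -
    have "g [^]\<^bsub>Tilt\<^esub> (p ^ i) \<in> carrier Tilt" "r i \<in> carrier Tilt" using that witt_tilt_nth by auto
    then have "s i 0 = g 0 [^]\<^bsub>Ap\<^esub> (p ^ i) \<otimes>\<^bsub>Ap\<^esub> r i 0"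
      unfolding that(1) T.teich_mult_left[OF that(2,4)] using that(2) by (simp add: tilt_pow)
    moreover have "\<zero>\<^bsub>Ap\<^esub> [^]\<^bsub>Ap\<^esub> (p ^ i) = \<zero>\<^bsub>Ap\<^esub>" using p_pos by (intro Ap.nat_pow_zero) simp
    ultimately show ?thesis using that(3,4) witt_tilt_nth(1) by simp
  qed
  \<comment> \<open>Projected to A/p, both summands on the right of \<open>main\<close> have only
    zero components, hence so has their Witt sum. On the left, component 1 of p w is w_0^p.\<close>
  have "([p] \<cdot>\<^bsub>W\<^esub> ?w) 1 0 = \<zero>\<^bsub>Ap\<^esub>"
  proof -
    let ?s = "teich Tilt ?x0 \<otimes>\<^bsub>W\<^esub> \<eta>" and ?r = "?t \<otimes>\<^bsub>W\<^esub> x"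
    have sr: "?s \<in> carrier W" "?r \<in> carrier W" using txc \<eta> tc x by auto
    have "case_sum ?s ?r v 0 = \<zero>\<^bsub>Ap\<^esub>" for v
      using comp[of ?s ?x0 \<eta>] comp[of ?r f x] x0 x00 f \<eta> x by (auto split: sum.split)
    moreover have "poly_eval Tilt (witt_sum_poly p 1) (case_sum ?s ?r) 0 =
        poly_eval Ap (witt_sum_poly p 1) (\<lambda>v. case_sum ?s ?r v 0)"
      by (rule poly_eval_ring_hom[OF tilt_cring mod_p_cring tilt_proj])
        (use sr witt_tilt_nth(2) in \<open>auto split: sum.split\<close>)
    ultimately show ?thesis unfolding main by (simp add: witt_ring_add Ap.witt_sum_poly_zero)
  qed
  then have "(?w 0) 0 [^]\<^bsub>Ap\<^esub> p = \<zero>\<^bsub>Ap\<^esub>"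
    using T.witt_nat_mult_p[OF wc] witt_tilt_nth(2)[OF wc, of 0] by (simp add: tilt_pow)
  then have w0p: "(\<one>\<^bsub>Ap\<^esub> \<ominus>\<^bsub>Ap\<^esub> ?y 0) [^]\<^bsub>Ap\<^esub> p = \<zero>\<^bsub>Ap\<^esub>"
    unfolding w0 using z0 e0 by (simp add: T.minus_eq Ap.minus_eq)
  have y0: "?y 0 \<in> carrier Ap" using z0 e0 by auto
  \<comment> \<open>From (1 - y)^p = 0 additivity of Frobenius gives 1 = y^p, so y is a unit in A/p,
    and \<open>tilt_unitI\<close> lifts this to the tilt.\<close>
  have "\<one>\<^bsub>Ap\<^esub> = (\<one>\<^bsub>Ap\<^esub> \<ominus>\<^bsub>Ap\<^esub> ?y 0 \<oplus>\<^bsub>Ap\<^esub> ?y 0) [^]\<^bsub>Ap\<^esub> p"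
    using y0 by (simp add: Ap.minus_eq Ap.a_assoc Ap.l_neg Ap.nat_pow_one)
  also have "\<dots> = ?y 0 [^]\<^bsub>Ap\<^esub> p" using y0 w0p by (simp add: Ap.freshman)
  also have "\<dots> = ?y 0 \<otimes>\<^bsub>Ap\<^esub> ?y 0 [^]\<^bsub>Ap\<^esub> (p - 1)"
    by (rule Ap.nat_pow_pred[OF y0 p_pos])
  finally have "?y 0 \<otimes>\<^bsub>Ap\<^esub> ?y 0 [^]\<^bsub>Ap\<^esub> (p - 1) \<in> Units Ap"
    using Ap.Units_one_closed by metis
  then have "?y 0 \<in> Units Ap" by (rule Ap.unit_factor) (use y0 in auto)
  then have yu: "?y \<in> Units Tilt" using z0 e0 by (intro tilt_unitI) auto
  then have "?z 0 \<in> Units Tilt" by (rule T.unit_factor) (rule z0 e0)+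
  then show "?z \<in> Units W" by (rule T.witt_unit[OF zc])
  have e0u: "\<eta> 0 \<in> Units Tilt" using yu z0 e0 T.unit_factor[of "\<eta> 0" "?z 0"] by (simp add: T.m_comm)
  have x_0: "x 0 \<in> carrier Tilt" using witt_tilt_nth x by auto
  have P0: "?P 0 = \<zero>\<^bsub>Tilt\<^esub>" using T.witt_nat_mult_p[OF T.W.one_closed] by simp
  \<comment> \<open>Component 0 of p = xi \<eta> + [f]x reads 0 = xi_0 \<eta>_0 + f x_0, and
    \<eta>_0 is a unit, so f divides xi_0.\<close>
  have "(xi \<otimes>\<^bsub>W\<^esub> \<eta> \<oplus>\<^bsub>W\<^esub> ?t \<otimes>\<^bsub>W\<^esub> x) 0 = ?x0 \<otimes>\<^bsub>Tilt\<^esub> \<eta> 0 \<oplus>\<^bsub>Tilt\<^esub> f \<otimes>\<^bsub>Tilt\<^esub> x 0"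
    using xi(1) \<eta>(1) tc x(1) by (simp add: T.witt_add_0 T.witt_mult_0)
  then have "?x0 \<otimes>\<^bsub>Tilt\<^esub> \<eta> 0 \<oplus>\<^bsub>Tilt\<^esub> f \<otimes>\<^bsub>Tilt\<^esub> x 0 = \<zero>\<^bsub>Tilt\<^esub>"
    unfolding P_eq[symmetric] P0 by simp
  then have "?x0 \<otimes>\<^bsub>Tilt\<^esub> \<eta> 0 = \<ominus>\<^bsub>Tilt\<^esub> (f \<otimes>\<^bsub>Tilt\<^esub> x 0)"
    by (rule T.minus_equality[symmetric]) (use x0 e0 f x_0 in auto)
  then have "?x0 \<otimes>\<^bsub>Tilt\<^esub> \<eta> 0 \<otimes>\<^bsub>Tilt\<^esub> inv\<^bsub>Tilt\<^esub> (\<eta> 0) = \<ominus>\<^bsub>Tilt\<^esub> (f \<otimes>\<^bsub>Tilt\<^esub> x 0) \<otimes>\<^bsub>Tilt\<^esub> inv\<^bsub>Tilt\<^esub> (\<eta> 0)"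
    by simp
  then have "?x0 = f \<otimes>\<^bsub>Tilt\<^esub> (\<ominus>\<^bsub>Tilt\<^esub> (x 0 \<otimes>\<^bsub>Tilt\<^esub> inv\<^bsub>Tilt\<^esub> (\<eta> 0)))"
    using x0 e0 e0u f x_0 by (simp add: T.m_assoc T.l_minus T.r_minus)
  then show "\<exists>h\<in>carrier Tilt. ?x0 = f \<otimes>\<^bsub>Tilt\<^esub> h"
    using x_0 e0u by (intro bexI[of _ "\<ominus>\<^bsub>Tilt\<^esub> (x 0 \<otimes>\<^bsub>Tilt\<^esub> inv\<^bsub>Tilt\<^esub> (\<eta> 0))"]) auto
qed

text \<open>\<open>om m\<close> is \<theta>([g]) for the p^m-th root g of f. Torsion: if
  \<open>om m\<close> kills a, then \<open>T.teich_torsion\<close> gives a = \<theta>([c]) with g c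
  = 0, and the p-th root of g kills c as well because the p-th power of the product is zero and the
  tilt is reduced. Roots: if a^p is a multiple of \<open>om m\<close>, then component 0 of a
  preimage of a is divisible by the p-th root of g; the remaining components contribute a multiple
  of p, hence of \<open>om (Suc m)\<close>.\<close>

lemma exists_p_roots:
  "\<exists>om. (\<forall>m. om m \<in> carrier A \<and> om (Suc m) [^] p = om m) \<and> (\<exists>v\<in>Units A. om 0 = \<pi> \<otimes> v) \<and>
    (\<forall>m. \<forall>a\<in>carrier A. om m \<otimes> a = \<zero> \<longrightarrow> om (Suc m) \<otimes> a = \<zero>) \<and>
    (\<forall>m. \<forall>a\<in>carrier A. \<forall>b\<in>carrier A. a [^] p = om m \<otimes> b \<longrightarrow> (\<exists>c\<in>carrier A. a = om (Suc m) \<otimes> c))"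
proof -
  obtain f v where f: "f \<in> carrier Tilt" "f 0 = \<zero>\<^bsub>Ap\<^esub>" and v: "v \<in> Units A" "theta (teich Tilt f) = \<pi> \<otimes> v"
    using exists_f by blast
  obtain h where h: "h \<in> carrier Tilt" "xi 0 = f \<otimes>\<^bsub>Tilt\<^esub> h" using xi_distinguished[OF f v] by blast
  note zu = xi_distinguished(1)[OF f v]
  define g where "g m = (T.p_root ^^ m) f" for m
  have gc: "g m \<in> carrier Tilt" for m unfolding g_def by (induction m) (use f in auto)
  have gS: "g (Suc m) [^]\<^bsub>Tilt\<^esub> p = g m" for m using T.p_root_pow[OF gc[of m]] by (simp add: g_def)
  have gf: "\<exists>r\<in>carrier Tilt. f = g m \<otimes>\<^bsub>Tilt\<^esub> r" for m
  proof (induction m)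
    case 0 then show ?case using f by (intro bexI[of _ "\<one>\<^bsub>Tilt\<^esub>"]) (auto simp: g_def)
  next
    case (Suc m)
    then obtain r where r: "r \<in> carrier Tilt" "f = g m \<otimes>\<^bsub>Tilt\<^esub> r" by blast
    have "g m = g (Suc m) \<otimes>\<^bsub>Tilt\<^esub> g (Suc m) [^]\<^bsub>Tilt\<^esub> (p - 1)"
      using gS[of m] T.nat_pow_pred[OF gc[of "Suc m"] p_pos] by simp
    then have "f = g (Suc m) \<otimes>\<^bsub>Tilt\<^esub> (g (Suc m) [^]\<^bsub>Tilt\<^esub> (p - 1) \<otimes>\<^bsub>Tilt\<^esub> r)"
      using r gc[of "Suc m"] T.m_assoc[of "g (Suc m)" "g (Suc m) [^]\<^bsub>Tilt\<^esub> (p - 1)" r] by simp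
    then show ?case using r gc[of "Suc m"] by blast
  qed
  \<comment> \<open>Divisibility of xi_0 by every root of f is what permits
    \<open>T.teich_torsion\<close> with \<open>g m\<close> in place of f.\<close>
  have xg: "\<exists>r\<in>carrier Tilt. xi 0 = g m \<otimes>\<^bsub>Tilt\<^esub> r" for m
  proof -
    obtain r where r: "r \<in> carrier Tilt" "f = g m \<otimes>\<^bsub>Tilt\<^esub> r" using gf by blast
    have "xi 0 = g m \<otimes>\<^bsub>Tilt\<^esub> (r \<otimes>\<^bsub>Tilt\<^esub> h)"
      unfolding h(2) by (subst r(2)) (rule T.m_assoc[OF gc r(1) h(1)])
    then show ?thesis using r(1) h(1) by blast
  qed
  define om where "om m = theta (teich Tilt (g m))" for m
  have tg: "teich Tilt (g m) \<in> carrier W" for m using gc by simp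
  have omc: "om m \<in> carrier A" for m using tg by (simp add: om_def)
  have omS: "om (Suc m) [^] p = om m" for m
  proof -
    have "om (Suc m) [^] p = theta (teich Tilt (g (Suc m)) [^]\<^bsub>W\<^esub> p)"
      unfolding om_def by (rule th.hom_pow[OF tg, symmetric])
    then show ?thesis unfolding teich_power[OF gc] gS by (simp add: om_def)
  qed
  have om0: "om 0 = \<pi> \<otimes> v" using v by (simp add: om_def g_def)
  have tors: "om (Suc m) \<otimes> a = \<zero>" if a: "a \<in> carrier A" "om m \<otimes> a = \<zero>" for m a
  proof -
    obtain \<alpha> where \<alpha>: "\<alpha> \<in> carrier W" "theta \<alpha> = a" using theta_surj a by blast
    have "theta (teich Tilt (g m) \<otimes>\<^bsub>W\<^esub> \<alpha>) = \<zero>" using \<alpha> tg a by (simp add: om_def)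
    then obtain \<beta> where \<beta>: "\<beta> \<in> carrier W" "teich Tilt (g m) \<otimes>\<^bsub>W\<^esub> \<alpha> = xi \<otimes>\<^bsub>W\<^esub> \<beta>"
      using xi_gen[of "teich Tilt (g m) \<otimes>\<^bsub>W\<^esub> \<alpha>"] \<alpha> tg by auto
    obtain r where r: "r \<in> carrier Tilt" "xi 0 = g m \<otimes>\<^bsub>Tilt\<^esub> r" using xg by blast
    have "xi = teich Tilt (g m \<otimes>\<^bsub>Tilt\<^esub> r) \<oplus>\<^bsub>W\<^esub> [p] \<cdot>\<^bsub>W\<^esub> T.witt_div xi"
      using T.witt_decomp[OF xi(1)] r by simp
    from T.teich_torsion[OF gc r(1) zu \<alpha>(1) \<beta>(1) this \<beta>(2)] obtain c d where
      c: "c \<in> carrier Tilt" "d \<in> carrier W" "g m \<otimes>\<^bsub>Tilt\<^esub> c = \<zero>\<^bsub>Tilt\<^esub>" "\<alpha> = teich Tilt c \<oplus>\<^bsub>W\<^esub> xi \<otimes>\<^bsub>W\<^esub> d" by blast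
    have tcc: "teich Tilt c \<in> carrier W" using c by simp
    have "a = theta (teich Tilt c)" using \<alpha>(2) c(4) tcc c(2) xi by simp
    moreover have "(g (Suc m) \<otimes>\<^bsub>Tilt\<^esub> c) [^]\<^bsub>Tilt\<^esub> p = \<zero>\<^bsub>Tilt\<^esub> [^]\<^bsub>Tilt\<^esub> p"
    proof -
      have "c [^]\<^bsub>Tilt\<^esub> p = c \<otimes>\<^bsub>Tilt\<^esub> c [^]\<^bsub>Tilt\<^esub> (p - 1)" using T.nat_pow_pred[OF c(1) p_pos] .
      then have "(g (Suc m) \<otimes>\<^bsub>Tilt\<^esub> c) [^]\<^bsub>Tilt\<^esub> p = g m \<otimes>\<^bsub>Tilt\<^esub> (c \<otimes>\<^bsub>Tilt\<^esub> c [^]\<^bsub>Tilt\<^esub> (p - 1))"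
        using gS[of m] gc[of "Suc m"] c(1) by (simp add: T.nat_pow_distrib)
      also have "\<dots> = \<zero>\<^bsub>Tilt\<^esub>" using c(1,3) gc[of m] by (simp flip: T.m_assoc)
      finally show ?thesis by simp
    qed
    then have "g (Suc m) \<otimes>\<^bsub>Tilt\<^esub> c = \<zero>\<^bsub>Tilt\<^esub>"
      by (rule T.pow_p_inject[rotated 2]) (use gc[of "Suc m"] c(1) in auto)
    then have "teich Tilt (g (Suc m)) \<otimes>\<^bsub>W\<^esub> teich Tilt c = \<zero>\<^bsub>W\<^esub>"
      using T.teich_mult[OF gc[of "Suc m"] c(1)] by (auto simp: teich_def witt_ring_simps)
    then have "theta (teich Tilt (g (Suc m))) \<otimes> theta (teich Tilt c) = \<zero>"
      using th.hom_mult[OF tg[of "Suc m"] tcc] by simp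
    ultimately show ?thesis by (simp add: om_def)
  qed
  have rad: "\<exists>c\<in>carrier A. a = om (Suc m) \<otimes> c"
    if a: "a \<in> carrier A" and b: "b \<in> carrier A" and ab: "a [^] p = om m \<otimes> b" for m a b
  proof -
    obtain \<alpha> where \<alpha>: "\<alpha> \<in> carrier W" "theta \<alpha> = a" using theta_surj a by blast
    obtain \<beta> where \<beta>: "\<beta> \<in> carrier W" "theta \<beta> = b" using theta_surj b by blast
    let ?w = "\<alpha> [^]\<^bsub>W\<^esub> p \<ominus>\<^bsub>W\<^esub> teich Tilt (g m) \<otimes>\<^bsub>W\<^esub> \<beta>"
    have "theta ?w = \<zero>" using \<alpha> \<beta> tg[of m] ab a b omc by (simp add: T.W.minus_eq om_def r_neg)
    then obtain \<delta> where \<delta>: "\<delta> \<in> carrier W" "?w = xi \<otimes>\<^bsub>W\<^esub> \<delta>" using xi_gen[of ?w] \<alpha> \<beta> tg[of m] by auto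
    have "\<alpha> [^]\<^bsub>W\<^esub> p = xi \<otimes>\<^bsub>W\<^esub> \<delta> \<oplus>\<^bsub>W\<^esub> teich Tilt (g m) \<otimes>\<^bsub>W\<^esub> \<beta>"
      unfolding \<delta>(2)[symmetric] using \<alpha> \<beta> tg[of m] by (simp add: T.W.minus_eq T.W.a_assoc T.W.l_neg)
    moreover have "(\<alpha> [^]\<^bsub>W\<^esub> k) 0 = \<alpha> 0 [^]\<^bsub>Tilt\<^esub> k" for k :: nat
      by (induction k) (use \<alpha> in \<open>auto simp: T.witt_mult_0 witt_ring_simps(2)\<close>)
    ultimately have "\<alpha> 0 [^]\<^bsub>Tilt\<^esub> p = (xi \<otimes>\<^bsub>W\<^esub> \<delta> \<oplus>\<^bsub>W\<^esub> teich Tilt (g m) \<otimes>\<^bsub>W\<^esub> \<beta>) 0"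
      by metis
    then have "\<alpha> 0 [^]\<^bsub>Tilt\<^esub> p = xi 0 \<otimes>\<^bsub>Tilt\<^esub> \<delta> 0 \<oplus>\<^bsub>Tilt\<^esub> g m \<otimes>\<^bsub>Tilt\<^esub> \<beta> 0"
      using T.witt_add_0[of "xi \<otimes>\<^bsub>W\<^esub> \<delta>" "teich Tilt (g m) \<otimes>\<^bsub>W\<^esub> \<beta>"] T.witt_mult_0 xi(1) \<delta>(1) tg[of m] \<beta>(1) by simp
    moreover obtain r where r: "r \<in> carrier Tilt" "xi 0 = g m \<otimes>\<^bsub>Tilt\<^esub> r" using xg by blast
    moreover have nth: "\<alpha> 0 \<in> carrier Tilt" "\<beta> 0 \<in> carrier Tilt" "\<delta> 0 \<in> carrier Tilt"
      using witt_tilt_nth(2) \<alpha> \<beta> \<delta> by auto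
    ultimately have e: "\<alpha> 0 [^]\<^bsub>Tilt\<^esub> p = g m \<otimes>\<^bsub>Tilt\<^esub> (r \<otimes>\<^bsub>Tilt\<^esub> \<delta> 0 \<oplus>\<^bsub>Tilt\<^esub> \<beta> 0)" (is "_ = _ \<otimes>\<^bsub>Tilt\<^esub> ?e")
      using gc[of m] by (simp add: T.r_distr T.m_assoc)
    have ec: "?e \<in> carrier Tilt" using r nth by auto
    have "\<alpha> 0 = g (Suc m) \<otimes>\<^bsub>Tilt\<^esub> T.p_root ?e"
      by (rule T.pow_p_inject) (use nth gc[of "Suc m"] gS[of m] ec e in \<open>auto simp: T.nat_pow_distrib\<close>)
    then have "teich Tilt (\<alpha> 0) = teich Tilt (g (Suc m)) \<otimes>\<^bsub>W\<^esub> teich Tilt (T.p_root ?e)"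
      using T.teich_mult gc[of "Suc m"] ec by simp
    moreover have te: "teich Tilt (T.p_root ?e) \<in> carrier W" using ec by simp
    moreover have "\<alpha> = teich Tilt (\<alpha> 0) \<oplus>\<^bsub>W\<^esub> [p] \<cdot>\<^bsub>W\<^esub> T.witt_div \<alpha>" using T.witt_decomp[OF \<alpha>(1)] by simp
    moreover have wd: "T.witt_div \<alpha> \<in> carrier W" using \<alpha> by simp
    ultimately have "theta \<alpha> = theta (teich Tilt (g (Suc m)) \<otimes>\<^bsub>W\<^esub> teich Tilt (T.p_root ?e) \<oplus>\<^bsub>W\<^esub> [p] \<cdot>\<^bsub>W\<^esub> T.witt_div \<alpha>)"
      by simp
    also have "\<dots> = om (Suc m) \<otimes> theta (teich Tilt (T.p_root ?e)) \<oplus> \<pi> \<otimes> theta (T.witt_div \<alpha>)"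
      using te wd tg[of "Suc m"] hom_nat_mult[OF theta_hom wd] by (simp add: om_def)
    finally have a_eq: "a = om (Suc m) \<otimes> theta (teich Tilt (T.p_root ?e)) \<oplus> \<pi> \<otimes> theta (T.witt_div \<alpha>)"
      using \<alpha> by simp
    \<comment> \<open>Up to a unit, p is \<theta>([f]), and f is a multiple of
      \<open>g (Suc m)\<close>.\<close>
    have "\<exists>r\<in>carrier A. \<pi> = om (Suc m) \<otimes> r"
    proof -
      obtain r where r: "r \<in> carrier Tilt" "f = g (Suc m) \<otimes>\<^bsub>Tilt\<^esub> r" using gf by blast
      have tr: "teich Tilt r \<in> carrier W" using r by simp
      have "\<pi> \<otimes> v = om (Suc m) \<otimes> theta (teich Tilt r)"
        unfolding v(2)[symmetric] om_def th.hom_mult[OF tg tr, symmetric] T.teich_mult[OF gc r(1)] r(2)[symmetric] ..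
      then have "\<pi> \<otimes> v \<otimes> inv v = om (Suc m) \<otimes> theta (teich Tilt r) \<otimes> inv v" by simp
      then have "\<pi> = om (Suc m) \<otimes> (theta (teich Tilt r) \<otimes> inv v)"
        using v(1) tr omc by (simp add: m_assoc Units_closed)
      then show ?thesis using v(1) tr by blast
    qed
    then obtain r' where r': "r' \<in> carrier A" "\<pi> = om (Suc m) \<otimes> r'" by blast
    have "a = om (Suc m) \<otimes> (theta (teich Tilt (T.p_root ?e)) \<oplus> r' \<otimes> theta (T.witt_div \<alpha>))"
      unfolding a_eq r'(2) using r'(1) omc te wd by (simp add: r_distr m_assoc)
    then show ?thesis using r'(1) te wd by blast
  qed
  show ?thesis
    by (rule exI[of _ om]) (use omc omS om0 v(1) tors rad in blast)
qed

end

lemma perfectoid_p_roots: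
  fixes A (structure)
  assumes "Factorial_Ring.prime p" and perf: "perfectoid p A"
  obtains om where "\<And>m. om m \<in> carrier A" "\<And>m. om (Suc m) [^] p = om m"
    "\<exists>v\<in>Units A. om 0 = p_elem p A \<otimes> v"
    "\<And>m a. a \<in> carrier A \<Longrightarrow> om m \<otimes> a = \<zero> \<Longrightarrow> om (Suc m) \<otimes> a = \<zero>"
    "\<And>m a b. a \<in> carrier A \<Longrightarrow> b \<in> carrier A \<Longrightarrow> a [^] p = om m \<otimes> b \<Longrightarrow> \<exists>c\<in>carrier A. a = om (Suc m) \<otimes> c"
proof -
  have P: "principalideal (a_kernel (A_inf p A) A (fontaine_theta p A)) (A_inf p A)"
    using perf by (simp add: perfectoid_def)
  then interpret K: principalideal "a_kernel (A_inf p A) A (fontaine_theta p A)" "A_inf p A" .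
  \<comment> \<open>An ideal of \<open>A_inf p A\<close> carries with it that
    \<open>A_inf p A\<close> is a ring: \<open>K.ring_axioms\<close> is the origin of the ring
    structure on the Witt vectors.\<close>
  interpret perfectoid_base A p
    using perf assms K.ring_axioms
    by (intro perfectoid_base.intro p_complete_ring.intro p_base.intro p_base_axioms.intro
      p_complete_ring_axioms.intro perfectoid_base_axioms.intro)
      (auto simp: perfectoid_def A_inf_def)
  obtain varpi u where vu: "varpi \<in> carrier A" "u \<in> Units A" "varpi [^] p = p_elem p A \<otimes> u"
    using perf by (auto simp: perfectoid_def)
  have ker: "a_kernel (A_inf p A) A (fontaine_theta p A) = {w \<in> carrier W. theta w = \<zero>}"
    by (auto simp: fontaine_theta_eq A_inf_def a_kernel_def')
  obtain xi where xi: "xi \<in> carrier W" "{w \<in> carrier W. theta w = \<zero>} = Idl\<^bsub>W\<^esub> {xi}"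
    using K.generate unfolding ker by (auto simp: A_inf_def)
  have "Idl\<^bsub>W\<^esub> {xi} = PIdl\<^bsub>W\<^esub> xi" using T.W.cgenideal_eq_genideal[OF xi(1)] by simp
  then have g: "{w \<in> carrier W. theta w = \<zero>} = {x \<otimes>\<^bsub>W\<^esub> xi | x. x \<in> carrier W}"
    using xi(2) by (simp add: cgenideal_def)
  interpret perfectoid_gen A p xi varpi u
  proof (unfold_locales; (rule vu)?)
    show "xi \<in> carrier W" by (rule xi)
    have "xi = \<one>\<^bsub>W\<^esub> \<otimes>\<^bsub>W\<^esub> xi" using xi(1) by simp
    then have "xi \<in> {x \<otimes>\<^bsub>W\<^esub> xi | x. x \<in> carrier W}" using T.W.one_closed by blast
    then show "theta xi = \<zero>" using g by blast
    show "\<exists>b\<in>carrier W. w = xi \<otimes>\<^bsub>W\<^esub> b" if "w \<in> carrier W" "theta w = \<zero>" for w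
    proof -
      have "w \<in> {x \<otimes>\<^bsub>W\<^esub> xi | x. x \<in> carrier W}" using g that by blast
      then obtain x where "x \<in> carrier W" "w = x \<otimes>\<^bsub>W\<^esub> xi" by blast
      then show ?thesis using T.W.m_comm[of x xi] xi(1) by blast
    qed
  qed
  obtain om where om: "\<forall>m. om m \<in> carrier A \<and> om (Suc m) [^] p = om m" "\<exists>v\<in>Units A. om 0 = p_elem p A \<otimes> v"
    "\<forall>m. \<forall>a\<in>carrier A. om m \<otimes> a = \<zero> \<longrightarrow> om (Suc m) \<otimes> a = \<zero>"
    "\<forall>m. \<forall>a\<in>carrier A. \<forall>b\<in>carrier A. a [^] p = om m \<otimes> b \<longrightarrow> (\<exists>c\<in>carrier A. a = om (Suc m) \<otimes> c)"
    using exists_p_roots by (elim exE conjE)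
  show ?thesis
    by (rule that[OF om(1)[rule_format, THEN conjunct1] om(1)[rule_format, THEN conjunct2] om(2)
      om(3)[rule_format] om(4)[rule_format]])
qed

section \<open>Linear maps and finitely supported functions\<close>

definition linear_map ::
  "('r, 'q) ring_scheme \<Rightarrow> ('r, 'a, 'q1) module_scheme \<Rightarrow> ('r, 'b, 'q2) module_scheme \<Rightarrow> ('a \<Rightarrow> 'b) \<Rightarrow> bool" where
  "linear_map R M N f \<longleftrightarrow> f \<in> carrier M \<rightarrow> carrier N \<and>
     (\<forall>x\<in>carrier M. \<forall>y\<in>carrier M. f (x \<oplus>\<^bsub>M\<^esub> y) = f x \<oplus>\<^bsub>N\<^esub> f y) \<and>
     (\<forall>r\<in>carrier R. \<forall>x\<in>carrier M. f (r \<odot>\<^bsub>M\<^esub> x) = r \<odot>\<^bsub>N\<^esub> f x)"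

lemma linear_mapI:
  assumes "\<And>x. x \<in> carrier M \<Longrightarrow> f x \<in> carrier N"
    and "\<And>x y. x \<in> carrier M \<Longrightarrow> y \<in> carrier M \<Longrightarrow> f (x \<oplus>\<^bsub>M\<^esub> y) = f x \<oplus>\<^bsub>N\<^esub> f y"
    and "\<And>r x. r \<in> carrier R \<Longrightarrow> x \<in> carrier M \<Longrightarrow> f (r \<odot>\<^bsub>M\<^esub> x) = r \<odot>\<^bsub>N\<^esub> f x"
  shows "linear_map R M N f"
  using assms by (auto simp: linear_map_def)

lemma linear_mapD:
  assumes "linear_map R M N f"
  shows "x \<in> carrier M \<Longrightarrow> f x \<in> carrier N"
    and "x \<in> carrier M \<Longrightarrow> y \<in> carrier M \<Longrightarrow> f (x \<oplus>\<^bsub>M\<^esub> y) = f x \<oplus>\<^bsub>N\<^esub> f y"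
    and "r \<in> carrier R \<Longrightarrow> x \<in> carrier M \<Longrightarrow> f (r \<odot>\<^bsub>M\<^esub> x) = r \<odot>\<^bsub>N\<^esub> f x"
  using assms by (auto simp: linear_map_def)

lemma linear_map_comp:
  assumes "linear_map R M N f" "linear_map R N P g"
  shows "linear_map R M P (\<lambda>x. g (f x))"
  by (rule linear_mapI) (auto simp: linear_mapD[OF assms(1)] linear_mapD[OF assms(2)])

lemma linear_map_zero:
  assumes "module R M" "module R N" "linear_map R M N f"
  shows "f \<zero>\<^bsub>M\<^esub> = \<zero>\<^bsub>N\<^esub>"
proof -
  interpret M: module R M by fact
  interpret N: module R N by fact
  have "f (\<zero>\<^bsub>R\<^esub> \<odot>\<^bsub>M\<^esub> \<zero>\<^bsub>M\<^esub>) = \<zero>\<^bsub>R\<^esub> \<odot>\<^bsub>N\<^esub> f \<zero>\<^bsub>M\<^esub>" 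
    by (rule linear_mapD(3)[OF assms(3)]) auto
  then show ?thesis using linear_mapD(1)[OF assms(3), of "\<zero>\<^bsub>M\<^esub>"] by simp
qed

lemma linear_map_minus:
  assumes "module R M" "module R N" "linear_map R M N f" "x \<in> carrier M" "y \<in> carrier M"
  shows "f (x \<ominus>\<^bsub>M\<^esub> y) = f x \<ominus>\<^bsub>N\<^esub> f y"
proof -
  interpret M: module R M by fact
  interpret N: module R N by fact
  note f = linear_mapD[OF assms(3)]
  have "f (x \<ominus>\<^bsub>M\<^esub> y) \<oplus>\<^bsub>N\<^esub> f y = f x"
    using f(2)[of "x \<ominus>\<^bsub>M\<^esub> y" y] assms(4,5) by (simp add: M.minus_eq M.a_assoc M.l_neg)
  moreover have "f (x \<ominus>\<^bsub>M\<^esub> y) \<in> carrier N" "f x \<in> carrier N" "f y \<in> carrier N"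
    using f(1) assms(4,5) by auto
  ultimately show ?thesis by (simp add: N.add.inv_solve_right N.minus_eq)
qed

lemma mk_module_simps [simp]:
  "carrier (mk_module C z a s) = C" "\<zero>\<^bsub>mk_module C z a s\<^esub> = z"
  "x \<oplus>\<^bsub>mk_module C z a s\<^esub> y = a x y" "r \<odot>\<^bsub>mk_module C z a s\<^esub> x = s r x"
  by (simp_all add: mk_module_def)

section \<open>Free modules and direct sums of copies of a module\<close>

lemma module_regular_module:
  assumes "cring R" shows "module R (regular_module R)"
proof -
  interpret cring R by fact
  have "abelian_group (regular_module R)"
  proof (rule abelian_groupI)
    fix x assume "x \<in> carrier (regular_module R)"
    then show "\<exists>y\<in>carrier (regular_module R). y \<oplus>\<^bsub>regular_module R\<^esub> x = \<zero>\<^bsub>regular_module R\<^esub>"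
      by (intro bexI[of _ "\<ominus>\<^bsub>R\<^esub> x"]) (simp_all add: regular_module_def l_neg)
  qed (simp_all add: regular_module_def a_ac)
  then show ?thesis
    by (intro moduleI assms) (auto simp: regular_module_def l_distr r_distr m_assoc)
qed

text \<open>The direct sum of copies of N indexed by S. The encoding repeats that of
  \<open>free_module\<close>, which becomes the case of the regular module, and the operations
  likewise do not depend on S.\<close>

definition fsm :: "('r, 'b, 'q) module_scheme \<Rightarrow> 's set \<Rightarrow> ('r, 's \<Rightarrow> 'b) module" where
  "fsm N S = mk_module
     {x. (\<forall>s\<in>S. x s \<in> carrier N) \<and> (\<forall>s. s \<notin> S \<longrightarrow> x s = \<zero>\<^bsub>N\<^esub>) \<and> finite {s. x s \<noteq> \<zero>\<^bsub>N\<^esub>}}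
     (\<lambda>s. \<zero>\<^bsub>N\<^esub>) (\<lambda>x y s. x s \<oplus>\<^bsub>N\<^esub> y s) (\<lambda>r x s. r \<odot>\<^bsub>N\<^esub> x s)"

lemma fsm_simps [simp]:
  "\<zero>\<^bsub>fsm N S\<^esub> = (\<lambda>s. \<zero>\<^bsub>N\<^esub>)" "x \<oplus>\<^bsub>fsm N S\<^esub> y = (\<lambda>s. x s \<oplus>\<^bsub>N\<^esub> y s)"
  "r \<odot>\<^bsub>fsm N S\<^esub> x = (\<lambda>s. r \<odot>\<^bsub>N\<^esub> x s)"
  by (simp_all add: fsm_def)

lemma fsm_carrier:
  "x \<in> carrier (fsm N S) \<longleftrightarrow>
    (\<forall>s\<in>S. x s \<in> carrier N) \<and> (\<forall>s. s \<notin> S \<longrightarrow> x s = \<zero>\<^bsub>N\<^esub>) \<and> finite {s. x s \<noteq> \<zero>\<^bsub>N\<^esub>}"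
  by (simp add: fsm_def)

lemma free_module_eq_fsm: "free_module R S = fsm (regular_module R) S"
  by (simp add: free_module_def fsm_def regular_module_def)

lemma fsm_nth:
  assumes "module R N" "x \<in> carrier (fsm N S)"
  shows "x s \<in> carrier N"
proof -
  interpret N: module R N by fact
  show ?thesis using assms(2) N.zero_closed by (cases "s \<in> S") (auto simp: fsm_carrier)
qed

lemma module_fsm:
  assumes "module R N" shows "module R (fsm N S)"
proof -
  interpret N: module R N by fact
  note n = fsm_nth[OF assms, of _ S]
  have add: "(\<lambda>s. x s \<oplus>\<^bsub>N\<^esub> y s) \<in> carrier (fsm N S)"
    if "x \<in> carrier (fsm N S)" "y \<in> carrier (fsm N S)" for x y
  proof -
    have "{s. x s \<oplus>\<^bsub>N\<^esub> y s \<noteq> \<zero>\<^bsub>N\<^esub>} \<subseteq> {s. x s \<noteq> \<zero>\<^bsub>N\<^esub>} \<union> {s. y s \<noteq> \<zero>\<^bsub>N\<^esub>}" by auto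
    moreover have "finite ({s. x s \<noteq> \<zero>\<^bsub>N\<^esub>} \<union> {s. y s \<noteq> \<zero>\<^bsub>N\<^esub>})" using that by (simp add: fsm_carrier)
    ultimately have "finite {s. x s \<oplus>\<^bsub>N\<^esub> y s \<noteq> \<zero>\<^bsub>N\<^esub>}" by (rule finite_subset)
    then show ?thesis using that by (simp add: fsm_carrier)
  qed
  have smult: "(\<lambda>s. r \<odot>\<^bsub>N\<^esub> x s) \<in> carrier (fsm N S)"
    if "x \<in> carrier (fsm N S)" "r \<in> carrier R" for r x
  proof -
    have "{s. r \<odot>\<^bsub>N\<^esub> x s \<noteq> \<zero>\<^bsub>N\<^esub>} \<subseteq> {s. x s \<noteq> \<zero>\<^bsub>N\<^esub>}" using that by auto
    moreover have "finite {s. x s \<noteq> \<zero>\<^bsub>N\<^esub>}" using that by (simp add: fsm_carrier)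
    ultimately have "finite {s. r \<odot>\<^bsub>N\<^esub> x s \<noteq> \<zero>\<^bsub>N\<^esub>}" by (rule finite_subset)
    then show ?thesis using that by (simp add: fsm_carrier)
  qed
  have neg: "(\<lambda>s. (\<ominus>\<^bsub>R\<^esub> \<one>\<^bsub>R\<^esub>) \<odot>\<^bsub>N\<^esub> x s) \<in> carrier (fsm N S)"
    if "x \<in> carrier (fsm N S)" for x using smult[OF that] by simp
  have inv: "(\<ominus>\<^bsub>R\<^esub> \<one>\<^bsub>R\<^esub>) \<odot>\<^bsub>N\<^esub> x s \<oplus>\<^bsub>N\<^esub> x s = \<zero>\<^bsub>N\<^esub>" if "x \<in> carrier (fsm N S)" for x s
    using n[OF that, of s] by (simp add: N.smult_l_minus N.l_neg)
  have "abelian_group (fsm N S)"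
  proof (rule abelian_groupI)
    show "\<zero>\<^bsub>fsm N S\<^esub> \<in> carrier (fsm N S)" by (simp add: fsm_carrier)
    fix x assume x: "x \<in> carrier (fsm N S)"
    show "\<exists>y\<in>carrier (fsm N S). y \<oplus>\<^bsub>fsm N S\<^esub> x = \<zero>\<^bsub>fsm N S\<^esub>"
      using neg[OF x] inv[OF x] by (intro bexI[of _ "\<lambda>s. (\<ominus>\<^bsub>R\<^esub> \<one>\<^bsub>R\<^esub>) \<odot>\<^bsub>N\<^esub> x s"]) auto
  qed (use n in \<open>auto simp: add N.a_ac fun_eq_iff\<close>)
  then show ?thesis
    by (intro moduleI N.R.cring_axioms) (use n in \<open>auto simp: smult N.smult_l_distr N.smult_r_distr N.smult_assoc1 fun_eq_iff\<close>)
qed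

lemma fsm_minus:
  assumes "module R N" "x \<in> carrier (fsm N S)" "y \<in> carrier (fsm N S)"
  shows "(x \<ominus>\<^bsub>fsm N S\<^esub> y) = (\<lambda>s. x s \<ominus>\<^bsub>N\<^esub> y s)"
proof
  fix s
  have "linear_map R (fsm N S) N (\<lambda>x. x s)"
    by (rule linear_mapI) (use fsm_nth[OF assms(1), of _ S] in auto)
  from linear_map_minus[OF module_fsm[OF assms(1)] assms(1) this assms(2,3)]
  show "(x \<ominus>\<^bsub>fsm N S\<^esub> y) s = x s \<ominus>\<^bsub>N\<^esub> y s" .
qed

definition sgl :: "('r, 'b, 'q) module_scheme \<Rightarrow> 's \<Rightarrow> 'b \<Rightarrow> 's \<Rightarrow> 'b" where
  "sgl N s n = (\<lambda>t. if t = s then n else \<zero>\<^bsub>N\<^esub>)"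

lemma sgl_closed: "s \<in> S \<Longrightarrow> n \<in> carrier N \<Longrightarrow> module R N \<Longrightarrow> sgl N s n \<in> carrier (fsm N S)"
proof -
  assume a: "s \<in> S" "n \<in> carrier N" "module R N"
  interpret N: module R N by fact
  have "{t. sgl N s n t \<noteq> \<zero>\<^bsub>N\<^esub>} \<subseteq> {s}" by (auto simp: sgl_def)
  then have "finite {t. sgl N s n t \<noteq> \<zero>\<^bsub>N\<^esub>}" by (rule finite_subset) simp
  then show ?thesis using a by (auto simp: fsm_carrier sgl_def)
qed

lemma fsm_induct [consumes 2, case_names zero add]:
  assumes N: "module R N" and z: "z \<in> carrier (fsm N S)"
    and zero: "P (\<lambda>s. \<zero>\<^bsub>N\<^esub>)"
    and add: "\<And>x s n. x \<in> carrier (fsm N S) \<Longrightarrow> s \<in> S \<Longrightarrow> n \<in> carrier N \<Longrightarrow> P x \<Longrightarrow>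
      P (\<lambda>t. x t \<oplus>\<^bsub>N\<^esub> sgl N s n t)"
  shows "P z"
proof -
  interpret N: module R N by fact
  have "\<forall>z\<in>carrier (fsm N S). {s. z s \<noteq> \<zero>\<^bsub>N\<^esub>} \<subseteq> T \<longrightarrow> P z" if "finite T" for T
    using that
  proof (induction T)
    case empty
    show ?case
    proof (intro ballI impI)
      fix z assume "z \<in> carrier (fsm N S)" "{s. z s \<noteq> \<zero>\<^bsub>N\<^esub>} \<subseteq> {}"
      then have "z = (\<lambda>s. \<zero>\<^bsub>N\<^esub>)" by auto
      then show "P z" using zero by simp
    qed
  next
    case (insert t T)
    show ?case
    proof (intro ballI impI)
      fix z assume z: "z \<in> carrier (fsm N S)" "{s. z s \<noteq> \<zero>\<^bsub>N\<^esub>} \<subseteq> insert t T"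
      show "P z"
      proof (cases "z t = \<zero>\<^bsub>N\<^esub>")
        case True
        then have "{s. z s \<noteq> \<zero>\<^bsub>N\<^esub>} \<subseteq> T" using z(2) by auto
        then show ?thesis using insert.IH z(1) by blast
      next
        case False
        then have t: "t \<in> S" using z(1) by (auto simp: fsm_carrier)
        let ?x = "z(t := \<zero>\<^bsub>N\<^esub>)"
        have supp: "{s. ?x s \<noteq> \<zero>\<^bsub>N\<^esub>} \<subseteq> {s. z s \<noteq> \<zero>\<^bsub>N\<^esub>} \<inter> T" using z(2) by auto
        have "finite {s. z s \<noteq> \<zero>\<^bsub>N\<^esub>}" using z(1) by (simp add: fsm_carrier)
        then have "finite {s. ?x s \<noteq> \<zero>\<^bsub>N\<^esub>}" using supp by (meson finite_subset le_inf_iff)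
        then have x: "?x \<in> carrier (fsm N S)" using z(1) by (simp add: fsm_carrier)
        have "{s. ?x s \<noteq> \<zero>\<^bsub>N\<^esub>} \<subseteq> T" using supp by blast
        then have "P ?x" using insert.IH x by blast
        from add[OF x t fsm_nth[OF N z(1)] this, of t]
        have "P (\<lambda>s. ?x s \<oplus>\<^bsub>N\<^esub> sgl N t (z t) s)" .
        moreover have "(\<lambda>s. ?x s \<oplus>\<^bsub>N\<^esub> sgl N t (z t) s) = z"
          using fsm_nth[OF N z(1)] by (simp add: sgl_def fun_eq_iff)
        ultimately show ?thesis by simp
      qed
    qed
  qed
  moreover have "finite {s. z s \<noteq> \<zero>\<^bsub>N\<^esub>}" using z by (simp add: fsm_carrier)
  ultimately show ?thesis using z by blast
qed

lemma linear_map_eq_on_sgl: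
  assumes N: "module R N" and M: "module R M"
    and f: "linear_map R (fsm N S) M f" and g: "linear_map R (fsm N S) M g"
    and eq: "\<And>s n. s \<in> S \<Longrightarrow> n \<in> carrier N \<Longrightarrow> f (sgl N s n) = g (sgl N s n)"
    and z: "z \<in> carrier (fsm N S)"
  shows "f z = g z"
  using N z
proof (induction rule: fsm_induct)
  case zero
  then show ?case using linear_map_zero[OF module_fsm[OF N] M f] linear_map_zero[OF module_fsm[OF N] M g] by simp
next
  case (add x s n)
  then show ?case
    using linear_mapD(2)[OF f, of x "sgl N s n"] linear_mapD(2)[OF g, of x "sgl N s n"] sgl_closed[OF add(2,3) N] eq
    by simp
qed

text \<open>The map out of a direct sum that is given on the summand s by \<open>\<phi> s\<close>;
  the sum runs over the support and is therefore finite.\<close>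

definition fs_sum :: "('r, 'b, 'q) module_scheme \<Rightarrow> ('r, 'c, 'q1) module_scheme \<Rightarrow> ('s \<Rightarrow> 'b \<Rightarrow> 'c) \<Rightarrow> ('s \<Rightarrow> 'b) \<Rightarrow> 'c" where
  "fs_sum N M \<phi> z = (\<Oplus>\<^bsub>M\<^esub>s\<in>{s. z s \<noteq> \<zero>\<^bsub>N\<^esub>}. \<phi> s (z s))"

lemma fs_sum_superset:
  assumes N: "module R N" and M: "module R M" and \<phi>: "\<And>s. s \<in> S \<Longrightarrow> linear_map R N M (\<phi> s)"
    and z: "z \<in> carrier (fsm N S)" and T: "finite T" "{s. z s \<noteq> \<zero>\<^bsub>N\<^esub>} \<subseteq> T" "T \<subseteq> S"
  shows "fs_sum N M \<phi> z = (\<Oplus>\<^bsub>M\<^esub>s\<in>T. \<phi> s (z s))"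
proof -
  interpret M: module R M by fact
  show ?thesis unfolding fs_sum_def
  proof (rule M.add.finprod_mono_neutral_cong_left[OF T(1,2)])
    show "\<phi> i (z i) = \<zero>\<^bsub>M\<^esub>" if "i \<in> T - {s. z s \<noteq> \<zero>\<^bsub>N\<^esub>}" for i
      using that linear_map_zero[OF N M \<phi>[of i]] T(3) by auto
  qed (use linear_mapD(1)[OF \<phi>] fsm_nth[OF N z] T(3) in auto)
qed

lemma linear_map_fs_sum:
  assumes N: "module R N" and M: "module R M" and \<phi>: "\<And>s. s \<in> S \<Longrightarrow> linear_map R N M (\<phi> s)"
  shows "linear_map R (fsm N S) M (fs_sum N M \<phi>)"
proof (rule linear_mapI)
  interpret N: module R N by fact
  interpret M: module R M by fact
  interpret F: module R "fsm N S" by (rule module_fsm[OF N])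
  let ?supp = "\<lambda>z. {s. z s \<noteq> \<zero>\<^bsub>N\<^esub>}"
  have supp: "?supp z \<subseteq> S" "finite (?supp z)" if "z \<in> carrier (fsm N S)" for z
    using that by (auto simp: fsm_carrier)
  note n = fsm_nth[OF N, of _ S]
  have cl: "\<phi> s (z s) \<in> carrier M" if "z \<in> carrier (fsm N S)" "s \<in> S" for z s
    using linear_mapD(1)[OF \<phi>[OF that(2)] n[OF that(1)]] .
  fix x assume x: "x \<in> carrier (fsm N S)"
  show "fs_sum N M \<phi> x \<in> carrier M"
    unfolding fs_sum_def by (rule M.finsum_closed) (use cl[OF x] supp(1)[OF x] in auto)
  {
    fix y assume y: "y \<in> carrier (fsm N S)"
    have xy: "x \<oplus>\<^bsub>fsm N S\<^esub> y \<in> carrier (fsm N S)" using x y by (rule F.a_closed)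
    let ?T = "?supp x \<union> ?supp y"
    have T: "finite ?T" "?T \<subseteq> S" using supp x y by auto
    have "fs_sum N M \<phi> (x \<oplus>\<^bsub>fsm N S\<^esub> y) = (\<Oplus>\<^bsub>M\<^esub>s\<in>?T. \<phi> s ((x \<oplus>\<^bsub>fsm N S\<^esub> y) s))"
      by (rule fs_sum_superset[OF N M \<phi> xy T(1) _ T(2)]) auto
    also have "\<dots> = (\<Oplus>\<^bsub>M\<^esub>s\<in>?T. \<phi> s (x s) \<oplus>\<^bsub>M\<^esub> \<phi> s (y s))"
    proof (rule M.add.finprod_cong')
      show "\<phi> i ((x \<oplus>\<^bsub>fsm N S\<^esub> y) i) = \<phi> i (x i) \<oplus>\<^bsub>M\<^esub> \<phi> i (y i)" if "i \<in> ?T" for i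
        using that T(2) linear_mapD(2)[OF \<phi> n[OF x] n[OF y], of i i i] by auto
    qed (use T(2) cl x y in auto)
    also have "\<dots> = (\<Oplus>\<^bsub>M\<^esub>s\<in>?T. \<phi> s (x s)) \<oplus>\<^bsub>M\<^esub> (\<Oplus>\<^bsub>M\<^esub>s\<in>?T. \<phi> s (y s))"
      by (rule M.finsum_addf) (use T(2) cl x y in auto)
    also have "\<dots> = fs_sum N M \<phi> x \<oplus>\<^bsub>M\<^esub> fs_sum N M \<phi> y"
      using fs_sum_superset[OF N M \<phi> x T(1) _ T(2)] fs_sum_superset[OF N M \<phi> y T(1) _ T(2)] by simp
    finally show "fs_sum N M \<phi> (x \<oplus>\<^bsub>fsm N S\<^esub> y) = fs_sum N M \<phi> x \<oplus>\<^bsub>M\<^esub> fs_sum N M \<phi> y" .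
  }
  fix r assume r: "r \<in> carrier R"
  have rx: "r \<odot>\<^bsub>fsm N S\<^esub> x \<in> carrier (fsm N S)" using r x by (rule F.smult_closed)
  let ?T = "?supp x"
  have T: "finite ?T" "?T \<subseteq> S" using supp x by auto
  have "fs_sum N M \<phi> (r \<odot>\<^bsub>fsm N S\<^esub> x) = (\<Oplus>\<^bsub>M\<^esub>s\<in>?T. \<phi> s ((r \<odot>\<^bsub>fsm N S\<^esub> x) s))"
    by (rule fs_sum_superset[OF N M \<phi> rx T(1) _ T(2)]) (use r in auto)
  also have "\<dots> = (\<Oplus>\<^bsub>M\<^esub>s\<in>?T. r \<odot>\<^bsub>M\<^esub> \<phi> s (x s))"
  proof (rule M.add.finprod_cong')
    show "\<phi> i ((r \<odot>\<^bsub>fsm N S\<^esub> x) i) = r \<odot>\<^bsub>M\<^esub> \<phi> i (x i)" if "i \<in> ?T" for i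
      using that T(2) linear_mapD(3)[OF \<phi> r n[OF x], of i i] by auto
  qed (use T(2) cl x r in auto)
  also have "\<dots> = r \<odot>\<^bsub>M\<^esub> fs_sum N M \<phi> x"
    unfolding fs_sum_def by (rule M.finsum_smult_ldistr[symmetric]) (use T cl x r in auto)
  finally show "fs_sum N M \<phi> (r \<odot>\<^bsub>fsm N S\<^esub> x) = r \<odot>\<^bsub>M\<^esub> fs_sum N M \<phi> x" .
qed

lemma fs_sum_sgl:
  assumes N: "module R N" and M: "module R M" and \<phi>: "linear_map R N M (\<phi> s)"
    and n: "n \<in> carrier N"
  shows "fs_sum N M \<phi> (sgl N s n) = \<phi> s n"
proof -
  interpret M: module R M by fact
  have "fs_sum N M \<phi> (sgl N s n) = (\<Oplus>\<^bsub>M\<^esub>t\<in>{s}. \<phi> t (sgl N s n t))"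
    by (rule fs_sum_superset[OF N M, of "{s}"]) (use \<phi> sgl_closed[OF _ n N, of s "{s}"] in \<open>auto simp: sgl_def\<close>)
  then show ?thesis using linear_mapD(1)[OF \<phi> n] by (simp add: sgl_def)
qed

lemma fs_sum_in_submodule:
  assumes N: "module R N" and M: "module R M" and H: "submodule H R M"
    and z: "\<And>s. z s \<noteq> \<zero>\<^bsub>N\<^esub> \<Longrightarrow> \<phi> s (z s) \<in> H"
  shows "fs_sum N M \<phi> z \<in> H"
proof -
  interpret M: module R M by fact
  have *: "(\<Oplus>\<^bsub>M\<^esub>s\<in>K. \<phi> s (z s)) \<in> H" if "\<And>s. s \<in> K \<Longrightarrow> \<phi> s (z s) \<in> H" for K
    using that
  proof (induction K rule: infinite_finite_induct)
    case (infinite A)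
    then show ?case using subgroup.one_closed[OF submodule.axioms(1)[OF H]] by simp
  next
    case empty
    then show ?case using subgroup.one_closed[OF submodule.axioms(1)[OF H]] by simp
  next
    case (insert x F)
    have "\<phi> s (z s) \<in> carrier M" if "s \<in> insert x F" for s
      using insert.prems[OF that] M.submoduleE(1)[OF H] by blast
    then show ?case using insert M.submoduleE(5)[OF H] by (simp add: Pi_def)
  qed
  show ?thesis unfolding fs_sum_def by (rule *) (use z in simp)
qed

lemma lin_extend_eq_fs_sum: "lin_extend R M g = fs_sum (regular_module R) M (\<lambda>s r. r \<odot>\<^bsub>M\<^esub> g s)"
  by (simp add: lin_extend_def fs_sum_def regular_module_def fun_eq_iff)

lemma linear_map_smult_vec:
  assumes "module R M" "v \<in> carrier M"
  shows "linear_map R (regular_module R) M (\<lambda>r. r \<odot>\<^bsub>M\<^esub> v)"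
proof -
  interpret M: module R M by fact
  show ?thesis by (rule linear_mapI) (use assms in \<open>auto simp: regular_module_def M.smult_l_distr M.smult_assoc1\<close>)
qed

lemma module_free_module: "cring R \<Longrightarrow> module R (free_module R S)"
  unfolding free_module_eq_fsm by (intro module_fsm module_regular_module)

lemma linear_map_lin_extend:
  assumes "module R M" "\<And>s. s \<in> S \<Longrightarrow> g s \<in> carrier M"
  shows "linear_map R (free_module R S) M (lin_extend R M g)"
proof -
  interpret M: module R M by fact
  show ?thesis unfolding lin_extend_eq_fs_sum free_module_eq_fsm
    by (intro linear_map_fs_sum module_regular_module assms(1) linear_map_smult_vec assms(2) M.R.cring_axioms)
qed

lemma free_basis_eq_sgl: "free_basis R s = sgl (regular_module R) s \<one>\<^bsub>R\<^esub>"
  by (simp add: free_basis_def sgl_def regular_module_def fun_eq_iff)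

lemma free_basis_closed: "cring R \<Longrightarrow> s \<in> S \<Longrightarrow> free_basis R s \<in> carrier (free_module R S)"
  unfolding free_basis_eq_sgl free_module_eq_fsm
  by (rule sgl_closed[OF _ _ module_regular_module]) (auto simp: regular_module_def cring.cring_simprules)

lemma lin_extend_free_basis:
  assumes "module R M" "g s \<in> carrier M"
  shows "lin_extend R M g (free_basis R s) = g s"
proof -
  interpret M: module R M by fact
  show ?thesis unfolding lin_extend_eq_fs_sum free_basis_eq_sgl
    using fs_sum_sgl[OF module_regular_module[OF M.R.cring_axioms] assms(1), of "\<lambda>s r. r \<odot>\<^bsub>M\<^esub> g s" s "\<one>\<^bsub>R\<^esub>"]
      linear_map_smult_vec[OF assms] assms by (simp add: regular_module_def)
qed

lemma linear_map_eq_on_basis: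
  assumes M: "module R M"
    and f: "linear_map R (free_module R S) M f" and g: "linear_map R (free_module R S) M g"
    and eq: "\<And>s. s \<in> S \<Longrightarrow> f (free_basis R s) = g (free_basis R s)"
    and z: "z \<in> carrier (free_module R S)"
  shows "f z = g z"
proof -
  interpret M: module R M by fact
  note reg = module_regular_module[OF M.R.cring_axioms]
  have "f (sgl (regular_module R) s r) = g (sgl (regular_module R) s r)"
    if s: "s \<in> S" and r: "r \<in> carrier (regular_module R)" for s r
  proof -
    have rR: "r \<in> carrier R" using r by (simp add: regular_module_def)
    have "sgl (regular_module R) s r = r \<odot>\<^bsub>free_module R S\<^esub> free_basis R s"
      unfolding free_basis_eq_sgl free_module_eq_fsm using rR by (auto simp: sgl_def regular_module_def)
    then show ?thesis
      using linear_mapD(3)[OF f rR free_basis_closed[OF M.R.cring_axioms s]]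
        linear_mapD(3)[OF g rR free_basis_closed[OF M.R.cring_axioms s]] eq[OF s] by simp
  qed
  then show ?thesis
    using linear_map_eq_on_sgl[OF reg M f[unfolded free_module_eq_fsm] g[unfolded free_module_eq_fsm]]
      z[unfolded free_module_eq_fsm] by blast
qed

lemma list_comb_linear:
  assumes M: "module R M" and N: "module R N" and f: "linear_map R M N f"
    and l: "\<And>r s. (r, s) \<in> set l \<Longrightarrow> r \<in> carrier R \<and> g s \<in> carrier M"
  shows "list_comb M g l \<in> carrier M \<and> f (list_comb M g l) = list_comb N (\<lambda>s. f (g s)) l"
  using l
proof (induction l)
  case Nil
  interpret M: module R M by fact
  show ?case using linear_map_zero[OF M N f] by (simp add: list_comb_def)
next
  case (Cons a l)
  interpret M: module R M by fact
  obtain r s where a: "a = (r, s)" by (cases a)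
  have rs: "r \<in> carrier R" "g s \<in> carrier M" using Cons.prems[of r s] a by auto
  have IH: "list_comb M g l \<in> carrier M" "f (list_comb M g l) = list_comb N (\<lambda>s. f (g s)) l"
    using Cons.IH Cons.prems by auto
  have e: "list_comb M g (a # l) = (r \<odot>\<^bsub>M\<^esub> g s) \<oplus>\<^bsub>M\<^esub> list_comb M g l"
    "list_comb N (\<lambda>s. f (g s)) (a # l) = (r \<odot>\<^bsub>N\<^esub> f (g s)) \<oplus>\<^bsub>N\<^esub> list_comb N (\<lambda>s. f (g s)) l"
    by (simp_all add: list_comb_def a)
  show ?case unfolding e using rs IH linear_mapD[OF f] by simp
qed

section \<open>Quotient modules\<close>

lemma abelian_subgroup_submodule:
  assumes "module R M" "submodule H R M"
  shows "abelian_subgroup H M"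
proof -
  interpret M: module R M by fact
  show ?thesis
    by (intro abelian_subgroupI3 additive_subgroup.intro submodule.axioms(1)[OF assms(2)] M.abelian_group_axioms)
qed

lemma rcoset_eq_iff:
  assumes "module R M" "submodule H R M" "x \<in> carrier M" "y \<in> carrier M"
  shows "H +>\<^bsub>M\<^esub> x = H +>\<^bsub>M\<^esub> y \<longleftrightarrow> x \<ominus>\<^bsub>M\<^esub> y \<in> H"
proof -
  interpret M: module R M by fact
  interpret H: abelian_subgroup H M by (rule abelian_subgroup_submodule[OF assms(1,2)])
  have "x \<in> H +>\<^bsub>M\<^esub> y \<longleftrightarrow> x \<ominus>\<^bsub>M\<^esub> y \<in> H"
    using H.a_rcos_module assms(3,4) by (simp add: M.minus_eq)
  then show ?thesis
    using H.a_repr_independence' H.a_rcos_self assms(3,4) by metis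
qed

lemma quot_module_carrier: "carrier (quot_module M H) = (\<lambda>x. H +>\<^bsub>M\<^esub> x) ` carrier M"
  by (auto simp: quot_module_def A_RCOSETS_def')

lemma quot_module_zero: "\<zero>\<^bsub>quot_module M H\<^esub> = H"
  by (simp add: quot_module_def)

lemma quot_module_ops:
  assumes "module R M" "submodule H R M" "x \<in> carrier M"
  shows "y \<in> carrier M \<Longrightarrow> (H +>\<^bsub>M\<^esub> x) \<oplus>\<^bsub>quot_module M H\<^esub> (H +>\<^bsub>M\<^esub> y) = H +>\<^bsub>M\<^esub> (x \<oplus>\<^bsub>M\<^esub> y)"
    and "r \<in> carrier R \<Longrightarrow> r \<odot>\<^bsub>quot_module M H\<^esub> (H +>\<^bsub>M\<^esub> x) = H +>\<^bsub>M\<^esub> (r \<odot>\<^bsub>M\<^esub> x)"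
proof -
  interpret M: module R M by fact
  interpret H: abelian_subgroup H M by (rule abelian_subgroup_submodule[OF assms(1,2)])
  show "(H +>\<^bsub>M\<^esub> x) \<oplus>\<^bsub>quot_module M H\<^esub> (H +>\<^bsub>M\<^esub> y) = H +>\<^bsub>M\<^esub> (x \<oplus>\<^bsub>M\<^esub> y)" if "y \<in> carrier M"
    using H.a_rcos_sum[OF assms(3) that] by (simp add: quot_module_def)
  assume r: "r \<in> carrier R"
  have "H +>\<^bsub>M\<^esub> (r \<odot>\<^bsub>M\<^esub> u) = H +>\<^bsub>M\<^esub> (r \<odot>\<^bsub>M\<^esub> x)" if u: "u \<in> H +>\<^bsub>M\<^esub> x" for u
  proof -
    obtain h where h: "h \<in> H" "u = h \<oplus>\<^bsub>M\<^esub> x" using u by (auto simp: a_r_coset_def')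
    have hM: "h \<in> carrier M" using h M.submoduleE(1)[OF assms(2)] by blast
    have "(r \<odot>\<^bsub>M\<^esub> u) \<ominus>\<^bsub>M\<^esub> (r \<odot>\<^bsub>M\<^esub> x) = r \<odot>\<^bsub>M\<^esub> h"
      using r hM assms(3) h by (simp add: M.smult_r_distr M.minus_eq M.a_assoc M.r_neg)
    then show ?thesis
      using rcoset_eq_iff[OF assms(1,2)] M.submoduleE(4)[OF assms(2) r h(1)] r hM assms(3) h by simp
  qed
  moreover have "H +>\<^bsub>M\<^esub> x \<noteq> {}" using H.a_rcos_self[OF assms(3)] by blast
  ultimately show "r \<odot>\<^bsub>quot_module M H\<^esub> (H +>\<^bsub>M\<^esub> x) = H +>\<^bsub>M\<^esub> (r \<odot>\<^bsub>M\<^esub> x)"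
    by (simp add: quot_module_def)
qed

lemma module_quot_module:
  assumes M: "module R M" and H: "submodule H R M"
  shows "module R (quot_module M H)"
proof -
  interpret M: module R M by fact
  note ops = quot_module_ops[OF M H]
  let ?q = "\<lambda>x. H +>\<^bsub>M\<^esub> x"
  have zero: "\<zero>\<^bsub>quot_module M H\<^esub> = ?q \<zero>\<^bsub>M\<^esub>"
    using abelian_subgroup.a_rcos_const[OF abelian_subgroup_submodule[OF M H], of "\<zero>\<^bsub>M\<^esub>"]
      M.submoduleE(2)[OF H] subgroup.one_closed[OF submodule.axioms(1)[OF H]]
    by (simp add: quot_module_zero)
  have "abelian_group (quot_module M H)"
  proof (rule abelian_groupI)
    show "\<zero>\<^bsub>quot_module M H\<^esub> \<in> carrier (quot_module M H)" unfolding zero quot_module_carrier by simp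
    fix x assume "x \<in> carrier (quot_module M H)"
    then obtain x' where x': "x' \<in> carrier M" "x = ?q x'" by (auto simp: quot_module_carrier)
    then show "\<exists>y\<in>carrier (quot_module M H). y \<oplus>\<^bsub>quot_module M H\<^esub> x = \<zero>\<^bsub>quot_module M H\<^esub>"
      by (intro bexI[of _ "?q (\<ominus>\<^bsub>M\<^esub> x')"]) (simp_all add: ops zero M.l_neg quot_module_carrier)
    show "\<zero>\<^bsub>quot_module M H\<^esub> \<oplus>\<^bsub>quot_module M H\<^esub> x = x" using x' by (simp add: zero ops)
    fix y assume "y \<in> carrier (quot_module M H)"
    then obtain y' where y': "y' \<in> carrier M" "y = ?q y'" by (auto simp: quot_module_carrier)
    show "x \<oplus>\<^bsub>quot_module M H\<^esub> y \<in> carrier (quot_module M H)"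
      using x' y' by (simp add: ops quot_module_carrier)
    show "x \<oplus>\<^bsub>quot_module M H\<^esub> y = y \<oplus>\<^bsub>quot_module M H\<^esub> x"
      using x' y' by (simp add: ops M.a_comm)
    fix z assume "z \<in> carrier (quot_module M H)"
    then obtain z' where z': "z' \<in> carrier M" "z = ?q z'" by (auto simp: quot_module_carrier)
    show "x \<oplus>\<^bsub>quot_module M H\<^esub> y \<oplus>\<^bsub>quot_module M H\<^esub> z = x \<oplus>\<^bsub>quot_module M H\<^esub> (y \<oplus>\<^bsub>quot_module M H\<^esub> z)"
      using x' y' z' by (simp add: ops M.a_assoc)
  qed
  then show ?thesis
    by (intro moduleI M.R.cring_axioms)
      (auto simp: quot_module_carrier ops M.smult_l_distr M.smult_r_distr M.smult_assoc1)
qed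

lemma linear_map_quot:
  assumes M: "module R M" and H: "submodule H R M"
  shows "linear_map R M (quot_module M H) (\<lambda>x. H +>\<^bsub>M\<^esub> x)"
  by (rule linear_mapI) (auto simp: quot_module_ops[OF M H] quot_module_carrier)

lemma submodule_gen_submodule:
  assumes M: "module R M" and U: "U \<subseteq> carrier M"
  shows "submodule (submodule_gen R M U) R M"
proof -
  interpret M: module R M by fact
  have c: "carrier M \<in> {H. submodule H R M \<and> U \<subseteq> H}" using M.carrier_is_submodule U by simp
  show ?thesis
  proof (rule M.submoduleI)
    show "submodule_gen R M U \<subseteq> carrier M" using c unfolding submodule_gen_def by blast
    show "\<zero>\<^bsub>M\<^esub> \<in> submodule_gen R M U"
      using subgroup.one_closed[OF submodule.axioms(1)] by (auto simp: submodule_gen_def)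
  qed (auto simp: submodule_gen_def dest: M.submoduleE)
qed

lemma submodule_gen_superset: "U \<subseteq> submodule_gen R M U"
  by (auto simp: submodule_gen_def)

lemma submodule_gen_least: "submodule H R M \<Longrightarrow> U \<subseteq> H \<Longrightarrow> submodule_gen R M U \<subseteq> H"
  by (auto simp: submodule_gen_def)

lemma submodule_kernel:
  assumes M: "module R M" and N: "module R N" and f: "linear_map R M N f"
  shows "submodule {x \<in> carrier M. f x = \<zero>\<^bsub>N\<^esub>} R M"
proof -
  interpret M: module R M by fact
  interpret N: module R N by fact
  note z = linear_map_zero[OF M N f]
  have "f (\<ominus>\<^bsub>M\<^esub> a) = \<zero>\<^bsub>N\<^esub>" if "a \<in> carrier M" "f a = \<zero>\<^bsub>N\<^esub>" for a
    using linear_map_minus[OF M N f M.zero_closed that(1)] that z by (simp add: M.minus_eq N.minus_eq)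
  then show ?thesis
    by (intro M.submoduleI) (auto simp: z linear_mapD[OF f])
qed

section \<open>Tensor products\<close>

locale tensor_modules =
  fixes R :: "('r, 'q) ring_scheme" and N :: "('r, 'a, 'q1) module_scheme" and F :: "('r, 'b, 'q2) module_scheme"
  assumes N: "module R N" and F: "module R F"
begin

interpretation N: module R N by (rule N)
interpretation F: module R F by (rule F)

abbreviation "FF \<equiv> tensor_free R N F"
abbreviation "rel \<equiv> tensor_rel R N F"
abbreviation "T \<equiv> tensor R N F"
abbreviation "pure \<equiv> pure_tensor R N F"
abbreviation "e x y \<equiv> free_basis R (x, y)"

lemma module_FF: "module R FF"
  unfolding tensor_free_def by (rule module_free_module[OF N.R.cring_axioms])

interpretation FF: module R FF by (rule module_FF)

lemma e_closed: "x \<in> carrier N \<Longrightarrow> y \<in> carrier F \<Longrightarrow> e x y \<in> carrier FF"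
  unfolding tensor_free_def by (rule free_basis_closed[OF N.R.cring_axioms]) simp

definition "relators =
      {e (x \<oplus>\<^bsub>N\<^esub> x') y \<ominus>\<^bsub>FF\<^esub> (e x y \<oplus>\<^bsub>FF\<^esub> e x' y) | x x' y.
          x \<in> carrier N \<and> x' \<in> carrier N \<and> y \<in> carrier F}
     \<union> {e x (y \<oplus>\<^bsub>F\<^esub> y') \<ominus>\<^bsub>FF\<^esub> (e x y \<oplus>\<^bsub>FF\<^esub> e x y') | x y y'.
          x \<in> carrier N \<and> y \<in> carrier F \<and> y' \<in> carrier F}
     \<union> {e (r \<odot>\<^bsub>N\<^esub> x) y \<ominus>\<^bsub>FF\<^esub> (r \<odot>\<^bsub>FF\<^esub> e x y) | r x y.
          r \<in> carrier R \<and> x \<in> carrier N \<and> y \<in> carrier F}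
     \<union> {e x (r \<odot>\<^bsub>F\<^esub> y) \<ominus>\<^bsub>FF\<^esub> (r \<odot>\<^bsub>FF\<^esub> e x y) | r x y.
          r \<in> carrier R \<and> x \<in> carrier N \<and> y \<in> carrier F}"

lemma rel_eq: "rel = submodule_gen R FF relators"
  unfolding tensor_rel_def relators_def Let_def ..

lemma relators_closed: "relators \<subseteq> carrier FF"
  unfolding relators_def by (auto simp: e_closed)

lemma rel_submodule: "submodule rel R FF"
  unfolding rel_eq by (rule submodule_gen_submodule[OF module_FF relators_closed])

lemma module_T: "module R T"
  unfolding tensor_def by (rule module_quot_module[OF module_FF rel_submodule])

interpretation T: module R T by (rule module_T)

abbreviation "q u \<equiv> rel +>\<^bsub>FF\<^esub> u"

lemma q_linear: "linear_map R FF T q"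
  unfolding tensor_def by (rule linear_map_quot[OF module_FF rel_submodule])

lemma q_eq: "u \<in> carrier FF \<Longrightarrow> v \<in> carrier FF \<Longrightarrow> u \<ominus>\<^bsub>FF\<^esub> v \<in> relators \<Longrightarrow> q u = q v"
  using rcoset_eq_iff[OF module_FF rel_submodule] submodule_gen_superset[of relators R FF] by (auto simp: rel_eq)

lemma T_carrier: "carrier T = q ` carrier FF"
  by (simp add: tensor_def quot_module_carrier)

lemma pure_q: "pure x y = q (e x y)"
  by (simp add: pure_tensor_def)

lemma pure_closed: "x \<in> carrier N \<Longrightarrow> y \<in> carrier F \<Longrightarrow> pure x y \<in> carrier T"
  unfolding pure_q T_carrier using e_closed by blast

lemma pure_linear_left:
  assumes y: "y \<in> carrier F" shows "linear_map R N T (\<lambda>x. pure x y)"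
proof (rule linear_mapI)
  fix x assume x: "x \<in> carrier N"
  show "pure x y \<in> carrier T" by (rule pure_closed[OF x y])
  show "pure (x \<oplus>\<^bsub>N\<^esub> x') y = pure x y \<oplus>\<^bsub>T\<^esub> pure x' y" if x': "x' \<in> carrier N" for x'
  proof -
    have "pure (x \<oplus>\<^bsub>N\<^esub> x') y = q (e x y \<oplus>\<^bsub>FF\<^esub> e x' y)"
      unfolding pure_q by (rule q_eq) (use x x' y e_closed in \<open>auto simp: relators_def\<close>)
    then show ?thesis using linear_mapD(2)[OF q_linear] x x' y e_closed by (simp add: pure_q)
  qed
  show "pure (r \<odot>\<^bsub>N\<^esub> x) y = r \<odot>\<^bsub>T\<^esub> pure x y" if r: "r \<in> carrier R" for r
  proof -
    have "pure (r \<odot>\<^bsub>N\<^esub> x) y = q (r \<odot>\<^bsub>FF\<^esub> e x y)"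
      unfolding pure_q by (rule q_eq) (use x r y e_closed in \<open>auto simp: relators_def\<close>)
    then show ?thesis using linear_mapD(3)[OF q_linear] x r y e_closed by (simp add: pure_q)
  qed
qed

lemma pure_linear_right:
  assumes x: "x \<in> carrier N" shows "linear_map R F T (\<lambda>y. pure x y)"
proof (rule linear_mapI)
  fix y assume y: "y \<in> carrier F"
  show "pure x y \<in> carrier T" by (rule pure_closed[OF x y])
  show "pure x (y \<oplus>\<^bsub>F\<^esub> y') = pure x y \<oplus>\<^bsub>T\<^esub> pure x y'" if y': "y' \<in> carrier F" for y'
  proof -
    have "pure x (y \<oplus>\<^bsub>F\<^esub> y') = q (e x y \<oplus>\<^bsub>FF\<^esub> e x y')"
      unfolding pure_q by (rule q_eq) (use x y' y e_closed in \<open>auto simp: relators_def\<close>)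
    then show ?thesis using linear_mapD(2)[OF q_linear] x y' y e_closed by (simp add: pure_q)
  qed
  show "pure x (r \<odot>\<^bsub>F\<^esub> y) = r \<odot>\<^bsub>T\<^esub> pure x y" if r: "r \<in> carrier R" for r
  proof -
    have "pure x (r \<odot>\<^bsub>F\<^esub> y) = q (r \<odot>\<^bsub>FF\<^esub> e x y)"
      unfolding pure_q by (rule q_eq) (use x r y e_closed in \<open>auto simp: relators_def\<close>)
    then show ?thesis using linear_mapD(3)[OF q_linear] x r y e_closed by (simp add: pure_q)
  qed
qed

lemma linear_map_eq_on_pure:
  assumes P: "module R P" and f: "linear_map R T P f" and g: "linear_map R T P g"
    and eq: "\<And>x y. x \<in> carrier N \<Longrightarrow> y \<in> carrier F \<Longrightarrow> f (pure x y) = g (pure x y)"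
    and U: "U \<in> carrier T"
  shows "f U = g U"
proof -
  obtain u where u: "u \<in> carrier FF" "U = q u" using U T_carrier by auto
  have *: "free_module R (carrier N \<times> carrier F) = FF" by (simp add: tensor_free_def)
  have "f (q u) = g (q u)"
    by (rule linear_map_eq_on_basis[of R P "carrier N \<times> carrier F" "\<lambda>u. f (q u)" "\<lambda>u. g (q u)", unfolded *,
          OF P linear_map_comp[OF q_linear f] linear_map_comp[OF q_linear g] _ u(1)])
      (use eq in \<open>auto simp: pure_q\<close>)
  then show ?thesis using u by simp
qed

definition "tensor_lift P \<beta> U = the_elem (lin_extend R P (\<lambda>(x, y). \<beta> x y) ` U)"

text \<open>The linear extension of \<beta> kills all four kinds of relators, because these state
  bilinearity. It is thus constant on cosets, so the image of a coset is a singleton and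
  \<open>the_elem\<close> is meaningful.\<close>

lemma
  assumes P: "module R P"
    and l: "\<And>y. y \<in> carrier F \<Longrightarrow> linear_map R N P (\<lambda>x. \<beta> x y)"
    and r: "\<And>x. x \<in> carrier N \<Longrightarrow> linear_map R F P (\<lambda>y. \<beta> x y)"
  shows tensor_lift_linear: "linear_map R T P (tensor_lift P \<beta>)"
    and tensor_lift_pure: "x \<in> carrier N \<Longrightarrow> y \<in> carrier F \<Longrightarrow> tensor_lift P \<beta> (pure x y) = \<beta> x y"
proof -
  interpret P: module R P by (rule P)
  let ?g = "\<lambda>(x, y). \<beta> x y"
  let ?f = "lin_extend R P ?g"
  have bc: "\<beta> x y \<in> carrier P" if "x \<in> carrier N" "y \<in> carrier F" for x y
    using linear_mapD(1)[OF l] that by blast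
  have f: "linear_map R FF P ?f"
    unfolding tensor_free_def by (rule linear_map_lin_extend[OF P]) (use bc in auto)
  have fe: "?f (e x y) = \<beta> x y" if "x \<in> carrier N" "y \<in> carrier F" for x y
    using lin_extend_free_basis[OF P, of ?g "(x, y)"] bc that by simp
  have fm: "?f (u \<ominus>\<^bsub>FF\<^esub> v) = ?f u \<ominus>\<^bsub>P\<^esub> ?f v" if "u \<in> carrier FF" "v \<in> carrier FF" for u v
    by (rule linear_map_minus[OF module_FF P f that])
  have "relators \<subseteq> {u \<in> carrier FF. ?f u = \<zero>\<^bsub>P\<^esub>}"
  proof
    fix u assume u: "u \<in> relators"
    have "?f u = \<zero>\<^bsub>P\<^esub>"
      using u unfolding relators_def
      by (elim UnE CollectE exE conjE; hypsubst)
        (simp_all add: fm fe e_closed linear_mapD(2,3)[OF f] linear_mapD(2,3)[OF l] linear_mapD(2,3)[OF r] bc P.minus_eq P.r_neg)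
    then show "u \<in> {u \<in> carrier FF. ?f u = \<zero>\<^bsub>P\<^esub>}" using u relators_closed by blast
  qed
  then have ker: "rel \<subseteq> {u \<in> carrier FF. ?f u = \<zero>\<^bsub>P\<^esub>}"
    unfolding rel_eq by (rule submodule_gen_least[OF submodule_kernel[OF module_FF P f]])
  have lift: "tensor_lift P \<beta> (q u) = ?f u" if u: "u \<in> carrier FF" for u
  proof -
    have "?f v = ?f u" if v: "v \<in> q u" for v
    proof -
      obtain h where h: "h \<in> rel" "v = h \<oplus>\<^bsub>FF\<^esub> u" using v by (auto simp: a_r_coset_def')
      then have "h \<in> carrier FF" "?f h = \<zero>\<^bsub>P\<^esub>" using ker by auto
      then show ?thesis using h u linear_mapD(1,2)[OF f] by simp
    qed
    moreover have "u \<in> q u"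
      by (rule abelian_subgroup.a_rcos_self[OF abelian_subgroup_submodule[OF module_FF rel_submodule] u])
    ultimately have "?f ` q u = {?f u}" by blast
    then show ?thesis by (simp add: tensor_lift_def)
  qed
  show "linear_map R T P (tensor_lift P \<beta>)"
  proof (rule linear_mapI)
    fix U assume "U \<in> carrier T"
    then obtain u where u: "u \<in> carrier FF" "U = q u" using T_carrier by auto
    show "tensor_lift P \<beta> U \<in> carrier P" using u lift linear_mapD(1)[OF f] by simp
    show "tensor_lift P \<beta> (r \<odot>\<^bsub>T\<^esub> U) = r \<odot>\<^bsub>P\<^esub> tensor_lift P \<beta> U" if "r \<in> carrier R" for r
      using u that lift by (simp add: linear_mapD(3)[OF f] linear_mapD(3)[OF q_linear, symmetric])
    fix V assume "V \<in> carrier T"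
    then obtain v where v: "v \<in> carrier FF" "V = q v" using T_carrier by auto
    show "tensor_lift P \<beta> (U \<oplus>\<^bsub>T\<^esub> V) = tensor_lift P \<beta> U \<oplus>\<^bsub>P\<^esub> tensor_lift P \<beta> V"
      using u v lift by (simp add: linear_mapD(2)[OF f] linear_mapD(2)[OF q_linear, symmetric])
  qed
  show "tensor_lift P \<beta> (pure x y) = \<beta> x y" if "x \<in> carrier N" "y \<in> carrier F"
    using lift e_closed fe that by (simp add: pure_q)
qed

end

lemma tensor_map_eq_lift:
  "tensor_map R N F' f = tensor_modules.tensor_lift R (tensor R N F') (\<lambda>x y. pure_tensor R N F' x (f y))"
  if "tensor_modules R N F"
  using that by (intro ext) (simp add: tensor_modules.tensor_lift_def tensor_map_def)

section \<open>The tensor product with a free module\<close>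

text \<open>The pure tensor of a and x under the identification of N tensor the free module on S
  with the direct sum of copies of N.\<close>

definition fs_vec :: "('r, 'a, 'q1) module_scheme \<Rightarrow> 'a \<Rightarrow> ('s \<Rightarrow> 'r) \<Rightarrow> 's \<Rightarrow> 'a" where
  "fs_vec N a x = (\<lambda>s. x s \<odot>\<^bsub>N\<^esub> a)"

lemma free_module_nth:
  "cring R \<Longrightarrow> x \<in> carrier (free_module R S) \<Longrightarrow> x s \<in> carrier R"
  using fsm_nth[OF module_regular_module, of R x S s] by (simp add: free_module_eq_fsm regular_module_def)

lemma fs_vec_closed:
  assumes N: "module R N" and x: "x \<in> carrier (free_module R S)" and a: "a \<in> carrier N"
  shows "fs_vec N a x \<in> carrier (fsm N S)"
proof -
  interpret N: module R N by (rule N)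
  have "{s. x s \<odot>\<^bsub>N\<^esub> a \<noteq> \<zero>\<^bsub>N\<^esub>} \<subseteq> {s. x s \<noteq> \<zero>\<^bsub>R\<^esub>}" using a by auto
  moreover have "finite {s. x s \<noteq> \<zero>\<^bsub>R\<^esub>}" using x by (simp add: free_module_def)
  ultimately have "finite {s. x s \<odot>\<^bsub>N\<^esub> a \<noteq> \<zero>\<^bsub>N\<^esub>}" by (rule finite_subset)
  then show ?thesis using x a by (simp add: fsm_carrier fs_vec_def free_module_def)
qed

lemma fs_vec_linear_left:
  assumes N: "module R N" and x: "x \<in> carrier (free_module R S)"
  shows "linear_map R N (fsm N S) (\<lambda>a. fs_vec N a x)"
proof -
  interpret N: module R N by (rule N)
  note xs = free_module_nth[OF N.R.cring_axioms x]
  show ?thesis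
  proof (rule linear_mapI)
    show "fs_vec N (r \<odot>\<^bsub>N\<^esub> a) x = r \<odot>\<^bsub>fsm N S\<^esub> fs_vec N a x" if "r \<in> carrier R" "a \<in> carrier N" for r a
      using that xs by (simp add: fs_vec_def N.smult_assoc1[symmetric] N.R.m_comm)
    show "fs_vec N a x \<in> carrier (fsm N S)" if "a \<in> carrier N" for a by (rule fs_vec_closed[OF N x that])
  qed (use xs in \<open>simp add: fs_vec_def N.smult_r_distr\<close>)
qed

lemma fs_vec_linear_right:
  assumes N: "module R N" and a: "a \<in> carrier N"
  shows "linear_map R (free_module R S) (fsm N S) (\<lambda>x. fs_vec N a x)"
proof -
  interpret N: module R N by (rule N)
  note xs = free_module_nth[OF N.R.cring_axioms, of _ S]
  show ?thesis
  proof (rule linear_mapI)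
    fix x assume x: "x \<in> carrier (free_module R S)"
    show "fs_vec N a x \<in> carrier (fsm N S)" by (rule fs_vec_closed[OF N x a])
    show "fs_vec N a (r \<odot>\<^bsub>free_module R S\<^esub> x) = r \<odot>\<^bsub>fsm N S\<^esub> fs_vec N a x" if "r \<in> carrier R" for r
      using that xs[OF x] a by (simp add: fs_vec_def free_module_def N.smult_assoc1)
    fix y assume y: "y \<in> carrier (free_module R S)"
    show "fs_vec N a (x \<oplus>\<^bsub>free_module R S\<^esub> y) = fs_vec N a x \<oplus>\<^bsub>fsm N S\<^esub> fs_vec N a y"
      using xs[OF x] xs[OF y] a by (simp add: fs_vec_def free_module_def N.smult_l_distr)
  qed
qed

lemma fs_vec_free_basis:
  assumes N: "module R N" and a: "a \<in> carrier N"
  shows "fs_vec N a (free_basis R s) = sgl N s a"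
proof -
  interpret N: module R N by (rule N)
  show ?thesis using a by (simp add: fs_vec_def free_basis_def sgl_def fun_eq_iff)
qed

text \<open>The identity of N tensored with the map of free modules whose matrix has the columns
  \<open>D t\<close>.\<close>

definition mat_map :: "('r, 'a, 'q1) module_scheme \<Rightarrow> 's set \<Rightarrow> ('t \<Rightarrow> 's \<Rightarrow> 'r) \<Rightarrow> ('t \<Rightarrow> 'a) \<Rightarrow> 's \<Rightarrow> 'a" where
  "mat_map N S D = fs_sum N (fsm N S) (\<lambda>t a. fs_vec N a (D t))"

lemma mat_map_linear:
  assumes N: "module R N" and D: "\<And>t. t \<in> S' \<Longrightarrow> D t \<in> carrier (free_module R S)"
  shows "linear_map R (fsm N S') (fsm N S) (mat_map N S D)"
  unfolding mat_map_def by (intro linear_map_fs_sum N module_fsm fs_vec_linear_left D)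

lemma mat_map_sgl:
  assumes N: "module R N" and D: "D t \<in> carrier (free_module R S)" and a: "a \<in> carrier N"
  shows "mat_map N S D (sgl N t a) = fs_vec N a (D t)"
  unfolding mat_map_def
  by (rule fs_sum_sgl[OF N module_fsm[OF N], where \<phi> = "\<lambda>t a. fs_vec N a (D t)"]) (intro fs_vec_linear_left N D a)+

lemma mat_map_fs_vec:
  assumes N: "module R N" and D: "\<And>t. t \<in> S' \<Longrightarrow> D t \<in> carrier (free_module R S)" and a: "a \<in> carrier N"
    and x: "x \<in> carrier (free_module R S')"
  shows "mat_map N S D (fs_vec N a x) = fs_vec N a (lin_extend R (free_module R S) D x)"
proof -
  interpret N: module R N by (rule N)
  note free = module_free_module[OF N.R.cring_axioms]
  note le = linear_map_lin_extend[OF free, of S' D S, OF D]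
  show ?thesis
  proof (rule linear_map_eq_on_basis[OF module_fsm[OF N] _ _ _ x])
    show "linear_map R (free_module R S') (fsm N S) (\<lambda>x. mat_map N S D (fs_vec N a x))"
      by (rule linear_map_comp[OF fs_vec_linear_right[OF N a] mat_map_linear[OF N D]])
    show "linear_map R (free_module R S') (fsm N S) (\<lambda>x. fs_vec N a (lin_extend R (free_module R S) D x))"
      by (rule linear_map_comp[OF le fs_vec_linear_right[OF N a]])
    show "mat_map N S D (fs_vec N a (free_basis R t)) = fs_vec N a (lin_extend R (free_module R S) D (free_basis R t))"
      if "t \<in> S'" for t
      using that D a by (simp add: fs_vec_free_basis[OF N a] mat_map_sgl[OF N] lin_extend_free_basis[OF free])
  qed
qed

lemma linear_map_fsm_map:
  assumes N: "module R N" and P: "module R P" and f: "linear_map R N P f"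
  shows "linear_map R (fsm N S) (fsm P S) (\<lambda>z t. f (z t))"
proof (rule linear_mapI)
  fix x assume x: "x \<in> carrier (fsm N S)"
  note xs = fsm_nth[OF N x]
  have "{s. f (x s) \<noteq> \<zero>\<^bsub>P\<^esub>} \<subseteq> {s. x s \<noteq> \<zero>\<^bsub>N\<^esub>}" using linear_map_zero[OF N P f] by auto
  moreover have "finite {s. x s \<noteq> \<zero>\<^bsub>N\<^esub>}" using x by (simp add: fsm_carrier)
  ultimately have "finite {s. f (x s) \<noteq> \<zero>\<^bsub>P\<^esub>}" by (rule finite_subset)
  then show "(\<lambda>t. f (x t)) \<in> carrier (fsm P S)"
    using x linear_mapD(1)[OF f] linear_map_zero[OF N P f] by (simp add: fsm_carrier)
  show "(\<lambda>t. f ((r \<odot>\<^bsub>fsm N S\<^esub> x) t)) = r \<odot>\<^bsub>fsm P S\<^esub> (\<lambda>t. f (x t))" if "r \<in> carrier R" for r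
    using that xs linear_mapD(3)[OF f] by simp
  fix y assume y: "y \<in> carrier (fsm N S)"
  show "(\<lambda>t. f ((x \<oplus>\<^bsub>fsm N S\<^esub> y) t)) = (\<lambda>t. f (x t)) \<oplus>\<^bsub>fsm P S\<^esub> (\<lambda>t. f (y t))"
    using xs fsm_nth[OF N y] linear_mapD(2)[OF f] by simp
qed

lemma mat_map_natural:
  assumes N: "module R N" and P: "module R P" and f: "linear_map R N P f"
    and D: "\<And>t. t \<in> S' \<Longrightarrow> D t \<in> carrier (free_module R S)"
    and z: "z \<in> carrier (fsm N S')"
  shows "(\<lambda>t. f (z t)) \<in> carrier (fsm P S')"
    and "mat_map P S D (\<lambda>t. f (z t)) = (\<lambda>s. f (mat_map N S D z s))"
proof -
  interpret N: module R N by (rule N)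
  interpret P: module R P by (rule P)
  note pt = linear_map_fsm_map[OF N P f]
  show "(\<lambda>t. f (z t)) \<in> carrier (fsm P S')" using linear_mapD(1)[OF pt z] .
  show "mat_map P S D (\<lambda>t. f (z t)) = (\<lambda>s. f (mat_map N S D z s))"
  proof (rule linear_map_eq_on_sgl[OF N module_fsm[OF P] _ _ _ z])
    show "linear_map R (fsm N S') (fsm P S) (\<lambda>z. mat_map P S D (\<lambda>t. f (z t)))"
      by (rule linear_map_comp[OF pt mat_map_linear[OF P D]])
    show "linear_map R (fsm N S') (fsm P S) (\<lambda>z s. f (mat_map N S D z s))"
      by (rule linear_map_comp[OF mat_map_linear[OF N D] pt])
    fix s n assume s: "s \<in> S'" and n: "n \<in> carrier N"
    have "(\<lambda>t. f (sgl N s n t)) = sgl P s (f n)"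
      using linear_map_zero[OF N P f] by (simp add: sgl_def fun_eq_iff)
    then show "mat_map P S D (\<lambda>t. f (sgl N s n t)) = (\<lambda>t. f (mat_map N S D (sgl N s n) t))"
      using linear_mapD(1,3)[OF f] n free_module_nth[OF N.R.cring_axioms D[OF s]] N P D[OF s]
        mat_map_sgl[of R N D s S n] mat_map_sgl[of R P D s S "f n"]
      by (simp add: fs_vec_def)
  qed
qed

text \<open>Matrix entries act by scalars from R, under which H is stable. Hence the differential is
  well defined modulo H; this is applied to ideals of an algebra and to a complement of the residue
  field.\<close>

lemma mat_map_in_submodule:
  assumes N: "module R N" and H: "submodule H R N" and D: "\<And>t. t \<in> S' \<Longrightarrow> D t \<in> carrier (free_module R S)"
    and z: "z \<in> carrier (fsm N S')" and zH: "\<And>t. z t \<in> H"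
  shows "mat_map N S D z s \<in> H"
proof -
  interpret N: module R N by (rule N)
  have H0: "\<zero>\<^bsub>N\<^esub> \<in> H" using subgroup.one_closed[OF submodule.axioms(1)[OF H]] by simp
  have "submodule {y \<in> carrier (fsm N S). \<forall>s. y s \<in> H} R (fsm N S)"
  proof -
    interpret F: module R "fsm N S" by (rule module_fsm[OF N])
    have inv: "(\<ominus>\<^bsub>fsm N S\<^esub> y) s \<in> H" if "y \<in> carrier (fsm N S)" "\<forall>s. y s \<in> H" for y s
    proof -
      have "\<ominus>\<^bsub>fsm N S\<^esub> y = (\<ominus>\<^bsub>R\<^esub> \<one>\<^bsub>R\<^esub>) \<odot>\<^bsub>fsm N S\<^esub> y"
        using F.smult_l_minus[OF N.R.one_closed that(1)] F.smult_one[OF that(1)] by metis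
      then show ?thesis using N.submoduleE(4)[OF H] that(2) by simp
    qed
    show ?thesis
      by (rule F.submoduleI) (use H0 inv N.submoduleE(4,5)[OF H] F.a_closed F.smult_closed F.zero_closed in auto)
  qed
  then have "mat_map N S D z \<in> {y \<in> carrier (fsm N S). \<forall>s. y s \<in> H}"
    unfolding mat_map_def
  proof (rule fs_sum_in_submodule[OF N module_fsm[OF N]])
    fix t assume "z t \<noteq> \<zero>\<^bsub>N\<^esub>"
    then have t: "t \<in> S'" using z by (auto simp: fsm_carrier)
    show "fs_vec N (z t) (D t) \<in> {y \<in> carrier (fsm N S). \<forall>s. y s \<in> H}"
      using fs_vec_closed[OF N D[OF t] fsm_nth[OF N z]] N.submoduleE(4)[OF H free_module_nth[OF N.R.cring_axioms D[OF t]] zH]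
      by (simp add: fs_vec_def)
  qed
  then show ?thesis by blast
qed

locale tensor_free_factor =
  fixes R :: "('r, 'q) ring_scheme" and N :: "('r, 'a, 'q1) module_scheme" and S :: "'s set"
  assumes N: "module R N"
begin

sublocale tensor_modules R N "free_module R S"
proof -
  interpret N: module R N by (rule N)
  show "tensor_modules R N (free_module R S)"
    by (intro tensor_modules.intro N module_free_module N.R.cring_axioms)
qed

text \<open>Together with \<open>uncoords\<close> below it realises the isomorphism between N tensor
  the free module on S and the direct sum of copies of N.\<close>

definition "coords = tensor_lift (fsm N S) (fs_vec N)"

lemma coords_linear: "linear_map R T (fsm N S) coords"
  unfolding coords_def by (intro tensor_lift_linear module_fsm N fs_vec_linear_left fs_vec_linear_right)

lemma coords_pure: "a \<in> carrier N \<Longrightarrow> x \<in> carrier (free_module R S) \<Longrightarrow> coords (pure a x) = fs_vec N a x"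
  unfolding coords_def by (intro tensor_lift_pure module_fsm N fs_vec_linear_left fs_vec_linear_right)

definition "uncoords = fs_sum N T (\<lambda>s n. pure n (free_basis R s))"

lemma basis_closed: "s \<in> S \<Longrightarrow> free_basis R s \<in> carrier (free_module R S)"
  using free_basis_closed[of R s S] N by (simp add: module_def)

lemma uncoords_linear: "linear_map R (fsm N S) T uncoords"
  unfolding uncoords_def by (intro linear_map_fs_sum N module_T pure_linear_left basis_closed)

lemma uncoords_sgl: "s \<in> S \<Longrightarrow> n \<in> carrier N \<Longrightarrow> uncoords (sgl N s n) = pure n (free_basis R s)"
  unfolding uncoords_def
  by (rule fs_sum_sgl[OF N module_T, where \<phi> = "\<lambda>s n. pure n (free_basis R s)"]) (intro pure_linear_left basis_closed)+

lemma coords_uncoords: "z \<in> carrier (fsm N S) \<Longrightarrow> coords (uncoords z) = z"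
proof (rule linear_map_eq_on_sgl[OF N module_fsm[OF N] linear_map_comp[OF uncoords_linear coords_linear]])
  show "linear_map R (fsm N S) (fsm N S) (\<lambda>z. z)" by (rule linear_mapI) auto
qed (simp_all add: uncoords_sgl coords_pure basis_closed fs_vec_free_basis[OF N])

lemma uncoords_coords: "U \<in> carrier T \<Longrightarrow> uncoords (coords U) = U"
proof (rule linear_map_eq_on_pure[OF module_T linear_map_comp[OF coords_linear uncoords_linear]])
  show "linear_map R T T (\<lambda>z. z)" by (rule linear_mapI) auto
  fix a x assume a: "a \<in> carrier N" and x: "x \<in> carrier (free_module R S)"
  have "uncoords (fs_vec N a x) = pure a x"
    by (rule linear_map_eq_on_basis[OF module_T linear_map_comp[OF fs_vec_linear_right[OF N a] uncoords_linear]
          pure_linear_right[OF a] _ x]) (simp add: fs_vec_free_basis[OF N a] uncoords_sgl a)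
  then show "uncoords (coords (pure a x)) = pure a x" using coords_pure a x by simp
qed

end

section \<open>Vanishing of Tor\<close>

text \<open>The differential of N tensor F in coordinates: a generator of degree n + 1 has the
  syzygy that it names as its column.\<close>

abbreviation boundary ::
  "('r, 'q) ring_scheme \<Rightarrow> ('r, 'm, 'q2) module_scheme \<Rightarrow> ('r, 'a, 'q1) module_scheme \<Rightarrow> nat
    \<Rightarrow> (('r, 'm) gen \<Rightarrow> 'a) \<Rightarrow> ('r, 'm) gen \<Rightarrow> 'a" where
  "boundary R M N n \<equiv> mat_map N (res_gens R M n) (gen_boundary R)"

lemma list_comb_free_module:
  "list_comb (free_module R S) g l = list_comb (free_module R S') g l"
  by (simp add: list_comb_def free_module_def)

lemma gen_boundary_closed:
  assumes R: "cring R" and g: "g \<in> res_gens R M (Suc n)"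
  shows "gen_boundary R g \<in> carrier (free_module R (res_gens R M n))"
proof -
  obtain l where l: "g = Syz l" "set l \<subseteq> carrier R \<times> res_gens R M n"
    using g by (cases n) auto
  have "linear_map R (free_module R (res_gens R M n)) (free_module R (res_gens R M n)) (\<lambda>x. x)"
    by (rule linear_mapI) auto
  from list_comb_linear[OF module_free_module[OF R] module_free_module[OF R] this, of l "free_basis R"]
  show ?thesis using l free_basis_closed[OF R, of _ "res_gens R M n"]
    by (fastforce simp: gen_boundary_def list_comb_free_module[of R UNIV _ _ "res_gens R M n"])
qed

text \<open>A generator of degree at least 2 is by construction a list whose combination of
  boundaries is zero, so dd = 0 is part of the definition of a syzygy.\<close>

lemma boundary_gen_boundary:
  assumes R: "cring R" and g: "g \<in> res_gens R M (Suc (Suc n))"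
  shows "lin_extend R (free_module R (res_gens R M n)) (gen_boundary R) (gen_boundary R g) = (\<lambda>s. \<zero>\<^bsub>R\<^esub>)"
proof -
  let ?F = "\<lambda>n. free_module R (res_gens R M n)"
  obtain l where l: "g = Syz l" "set l \<subseteq> carrier R \<times> res_gens R M (Suc n)"
    "list_comb (free_module R UNIV) (gen_boundary R) l = \<zero>\<^bsub>free_module R (UNIV :: ('a, 'c) gen set)\<^esub>"
    using g by auto
  have le: "linear_map R (?F (Suc n)) (?F n) (lin_extend R (?F n) (gen_boundary R))"
    by (intro linear_map_lin_extend module_free_module R gen_boundary_closed)
  have fb: "lin_extend R (?F n) (gen_boundary R) (free_basis R s) = gen_boundary R s" if "s \<in> res_gens R M (Suc n)" for s
    by (intro lin_extend_free_basis module_free_module R gen_boundary_closed that)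
  have "lin_extend R (?F n) (gen_boundary R) (gen_boundary R g) =
      list_comb (?F n) (\<lambda>s. lin_extend R (?F n) (gen_boundary R) (free_basis R s)) l"
    using list_comb_linear[OF module_free_module[OF R] module_free_module[OF R] le, of l "free_basis R"]
      l free_basis_closed[OF R, of _ "res_gens R M (Suc n)"]
    by (auto simp: gen_boundary_def list_comb_free_module[of R UNIV _ _ "res_gens R M (Suc n)"])
  also have "\<dots> = list_comb (?F n) (gen_boundary R) l"
    unfolding list_comb_def by (rule foldr_cong) (use l(2) fb in auto)
  also have "\<dots> = (\<lambda>s. \<zero>\<^bsub>R\<^esub>)"
    using l(3) unfolding list_comb_free_module[of R UNIV _ _ "res_gens R M n"] by (simp add: free_module_def)
  finally show ?thesis .
qed

lemma boundary_linear:
  assumes N: "module R N"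
  shows "linear_map R (fsm N (res_gens R M (Suc n))) (fsm N (res_gens R M n)) (boundary R M N n)"
proof -
  interpret N: module R N by (rule N)
  show ?thesis by (rule mat_map_linear[OF N gen_boundary_closed[OF N.R.cring_axioms]])
qed

lemma boundary_boundary:
  assumes N: "module R N" and z: "z \<in> carrier (fsm N (res_gens R M (Suc (Suc n))))"
  shows "boundary R M N n (boundary R M N (Suc n) z) = (\<lambda>s. \<zero>\<^bsub>N\<^esub>)"
proof (rule linear_map_eq_on_sgl[OF N module_fsm[OF N] linear_map_comp[OF boundary_linear[OF N] boundary_linear[OF N]] _ _ z])
  interpret N: module R N by (rule N)
  show "linear_map R (fsm N (res_gens R M (Suc (Suc n)))) (fsm N (res_gens R M n)) (\<lambda>z s. \<zero>\<^bsub>N\<^esub>)"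
    by (rule linear_mapI) (auto simp: fsm_carrier)
  fix g a assume g: "g \<in> res_gens R M (Suc (Suc n))" and a: "a \<in> carrier N"
  note c = gen_boundary_closed[OF N.R.cring_axioms, of _ M]
  have "boundary R M N (Suc n) (sgl N g a) = fs_vec N a (gen_boundary R g)"
    by (rule mat_map_sgl[where D = "gen_boundary R", OF N c[OF g] a])
  moreover have "boundary R M N n (fs_vec N a (gen_boundary R g)) = fs_vec N a (\<lambda>s. \<zero>\<^bsub>R\<^esub>)"
    using mat_map_fs_vec[where D = "gen_boundary R", OF N c a c[OF g]] boundary_gen_boundary[OF N.R.cring_axioms g] by simp
  ultimately show "boundary R M N n (boundary R M N (Suc n) (sgl N g a)) = (\<lambda>s. \<zero>\<^bsub>N\<^esub>)"
    using a by (simp add: fs_vec_def)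
qed

abbreviation tor_coords ::
  "('r, 'q) ring_scheme \<Rightarrow> ('r, 'm, 'q2) module_scheme \<Rightarrow> ('r, 'a, 'q1) module_scheme \<Rightarrow> nat
    \<Rightarrow> ('a \<times> (('r, 'm) gen \<Rightarrow> 'r) \<Rightarrow> 'r) set \<Rightarrow> ('r, 'm) gen \<Rightarrow> 'a" where
  "tor_coords R M N n \<equiv> tensor_free_factor.coords R N (res_gens R M n)"

text \<open>Both routes from the tensor product to the coordinates are linear, so they need only be
  compared on pure tensors, where \<open>mat_map_fs_vec\<close> applies.\<close>

lemma
  assumes N: "module R N"
  shows tor_diff_linear: "linear_map R (tor_complex R N M (Suc n)) (tor_complex R N M n) (tor_diff R N M n)"
    and tor_coords_diff: "U \<in> carrier (tor_complex R N M (Suc n)) \<Longrightarrow>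
      tor_coords R M N n (tor_diff R N M n U) = boundary R M N n (tor_coords R M N (Suc n) U)"
proof -
  interpret N: module R N by (rule N)
  let ?F = "\<lambda>n. free_module R (res_gens R M n)"
  interpret T1: tensor_free_factor R N "res_gens R M (Suc n)" by unfold_locales
  interpret T0: tensor_free_factor R N "res_gens R M n" by unfold_locales
  let ?d = "lin_extend R (?F n) (gen_boundary R)"
  let ?\<beta> = "\<lambda>x y. pure_tensor R N (?F n) x (?d y)"
  note free = module_free_module[OF N.R.cring_axioms]
  note c = gen_boundary_closed[OF N.R.cring_axioms, of _ M]
  have d: "linear_map R (?F (Suc n)) (?F n) ?d" by (intro linear_map_lin_extend free c)
  have l: "linear_map R N (tensor R N (?F n)) (\<lambda>x. ?\<beta> x y)" if "y \<in> carrier (?F (Suc n))" for y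
    by (rule T0.pure_linear_left[OF linear_mapD(1)[OF d that]])
  have r: "linear_map R (?F (Suc n)) (tensor R N (?F n)) (\<lambda>y. ?\<beta> x y)" if "x \<in> carrier N" for x
    by (rule linear_map_comp[OF d T0.pure_linear_right[OF that]])
  have eq: "tor_diff R N M n = T1.tensor_lift (tensor R N (?F n)) ?\<beta>"
    unfolding tor_diff_def res_diff_def res_def by (rule tensor_map_eq_lift) unfold_locales
  have lin: "linear_map R (tensor R N (?F (Suc n))) (tensor R N (?F n)) (tor_diff R N M n)"
    unfolding eq by (rule T1.tensor_lift_linear[OF T0.module_T l r])
  then show "linear_map R (tor_complex R N M (Suc n)) (tor_complex R N M n) (tor_diff R N M n)"
    by (simp add: tor_complex_def res_def)
  assume U: "U \<in> carrier (tor_complex R N M (Suc n))"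
  show "tor_coords R M N n (tor_diff R N M n U) = boundary R M N n (tor_coords R M N (Suc n) U)"
  proof (rule T1.linear_map_eq_on_pure[OF module_fsm[OF N] linear_map_comp[OF lin T0.coords_linear]
      linear_map_comp[OF T1.coords_linear boundary_linear[OF N]]])
    fix a x assume a: "a \<in> carrier N" and x: "x \<in> carrier (?F (Suc n))"
    have "tor_diff R N M n (T1.pure a x) = ?\<beta> a x"
      unfolding eq by (rule T1.tensor_lift_pure[OF T0.module_T l r a x])
    then have "T0.coords (tor_diff R N M n (T1.pure a x)) = fs_vec N a (?d x)"
      using T0.coords_pure[OF a linear_mapD(1)[OF d x]] by simp
    also have "\<dots> = boundary R M N n (fs_vec N a x)"
      by (rule mat_map_fs_vec[where D = "gen_boundary R", OF N c a x, symmetric])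
    also have "\<dots> = boundary R M N n (T1.coords (T1.pure a x))"
      unfolding T1.coords_pure[OF a x] ..
    finally show "T0.coords (tor_diff R N M n (T1.pure a x)) = boundary R M N n (T1.coords (T1.pure a x))" .
  qed (use U in \<open>simp add: tor_complex_def res_def\<close>)
qed

lemma submodule_image:
  assumes M: "module R M" and N: "module R N" and f: "linear_map R M N f"
  shows "submodule (f ` carrier M) R N"
proof -
  interpret M: module R M by (rule M)
  interpret N: module R N by (rule N)
  have inv: "\<ominus>\<^bsub>N\<^esub> f x = f (\<ominus>\<^bsub>M\<^esub> x)" if "x \<in> carrier M" for x
    using linear_map_minus[OF M N f M.zero_closed that] linear_map_zero[OF M N f] linear_mapD(1)[OF f that] that
    by (simp add: M.minus_eq N.minus_eq)
  show ?thesis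
  proof (rule N.submoduleI)
    show "f ` carrier M \<subseteq> carrier N" using linear_mapD(1)[OF f] by blast
    show "\<zero>\<^bsub>N\<^esub> \<in> f ` carrier M"
      by (rule image_eqI[where f = f, OF linear_map_zero[OF M N f, symmetric] M.zero_closed])
    fix a assume "a \<in> f ` carrier M"
    then obtain x where x: "x \<in> carrier M" "a = f x" by blast
    show "\<ominus>\<^bsub>N\<^esub> a \<in> f ` carrier M" unfolding x(2) inv[OF x(1)] using x(1) by blast
    show "r \<odot>\<^bsub>N\<^esub> a \<in> f ` carrier M" if "r \<in> carrier R" for r
      unfolding x(2) linear_mapD(3)[OF f that x(1), symmetric] using x(1) that by blast
    fix b assume "b \<in> f ` carrier M"
    then obtain y where y: "y \<in> carrier M" "b = f y" by blast
    show "a \<oplus>\<^bsub>N\<^esub> b \<in> f ` carrier M"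
      unfolding x(2) y(2) linear_mapD(2)[OF f x(1) y(1), symmetric] using x(1) y(1) by blast
  qed
qed

lemma is_zero_Tor_iff_cycles:
  assumes N: "module R N"
  shows "is_zero_module (Tor i R N M) \<longleftrightarrow> tor_cycles R N M i \<subseteq> tor_boundaries R N M i"
proof -
  interpret N: module R N by (rule N)
  have mC: "module R (tor_complex R N M i)" for i
  proof -
    interpret T: tensor_free_factor R N "res_gens R M i" by unfold_locales
    show ?thesis using T.module_T by (simp add: tor_complex_def res_def)
  qed
  let ?C = "tor_complex R N M i" and ?Z = "tor_cycles R N M i" and ?B = "tor_boundaries R N M i"
  interpret C: module R ?C by (rule mC)
  have B: "submodule ?B R ?C"
    unfolding tor_boundaries_def by (rule submodule_image[OF mC mC tor_diff_linear[OF N]])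
  interpret B: abelian_subgroup ?B ?C by (rule abelian_subgroup_submodule[OF mC B])
  have Z1: "?Z \<subseteq> carrier ?C" by (cases i) (auto simp: a_kernel_def')
  have Z2: "\<zero>\<^bsub>?C\<^esub> \<in> ?Z"
  proof (cases i)
    case 0 then show ?thesis using C.zero_closed by simp
  next
    case (Suc j)
    then show ?thesis using C.zero_closed linear_map_zero[OF mC mC tor_diff_linear[OF N, of M j]]
      by (simp add: a_kernel_def')
  qed
  note Z = Z1 Z2
  \<comment> \<open>Restricting the carrier to the cycles does not change the addition, so the
    elements of Tor are cosets formed in the full complex \<open>?C\<close>.\<close>
  have "carrier (Tor i R N M) = (\<Union>z\<in>?Z. {?B +>\<^bsub>?C\<^esub> z})"
    by (simp add: Tor_def quot_module_def A_RCOSETS_def' a_r_coset_def')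
  then have "carrier (Tor i R N M) = (\<lambda>z. ?B +>\<^bsub>?C\<^esub> z) ` ?Z" by (simp add: UNION_singleton_eq_range)
  moreover have "\<zero>\<^bsub>Tor i R N M\<^esub> = ?B" by (simp add: Tor_def quot_module_def)
  ultimately have "is_zero_module (Tor i R N M) \<longleftrightarrow> (\<lambda>z. ?B +>\<^bsub>?C\<^esub> z) ` ?Z = {?B}"
    by (simp add: is_zero_module_def)
  also have "\<dots> \<longleftrightarrow> ?Z \<subseteq> ?B"
  proof
    assume *: "(\<lambda>z. ?B +>\<^bsub>?C\<^esub> z) ` ?Z = {?B}"
    show "?Z \<subseteq> ?B"
    proof
      fix z assume z: "z \<in> ?Z"
      then have "?B +>\<^bsub>?C\<^esub> z = ?B" using * by blast
      then show "z \<in> ?B" using B.a_rcos_self[of z] z Z(1) by auto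
    qed
  next
    assume "?Z \<subseteq> ?B"
    then have "?B +>\<^bsub>?C\<^esub> z = ?B" if "z \<in> ?Z" for z using B.a_rcos_const that by blast
    then show "(\<lambda>z. ?B +>\<^bsub>?C\<^esub> z) ` ?Z = {?B}" using Z(2) by auto
  qed
  finally show ?thesis .
qed

text \<open>\<open>exact_mod R M N H i\<close> says that the complex computing \<open>Tor (N/H) M\<close> is exact in degree \<open>i\<close>,
  expressed by finitely supported \<open>N\<close>-valued functions that are cycles or boundaries modulo \<open>H\<close>.\<close>

definition exact_mod ::
  "('r, 'q) ring_scheme \<Rightarrow> ('r, 'm, 'q2) module_scheme \<Rightarrow> ('r, 'a, 'q1) module_scheme \<Rightarrow> 'a set \<Rightarrow> nat \<Rightarrow> bool" where
  "exact_mod R M N H i \<longleftrightarrow> (\<forall>z\<in>carrier (fsm N (res_gens R M i)).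
     (\<forall>j. i = Suc j \<longrightarrow> (\<forall>s. boundary R M N j z s \<in> H)) \<longrightarrow>
     (\<exists>w\<in>carrier (fsm N (res_gens R M (Suc i))). \<forall>s. z s \<ominus>\<^bsub>N\<^esub> boundary R M N i w s \<in> H))"

text \<open>The coordinate maps are bijective in every degree and commute with the differentials, so
  cycles and boundaries correspond.\<close>

lemma is_zero_Tor_iff:
  assumes N: "module R N"
  shows "is_zero_module (Tor i R N M) \<longleftrightarrow> exact_mod R M N {\<zero>\<^bsub>N\<^esub>} i"
proof -
  interpret N: module R N by (rule N)
  have tff: "tensor_free_factor R N" by unfold_locales
  define C where "C = (\<lambda>i. carrier (tensor R N (free_module R (res_gens R M i))))"
  define co where "co = tor_coords R M N"
  have C_eq: "C i = carrier (tor_complex R N M i)" for i by (simp add: C_def tor_complex_def res_def)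
  have co_closed: "co i U \<in> carrier (fsm N (res_gens R M i))" if "U \<in> C i" for i U
    using linear_mapD(1)[OF tensor_free_factor.coords_linear[OF tff]] that unfolding C_def co_def .
  have co_inj: "U = V" if "U \<in> C i" "V \<in> C i" "co i U = co i V" for i U V
  proof -
    have *: "tensor_free_factor.uncoords R N (res_gens R M i) (co i U) = U" if "U \<in> C i" for U
      using tensor_free_factor.uncoords_coords[OF tff] that unfolding C_def co_def .
    have "U = tensor_free_factor.uncoords R N (res_gens R M i) (co i U)" by (rule *[OF that(1), symmetric])
    also have "\<dots> = V" unfolding that(3) by (rule *[OF that(2)])
    finally show ?thesis .
  qed
  have co_surj: "\<exists>U\<in>C i. co i U = z" if "z \<in> carrier (fsm N (res_gens R M i))" for i z
    unfolding C_def co_def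
    by (rule bexI[of _ "tensor_free_factor.uncoords R N (res_gens R M i) z"])
      (rule tensor_free_factor.coords_uncoords[OF tff that],
        rule linear_mapD(1)[OF tensor_free_factor.uncoords_linear[OF tff] that])
  have co_diff: "co i (tor_diff R N M i U) = boundary R M N i (co (Suc i) U)" "tor_diff R N M i U \<in> C i"
    if "U \<in> C (Suc i)" for i U
    using tor_coords_diff[OF N] linear_mapD(1)[OF tor_diff_linear[OF N]] that unfolding C_eq co_def by blast+
  have co_zero: "U = \<zero>\<^bsub>tor_complex R N M i\<^esub> \<longleftrightarrow> co i U = (\<lambda>s. \<zero>\<^bsub>N\<^esub>)" if U: "U \<in> C i" for i U
  proof -
    interpret T: tensor_free_factor R N "res_gens R M i" by (rule tff)
    interpret T': module R "tor_complex R N M i" using T.module_T by (simp add: tor_complex_def res_def)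
    have z: "co i \<zero>\<^bsub>tor_complex R N M i\<^esub> = (\<lambda>s. \<zero>\<^bsub>N\<^esub>)"
      using linear_map_zero[OF T.module_T module_fsm[OF N] T.coords_linear]
      by (simp add: co_def tor_complex_def res_def)
    have "\<zero>\<^bsub>tor_complex R N M i\<^esub> \<in> C i" unfolding C_eq by (rule T'.zero_closed)
    from co_inj[OF U this] show ?thesis unfolding z using z by blast
  qed
  have sub: "{x \<in> A. P x} \<subseteq> {x \<in> A. Q x} \<longleftrightarrow> (\<forall>x\<in>A. P x \<longrightarrow> Q x)" for A :: "'x set" and P Q by blast
  have all: "(\<forall>U\<in>C i. Q (co i U)) \<longleftrightarrow> (\<forall>z\<in>carrier (fsm N (res_gens R M i)). Q z)" for Q
  proof (intro iffI ballI)
    fix z assume Q: "\<forall>U\<in>C i. Q (co i U)" and z: "z \<in> carrier (fsm N (res_gens R M i))"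
    obtain U where "U \<in> C i" "co i U = z" using co_surj[OF z] by blast
    then show "Q z" using Q by blast
  qed (use co_closed in blast)
  have "tor_cycles R N M i = {U \<in> C i. \<forall>j. i = Suc j \<longrightarrow> (\<forall>s. boundary R M N j (co i U) s = \<zero>\<^bsub>N\<^esub>)}"
  proof (cases i)
    case 0 then show ?thesis by (simp add: C_eq)
  next
    case (Suc j)
    have "tor_cycles R N M i = {U \<in> C (Suc j). tor_diff R N M j U = \<zero>\<^bsub>tor_complex R N M j\<^esub>}"
      by (simp add: Suc a_kernel_def' C_eq)
    also have "\<dots> = {U \<in> C (Suc j). \<forall>s. boundary R M N j (co (Suc j) U) s = \<zero>\<^bsub>N\<^esub>}"
    proof (rule Collect_cong, rule conj_cong[OF refl])
      fix U assume U: "U \<in> C (Suc j)"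
      show "tor_diff R N M j U = \<zero>\<^bsub>tor_complex R N M j\<^esub> \<longleftrightarrow> (\<forall>s. boundary R M N j (co (Suc j) U) s = \<zero>\<^bsub>N\<^esub>)"
        unfolding co_zero[OF co_diff(2)[OF U]] co_diff(1)[OF U] fun_eq_iff ..
    qed
    finally show ?thesis by (simp add: Suc)
  qed
  moreover have "tor_boundaries R N M i = {U \<in> C i. \<exists>w\<in>carrier (fsm N (res_gens R M (Suc i))). co i U = boundary R M N i w}"
  proof -
    have "tor_boundaries R N M i = tor_diff R N M i ` C (Suc i)" by (simp add: tor_boundaries_def C_eq)
    also have "\<dots> = {U \<in> C i. \<exists>w\<in>carrier (fsm N (res_gens R M (Suc i))). co i U = boundary R M N i w}"
    proof (intro equalityI subsetI)
      fix U assume "U \<in> tor_diff R N M i ` C (Suc i)"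
      then obtain V where V: "V \<in> C (Suc i)" "U = tor_diff R N M i V" by blast
      then show "U \<in> {U \<in> C i. \<exists>w\<in>carrier (fsm N (res_gens R M (Suc i))). co i U = boundary R M N i w}"
        using co_diff[OF V(1)] co_closed[OF V(1)] by blast
    next
      fix U assume "U \<in> {U \<in> C i. \<exists>w\<in>carrier (fsm N (res_gens R M (Suc i))). co i U = boundary R M N i w}"
      then obtain w where w: "U \<in> C i" "w \<in> carrier (fsm N (res_gens R M (Suc i)))" "co i U = boundary R M N i w"
        by blast
      obtain V where V: "V \<in> C (Suc i)" "co (Suc i) V = w" using co_surj[OF w(2)] by blast
      have "U = tor_diff R N M i V"
        by (rule co_inj[OF w(1) co_diff(2)[OF V(1)]]) (simp add: co_diff(1)[OF V(1)] V(2) w(3))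
      then show "U \<in> tor_diff R N M i ` C (Suc i)" using V(1) by blast
    qed
    finally show ?thesis .
  qed
  ultimately have "is_zero_module (Tor i R N M) \<longleftrightarrow>
      (\<forall>U\<in>C i. (\<forall>j. i = Suc j \<longrightarrow> (\<forall>s. boundary R M N j (co i U) s = \<zero>\<^bsub>N\<^esub>)) \<longrightarrow>
        (\<exists>w\<in>carrier (fsm N (res_gens R M (Suc i))). co i U = boundary R M N i w))"
    unfolding is_zero_Tor_iff_cycles[OF N] by (simp only: sub)
  also have "\<dots> \<longleftrightarrow> (\<forall>z\<in>carrier (fsm N (res_gens R M i)). (\<forall>j. i = Suc j \<longrightarrow> (\<forall>s. boundary R M N j z s = \<zero>\<^bsub>N\<^esub>)) \<longrightarrow>
        (\<exists>w\<in>carrier (fsm N (res_gens R M (Suc i))). z = boundary R M N i w))"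
    by (rule all)
  also have "\<dots> \<longleftrightarrow> exact_mod R M N {\<zero>\<^bsub>N\<^esub>} i"
  proof -
    have "z = boundary R M N i w \<longleftrightarrow> (\<forall>s. z s \<ominus>\<^bsub>N\<^esub> boundary R M N i w s \<in> {\<zero>\<^bsub>N\<^esub>})"
      if "z \<in> carrier (fsm N (res_gens R M i))" "w \<in> carrier (fsm N (res_gens R M (Suc i)))" for z w
      using fsm_nth[OF N that(1)] fsm_nth[OF N linear_mapD(1)[OF boundary_linear[OF N] that(2)]]
      by (simp add: fun_eq_iff N.add.inv_solve_right' N.minus_eq)
    then have "(\<exists>w\<in>carrier (fsm N (res_gens R M (Suc i))). z = boundary R M N i w) \<longleftrightarrow>
        (\<exists>w\<in>carrier (fsm N (res_gens R M (Suc i))). \<forall>s. z s \<ominus>\<^bsub>N\<^esub> boundary R M N i w s \<in> {\<zero>\<^bsub>N\<^esub>})"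
      if "z \<in> carrier (fsm N (res_gens R M i))" for z using that by (meson bex_cong)
    then show ?thesis unfolding exact_mod_def by (simp only: singleton_iff cong: ball_cong)
  qed
  finally show ?thesis .
qed

section \<open>Systems of parameters\<close>

text \<open>A nonempty chain of ideals contains its union, so Zorn's lemma applies within any
  nonempty family of ideals, whatever its defining property.\<close>

lemma (in noetherian_ring) maximal_ideal_exists:
  assumes "\<A> \<noteq> {}" "\<And>I. I \<in> \<A> \<Longrightarrow> ideal I R"
  obtains I where "I \<in> \<A>" "\<And>J. J \<in> \<A> \<Longrightarrow> I \<subseteq> J \<Longrightarrow> J = I"
proof -
  have "\<exists>M\<in>\<A>. \<forall>J\<in>\<A>. M \<subseteq> J \<longrightarrow> J = M"
  proof (rule subset_Zorn_nonempty[OF assms(1)])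
    fix C assume C: "C \<noteq> {}" "subset.chain \<A> C"
    then have "subset.chain {I. ideal I R} C" using assms(2) by (auto simp: subset.chain_def)
    then have "\<Union> C \<in> C" using ideal_chain_is_trivial C(1) by blast
    then show "\<Union> C \<in> \<A>" using C(2) by (auto simp: subset.chain_def)
  qed
  then show ?thesis using that by blast
qed

section \<open>Adjoining elements to ideals and prime avoidance\<close>

context cring
begin

lemma adjoin_ideal:
  assumes I: "ideal I R" and a: "a \<in> carrier R"
  shows "ideal (I <+>\<^bsub>R\<^esub> PIdl a) R" "I \<subseteq> I <+>\<^bsub>R\<^esub> PIdl a" "a \<in> I <+>\<^bsub>R\<^esub> PIdl a"
    "x \<in> I <+>\<^bsub>R\<^esub> PIdl a \<Longrightarrow> \<exists>i\<in>I. \<exists>r\<in>carrier R. x = i \<oplus> r \<otimes> a"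
proof -
  interpret I: ideal I R by (rule I)
  interpret P: ideal "PIdl a" R by (rule cgenideal_ideal[OF a])
  show "ideal (I <+>\<^bsub>R\<^esub> PIdl a) R" by (rule add_ideals[OF I cgenideal_ideal[OF a]])
  show "I \<subseteq> I <+>\<^bsub>R\<^esub> PIdl a"
  proof
    fix x assume x: "x \<in> I"
    then have "x = x \<oplus> \<zero>" using I.Icarr by simp
    then show "x \<in> I <+>\<^bsub>R\<^esub> PIdl a" unfolding set_add_def' using x P.zero_closed by blast
  qed
  have "a = \<zero> \<oplus> a" using a by simp
  then show "a \<in> I <+>\<^bsub>R\<^esub> PIdl a"
    unfolding set_add_def' using I.zero_closed cgenideal_self[OF a] by blast
  show "\<exists>i\<in>I. \<exists>r\<in>carrier R. x = i \<oplus> r \<otimes> a" if "x \<in> I <+>\<^bsub>R\<^esub> PIdl a"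
    using that unfolding set_add_def' cgenideal_def by blast
qed

lemma adjoin_minimal:
  assumes P: "ideal P R" and "I \<subseteq> P" "a \<in> P" "ideal I R"
  shows "I <+>\<^bsub>R\<^esub> PIdl a \<subseteq> P"
proof
  interpret P: ideal P R by (rule P)
  fix x assume "x \<in> I <+>\<^bsub>R\<^esub> PIdl a"
  then obtain i r where "i \<in> I" "r \<in> carrier R" "x = i \<oplus> r \<otimes> a"
    using adjoin_ideal(4)[OF assms(4)] P.Icarr assms(3) by blast
  then show "x \<in> P" using assms(2,3) P.I_l_closed P.a_closed by blast
qed

text \<open>By induction each P has an element x_P of J outside all the other primes. If every x_P
  lies in its own P, fix one P: an element of J outside P, multiplied by x_Q for all Q other than P,
  gives z in every Q but not in P, and x_P + z avoids all of them.\<close>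

lemma prime_avoidance:
  assumes J: "ideal J R" and "finite \<P>" and "\<And>P. P \<in> \<P> \<Longrightarrow> primeideal P R \<and> \<not> J \<subseteq> P"
  shows "\<exists>x\<in>J. \<forall>P\<in>\<P>. x \<notin> P"
  using assms(2,3)
proof (induction "card \<P>" arbitrary: \<P> rule: less_induct)
  case less
  interpret J: ideal J R by (rule J)
  have "\<exists>x\<in>J. \<forall>Q\<in>\<P> - {P}. x \<notin> Q" if "P \<in> \<P>" for P
    using less.prems that by (intro less.hyps card_Diff1_less) auto
  then obtain x where x: "\<And>P. P \<in> \<P> \<Longrightarrow> x P \<in> J" "\<And>P Q. P \<in> \<P> \<Longrightarrow> Q \<in> \<P> \<Longrightarrow> Q \<noteq> P \<Longrightarrow> x P \<notin> Q"
    by (metis Diff_iff singletonD)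
  show ?case
  proof (cases "\<P> = {} \<or> (\<exists>P\<in>\<P>. x P \<notin> P)")
    case True
    then show ?thesis using x J.zero_closed by (metis empty_iff)
  next
    case False
    then obtain P where P: "P \<in> \<P>" by blast
    have xP: "x Q \<in> Q" if "Q \<in> \<P>" for Q using False that by blast
    interpret P: primeideal P R using less.prems(2)[OF P] by blast
    have "\<exists>z\<in>J. z \<notin> P \<and> (\<forall>Q\<in>F. z \<in> Q)" if "finite F" "F \<subseteq> \<P> - {P}" for F
      using that
    proof (induction F)
      case empty
      then show ?case using less.prems(2)[OF P] by blast
    next
      case (insert Q F)
      then obtain z where z: "z \<in> J" "z \<notin> P" "\<forall>Q\<in>F. z \<in> Q" by blast
      have Q: "Q \<in> \<P>" "Q \<noteq> P" using insert.prems by auto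
      have zc: "z \<in> carrier R" "x Q \<in> carrier R" using z(1) x(1)[OF Q(1)] J.Icarr by auto
      have "z \<otimes> x Q \<in> Q'" if "Q' \<in> insert Q F" for Q'
      proof -
        have "Q' \<in> \<P>" using that insert.prems by blast
        then interpret Q': primeideal Q' R using less.prems(2) by blast
        show ?thesis
          using that z(3) xP[OF Q(1)] zc Q'.I_l_closed Q'.I_r_closed by blast
      qed
      moreover have "z \<otimes> x Q \<notin> P"
        using P.I_prime[OF zc] z(2) x(2)[OF Q(1) P] Q(2) by blast
      moreover have "z \<otimes> x Q \<in> J" using J.I_r_closed[OF z(1) zc(2)] .
      ultimately show ?case by blast
    qed
    then obtain z where z: "z \<in> J" "z \<notin> P" "\<forall>Q\<in>\<P> - {P}. z \<in> Q"
      using less.prems(1) by (meson finite_Diff order_refl)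
    have c: "x P \<in> carrier R" "z \<in> carrier R" using x(1)[OF P] z(1) J.Icarr by auto
    have cancel: "u \<in> Q" if "primeideal Q R" "u \<oplus> v \<in> Q" "v \<in> Q" "u \<in> carrier R" for u v Q
    proof -
      interpret Q: primeideal Q R by fact
      have vc: "v \<in> carrier R" using that(3) Q.Icarr by blast
      have "(u \<oplus> v) \<oplus> \<ominus> v \<in> Q" using that(2,3) Q.a_inv_closed Q.a_closed by blast
      then show ?thesis using that(4) vc by (simp add: a_assoc r_neg)
    qed
    have "x P \<oplus> z \<notin> Q" if Q: "Q \<in> \<P>" for Q
    proof (cases "Q = P")
      case True
      then show ?thesis
        using cancel[of P z "x P"] P.primeideal_axioms xP[OF P] z(2) c by (auto simp: a_comm)
    next
      case False
      then show ?thesis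
        using cancel[of Q "x P" z] less.prems(2)[OF Q] z(3) Q x(2)[OF P Q] c by blast
    qed
    then show ?thesis using J.a_closed[OF x(1)[OF P] z(1)] by blast
  qed
qed

end

section \<open>Primes over an ideal of a Noetherian ring\<close>

locale noetherian_cring = noetherian_ring + cring
begin

text \<open>Such a set contains all minimal primes over I. Its members may be non-minimal, which
  lets covers be combined by a plain union.\<close>

definition finite_cover :: "'a set \<Rightarrow> 'a set set \<Rightarrow> bool" where
  "finite_cover I \<P> \<longleftrightarrow> finite \<P> \<and> (\<forall>P\<in>\<P>. primeideal P R \<and> I \<subseteq> P) \<and>
    (\<forall>P. primeideal P R \<longrightarrow> I \<subseteq> P \<longrightarrow> (\<exists>Q\<in>\<P>. Q \<subseteq> P))"

text \<open>Noetherian induction: a maximal counterexample I is not prime, so it contains a product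
  ab with neither factor in I. A prime over I contains a or b, and the covers of I + (a) and I + (b)
  together cover I.\<close>

lemma finite_primes_over:
  assumes "ideal I R"
  shows "\<exists>\<P>. finite_cover I \<P>"
proof (rule ccontr)
  assume "\<not> (\<exists>\<P>. finite_cover I \<P>)"
  then have "I \<in> {I. ideal I R \<and> \<not> (\<exists>\<P>. finite_cover I \<P>)}" using assms by simp
  then obtain I where I: "I \<in> {I. ideal I R \<and> \<not> (\<exists>\<P>. finite_cover I \<P>)}"
    and max: "\<And>J. J \<in> {I. ideal I R \<and> \<not> (\<exists>\<P>. finite_cover I \<P>)} \<Longrightarrow> I \<subseteq> J \<Longrightarrow> J = I"
    using maximal_ideal_exists[of "{I. ideal I R \<and> \<not> (\<exists>\<P>. finite_cover I \<P>)}"] by blast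
  have idI: "ideal I R" and nG: "\<not> finite_cover I \<P>" for \<P> using I by auto
  interpret I: ideal I R by (rule idI)
  have "\<not> primeideal I R"
    using nG[of "{I}"] by (auto simp: finite_cover_def)
  moreover have "carrier R \<noteq> I"
  proof
    assume c: "carrier R = I"
    have "\<not> I \<subseteq> P" if "primeideal P R" for P
    proof -
      interpret P: primeideal P R by fact
      show ?thesis using P.I_notcarr P.a_subset c by blast
    qed
    then have "finite_cover I {}" by (simp add: finite_cover_def)
    then show False using nG by blast
  qed
  ultimately obtain a b where ab: "a \<in> carrier R" "b \<in> carrier R" "a \<otimes> b \<in> I" "a \<notin> I" "b \<notin> I"
    using primeidealI[OF idI is_cring] by blast
  have G: "\<exists>\<P>. finite_cover (I <+>\<^bsub>R\<^esub> PIdl c) \<P>" if c: "c \<in> carrier R" "c \<notin> I" for c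
  proof (rule ccontr)
    assume "\<not> (\<exists>\<P>. finite_cover (I <+>\<^bsub>R\<^esub> PIdl c) \<P>)"
    then have "I <+>\<^bsub>R\<^esub> PIdl c = I"
      by (intro max) (simp_all add: adjoin_ideal(1,2)[OF idI c(1)])
    then show False using adjoin_ideal(3)[OF idI c(1)] c(2) by simp
  qed
  obtain \<P>1 where P1: "finite_cover (I <+>\<^bsub>R\<^esub> PIdl a) \<P>1" using G[OF ab(1,4)] by blast
  obtain \<P>2 where P2: "finite_cover (I <+>\<^bsub>R\<^esub> PIdl b) \<P>2" using G[OF ab(2,5)] by blast
  have "\<exists>Q\<in>\<P>1 \<union> \<P>2. Q \<subseteq> P" if P: "primeideal P R" "I \<subseteq> P" for P
  proof -
    interpret P: primeideal P R by (rule P(1))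
    have "a \<in> P \<or> b \<in> P" using P.I_prime[OF ab(1,2)] ab(3) P(2) by blast
    then consider "I <+>\<^bsub>R\<^esub> PIdl a \<subseteq> P" | "I <+>\<^bsub>R\<^esub> PIdl b \<subseteq> P"
      using adjoin_minimal[OF P.is_ideal P(2) _ idI] by blast
    then show ?thesis
    proof cases
      case 1 then show ?thesis using P1 P(1) unfolding finite_cover_def by blast
    next
      case 2 then show ?thesis using P2 P(1) unfolding finite_cover_def by blast
    qed
  qed
  moreover have "primeideal P R \<and> I \<subseteq> P" if PU: "P \<in> \<P>1 \<union> \<P>2" for P
  proof -
    consider "P \<in> \<P>1" | "P \<in> \<P>2" using PU by blast
    then show ?thesis
    proof cases
      case 1
      then have "primeideal P R" "I <+>\<^bsub>R\<^esub> PIdl a \<subseteq> P" using P1 by (simp_all add: finite_cover_def)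
      then show ?thesis using adjoin_ideal(2)[OF idI ab(1)] by simp
    next
      case 2
      then have "primeideal P R" "I <+>\<^bsub>R\<^esub> PIdl b \<subseteq> P" using P2 by (simp_all add: finite_cover_def)
      then show ?thesis using adjoin_ideal(2)[OF idI ab(2)] by simp
    qed
  qed
  moreover have "finite (\<P>1 \<union> \<P>2)" using P1 P2 by (simp add: finite_cover_def)
  ultimately have "finite_cover I (\<P>1 \<union> \<P>2)" unfolding finite_cover_def by blast
  then show False using nG by blast
qed

text \<open>An ideal maximal among those over Q that contain no power of y is prime: if a and b lie
  outside it, adjoining either one captures a power of y, and if ab were inside, so would be the
  product of these powers.\<close>

lemma prime_avoiding_powers:
  assumes Q: "ideal Q R" and y: "y \<in> carrier R" and yk: "\<And>k :: nat. y [^] k \<notin> Q"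
  obtains P where "primeideal P R" "Q \<subseteq> P" "y \<notin> P"
proof -
  define \<A> where "\<A> = {I. ideal I R \<and> Q \<subseteq> I \<and> (\<forall>k :: nat. y [^] k \<notin> I)}"
  have "Q \<in> \<A>" using Q yk by (simp add: \<A>_def)
  then have ne: "\<A> \<noteq> {}" by blast
  have id: "\<And>I. I \<in> \<A> \<Longrightarrow> ideal I R" by (simp add: \<A>_def)
  obtain P where PA: "P \<in> \<A>" and max: "\<And>J. J \<in> \<A> \<Longrightarrow> P \<subseteq> J \<Longrightarrow> J = P"
    using maximal_ideal_exists[OF ne id] by metis
  have P: "ideal P R" "Q \<subseteq> P" "\<And>k :: nat. y [^] k \<notin> P" using PA by (simp_all add: \<A>_def)
  interpret P: ideal P R by (rule P(1))
  have pow: "\<exists>k :: nat. \<exists>i\<in>P. \<exists>r\<in>carrier R. y [^] k = i \<oplus> r \<otimes> a" if a: "a \<in> carrier R" "a \<notin> P" for a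
  proof -
    have "P <+>\<^bsub>R\<^esub> PIdl a \<notin> \<A>"
      using max[of "P <+>\<^bsub>R\<^esub> PIdl a"] adjoin_ideal(2,3)[OF P(1) a(1)] a(2) by metis
    moreover have "Q \<subseteq> P <+>\<^bsub>R\<^esub> PIdl a" using adjoin_ideal(2)[OF P(1) a(1)] P(2) by simp
    ultimately obtain k :: nat where "y [^] k \<in> P <+>\<^bsub>R\<^esub> PIdl a"
      using adjoin_ideal(1)[OF P(1) a(1)] by (auto simp: \<A>_def)
    then show ?thesis using adjoin_ideal(4)[OF P(1) a(1)] by blast
  qed
  have "primeideal P R"
  proof (rule primeidealI[OF P(1) is_cring])
    show "carrier R \<noteq> P" using P(3)[of 0] by auto
    fix a b assume ab: "a \<in> carrier R" "b \<in> carrier R" "a \<otimes> b \<in> P"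
    show "a \<in> P \<or> b \<in> P"
    proof (rule ccontr)
      assume n: "\<not> (a \<in> P \<or> b \<in> P)"
      obtain k i r where k: "i \<in> P" "r \<in> carrier R" "y [^] (k :: nat) = i \<oplus> r \<otimes> a" using pow[of a] ab n by blast
      obtain k' i' r' where k': "i' \<in> P" "r' \<in> carrier R" "y [^] (k' :: nat) = i' \<oplus> r' \<otimes> b" using pow[of b] ab n by blast
      have c: "i \<in> carrier R" "i' \<in> carrier R" using k k' P.Icarr by auto
      have "y [^] (k + k') = (i \<oplus> r \<otimes> a) \<otimes> (i' \<oplus> r' \<otimes> b)" using y k(3) k'(3) by (simp flip: nat_pow_mult)
      also have "\<dots> = i \<otimes> (i' \<oplus> r' \<otimes> b) \<oplus> ((r \<otimes> a) \<otimes> i' \<oplus> (r \<otimes> r') \<otimes> (a \<otimes> b))"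
        using c k(2) k'(2) ab by (simp add: l_distr r_distr m_ac)
      also have "\<dots> \<in> P"
      proof (intro P.a_closed)
        show "i \<otimes> (i' \<oplus> r' \<otimes> b) \<in> P" by (rule P.I_r_closed[OF k(1)]) (use c k'(2) ab in simp)
        show "(r \<otimes> a) \<otimes> i' \<in> P" by (rule P.I_l_closed[OF k'(1)]) (use k(2) ab in simp)
        show "(r \<otimes> r') \<otimes> (a \<otimes> b) \<in> P" by (rule P.I_l_closed[OF ab(3)]) (use k(2) k'(2) in simp)
      qed
      finally show False using P(3) by blast
    qed
  qed
  then show ?thesis using that P(2) P(3)[of 1] y by simp
qed

section \<open>Parameters of a local ring\<close>

lemma local_ideal_le:
  assumes "local_ring R \<mm>" "ideal I R" "carrier R \<noteq> I"
  shows "I \<subseteq> \<mm>"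
proof -
  define \<A> where "\<A> = {J. ideal J R \<and> I \<subseteq> J \<and> carrier R \<noteq> J}"
  have "I \<in> \<A>" using assms(2,3) by (simp add: \<A>_def)
  then have ne: "\<A> \<noteq> {}" by blast
  have id: "\<And>I. I \<in> \<A> \<Longrightarrow> ideal I R" by (simp add: \<A>_def)
  obtain M where MA: "M \<in> \<A>" and max: "\<And>J. J \<in> \<A> \<Longrightarrow> M \<subseteq> J \<Longrightarrow> J = M"
    using maximal_ideal_exists[OF ne id] by metis
  have M: "ideal M R" "I \<subseteq> M" "carrier R \<noteq> M" using MA by (simp_all add: \<A>_def)
  have "maximalideal M R"
  proof (rule maximalidealI[OF M(1,3)])
    fix J assume J: "ideal J R" "M \<subseteq> J"
    show "J = M \<or> J = carrier R"
    proof (cases "J = carrier R")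
      case False
      then have "J \<in> \<A>" using J M(2) by (auto simp: \<A>_def)
      then show ?thesis using max J(2) by blast
    qed simp
  qed
  then have "M = \<mm>" using assms(1) by (simp add: local_ring_def)
  then show ?thesis using M(2) by simp
qed

lemma local_prime_le:
  assumes "local_ring R \<mm>" "primeideal P R"
  shows "P \<subseteq> \<mm>"
proof -
  interpret P: primeideal P R by fact
  show ?thesis by (rule local_ideal_le[OF assms(1) P.is_ideal P.I_notcarr])
qed

lemma local_unit:
  assumes "local_ring R \<mm>" "r \<in> carrier R" "r \<notin> \<mm>"
  shows "r \<in> Units R"
proof -
  have "carrier R = PIdl r"
    using local_ideal_le[OF assms(1) cgenideal_ideal[OF assms(2)]] cgenideal_self[OF assms(2)] assms(3) by blast
  then obtain s where "s \<in> carrier R" "\<one> = s \<otimes> r" unfolding cgenideal_def using one_closed by blast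
  then show ?thesis using assms(2) m_comm[of s r] unfolding Units_def by auto
qed

text \<open>The bound dim R/I \<le> k, phrased with chains of primes of R to avoid the quotient
  ring.\<close>

definition dim_over_le :: "'a set \<Rightarrow> nat \<Rightarrow> bool" where
  "dim_over_le I k \<longleftrightarrow> (\<forall>d P. (\<forall>i\<le>d. primeideal (P i) R) \<and> (\<forall>i<d. P i \<subset> P (Suc i)) \<and> I \<subseteq> P 0 \<longrightarrow> d \<le> k)"

lemma dim_over_leD:
  assumes "dim_over_le I k" "\<And>i. i \<le> d \<Longrightarrow> primeideal (P i) R" "\<And>i. i < d \<Longrightarrow> P i \<subset> P (Suc i)" "I \<subseteq> P 0"
  shows "d \<le> k"
  using assms unfolding dim_over_le_def by metis

text \<open>Prime avoidance gives x in \<mm> outside every member of a finite cover of I other than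
  \<mm>. A chain of primes over I + (x) can then be prolonged downwards by a member of the cover, so
  the dimension drops by one. In dimension 0 every prime over I is \<mm>.\<close>

lemma exists_parameters:
  assumes loc: "local_ring R \<mm>"
  shows "ideal I R \<Longrightarrow> dim_over_le I k \<Longrightarrow>
    \<exists>xs. length xs = k \<and> set xs \<subseteq> \<mm> \<and> (\<forall>P. primeideal P R \<longrightarrow> I \<subseteq> P \<longrightarrow> set xs \<subseteq> P \<longrightarrow> P = \<mm>)"
proof (induction k arbitrary: I)
  case 0
  interpret m: maximalideal \<mm> R using loc by (simp add: local_ring_def)
  have mp: "primeideal \<mm> R" using m.maximalideal_axioms by (rule maximalideal_prime)
  have "P = \<mm>" if P: "primeideal P R" "I \<subseteq> P" for P
  proof (rule ccontr)
    assume "P \<noteq> \<mm>"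
    then have "P \<subset> \<mm>" using local_prime_le[OF loc P(1)] by blast
    then have "(1::nat) \<le> 0"
      using P mp by (intro dim_over_leD[OF "0.prems"(2), of 1 "\<lambda>i. if i = 0 then P else \<mm>"]) auto
    then show False by simp
  qed
  then show ?case by (intro exI[of _ "[]"]) auto
next
  case (Suc k)
  interpret m: maximalideal \<mm> R using loc by (simp add: local_ring_def)
  obtain \<P> where \<P>: "finite \<P>" "\<And>P. P \<in> \<P> \<Longrightarrow> primeideal P R \<and> I \<subseteq> P"
    "\<And>P. primeideal P R \<Longrightarrow> I \<subseteq> P \<Longrightarrow> \<exists>Q\<in>\<P>. Q \<subseteq> P"
    using finite_primes_over[OF Suc.prems(1)] unfolding finite_cover_def by metis
  have "\<exists>x\<in>\<mm>. \<forall>P\<in>\<P> - {\<mm>}. x \<notin> P"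
  proof (rule prime_avoidance[OF m.is_ideal])
    show "primeideal P R \<and> \<not> \<mm> \<subseteq> P" if "P \<in> \<P> - {\<mm>}" for P
      using that \<P>(2)[of P] local_prime_le[OF loc, of P] by blast
  qed (use \<P>(1) in simp)
  then obtain x where x: "x \<in> \<mm>" "\<And>P. P \<in> \<P> \<Longrightarrow> P \<noteq> \<mm> \<Longrightarrow> x \<notin> P" by blast
  have xc: "x \<in> carrier R" using x(1) m.Icarr by blast
  let ?I = "I <+>\<^bsub>R\<^esub> PIdl x"
  note adj = adjoin_ideal[OF Suc.prems(1) xc]
  have "dim_over_le ?I k"
    unfolding dim_over_le_def
  proof (intro allI impI)
    fix d P
    assume *: "(\<forall>i\<le>d. primeideal (P i) R) \<and> (\<forall>i<d. P i \<subset> P (Suc i)) \<and> ?I \<subseteq> P 0"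
    have P0: "primeideal (P 0) R" "I \<subseteq> P 0" "x \<in> P 0" using * adj(2,3) by auto
    obtain Q where Q: "Q \<in> \<P>" "Q \<subseteq> P 0" using \<P>(3)[OF P0(1,2)] by blast
    show "d \<le> k"
    \<comment> \<open>If the cover member below the chain is \<mm> itself, the chain cannot be
      prolonged, but then it starts at \<mm> and has length 0.\<close>
    proof (cases "Q = \<mm>")
      case True
      have "d = 0"
      proof (rule ccontr)
        assume "d \<noteq> 0"
        then have "P 0 \<subset> P 1" "primeideal (P 1) R" using * by auto
        then show False using local_prime_le[OF loc, of "P 1"] True Q(2) by blast
      qed
      then show ?thesis by simp
    next
      case False
      then have QP: "Q \<subset> P 0" using x(2)[OF Q(1)] P0(3) Q(2) by blast
      let ?P = "case_nat Q P"
      have "Suc d \<le> Suc k"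
      proof (rule dim_over_leD[OF Suc.prems(2), of "Suc d" ?P])
        show "primeideal (?P i) R" if "i \<le> Suc d" for i
          using that * \<P>(2)[OF Q(1)] by (cases i) simp_all
        show "?P i \<subset> ?P (Suc i)" if "i < Suc d" for i
          using that * QP by (cases i) simp_all
        show "I \<subseteq> ?P 0" using \<P>(2)[OF Q(1)] by simp
      qed
      then show ?thesis by simp
    qed
  qed
  from Suc.IH[OF adj(1) this] obtain xs where xs: "length xs = k" "set xs \<subseteq> \<mm>"
    "\<And>P. primeideal P R \<Longrightarrow> ?I \<subseteq> P \<Longrightarrow> set xs \<subseteq> P \<Longrightarrow> P = \<mm>" by blast
  have "P = \<mm>" if P: "primeideal P R" "I \<subseteq> P" "set (x # xs) \<subseteq> P" for P
  proof -
    interpret P: primeideal P R by (rule P(1))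
    show ?thesis using adjoin_minimal[OF P.is_ideal P(2) _ Suc.prems(1), of x] xs(3)[OF P(1)] P(3) by auto
  qed
  then show ?case using xs x(1) by (intro exI[of _ "x # xs"]) auto
qed

text \<open>Phrased for radical ideals because it is applied to the contraction of a radical ideal
  of A. An element of \<mm> outside Q would be avoided by a prime over Q, and that prime contains
  the parameters, so it is \<mm>.\<close>

lemma parameters_radical:
  assumes loc: "local_ring R \<mm>" and dim: "krull_dim R = enat n"
  obtains xs where "length xs = n" "set xs \<subseteq> \<mm>"
    "\<And>Q. ideal Q R \<Longrightarrow> set xs \<subseteq> Q \<Longrightarrow> (\<And>y k. y \<in> carrier R \<Longrightarrow> y [^] (k::nat) \<in> Q \<Longrightarrow> y \<in> Q) \<Longrightarrow> \<mm> \<subseteq> Q"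
proof -
  interpret m: maximalideal \<mm> R using loc by (simp add: local_ring_def)
  have "dim_over_le {\<zero>} n"
    unfolding dim_over_le_def
  proof (intro allI impI)
    fix d P assume *: "(\<forall>i\<le>d. primeideal (P i) R) \<and> (\<forall>i<d. P i \<subset> P (Suc i)) \<and> {\<zero>} \<subseteq> P 0"
    have "enat d \<le> krull_dim R"
      unfolding krull_dim_def by (rule Sup_upper) (use * in blast)
    then show "d \<le> n" by (simp add: dim)
  qed
  from exists_parameters[OF loc zeroideal this] obtain xs where xs: "length xs = n" "set xs \<subseteq> \<mm>"
    "\<And>P. primeideal P R \<Longrightarrow> {\<zero>} \<subseteq> P \<Longrightarrow> set xs \<subseteq> P \<Longrightarrow> P = \<mm>" by blast
  show ?thesis
  proof (rule that[OF xs(1,2)])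
    fix Q assume Q: "ideal Q R" "set xs \<subseteq> Q" and rad: "\<And>y k. y \<in> carrier R \<Longrightarrow> y [^] (k::nat) \<in> Q \<Longrightarrow> y \<in> Q"
    show "\<mm> \<subseteq> Q"
    proof (rule ccontr)
      assume "\<not> \<mm> \<subseteq> Q"
      then obtain y where y: "y \<in> \<mm>" "y \<notin> Q" by blast
      then have yc: "y \<in> carrier R" using m.Icarr by blast
      obtain P where P: "primeideal P R" "Q \<subseteq> P" "y \<notin> P"
        using prime_avoiding_powers[OF Q(1) yc] rad[OF yc] y(2) by blast
      interpret P: primeideal P R by (rule P(1))
      have "P = \<mm>" using xs(3)[OF P(1)] P.zero_closed Q(2) P(2) by blast
      then show False using y(1) P(3) by blast
    qed
  qed
qed

end

section \<open>Killing the roots of an element\<close>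

text \<open>The ideal generated by I and all \<open>f m\<close>. A single multiple suffices for each
  element because modulo I every \<open>f m\<close> is a multiple of
  \<open>f (Suc m)\<close>.\<close>

definition root_ideal :: "('a, 'q) ring_scheme \<Rightarrow> 'a set \<Rightarrow> (nat \<Rightarrow> 'a) \<Rightarrow> 'a set" where
  "root_ideal A I f = {a \<in> carrier A. \<exists>m. \<exists>b\<in>carrier A. a \<ominus>\<^bsub>A\<^esub> f m \<otimes>\<^bsub>A\<^esub> b \<in> I}"

locale compatible_roots = cring A + I: ideal I A for A (structure) and I +
  fixes p :: nat and f :: "nat \<Rightarrow> 'a"
  assumes p_gt_1: "p > 1"
    and f_closed: "\<And>m. f m \<in> carrier A"
    and f_root: "\<And>m. f (Suc m) [^] p \<ominus> f m \<in> I"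
begin

abbreviation Q where "Q \<equiv> A Quot I"
abbreviation q where "q \<equiv> (\<lambda>a. I +> a)"
abbreviation J where "J \<equiv> root_ideal A I f"

lemma q_hom: "ring_hom_cring A Q q"
  by (rule I.rcos_ring_hom_cring[OF cring_axioms])

lemma q_eq_iff: "a \<in> carrier A \<Longrightarrow> b \<in> carrier A \<Longrightarrow> a \<ominus> b \<in> I \<longleftrightarrow> q a = q b"
  by (rule quotient_eq_iff_same_a_r_cos[OF I.is_ideal])

lemma q_eq_0_iff:
  assumes a: "a \<in> carrier A" shows "a \<in> I \<longleftrightarrow> q a = \<zero>\<^bsub>Q\<^esub>"
proof -
  interpret q: ring_hom_cring A Q q by (rule q_hom)
  show ?thesis using q_eq_iff[of a \<zero>] a by (simp add: minus_eq)
qed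

lemma q_root: "q (f m) = q (f (Suc m)) [^]\<^bsub>Q\<^esub> p"
proof -
  interpret q: ring_hom_cring A Q q by (rule q_hom)
  show ?thesis using f_root[of m] q_eq_iff[of "f (Suc m) [^] p" "f m"] f_closed by simp
qed

lemma q_closed: "a \<in> carrier A \<Longrightarrow> q a \<in> carrier Q"
  using ring_hom_closed[OF I.rcos_ring_hom] .

lemma root_ideal_iff:
  "a \<in> J \<longleftrightarrow> a \<in> carrier A \<and> (\<exists>m. \<exists>b\<in>carrier A. q a = q (f m) \<otimes>\<^bsub>Q\<^esub> q b)"
proof -
  interpret q: ring_hom_cring A Q q by (rule q_hom)
  have "a \<ominus> f m \<otimes> b \<in> I \<longleftrightarrow> q a = q (f m) \<otimes>\<^bsub>Q\<^esub> q b" if "a \<in> carrier A" "b \<in> carrier A" for a b m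
    using q_eq_iff[of a "f m \<otimes> b"] that f_closed by simp
  then show ?thesis unfolding root_ideal_def by blast
qed

lemma root_level_mono:
  assumes "m \<le> m'" "a \<in> carrier A" "b \<in> carrier A" "q a = q (f m) \<otimes>\<^bsub>Q\<^esub> q b"
  shows "\<exists>b\<in>carrier A. q a = q (f m') \<otimes>\<^bsub>Q\<^esub> q b"
  using assms(1)
proof (induction m' rule: dec_induct)
  case base then show ?case using assms by blast
next
  case (step k)
  interpret q: ring_hom_cring A Q q by (rule q_hom)
  obtain b where b: "b \<in> carrier A" "q a = q (f k) \<otimes>\<^bsub>Q\<^esub> q b" using step.IH by blast
  have "p = Suc (p - 1)" using p_gt_1 by simp
  then have "q (f k) = q (f (Suc k)) \<otimes>\<^bsub>Q\<^esub> q (f (Suc k)) [^]\<^bsub>Q\<^esub> (p - 1)"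
    using q_root[of k] q.S.nat_pow_Suc2[OF q_closed[OF f_closed[of "Suc k"]], of "p - 1"] by simp
  then have "q a = q (f (Suc k)) \<otimes>\<^bsub>Q\<^esub> q (f (Suc k) [^] (p - 1) \<otimes> b)"
    using b f_closed[of "Suc k"] by (simp add: q.S.m_assoc)
  then show ?case using b(1) f_closed by blast
qed

lemma root_ideal_ideal: "ideal J A"
proof (rule idealI[OF ring_axioms])
  interpret q: ring_hom_cring A Q q by (rule q_hom)
  have add: "a \<oplus> b \<in> J" if ab: "a \<in> J" "b \<in> J" for a b
  proof -
    obtain m c m' c' where c: "c \<in> carrier A" "q a = q (f m) \<otimes>\<^bsub>Q\<^esub> q c" "c' \<in> carrier A" "q b = q (f m') \<otimes>\<^bsub>Q\<^esub> q c'"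
      using ab unfolding root_ideal_iff by blast
    have ac: "a \<in> carrier A" "b \<in> carrier A" using ab unfolding root_ideal_iff by blast+
    obtain d where d: "d \<in> carrier A" "q a = q (f (max m m')) \<otimes>\<^bsub>Q\<^esub> q d"
      using root_level_mono[OF _ ac(1) c(1,2), of "max m m'"] by auto
    obtain d' where d': "d' \<in> carrier A" "q b = q (f (max m m')) \<otimes>\<^bsub>Q\<^esub> q d'"
      using root_level_mono[OF _ ac(2) c(3,4), of "max m m'"] by auto
    have "q (a \<oplus> b) = q (f (max m m')) \<otimes>\<^bsub>Q\<^esub> q (d \<oplus> d')"
      using d d' ac f_closed by (simp add: q.S.r_distr)
    then show ?thesis unfolding root_ideal_iff using ac d(1) d'(1) by blast
  qed
  have mult: "x \<otimes> a \<in> J" if a: "a \<in> J" and x: "x \<in> carrier A" for a x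
  proof -
    obtain m c where c: "a \<in> carrier A" "c \<in> carrier A" "q a = q (f m) \<otimes>\<^bsub>Q\<^esub> q c"
      using a unfolding root_ideal_iff by blast
    have "q (x \<otimes> a) = q (f m) \<otimes>\<^bsub>Q\<^esub> q (x \<otimes> c)"
      using c x f_closed by (simp add: q.S.m_lcomm)
    then show ?thesis unfolding root_ideal_iff using c(1,2) x by blast
  qed
  have zero: "\<zero> \<in> J"
  proof -
    have "q \<zero> = q (f 0) \<otimes>\<^bsub>Q\<^esub> q \<zero>" using f_closed by simp
    then show ?thesis unfolding root_ideal_iff by blast
  qed
  show "subgroup J (add_monoid A)"
  proof (rule add.subgroupI)
    show "J \<subseteq> carrier A" unfolding root_ideal_def by blast
    show "J \<noteq> {}" using zero by blast
    show "\<ominus> a \<in> J" if "a \<in> J" for a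
    proof -
      have "a \<in> carrier A" using that unfolding root_ideal_iff by blast
      then show ?thesis using mult[OF that, of "\<ominus> \<one>"] by (simp add: l_minus)
    qed
  qed (rule add)
  show "x \<otimes> a \<in> J" if "a \<in> J" "x \<in> carrier A" for a x by (rule mult[OF that])
  show "a \<otimes> x \<in> J" if "a \<in> J" "x \<in> carrier A" for a x
  proof -
    have "a \<in> carrier A" using that unfolding root_ideal_iff by blast
    then show ?thesis using mult[OF that] that(2) by (simp add: m_comm)
  qed
qed

lemma root_ideal_superset: "I \<subseteq> J"
proof
  interpret q: ring_hom_cring A Q q by (rule q_hom)
  fix a assume a: "a \<in> I"
  have "q a = q (f 0) \<otimes>\<^bsub>Q\<^esub> q \<zero>" using a q_eq_0_iff[of a] I.Icarr[OF a] f_closed by simp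
  then show "a \<in> J" unfolding root_ideal_iff using I.Icarr[OF a] by blast
qed

lemma f_in_root_ideal: "f m \<in> J"
proof -
  interpret q: ring_hom_cring A Q q by (rule q_hom)
  have "q (f m) = q (f m) \<otimes>\<^bsub>Q\<^esub> q \<one>" using f_closed by simp
  then show ?thesis unfolding root_ideal_iff using f_closed by blast
qed

text \<open>Modulo I the \<open>f m\<close> are iterated p-th roots of \<open>f 0\<close>, so an
  ideal over I that contains \<open>f 0\<close> and is closed under p-th roots contains them
  all.\<close>

lemma root_ideal_least:
  assumes K: "ideal K A" "I \<subseteq> K" "f 0 \<in> K" and rad: "\<And>a. a \<in> carrier A \<Longrightarrow> a [^] p \<in> K \<Longrightarrow> a \<in> K"
  shows "J \<subseteq> K"
proof
  interpret K: ideal K A by (rule K(1))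
  have sub': "a \<in> K" if "a \<ominus> b \<in> I" "b \<in> K" "a \<in> carrier A" for a b
  proof -
    have "(a \<ominus> b) \<oplus> b \<in> K" using that K(2) K.a_closed by auto
    then show ?thesis using that K.Icarr by (simp add: minus_eq a_assoc l_neg)
  qed
  have fK: "f m \<in> K" for m
  proof (induction m)
    case (Suc m)
    have "f (Suc m) [^] p \<in> K" by (rule sub'[OF f_root Suc]) (use f_closed in simp)
    then show ?case by (rule rad[OF f_closed])
  qed (rule K(3))
  fix a assume "a \<in> J"
  then obtain m b where b: "a \<in> carrier A" "b \<in> carrier A" "a \<ominus> f m \<otimes> b \<in> I" unfolding root_ideal_def by blast
  show "a \<in> K" by (rule sub'[OF b(3) K.I_r_closed[OF fK b(2)] b(1)])
qed

end

lemma ideal_submodule: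
  fixes A (structure)
  assumes alg: "algebra R A" and H: "ideal H A"
  shows "submodule H R A"
proof -
  interpret H: ideal H A by (rule H)
  interpret A: algebra R A by (rule alg)
  have "r \<odot> a \<in> H" if "r \<in> carrier R" "a \<in> H" for r a
  proof -
    have ac: "a \<in> carrier A" using that(2) by (rule H.Icarr)
    have "r \<odot> a = (r \<odot> \<one>) \<otimes> a" using A.smult_assoc2[OF that(1) H.one_closed ac] ac by simp
    then show ?thesis using H.I_l_closed[OF that(2)] that(1) by simp
  qed
  then show ?thesis
    by (intro A.submoduleI) (use H.a_subset H.zero_closed H.a_inv_closed H.a_closed in auto)
qed

text \<open>If \<open>f m\<close>-torsion modulo \<open>I\<close> is killed by \<open>f (m + 1)\<close>, then the root ideal of \<open>f\<close> modulo \<open>I\<close> is a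
  filtered colimit of copies of \<open>A/I\<close>; hence passing to its quotient costs one degree of exactness.\<close>

lemma exact_mod_root_ideal:
  fixes A :: "('r, 'a) module" (structure) and R :: "('r, 'q) ring_scheme"
  assumes alg: "algebra R A" and roots: "compatible_roots A I p f"
    and tors: "\<And>m a. a \<in> carrier A \<Longrightarrow> f m \<otimes> a \<in> I \<Longrightarrow> f (Suc m) \<otimes> a \<in> I"
    and ex: "exact_mod R M A I i" "exact_mod R M A I (Suc i)"
  shows "exact_mod R M A (root_ideal A I f) (Suc i)"
  unfolding exact_mod_def
proof (intro ballI impI)
  interpret compatible_roots A I p f by (rule roots)
  interpret A: algebra R A by (rule alg)
  interpret q: ring_hom_cring A Q q by (rule q_hom)
  have mA: "module R A" by (rule A.module)
  define S where "S = res_gens R M"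
  define d where "d = boundary R M A"
  have dl: "linear_map R (fsm A (S (Suc n))) (fsm A (S n)) (d n)" for n
    unfolding S_def d_def by (rule boundary_linear[OF mA])
  note gb = gen_boundary_closed[OF A.R_cring, of _ M]
  have scale: "linear_map R A A (\<lambda>x. c \<otimes> x)" if c: "c \<in> carrier A" for c
  proof (rule linear_mapI)
    show "c \<otimes> (r \<odot> x) = r \<odot> (c \<otimes> x)" if "r \<in> carrier R" "x \<in> carrier A" for r x
      using A.smult_assoc2[OF that c] that c by (simp add: m_comm)
  qed (use c in \<open>auto simp: r_distr\<close>)
  have sc: "(\<lambda>t. c \<otimes> y t) \<in> carrier (fsm A (S (Suc n)))" "d n (\<lambda>t. c \<otimes> y t) = (\<lambda>s. c \<otimes> d n y s)"
    if "c \<in> carrier A" "y \<in> carrier (fsm A (S (Suc n)))" for c y n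
    unfolding S_def d_def
    using mat_map_natural[where D = "gen_boundary R", OF mA mA scale[OF that(1)] gb that(2)[unfolded S_def]] by blast+
  have sc0: "(\<lambda>t. c \<otimes> y t) \<in> carrier (fsm A (S n))" if "c \<in> carrier A" "y \<in> carrier (fsm A (S n))" for c y n
    using linear_mapD(1)[OF linear_map_fsm_map[OF mA mA scale[OF that(1)]] that(2)] .
  have dI: "d n y s \<in> I" if "y \<in> carrier (fsm A (S (Suc n)))" "\<And>t. y t \<in> I" for y n s
    unfolding d_def by (rule mat_map_in_submodule[OF mA ideal_submodule[OF alg I.is_ideal] gb that(1)[unfolded S_def] that(2)])
  have dm: "d n (\<lambda>t. x t \<ominus> y t) = (\<lambda>s. d n x s \<ominus> d n y s)" "(\<lambda>t. x t \<ominus> y t) \<in> carrier (fsm A (S (Suc n)))"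
    if xy: "x \<in> carrier (fsm A (S (Suc n)))" "y \<in> carrier (fsm A (S (Suc n)))" for x y n
  proof -
    interpret F: module R "fsm A (S (Suc n))" by (rule module_fsm[OF mA])
    show "d n (\<lambda>t. x t \<ominus> y t) = (\<lambda>s. d n x s \<ominus> d n y s)"
      using linear_map_minus[OF module_fsm[OF mA] module_fsm[OF mA] dl xy]
      unfolding fsm_minus[OF mA xy] fsm_minus[OF mA linear_mapD(1)[OF dl xy(1)] linear_mapD(1)[OF dl xy(2)]] .
    show "(\<lambda>t. x t \<ominus> y t) \<in> carrier (fsm A (S (Suc n)))"
      using F.minus_closed[OF xy] unfolding fsm_minus[OF mA xy] .
  qed
  note nth = fsm_nth[OF mA]
  fix z assume "z \<in> carrier (fsm A (res_gens R M (Suc i)))"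
    and "\<forall>j. Suc i = Suc j \<longrightarrow> (\<forall>s. boundary R M A j z s \<in> J)"
  then have z: "z \<in> carrier (fsm A (S (Suc i)))" and dz: "\<And>s. d i z s \<in> J"
    by (auto simp: S_def d_def)
  have dzc: "d i z \<in> carrier (fsm A (S i))" by (rule linear_mapD(1)[OF dl z])
  note dzn = nth[OF dzc]
  \<comment> \<open>Only finitely many coordinates of dz are nonzero, so by monotonicity of the
    levels they are all multiples of one \<open>f m\<close> modulo I; hence dz = f_m y modulo
    I.\<close>
  have "\<exists>m. \<forall>s\<in>T. \<exists>b\<in>carrier A. q (d i z s) = q (f m) \<otimes>\<^bsub>Q\<^esub> q b" if "finite T" for T
    using that
  proof (induction T)
    case (insert s T)
    obtain m where m: "\<And>s. s \<in> T \<Longrightarrow> \<exists>b\<in>carrier A. q (d i z s) = q (f m) \<otimes>\<^bsub>Q\<^esub> q b" using insert.IH by blast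
    obtain m' b where b: "b \<in> carrier A" "q (d i z s) = q (f m') \<otimes>\<^bsub>Q\<^esub> q b"
      using dz[of s] unfolding root_ideal_iff by blast
    have "\<exists>b\<in>carrier A. q (d i z t) = q (f (max m m')) \<otimes>\<^bsub>Q\<^esub> q b" if t: "t \<in> insert s T" for t
    proof (cases "t = s")
      case True
      then show ?thesis using root_level_mono[OF _ dzn b, of "max m m'"] by simp
    next
      case False
      then obtain b where "b \<in> carrier A" "q (d i z t) = q (f m) \<otimes>\<^bsub>Q\<^esub> q b" using m t by blast
      then show ?thesis using root_level_mono[OF _ dzn, of m "max m m'"] by simp
    qed
    then show ?case by blast
  qed simp
  moreover have fin: "finite {s. d i z s \<noteq> \<zero>}" using dzc by (simp add: fsm_carrier)
  ultimately obtain m where "\<forall>s\<in>{s. d i z s \<noteq> \<zero>}. \<exists>b\<in>carrier A. q (d i z s) = q (f m) \<otimes>\<^bsub>Q\<^esub> q b" by blast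
  then have "\<forall>s. \<exists>b. d i z s \<noteq> \<zero> \<longrightarrow> b \<in> carrier A \<and> q (d i z s) = q (f m) \<otimes>\<^bsub>Q\<^esub> q b" by blast
  then obtain b where b: "\<And>s. d i z s \<noteq> \<zero> \<Longrightarrow> b s \<in> carrier A \<and> q (d i z s) = q (f m) \<otimes>\<^bsub>Q\<^esub> q (b s)"
    by metis
  define y where "y s = (if d i z s = \<zero> then \<zero> else b s)" for s
  have y: "y \<in> carrier (fsm A (S i))"
  proof -
    have "finite {s. y s \<noteq> \<zero>}" by (rule finite_subset[OF _ fin]) (auto simp: y_def)
    then show ?thesis using b dzc by (simp add: fsm_carrier y_def)
  qed
  have yq: "q (d i z s) = q (f m) \<otimes>\<^bsub>Q\<^esub> q (y s)" for s
    using b[of s] f_closed by (simp add: y_def)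
  let ?g = "f (Suc m)"
  let ?c = "?g [^] (p - 1)"
  have gc: "?g \<in> carrier A" "?c \<in> carrier A" using f_closed by auto
  \<comment> \<open>The image of y at the next level of the direct system: with \<open>?g\<close>
    the root of \<open>f m\<close>, the product of \<open>f m\<close> and y equals \<open>?g\<close>
    times y' modulo I.\<close>
  define y' where "y' = (\<lambda>s. ?c \<otimes> y s)"
  have y': "y' \<in> carrier (fsm A (S i))" unfolding y'_def by (rule sc0[OF gc(2) y])
  have qg: "q (f m) = q ?g \<otimes>\<^bsub>Q\<^esub> q ?c"
  proof -
    have "p = Suc (p - 1)" using p_gt_1 by simp
    then show ?thesis
      using q_root[of m] q.S.nat_pow_Suc2[OF q_closed[OF gc(1)], of "p - 1"] gc by simp
  qed
  \<comment> \<open>From ddz = 0 it follows that \<open>f m\<close> kills dy modulo I, hence so does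
    \<open>?g\<close>, and since p - 1 is positive so does \<open>?c\<close>. This is why y has to
    be moved up one level before exactness is used.\<close>
  have cyc: "d j y' s \<in> I" if j: "i = Suc j" for j s
  proof -
    have zz: "z \<in> carrier (fsm A (S (Suc (Suc j))))" and dzc': "d i z \<in> carrier (fsm A (S (Suc j)))"
      and y1: "y \<in> carrier (fsm A (S (Suc j)))"
      using z dzc y j by simp_all
    have fy: "(\<lambda>s. f m \<otimes> y s) \<in> carrier (fsm A (S (Suc j)))" by (rule sc(1)[OF f_closed y1])
    have "d i z t \<ominus> f m \<otimes> y t \<in> I" for t
      using q_eq_iff[of "d i z t" "f m \<otimes> y t"] yq[of t] dzn nth[OF y] f_closed by simp
    then have "d j (\<lambda>t. d i z t \<ominus> f m \<otimes> y t) s \<in> I"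
      by (intro dI dm(2)[OF dzc' fy])
    then have "d j (d i z) s \<ominus> f m \<otimes> d j y s \<in> I"
      unfolding dm(1)[OF dzc' fy] sc(2)[OF f_closed y1] .
    moreover have "d j (d i z) s = \<zero>"
      using boundary_boundary[OF mA zz[unfolded S_def]] by (simp add: d_def j)
    moreover have dy: "d j y s \<in> carrier A" by (rule nth[OF linear_mapD(1)[OF dl y1]])
    ultimately have "q \<zero> = q (f m \<otimes> d j y s)" using q_eq_iff[of \<zero> "f m \<otimes> d j y s"] f_closed by simp
    then have "f m \<otimes> d j y s \<in> I" using q_eq_0_iff[of "f m \<otimes> d j y s"] dy f_closed by simp
    then have t: "?g \<otimes> d j y s \<in> I" by (rule tors[OF dy])
    have "p - 1 = Suc (p - 2)" using p_gt_1 by simp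
    then have "?c = ?g [^] (p - 2) \<otimes> ?g" by simp
    then have "?c \<otimes> d j y s = ?g [^] (p - 2) \<otimes> (?g \<otimes> d j y s)" using gc dy by (simp add: m_assoc)
    then show ?thesis unfolding y'_def sc(2)[OF gc(2) y1] using I.I_l_closed[OF t] gc by simp
  qed
  obtain w where w: "w \<in> carrier (fsm A (S (Suc i)))" "\<And>s. y' s \<ominus> d i w s \<in> I"
    using ex(1)[unfolded exact_mod_def, rule_format, of y'] y' cyc unfolding S_def d_def by blast
  have gw: "(\<lambda>t. ?g \<otimes> w t) \<in> carrier (fsm A (S (Suc i)))" by (rule sc(1)[OF gc(1) w(1)])
  \<comment> \<open>Exactness in degree i gives y' = dw, so dz and d(\<open>?g\<close> w) agree
    modulo I. Subtracting the correction, which lies in the root ideal, turns z into a cycle modulo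
    I, and exactness in degree i + 1 applies.\<close>
  define z' where "z' = (\<lambda>t. z t \<ominus> ?g \<otimes> w t)"
  have z': "z' \<in> carrier (fsm A (S (Suc i)))" unfolding z'_def by (rule dm(2)[OF z gw])
  have dw: "d i w s \<in> carrier A" for s by (rule nth[OF linear_mapD(1)[OF dl w(1)]])
  have "d i z' s \<in> I" for s
  proof -
    have "d i z' s = d i z s \<ominus> ?g \<otimes> d i w s" unfolding z'_def dm(1)[OF z gw] sc(2)[OF gc(1) w(1)] ..
    moreover have "q (d i z s) = q (?g \<otimes> d i w s)"
    proof -
      have "q (y' s) = q (d i w s)" using w(2)[of s] q_eq_iff[of "y' s" "d i w s"] nth[OF y'] dw by simp
      then have "q (?g \<otimes> d i w s) = q ?g \<otimes>\<^bsub>Q\<^esub> (q ?c \<otimes>\<^bsub>Q\<^esub> q (y s))"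
        using gc dw nth[OF y] by (simp add: y'_def del: q.hom_pow)
      also have "\<dots> = q (d i z s)" unfolding yq qg
        by (rule q.S.m_assoc[symmetric]) (use q_closed gc nth[OF y] in blast)+
      finally show ?thesis by simp
    qed
    ultimately show ?thesis using q_eq_iff[of "d i z s" "?g \<otimes> d i w s"] dzn gc dw by simp
  qed
  then obtain w' where w': "w' \<in> carrier (fsm A (S (Suc (Suc i))))" "\<And>s. z' s \<ominus> d (Suc i) w' s \<in> I"
    using ex(2)[unfolded exact_mod_def, rule_format, of z'] z' unfolding S_def d_def by blast
  have "z s \<ominus> d (Suc i) w' s \<in> J" for s
  proof -
    have c: "z s \<in> carrier A" "w s \<in> carrier A" "d (Suc i) w' s \<in> carrier A" "z' s \<in> carrier A"
      using nth[OF z] nth[OF w(1)] nth[OF linear_mapD(1)[OF dl w'(1)]] nth[OF z'] by auto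
    have "(z s \<ominus> d (Suc i) w' s) \<ominus> ?g \<otimes> w s = z' s \<ominus> d (Suc i) w' s"
      using c gc by (simp add: z'_def minus_eq a_ac)
    then have "(z s \<ominus> d (Suc i) w' s) \<ominus> ?g \<otimes> w s \<in> I" using w'(2)[of s] by simp
    then show ?thesis unfolding root_ideal_def using c minus_closed[OF c(1,3)] by blast
  qed
  then show "\<exists>w\<in>carrier (fsm A (res_gens R M (Suc (Suc i)))). \<forall>s. z s \<ominus> boundary R M A (Suc i) w s \<in> J"
    using w'(1) unfolding S_def d_def by blast
qed

section \<open>Perfect quotients\<close>

lemma (in p_base) quotient_char_p:
  assumes I: "ideal I A" and pI: "\<pi> \<in> I"
  shows "char_p_ring (A Quot I) p"
proof -
  interpret I: ideal I A by (rule I)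
  interpret q: ring_hom_cring A "A Quot I" "\<lambda>a. I +> a" by (rule I.rcos_ring_hom_cring[OF cring_axioms])
  have k: "I +> ([k] \<cdot> \<one>) = [k] \<cdot>\<^bsub>A Quot I\<^esub> \<one>\<^bsub>A Quot I\<^esub>" for k :: nat
    by (induction k) auto
  have "I +> \<pi> = \<zero>\<^bsub>A Quot I\<^esub>"
    using quotient_eq_iff_same_a_r_cos[OF I, of \<pi> \<zero>] pI by (simp add: minus_eq)
  then have "[p] \<cdot>\<^bsub>A Quot I\<^esub> \<one>\<^bsub>A Quot I\<^esub> = \<zero>\<^bsub>A Quot I\<^esub>" using k[of p] by (simp add: p_elem_def)
  then show ?thesis
    by (intro char_p_ring.intro char_p_ring_axioms.intro p_prime I.quotient_is_cring[OF cring_axioms])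
qed

locale semiperfect_over = p_base +
  fixes K :: "'a set"
  assumes frobenius_surj: "(\<lambda>x. x [^]\<^bsub>mod_p p A\<^esub> p) ` carrier (mod_p p A) = carrier (mod_p p A)"
    and K: "ideal K A" "p_elem p A \<in> K"
begin

text \<open>The p-power radical of K; it is an ideal because Frobenius is additive on A/K. Adjoining
  roots leads out of K but not out of this radical, which contains 1 only if K does.\<close>

definition rad_K :: "'a set" where
  "rad_K = {a \<in> carrier A. \<exists>k. a [^] (p ^ k) \<in> K}"

lemma rad_K_ideal: "ideal rad_K A"
proof -
  interpret K: ideal K A by (rule K(1))
  interpret Q: char_p_ring "A Quot K" p by (rule quotient_char_p[OF K])
  interpret q: ring_hom_cring A "A Quot K" "\<lambda>a. K +> a" by (rule K.rcos_ring_hom_cring[OF cring_axioms])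
  have fresh: "(x \<oplus>\<^bsub>A Quot K\<^esub> y) [^]\<^bsub>A Quot K\<^esub> (p ^ k) = x [^]\<^bsub>A Quot K\<^esub> (p ^ k) \<oplus>\<^bsub>A Quot K\<^esub> y [^]\<^bsub>A Quot K\<^esub> (p ^ k)"
    if "x \<in> carrier (A Quot K)" "y \<in> carrier (A Quot K)" for x y k
  proof (induction k)
    case (Suc k)
    have e: "u [^]\<^bsub>A Quot K\<^esub> (p ^ Suc k) = (u [^]\<^bsub>A Quot K\<^esub> (p ^ k)) [^]\<^bsub>A Quot K\<^esub> p" if "u \<in> carrier (A Quot K)" for u
      using that by (simp add: Q.nat_pow_pow mult.commute)
    show ?case using that by (simp only: e Q.a_closed Suc Q.freshman Q.nat_pow_closed)
  qed (use that in simp)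
  have q0: "a \<in> K \<longleftrightarrow> K +> a = \<zero>\<^bsub>A Quot K\<^esub>" if "a \<in> carrier A" for a
    using quotient_eq_iff_same_a_r_cos[OF K(1) that zero_closed] that by (simp add: minus_eq)
  have mono: "a [^] (p ^ (k + j)) \<in> K" if a: "a \<in> carrier A" "a [^] (p ^ k) \<in> K" for a k j
  proof (induction j)
    case (Suc j)
    have "a [^] (p ^ (k + Suc j)) = (a [^] (p ^ (k + j))) [^] p" using a by (simp add: nat_pow_pow mult.commute)
    also have "\<dots> = a [^] (p ^ (k + j)) \<otimes> (a [^] (p ^ (k + j))) [^] (p - 1)"
      by (rule nat_pow_pred) (use a p_pos in auto)
    also have "\<dots> \<in> K" by (rule K.I_r_closed[OF Suc]) (use a in simp)
    finally show ?case .
  qed (use a in simp)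
  have add: "a \<oplus> b \<in> rad_K" if ab: "a \<in> rad_K" "b \<in> rad_K" for a b
  proof -
    obtain k k' where k: "a \<in> carrier A" "b \<in> carrier A" "a [^] (p ^ k) \<in> K" "b [^] (p ^ k') \<in> K"
      using ab unfolding rad_K_def by blast
    have "a [^] (p ^ (k + k')) \<in> K" "b [^] (p ^ (k + k')) \<in> K"
      using mono[OF k(1,3), of k'] mono[OF k(2,4), of k] by (simp_all add: add.commute)
    then have "(K +> a) [^]\<^bsub>A Quot K\<^esub> (p ^ (k + k')) = \<zero>\<^bsub>A Quot K\<^esub>" "(K +> b) [^]\<^bsub>A Quot K\<^esub> (p ^ (k + k')) = \<zero>\<^bsub>A Quot K\<^esub>"
      using q0[of "a [^] (p ^ (k + k'))"] q0[of "b [^] (p ^ (k + k'))"] k(1,2) by simp_all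
    then have "K +> ((a \<oplus> b) [^] (p ^ (k + k'))) = \<zero>\<^bsub>A Quot K\<^esub>" using k(1,2) by (simp add: fresh)
    then have "(a \<oplus> b) [^] (p ^ (k + k')) \<in> K" using q0[of "(a \<oplus> b) [^] (p ^ (k + k'))"] k(1,2) by simp
    then show ?thesis unfolding rad_K_def using k(1,2) by blast
  qed
  have mult: "x \<otimes> a \<in> rad_K" if a: "a \<in> rad_K" and x: "x \<in> carrier A" for a x
  proof -
    obtain k where k: "a \<in> carrier A" "a [^] (p ^ k) \<in> K" using a unfolding rad_K_def by blast
    have "(x \<otimes> a) [^] (p ^ k) = x [^] (p ^ k) \<otimes> a [^] (p ^ k)" using x k by (simp add: nat_pow_distrib)
    also have "\<dots> \<in> K" by (rule K.I_l_closed[OF k(2)]) (use x in simp)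
    finally show ?thesis unfolding rad_K_def using x k(1) by blast
  qed
  have sub: "rad_K \<subseteq> carrier A" unfolding rad_K_def by blast
  show ?thesis
  proof (rule idealI[OF ring_axioms])
    show "subgroup rad_K (add_monoid A)"
    proof (rule add.subgroupI[OF sub])
      have "\<zero> [^] (p ^ 0) \<in> K" using K.zero_closed by simp
      then show "rad_K \<noteq> {}" unfolding rad_K_def by blast
      show "\<ominus> a \<in> rad_K" if "a \<in> rad_K" for a
        using mult[OF that, of "\<ominus> \<one>"] sub that by (auto simp: l_minus)
    qed (rule add)
    show "x \<otimes> a \<in> rad_K" if "a \<in> rad_K" "x \<in> carrier A" for a x by (rule mult[OF that])
    show "a \<otimes> x \<in> rad_K" if "a \<in> rad_K" "x \<in> carrier A" for a x
      using mult[OF that] m_comm[of a x] sub that by auto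
  qed
qed

lemma rad_K_superset: "K \<subseteq> rad_K"
proof
  interpret K: ideal K A by (rule K(1))
  fix a assume "a \<in> K"
  moreover from this have "a [^] (p ^ 0) \<in> K" using K.Icarr by simp
  ultimately show "a \<in> rad_K" unfolding rad_K_def using K.Icarr by blast
qed

lemma rad_K_radical:
  assumes a: "a \<in> carrier A" "a [^] p \<in> rad_K" shows "a \<in> rad_K"
proof -
  obtain k where "(a [^] p) [^] (p ^ k) \<in> K" using a(2) unfolding rad_K_def by blast
  then have "a [^] (p ^ Suc k) \<in> K" using a(1) by (simp add: nat_pow_pow)
  then show ?thesis unfolding rad_K_def using a(1) by blast
qed

lemma one_in_rad_K: "\<one> \<in> rad_K \<Longrightarrow> \<one> \<in> K"
  unfolding rad_K_def by (auto simp: nat_pow_one)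

text \<open>A/I is a perfect ring of characteristic p: surjectivity of Frobenius is inherited from
  A/p, and injectivity is the condition on p-th powers. Containment in \<open>rad_K\<close> keeps
  the quotient nonzero when K is proper.\<close>

definition perfect_ideal :: "'a set \<Rightarrow> bool" where
  "perfect_ideal I \<longleftrightarrow> ideal I A \<and> \<pi> \<in> I \<and> (\<forall>a\<in>carrier A. a [^] p \<in> I \<longrightarrow> a \<in> I) \<and> I \<subseteq> rad_K"

lemma p_root_mod:
  assumes a: "a \<in> carrier A" and I: "ideal I A" "\<pi> \<in> I"
  shows "\<exists>b\<in>carrier A. b [^] p \<ominus> a \<in> I"
proof -
  interpret h: ring_hom_cring A Ap cls by (rule ring_hom_cls)
  have "cls a \<in> (\<lambda>x. x [^]\<^bsub>Ap\<^esub> p) ` carrier Ap" unfolding frobenius_surj using a by simp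
  then obtain b where b: "b \<in> carrier A" "cls a = (cls b) [^]\<^bsub>Ap\<^esub> p" unfolding mod_p_carrier by blast
  then have "cls (b [^] p) = cls a" by simp
  then have "b [^] p \<ominus> a \<in> PIdl \<pi>" using cls_eq[of "b [^] p" a] a b(1) by (simp add: pcong_def p_ideal_1)
  then show ?thesis using b(1) cgenideal_minimal[OF I] by blast
qed

text \<open>The roots of x are chosen modulo I one after another. In the reduced ring A/I, f_m a = 0
  makes the p-th power of f_(m+1) a vanish, hence f_(m+1) a itself. If a^p = f_m b and c^p = b, then
  a = f_(m+1) c by injectivity of Frobenius, so the quotient is perfect again.\<close>

lemma perfect_ideal_adjoin_roots:
  assumes I: "perfect_ideal I" and x: "x \<in> rad_K"
  shows "\<exists>f. compatible_roots A I p f \<and> (\<forall>m. \<forall>a\<in>carrier A. f m \<otimes> a \<in> I \<longrightarrow> f (Suc m) \<otimes> a \<in> I) \<and>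
    perfect_ideal (root_ideal A I f) \<and> x \<in> root_ideal A I f"
proof -
  have I': "ideal I A" "\<pi> \<in> I" "\<And>a. a \<in> carrier A \<Longrightarrow> a [^] p \<in> I \<Longrightarrow> a \<in> I" "I \<subseteq> rad_K"
    using I by (auto simp: perfect_ideal_def)
  interpret I: ideal I A by (rule I'(1))
  obtain r where r: "\<And>a. a \<in> carrier A \<Longrightarrow> r a \<in> carrier A \<and> r a [^] p \<ominus> a \<in> I"
    using p_root_mod[OF _ I'(1,2)] by metis
  define f where "f m = (r ^^ m) x" for m
  have xc: "x \<in> carrier A" using x unfolding rad_K_def by blast
  have fc: "f m \<in> carrier A" for m unfolding f_def by (induction m) (use r xc in auto)
  have f0: "f 0 = x" by (simp add: f_def)
  have p1: "p > 1" using p_prime prime_gt_1_nat by blast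
  interpret C: compatible_roots A I p f
    by unfold_locales (use p1 fc r in \<open>auto simp: f_def\<close>)
  interpret Q: char_p_ring "A Quot I" p by (rule quotient_char_p[OF I'(1,2)])
  interpret q: ring_hom_cring A "A Quot I" "\<lambda>a. I +> a" by (rule C.q_hom)
  have pw: "(f (Suc m) \<otimes> a) [^] p \<in> I" if a: "a \<in> carrier A" "f m \<otimes> a \<in> I" for m a
  proof -
    have z: "I +> (f m \<otimes> a) = \<zero>\<^bsub>A Quot I\<^esub>" using C.q_eq_0_iff[of "f m \<otimes> a"] a fc by simp
    have "a [^] p = a \<otimes> a [^] (p - 1)" by (rule nat_pow_pred[OF a(1) p_pos])
    then have "I +> ((f (Suc m) \<otimes> a) [^] p) = (I +> (f m \<otimes> a)) \<otimes>\<^bsub>A Quot I\<^esub> (I +> (a [^] (p - 1)))"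
      using a(1) fc C.q_root[of m, symmetric] by (simp add: nat_pow_distrib Q.m_assoc)
    also have "\<dots> = \<zero>\<^bsub>A Quot I\<^esub>" unfolding z using a(1) by simp
    finally show ?thesis using C.q_eq_0_iff[of "(f (Suc m) \<otimes> a) [^] p"] a(1) fc by simp
  qed
  then have tors: "f (Suc m) \<otimes> a \<in> I" if "a \<in> carrier A" "f m \<otimes> a \<in> I" for m a
    using I'(3)[of "f (Suc m) \<otimes> a"] that fc by simp
  have rad: "a \<in> root_ideal A I f" if a: "a \<in> carrier A" "a [^] p \<in> root_ideal A I f" for a
  proof -
    obtain m b where b: "b \<in> carrier A" "I +> (a [^] p) = (I +> f m) \<otimes>\<^bsub>A Quot I\<^esub> (I +> b)"
      using a(2) unfolding C.root_ideal_iff by blast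
    obtain c where c: "c \<in> carrier A" "c [^] p \<ominus> b \<in> I" using p_root_mod[OF b(1) I'(1,2)] by blast
    have "I +> (c [^] p) = I +> b" using C.q_eq_iff[of "c [^] p" b] c b(1) by simp
    let ?u = "f (Suc m) \<otimes> c"
    have u: "?u \<in> carrier A" using fc c(1) by simp
    have "I +> (a [^] p) = I +> (?u [^] p)"
      using b(2) \<open>I +> (c [^] p) = I +> b\<close> C.q_root[of m] fc c(1) by (simp add: nat_pow_distrib)
    moreover have "I +> (a [^] p) = (I +> ((a \<ominus> ?u) [^] p)) \<oplus>\<^bsub>A Quot I\<^esub> (I +> (?u [^] p))"
    proof -
      have eq: "(a \<ominus> ?u) \<oplus> ?u = a" using a(1) u by (simp add: minus_eq a_assoc l_neg)
      have "I +> a = (I +> (a \<ominus> ?u)) \<oplus>\<^bsub>A Quot I\<^esub> (I +> ?u)"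
        using q.hom_add[OF minus_closed[OF a(1) u] u] unfolding eq .
      then have "I +> (a [^] p) = ((I +> (a \<ominus> ?u)) \<oplus>\<^bsub>A Quot I\<^esub> (I +> ?u)) [^]\<^bsub>A Quot I\<^esub> p"
        using q.hom_pow[OF a(1), of p] by simp
      also have "\<dots> = (I +> (a \<ominus> ?u)) [^]\<^bsub>A Quot I\<^esub> p \<oplus>\<^bsub>A Quot I\<^esub> (I +> ?u) [^]\<^bsub>A Quot I\<^esub> p"
        by (rule Q.freshman) (use C.q_closed a(1) u in auto)
      also have "\<dots> = (I +> ((a \<ominus> ?u) [^] p)) \<oplus>\<^bsub>A Quot I\<^esub> (I +> (?u [^] p))"
        using a(1) u q.hom_pow[of "a \<ominus> ?u" p] q.hom_pow[of ?u p] by simp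
      finally show ?thesis .
    qed
    ultimately have "(I +> ((a \<ominus> ?u) [^] p)) \<oplus>\<^bsub>A Quot I\<^esub> (I +> (?u [^] p)) = I +> (?u [^] p)"
      by argo
    moreover have "I +> ((a \<ominus> ?u) [^] p) \<in> carrier (A Quot I)" "I +> (?u [^] p) \<in> carrier (A Quot I)"
      by (rule C.q_closed; use a(1) u in simp)+
    ultimately have "I +> ((a \<ominus> ?u) [^] p) = \<zero>\<^bsub>A Quot I\<^esub>"
      using Q.add.r_cancel_one by blast
    then have "(a \<ominus> ?u) [^] p \<in> I"
      using iffD2[OF C.q_eq_0_iff[OF nat_pow_closed[OF minus_closed[OF a(1) u]]]] by blast
    then have "a \<ominus> ?u \<in> I" by (rule I'(3)[OF minus_closed[OF a(1) u]])
    then show ?thesis unfolding root_ideal_def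
      by (intro CollectI conjI a(1) exI[of _ "Suc m"] bexI[OF _ c(1)])
  qed
  have "root_ideal A I f \<subseteq> rad_K"
    by (rule C.root_ideal_least[OF rad_K_ideal I'(4) x[folded f0] rad_K_radical])
  then have "perfect_ideal (root_ideal A I f)"
    unfolding perfect_ideal_def using C.root_ideal_ideal subsetD[OF C.root_ideal_superset I'(2)] rad by blast
  moreover have "x \<in> root_ideal A I f" using C.f_in_root_ideal[of 0] f0 by simp
  ultimately show ?thesis using C.compatible_roots_axioms tors by blast
qed

end

text \<open>Each element adjoined removes the lowest degree from the window of exactness, so a
  window of \<open>length xs + 1\<close> degrees leaves its top degree.\<close>

lemma exact_mod_adjoin_list:
  fixes A :: "('r, 'a) module" and R :: "('r, 'q) ring_scheme"
  assumes S: "semiperfect_over A p K" and alg: "algebra R A"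
  shows "semiperfect_over.perfect_ideal A p K I \<Longrightarrow> set xs \<subseteq> semiperfect_over.rad_K A p K \<Longrightarrow>
    \<exists>J. semiperfect_over.perfect_ideal A p K J \<and> set xs \<subseteq> J \<and> I \<subseteq> J \<and>
      (\<forall>s. (\<forall>i. s \<le> i \<and> i \<le> s + length xs \<longrightarrow> exact_mod R M A I i) \<longrightarrow> exact_mod R M A J (s + length xs))"
proof (induction xs arbitrary: I)
  case Nil
  then show ?case by (intro exI[of _ I]) auto
next
  case (Cons x xs)
  interpret semiperfect_over A p K by (rule S)
  obtain f where f: "compatible_roots A I p f" "\<And>m a. a \<in> carrier A \<Longrightarrow> f m \<otimes>\<^bsub>A\<^esub> a \<in> I \<Longrightarrow> f (Suc m) \<otimes>\<^bsub>A\<^esub> a \<in> I"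
    "perfect_ideal (root_ideal A I f)" "x \<in> root_ideal A I f"
    using perfect_ideal_adjoin_roots[OF Cons.prems(1), of x] Cons.prems(2) by auto
  let ?I = "root_ideal A I f"
  obtain J where J: "perfect_ideal J" "set xs \<subseteq> J" "?I \<subseteq> J"
    "\<And>s. (\<forall>i. s \<le> i \<and> i \<le> s + length xs \<longrightarrow> exact_mod R M A ?I i) \<Longrightarrow> exact_mod R M A J (s + length xs)"
    using Cons.IH[OF f(3)] Cons.prems(2) by auto
  have "exact_mod R M A J (s + length (x # xs))"
    if ex: "\<forall>i. s \<le> i \<and> i \<le> s + length (x # xs) \<longrightarrow> exact_mod R M A I i" for s
  proof -
    have "exact_mod R M A ?I i" if i: "Suc s \<le> i" "i \<le> Suc s + length xs" for i
    proof -
      obtain j where j: "i = Suc j" using i(1) by (cases i) auto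
      show ?thesis unfolding j by (rule exact_mod_root_ideal[OF alg f(1,2)]) (use ex i j in auto)
    qed
    then show ?thesis using J(4)[of "Suc s"] by simp
  qed
  moreover have "I \<subseteq> J" using compatible_roots.root_ideal_superset[OF f(1)] J(3) by blast
  ultimately show ?case using J(1,2,3) f(4) by (intro exI[of _ J]) auto
qed

section \<open>Descent to the residue field\<close>

text \<open>N/J is a complement of the line spanned by 1 in the vector space A/J over the residue
  field. Zorn gives N maximal over J without 1. For a outside N, maximality yields 1 = n + ra; here
  r is not in \<mm>, since \<mm>A lies in J, so r is a unit and the equation can be solved for
  a.\<close>

lemma exists_complement_submodule:
  fixes A :: "('r, 'a) module" (structure) and R :: "('r, 'q) ring_scheme"
  assumes alg: "algebra R A"
    and unit: "\<And>r. r \<in> carrier R \<Longrightarrow> r \<notin> \<mm> \<Longrightarrow> r \<in> Units R"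
    and J: "ideal J A" "\<one> \<notin> J" and mJ: "\<And>r. r \<in> \<mm> \<Longrightarrow> r \<odot> \<one> \<in> J"
  obtains N where "submodule N R A" "J \<subseteq> N" "\<one> \<notin> N"
    "\<And>a. a \<in> carrier A \<Longrightarrow> \<exists>n\<in>N. \<exists>r\<in>carrier R. a = n \<oplus> r \<odot> \<one>"
proof -
  interpret J: ideal J A by (rule J(1))
  interpret A: algebra R A by (rule alg)
  define \<A> where "\<A> = {H. submodule H R A \<and> J \<subseteq> H \<and> \<one> \<notin> H}"
  have JA: "J \<in> \<A>" using ideal_submodule[OF alg J(1)] J(2) by (simp add: \<A>_def)
  have "\<exists>N\<in>\<A>. \<forall>H\<in>\<A>. N \<subseteq> H \<longrightarrow> H = N"
  proof (rule subset_Zorn_nonempty)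
    show "\<A> \<noteq> {}" using JA by blast
    fix C assume C: "C \<noteq> {}" "subset.chain \<A> C"
    have CA: "submodule H R A" "J \<subseteq> H" "\<one> \<notin> H" if "H \<in> C" for H
      using C(2) that by (auto simp: subset.chain_def \<A>_def)
    obtain H0 where H0: "H0 \<in> C" using C(1) by blast
    have U: "\<exists>H\<in>C. a \<in> H" if "a \<in> \<Union>C" for a using that by (rule UnionE) (rule bexI)
    have "submodule (\<Union>C) R A"
    proof (rule A.submoduleI)
      show "\<Union>C \<subseteq> carrier A" by (rule Union_least) (rule A.submoduleE(1)[OF CA(1)])
      have "\<zero> \<in> H0" using subgroup.one_closed[OF submodule.axioms(1)[OF CA(1)[OF H0]]] by simp
      then show "\<zero> \<in> \<Union>C" using H0 by (rule UnionI[rotated])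
      fix a assume "a \<in> \<Union>C"
      then obtain H1 where H1: "H1 \<in> C" "a \<in> H1" using U by (metis (no_types))
      show "\<ominus> a \<in> \<Union>C" by (rule UnionI[OF H1(1) A.submoduleE(3)[OF CA(1)[OF H1(1)] H1(2)]])
      show "r \<odot> a \<in> \<Union>C" if "r \<in> carrier R" for r
        by (rule UnionI[OF H1(1) A.submoduleE(4)[OF CA(1)[OF H1(1)] that H1(2)]])
      fix b assume "b \<in> \<Union>C"
      then obtain H2 where H2: "H2 \<in> C" "b \<in> H2" using U by (metis (no_types))
      have "H1 \<subseteq> H2 \<or> H2 \<subseteq> H1" using C(2) H1(1) H2(1) unfolding subset.chain_def by blast
      then show "a \<oplus> b \<in> \<Union>C"
      proof
        assume "H1 \<subseteq> H2"
        then have "a \<in> H2" using H1(2) by (rule subsetD)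
        then show ?thesis by (rule UnionI[OF H2(1) A.submoduleE(5)[OF CA(1)[OF H2(1)] _ H2(2)]])
      next
        assume "H2 \<subseteq> H1"
        then have "b \<in> H1" using H2(2) by (rule subsetD)
        then show ?thesis by (rule UnionI[OF H1(1) A.submoduleE(5)[OF CA(1)[OF H1(1)] H1(2)]])
      qed
    qed
    moreover have "J \<subseteq> \<Union>C" by (rule order.trans[OF CA(2)[OF H0] Union_upper[OF H0]])
    moreover have "\<one> \<notin> \<Union>C" using CA(3) by (simp add: Union_iff)
    ultimately show "\<Union>C \<in> \<A>" by (simp add: \<A>_def)
  qed
  then obtain N where NA: "N \<in> \<A>" and max: "\<And>H. H \<in> \<A> \<Longrightarrow> N \<subseteq> H \<Longrightarrow> H = N" by blast
  have N: "submodule N R A" "J \<subseteq> N" "\<one> \<notin> N" using NA by (simp_all add: \<A>_def)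
  note N0 = subgroup.one_closed[OF submodule.axioms(1)[OF N(1)], simplified]
  note NE = A.submoduleE[OF N(1)]
  have Nc: "n \<in> carrier A" if "n \<in> N" for n using NE(1) that by blast
  have "\<exists>n\<in>N. \<exists>r\<in>carrier R. a = n \<oplus> r \<odot> \<one>" if a: "a \<in> carrier A" for a
  proof (cases "a \<in> N")
    case True
    have "a = a \<oplus> \<zero>\<^bsub>R\<^esub> \<odot> \<one>" using a by simp
    then show ?thesis using True by blast
  next
    case False
    define H where "H = {n \<oplus> r \<odot> a | n r. n \<in> N \<and> r \<in> carrier R}"
    have HI: "n \<oplus> r \<odot> a \<in> H" if "n \<in> N" "r \<in> carrier R" for n r using that unfolding H_def by blast
    have HE: "\<exists>n\<in>N. \<exists>r\<in>carrier R. h = n \<oplus> r \<odot> a" if "h \<in> H" for h using that unfolding H_def by blast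
    have "submodule H R A"
    proof (rule A.submoduleI)
      show "H \<subseteq> carrier A" unfolding H_def using a Nc by auto
      show "\<zero> \<in> H" using HI[OF N0 A.R.zero_closed] a by simp
      fix h assume "h \<in> H"
      then obtain n r where h: "n \<in> N" "r \<in> carrier R" "h = n \<oplus> r \<odot> a" using HE by blast
      show "\<ominus> h \<in> H"
        using HI[OF NE(3)[OF h(1)] A.R.a_inv_closed[OF h(2)]] h Nc a
        by (simp add: A.smult_l_minus J.minus_add)
      show "s \<odot> h \<in> H" if "s \<in> carrier R" for s
        using HI[OF NE(4)[OF that h(1)] A.R.m_closed[OF that h(2)]] h Nc a that
        by (simp add: A.smult_r_distr A.smult_assoc1)
      fix h' assume "h' \<in> H"
      then obtain n' r' where h': "n' \<in> N" "r' \<in> carrier R" "h' = n' \<oplus> r' \<odot> a" using HE by blast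
      show "h \<oplus> h' \<in> H"
        using HI[OF NE(5)[OF h(1) h'(1)] A.R.a_closed[OF h(2) h'(2)]] h h' Nc a
        by (simp add: A.smult_l_distr J.a_ac)
    qed
    moreover have NH: "N \<subseteq> H"
    proof
      fix n assume n: "n \<in> N"
      show "n \<in> H" using HI[OF n A.R.zero_closed] a Nc[OF n] by simp
    qed
    moreover have "a \<in> H" using HI[OF N0 A.R.one_closed] a by simp
    then have "H \<noteq> N" using False by blast
    ultimately have "\<one> \<in> H" using max[of H] N(2) unfolding \<A>_def by blast
    then obtain n r where nr: "n \<in> N" "r \<in> carrier R" "\<one> = n \<oplus> r \<odot> a" using HE by blast
    have "r \<notin> \<mm>"
    proof
      assume "r \<in> \<mm>"
      then have "(r \<odot> \<one>) \<otimes> a \<in> J" using J.I_r_closed[OF mJ a] by blast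
      then have "r \<odot> a \<in> N" using A.smult_assoc2[OF nr(2) J.one_closed a] a N(2) by auto
      then show False using NE(5)[OF nr(1), of "r \<odot> a"] nr(3) N(3) by simp
    qed
    then have u: "r \<in> Units R" using unit nr(2) by blast
    let ?i = "inv\<^bsub>R\<^esub> r"
    have i: "?i \<in> carrier R" "?i \<otimes>\<^bsub>R\<^esub> r = \<one>\<^bsub>R\<^esub>" using u by auto
    have "?i \<odot> \<one> = ?i \<odot> n \<oplus> a"
      using nr i a Nc[OF nr(1)] A.smult_r_distr[OF i(1), of n "r \<odot> a"] A.smult_assoc1[OF i(1) nr(2) a] by simp
    then have "a = \<ominus> (?i \<odot> n) \<oplus> ?i \<odot> \<one>"
      using i(1) a Nc[OF nr(1)] by (simp add: J.r_neg2 J.r_neg1)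
    moreover have "\<ominus> (?i \<odot> n) \<in> N" by (rule NE(3)[OF NE(4)[OF i(1) nr(1)]])
    ultimately show ?thesis using i(1) by blast
  qed
  then show ?thesis using that N by blast
qed

text \<open>A cycle over k is lifted to R and mapped to A, where it is a boundary modulo J. The
  bounding chain is projected along N to multiples of 1, which are scalars in R; the part in N has
  its boundary in N, and r 1 in N forces r in \<mm>. This is the splitting of k off A/J at the level
  of chains.\<close>

lemma is_zero_Tor_residue_field:
  fixes A :: "('r, 'a) module" (structure) and R :: "('r, 'q) ring_scheme"
  assumes alg: "algebra R A" and m: "ideal \<mm> R"
    and unit: "\<And>r. r \<in> carrier R \<Longrightarrow> r \<notin> \<mm> \<Longrightarrow> r \<in> Units R"
    and J: "ideal J A" "\<one> \<notin> J" and mJ: "\<And>r. r \<in> \<mm> \<Longrightarrow> r \<odot> \<one> \<in> J"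
    and ex: "exact_mod R M A J i"
  shows "is_zero_module (Tor i R (quot_module (regular_module R) \<mm>) M)"
proof -
  obtain N where N: "submodule N R A" "J \<subseteq> N" "\<one> \<notin> N"
    "\<And>a. a \<in> carrier A \<Longrightarrow> \<exists>n\<in>N. \<exists>r\<in>carrier R. a = n \<oplus> r \<odot> \<one>"
    using exists_complement_submodule[OF alg unit J mJ] by blast
  interpret J: ideal J A by (rule J(1))
  interpret A: algebra R A by (rule alg)
  interpret m: ideal \<mm> R by (rule m)
  note NE = A.submoduleE[OF N(1)]
  note N0 = subgroup.one_closed[OF submodule.axioms(1)[OF N(1)], simplified]
  let ?R = "regular_module R"
  have mR: "module R ?R" by (rule module_regular_module[OF A.R_cring])
  have mA: "module R A" by (rule A.module)
  interpret RR: module R ?R by (rule mR)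
  have cR: "carrier ?R = carrier R" and sR: "r \<odot>\<^bsub>?R\<^esub> x = r \<otimes>\<^bsub>R\<^esub> x" and zR: "\<zero>\<^bsub>?R\<^esub> = \<zero>\<^bsub>R\<^esub>"
    and aR: "x \<oplus>\<^bsub>?R\<^esub> y = x \<oplus>\<^bsub>R\<^esub> y" for r x y
    by (simp_all add: regular_module_def)
  have subm: "submodule \<mm> R ?R"
  proof (rule RR.submoduleI)
    have "\<ominus>\<^bsub>?R\<^esub> a = (\<ominus>\<^bsub>R\<^esub> \<one>\<^bsub>R\<^esub>) \<otimes>\<^bsub>R\<^esub> a" if "a \<in> carrier R" for a
      using RR.smult_l_minus[OF A.R.one_closed, of a] RR.smult_one[of a] that by (simp add: cR sR)
    then show "\<ominus>\<^bsub>?R\<^esub> a \<in> \<mm>" if "a \<in> \<mm>" for a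
      using m.I_l_closed[OF that, of "\<ominus>\<^bsub>R\<^esub> \<one>\<^bsub>R\<^esub>"] m.Icarr[OF that] by simp
  qed (use m.a_subset m.zero_closed m.a_closed m.I_l_closed in \<open>auto simp: cR sR zR aR\<close>)
  let ?k = "quot_module ?R \<mm>" and ?q = "\<lambda>r. \<mm> +>\<^bsub>?R\<^esub> r"
  have mk: "module R ?k" by (rule module_quot_module[OF mR subm])
  have ql: "linear_map R ?R ?k ?q" by (rule linear_map_quot[OF mR subm])
  interpret ab: abelian_subgroup \<mm> ?R by (rule abelian_subgroup_submodule[OF mR subm])
  have q0: "?q r = \<zero>\<^bsub>?k\<^esub> \<longleftrightarrow> r \<in> \<mm>" if "r \<in> carrier R" for r
    using ab.a_rcos_self[of r] ab.a_rcos_const[of r] that by (auto simp: quot_module_zero cR)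
  let ?h = "\<lambda>r. r \<odot> \<one>"
  have hl: "linear_map R ?R A ?h" by (rule linear_map_smult_vec[OF mA J.one_closed])
  have hN: "r \<in> \<mm>" if r: "r \<in> carrier R" "?h r \<in> N" for r
  proof (rule ccontr)
    assume "r \<notin> \<mm>"
    then have u: "r \<in> Units R" using unit r(1) by blast
    have "inv\<^bsub>R\<^esub> r \<odot> (r \<odot> \<one>) = \<one>"
      using u r(1) A.smult_assoc1[of "inv\<^bsub>R\<^esub> r" r \<one>] by simp
    then show False using NE(4)[OF A.R.Units_inv_closed[OF u] r(2)] N(3) by simp
  qed
  note gb = gen_boundary_closed[OF A.R_cring, of _ M]
  define S where "S = res_gens R M"
  have nat: "(\<lambda>t. g (z t)) \<in> carrier (fsm P (S (Suc n)))"
    "boundary R M P n (\<lambda>t. g (z t)) = (\<lambda>s. g (boundary R M ?R n z s))"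
    if "module R P" "linear_map R ?R P g" "z \<in> carrier (fsm ?R (S (Suc n)))"
    for P :: "('r, 'p) module" and g z n
    unfolding S_def
    using mat_map_natural[where D = "gen_boundary R", OF mR that(1,2) gb that(3)[unfolded S_def]] by blast+
  have "exact_mod R M ?k {\<zero>\<^bsub>?k\<^esub>} i"
    unfolding exact_mod_def
  proof (intro ballI impI)
    fix zk assume "zk \<in> carrier (fsm ?k (res_gens R M i))"
      and cyc: "\<forall>j. i = Suc j \<longrightarrow> (\<forall>s. boundary R M ?k j zk s \<in> {\<zero>\<^bsub>?k\<^esub>})"
    then have zk: "zk \<in> carrier (fsm ?k (S i))" by (simp add: S_def)
    have "\<exists>r\<in>carrier R. zk s = ?q r" for s
      using fsm_nth[OF mk zk, of s] by (auto simp: quot_module_carrier cR)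
    then obtain l where l: "\<And>s. l s \<in> carrier R" "\<And>s. zk s = ?q (l s)" by metis
    \<comment> \<open>Lifts of zero are set to zero so that z keeps finite support; the same device
      defines w below.\<close>
    define z where "z s = (if zk s = \<zero>\<^bsub>?k\<^esub> then \<zero>\<^bsub>R\<^esub> else l s)" for s
    have zq: "zk = (\<lambda>s. ?q (z s))"
    proof
      show "zk s = ?q (z s)" for s
        using l(2)[of s] q0[of "\<zero>\<^bsub>R\<^esub>"] m.zero_closed by (cases "zk s = \<zero>\<^bsub>?k\<^esub>") (simp_all add: z_def)
    qed
    have zc: "z s \<in> carrier R" for s using l(1) by (simp add: z_def)
    have z: "z \<in> carrier (fsm ?R (S i))"
    proof -
      have "finite {s. zk s \<noteq> \<zero>\<^bsub>?k\<^esub>}" using zk by (simp add: fsm_carrier)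
      then have "finite {s. z s \<noteq> \<zero>\<^bsub>R\<^esub>}" by (rule finite_subset[rotated]) (auto simp: z_def)
      then show ?thesis using zk zc by (simp add: fsm_carrier cR zR z_def)
    qed
    define zA where "zA = (\<lambda>s. ?h (z s))"
    have zA: "zA \<in> carrier (fsm A (S i))"
      unfolding zA_def using linear_mapD(1)[OF linear_map_fsm_map[OF mR mA hl] z] .
    have cycA: "boundary R M A j zA s \<in> J" if j: "i = Suc j" for j s
    proof -
      have zj: "z \<in> carrier (fsm ?R (S (Suc j)))" using z j by simp
      have bl: "linear_map R (fsm ?R (S (Suc j))) (fsm ?R (S j)) (boundary R M ?R j)"
        unfolding S_def by (rule boundary_linear[OF mR])
      have bc: "boundary R M ?R j z s \<in> carrier R"
        using fsm_nth[OF mR linear_mapD(1)[OF bl zj], of s] by (simp add: cR)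
      have "boundary R M ?k j zk s = \<zero>\<^bsub>?k\<^esub>" using cyc j by blast
      then have "?q (boundary R M ?R j z s) = \<zero>\<^bsub>?k\<^esub>" unfolding zq nat(2)[OF mk ql zj] .
      then have "boundary R M ?R j z s \<in> \<mm>" using q0[OF bc] by blast
      then show ?thesis unfolding zA_def nat(2)[OF mA hl zj] by (rule mJ)
    qed
    obtain wA where wA: "wA \<in> carrier (fsm A (S (Suc i)))" "\<And>s. zA s \<ominus> boundary R M A i wA s \<in> J"
      using ex[unfolded exact_mod_def, rule_format, of zA] zA cycA unfolding S_def by blast
    have "\<exists>r\<in>carrier R. \<exists>n\<in>N. wA t = n \<oplus> ?h r" for t
      using N(4)[OF fsm_nth[OF mA wA(1), of t]] by blast
    then obtain \<rho> n where \<rho>: "\<And>t. \<rho> t \<in> carrier R" "\<And>t. n t \<in> N" "\<And>t. wA t = n t \<oplus> ?h (\<rho> t)" by metis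
    define w where "w t = (if wA t = \<zero> then \<zero>\<^bsub>R\<^esub> else \<rho> t)" for t
    have wc: "w t \<in> carrier R" for t using \<rho>(1) by (simp add: w_def)
    have w: "w \<in> carrier (fsm ?R (S (Suc i)))"
    proof -
      have "finite {s. wA s \<noteq> \<zero>}" using wA(1) by (simp add: fsm_carrier)
      then have "finite {s. w s \<noteq> \<zero>\<^bsub>R\<^esub>}" by (rule finite_subset[rotated]) (auto simp: w_def)
      then show ?thesis using wA(1) wc by (simp add: fsm_carrier cR zR w_def)
    qed
    have hw: "(\<lambda>t. ?h (w t)) \<in> carrier (fsm A (S (Suc i)))" by (rule nat(1)[OF mA hl w])
    define v where "v = (\<lambda>t. wA t \<ominus> ?h (w t))"
    interpret F: module R "fsm A (S (Suc i))" by (rule module_fsm[OF mA])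
    have v: "v \<in> carrier (fsm A (S (Suc i)))"
      using F.minus_closed[OF wA(1) hw] unfolding fsm_minus[OF mA wA(1) hw] v_def .
    have vN: "v t \<in> N" for t
    proof (cases "wA t = \<zero>")
      case True
      then show ?thesis using N0 by (simp add: v_def w_def J.minus_eq)
    next
      case False
      have nc: "n t \<in> carrier A" using \<rho>(2) NE(1) by blast
      have "v t = n t"
        using False \<rho>(3)[of t] nc \<rho>(1)[of t] by (simp add: v_def w_def J.minus_eq J.a_assoc J.r_neg)
      then show ?thesis using \<rho>(2) by simp
    qed
    have bl: "linear_map R (fsm A (S (Suc i))) (fsm A (S i)) (boundary R M A i)"
      unfolding S_def by (rule boundary_linear[OF mA])
    have blR: "linear_map R (fsm ?R (S (Suc i))) (fsm ?R (S i)) (boundary R M ?R i)"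
      unfolding S_def by (rule boundary_linear[OF mR])
    have bv: "boundary R M A i v s \<in> N" for s
      by (rule mat_map_in_submodule[OF mA N(1) gb v[unfolded S_def] vN])
    have bv_eq: "boundary R M A i v s = boundary R M A i wA s \<ominus> ?h (boundary R M ?R i w s)" for s
    proof -
      have "v = wA \<ominus>\<^bsub>fsm A (S (Suc i))\<^esub> (\<lambda>t. ?h (w t))" unfolding v_def fsm_minus[OF mA wA(1) hw] ..
      then have e: "boundary R M A i v = boundary R M A i wA \<ominus>\<^bsub>fsm A (S i)\<^esub> boundary R M A i (\<lambda>t. ?h (w t))"
        using linear_map_minus[OF module_fsm[OF mA] module_fsm[OF mA] bl wA(1) hw] by simp
      show ?thesis unfolding fun_cong[OF e]
        unfolding fsm_minus[OF mA linear_mapD(1)[OF bl wA(1)] linear_mapD(1)[OF bl hw]] unfolding nat(2)[OF mA hl w] ..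
    qed
    have bw: "boundary R M ?R i w s \<in> carrier R" for s
      using fsm_nth[OF mR linear_mapD(1)[OF blR w], of s] by (simp add: cR)
    \<comment> \<open>Times 1, this difference equals the error modulo J plus the boundary of the
      component v in N. Both lie in N, so \<open>hN\<close> applies.\<close>
    have zw: "z s \<ominus>\<^bsub>?R\<^esub> boundary R M ?R i w s \<in> \<mm>" for s
    proof (rule hN)
      have c: "z s \<in> carrier ?R" "boundary R M ?R i w s \<in> carrier ?R" using zc bw by (simp_all add: cR)
      show "z s \<ominus>\<^bsub>?R\<^esub> boundary R M ?R i w s \<in> carrier R" using RR.minus_closed[OF c] by (simp add: cR)
      have cA: "zA s \<in> carrier A" "boundary R M A i wA s \<in> carrier A" "?h (boundary R M ?R i w s) \<in> carrier A"
        using fsm_nth[OF mA zA] fsm_nth[OF mA linear_mapD(1)[OF bl wA(1)]] bw by auto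
      have "?h (z s \<ominus>\<^bsub>?R\<^esub> boundary R M ?R i w s) = zA s \<ominus> ?h (boundary R M ?R i w s)"
        unfolding zA_def by (rule linear_map_minus[OF mR mA hl c])
      also have "\<dots> = (zA s \<ominus> boundary R M A i wA s) \<oplus> boundary R M A i v s"
        unfolding bv_eq using cA by (simp add: J.minus_eq J.a_assoc J.r_neg1)
      also have "\<dots> \<in> N" using NE(5)[OF _ bv] wA(2) N(2) by blast
      finally show "?h (z s \<ominus>\<^bsub>?R\<^esub> boundary R M ?R i w s) \<in> N" .
    qed
    have "zk s \<ominus>\<^bsub>?k\<^esub> boundary R M ?k i (\<lambda>t. ?q (w t)) s \<in> {\<zero>\<^bsub>?k\<^esub>}" for s
    proof -
      have c: "z s \<in> carrier ?R" "boundary R M ?R i w s \<in> carrier ?R" using zc bw by (simp_all add: cR)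
      have "zk s \<ominus>\<^bsub>?k\<^esub> boundary R M ?k i (\<lambda>t. ?q (w t)) s = ?q (z s \<ominus>\<^bsub>?R\<^esub> boundary R M ?R i w s)"
        unfolding zq nat(2)[OF mk ql w] by (rule linear_map_minus[OF mR mk ql c, symmetric])
      also have "\<dots> = \<zero>\<^bsub>?k\<^esub>" using q0[OF m.Icarr[OF zw]] zw by blast
      finally show ?thesis by simp
    qed
    moreover have "(\<lambda>t. ?q (w t)) \<in> carrier (fsm ?k (res_gens R M (Suc i)))"
      using nat(1)[OF mk ql w] by (simp add: S_def)
    ultimately show "\<exists>w\<in>carrier (fsm ?k (res_gens R M (Suc i))). \<forall>s. zk s \<ominus>\<^bsub>?k\<^esub> boundary R M ?k i w s \<in> {\<zero>\<^bsub>?k\<^esub>}"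
      by blast
  qed
  then show ?thesis using is_zero_Tor_iff[OF mk] by blast
qed

text \<open>The first step, with I = 0. Here A itself need not be perfect, so torsion control and
  closure under p-th roots come from \<open>perfectoid_p_roots\<close>. The ideal contains p because
  \<open>om 0\<close> is a unit multiple of p.\<close>

lemma (in semiperfect_over) perfectoid_root_ideal:
  assumes perf: "perfectoid p A"
  shows "\<exists>om. compatible_roots A {\<zero>} p om \<and> (\<forall>m. \<forall>a\<in>carrier A. om m \<otimes> a \<in> {\<zero>} \<longrightarrow> om (Suc m) \<otimes> a \<in> {\<zero>}) \<and>
    perfect_ideal (root_ideal A {\<zero>} om)"
proof (rule perfectoid_p_roots[OF p_prime perf])
  interpret K: ideal K A by (rule K(1))
  fix om assume om: "\<And>m. om m \<in> carrier A" "\<And>m. om (Suc m) [^] p = om m"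
    "\<exists>v\<in>Units A. om 0 = \<pi> \<otimes> v"
    "\<And>m a. a \<in> carrier A \<Longrightarrow> om m \<otimes> a = \<zero> \<Longrightarrow> om (Suc m) \<otimes> a = \<zero>"
    "\<And>m a b. a \<in> carrier A \<Longrightarrow> b \<in> carrier A \<Longrightarrow> a [^] p = om m \<otimes> b \<Longrightarrow> \<exists>c\<in>carrier A. a = om (Suc m) \<otimes> c"
  have p1: "p > 1" using p_prime prime_gt_1_nat by blast
  interpret Z: ideal "{\<zero>}" A by (rule zeroideal)
  interpret C: compatible_roots A "{\<zero>}" p om
  proof unfold_locales
    show "om (Suc m) [^] p \<ominus> om m \<in> {\<zero>}" for m unfolding om(2) using om(1) by (simp add: minus_eq r_neg)
  qed (rule p1 om(1))+
  have J_iff: "a \<in> root_ideal A {\<zero>} om \<longleftrightarrow> (\<exists>m. \<exists>b\<in>carrier A. a = om m \<otimes> b)" for a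
  proof -
    have "a \<ominus> om m \<otimes> b \<in> {\<zero>} \<longleftrightarrow> a = om m \<otimes> b" if "a \<in> carrier A" "b \<in> carrier A" for a b m
      using that om(1) by simp
    moreover have "om m \<otimes> b \<in> carrier A" if "b \<in> carrier A" for m b using om(1) that by simp
    ultimately show ?thesis unfolding root_ideal_def by blast
  qed
  obtain v where v: "v \<in> Units A" "om 0 = \<pi> \<otimes> v" using om(3) by blast
  have "\<pi> = om 0 \<otimes> inv v" unfolding v(2) using v(1) by (simp add: m_assoc Units_closed)
  then have pJ: "\<pi> \<in> root_ideal A {\<zero>} om" unfolding J_iff using v(1) by blast
  have "om 0 \<in> K" unfolding v(2) by (rule K.I_r_closed[OF K(2)]) (use v(1) in auto)
  then have om0: "om 0 \<in> rad_K" by (rule subsetD[OF rad_K_superset])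
  have "{\<zero>} \<subseteq> rad_K" using subsetD[OF rad_K_superset K.zero_closed] by simp
  from C.root_ideal_least[OF rad_K_ideal this om0 rad_K_radical]
  have "root_ideal A {\<zero>} om \<subseteq> rad_K" .
  moreover have "a \<in> root_ideal A {\<zero>} om" if a: "a \<in> carrier A" "a [^] p \<in> root_ideal A {\<zero>} om" for a
  proof -
    obtain m b where b: "b \<in> carrier A" "a [^] p = om m \<otimes> b" using a(2) unfolding J_iff by blast
    from om(5)[OF a(1) b] show ?thesis unfolding J_iff by blast
  qed
  ultimately have "perfect_ideal (root_ideal A {\<zero>} om)"
    unfolding perfect_ideal_def using C.root_ideal_ideal pJ by blast
  moreover have "om (Suc m) \<otimes> a \<in> {\<zero>}" if "a \<in> carrier A" "om m \<otimes> a \<in> {\<zero>}" for m a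
    using om(4)[OF that(1), of m] that(2) by simp
  ultimately show ?thesis using C.compatible_roots_axioms by blast
qed

section \<open>The theorem\<close>

text \<open>If \<mm> contained both p and some j prime to p, a Bezout relation would put 1 into
  \<mm>.\<close>

lemma residue_field_char:
  assumes m: "maximalideal \<mm> R" and R: "cring R" and p: "Factorial_Ring.prime p"
    and pm: "[p] \<cdot>\<^bsub>R\<^esub> \<one>\<^bsub>R\<^esub> \<in> \<mm>"
  shows "[j] \<cdot>\<^bsub>R Quot \<mm>\<^esub> \<one>\<^bsub>R Quot \<mm>\<^esub> = \<zero>\<^bsub>R Quot \<mm>\<^esub> \<longleftrightarrow> p dvd (j :: nat)"
proof -
  interpret R: cring R by (rule R)
  interpret m: maximalideal \<mm> R by (rule m)
  interpret q: ring_hom_cring R "R Quot \<mm>" "\<lambda>a. \<mm> +>\<^bsub>R\<^esub> a" by (rule m.rcos_ring_hom_cring[OF R])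
  have k: "\<mm> +>\<^bsub>R\<^esub> ([k] \<cdot>\<^bsub>R\<^esub> \<one>\<^bsub>R\<^esub>) = [k] \<cdot>\<^bsub>R Quot \<mm>\<^esub> \<one>\<^bsub>R Quot \<mm>\<^esub>" for k :: nat
    by (induction k) auto
  have "[j] \<cdot>\<^bsub>R Quot \<mm>\<^esub> \<one>\<^bsub>R Quot \<mm>\<^esub> = \<zero>\<^bsub>R Quot \<mm>\<^esub> \<longleftrightarrow> [j] \<cdot>\<^bsub>R\<^esub> \<one>\<^bsub>R\<^esub> \<in> \<mm>"
    using R.quotient_eq_iff_same_a_r_cos[OF m.is_ideal, of "[j] \<cdot>\<^bsub>R\<^esub> \<one>\<^bsub>R\<^esub>" "\<zero>\<^bsub>R\<^esub>"] k[of j] by (simp add: R.minus_eq)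
  also have "\<dots> \<longleftrightarrow> p dvd j"
  proof
    define c where "c k = [k] \<cdot>\<^bsub>R\<^esub> \<one>\<^bsub>R\<^esub>" for k :: nat
    have cc: "c k \<in> carrier R" for k by (simp add: c_def)
    have mult: "c (a * b) = c b \<otimes>\<^bsub>R\<^esub> c a" for a b
    proof -
      have "c b \<otimes>\<^bsub>R\<^esub> c a = [b] \<cdot>\<^bsub>R\<^esub> (\<one>\<^bsub>R\<^esub> \<otimes>\<^bsub>R\<^esub> c a)"
        unfolding c_def[of b] by (rule R.add_pow_ldistr[OF R.one_closed cc])
      also have "\<dots> = [b] \<cdot>\<^bsub>R\<^esub> c a" using cc by simp
      also have "\<dots> = c (a * b)" unfolding c_def by (rule R.add.nat_pow_pow) simp
      finally show ?thesis by simp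
    qed
    have add1: "c (a + 1) = c a \<oplus>\<^bsub>R\<^esub> \<one>\<^bsub>R\<^esub>" for a by (simp add: c_def)
    show "[j] \<cdot>\<^bsub>R\<^esub> \<one>\<^bsub>R\<^esub> \<in> \<mm>" if pj: "p dvd j"
    proof -
      obtain b where "j = p * b" using pj by (rule dvdE)
      then have "j = b * p" by simp
      then have "c j \<in> \<mm>" using m.I_r_closed[OF pm[folded c_def] cc[of b]] mult[of b p] by simp
      then show ?thesis unfolding c_def .
    qed
    show "p dvd j" if jm: "[j] \<cdot>\<^bsub>R\<^esub> \<one>\<^bsub>R\<^esub> \<in> \<mm>"
    proof (rule ccontr)
      assume nd: "\<not> p dvd j"
      have "coprime p j" by (rule prime_imp_coprime[OF p nd])
      then have g: "gcd j p = 1" using coprime_imp_gcd_eq_1[of p j] by (simp add: gcd.commute)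
      have "j \<noteq> 0" using nd by (rule contrapos_nn) simp
      from bezout_nat[OF this, of p] obtain x y where xy: "j * x = p * y + 1" unfolding g by blast
      let ?u = "c (p * y)"
      have u: "?u \<in> \<mm>" using m.I_l_closed[OF pm[folded c_def] cc[of y]] mult[of p y] by simp
      have "c (j * x) \<in> \<mm>" using m.I_l_closed[OF jm[folded c_def] cc[of x]] mult[of j x] by simp
      then have "?u \<oplus>\<^bsub>R\<^esub> \<one>\<^bsub>R\<^esub> \<in> \<mm>" unfolding xy add1 .
      then have "\<ominus>\<^bsub>R\<^esub> ?u \<oplus>\<^bsub>R\<^esub> (?u \<oplus>\<^bsub>R\<^esub> \<one>\<^bsub>R\<^esub>) \<in> \<mm>" using m.a_closed m.a_inv_closed[OF u] by blast
      then have "\<one>\<^bsub>R\<^esub> \<in> \<mm>" using cc by (simp add: R.r_neg1)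
      then show False using m.one_imp_carrier m.I_notcarr by blast
    qed
  qed
  finally show ?thesis .
qed

theorem theorem4p1:
  fixes p n :: nat
    and R :: "'r ring" and \<mm> :: "'r set"
    and A :: "('r, 'a) module" and M :: "('r, 'm) module"
  assumes "Factorial_Ring.prime p"
    and "noetherian_ring R" and "local_ring R \<mm>"
    and "algebra R A"
    and "Idl\<^bsub>A\<^esub> ((\<lambda>r. r \<odot>\<^bsub>A\<^esub> \<one>\<^bsub>A\<^esub>) ` \<mm>) \<noteq> carrier A"
    and "perfectoid p A"
    and "krull_dim R = enat n"
    and "module R M"
  shows "(\<forall>j::nat. [j] \<cdot>\<^bsub>R Quot \<mm>\<^esub> \<one>\<^bsub>R Quot \<mm>\<^esub> = \<zero>\<^bsub>R Quot \<mm>\<^esub> \<longleftrightarrow> p dvd j)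
    \<and> (\<forall>s::nat. (\<forall>i. s \<le> i \<and> i \<le> s + n + 1 \<longrightarrow> is_zero_module (Tor i R A M))
          \<longrightarrow> is_zero_module (Tor (s + n + 1) R (quot_module (regular_module R) \<mm>) M))
    \<and> ((\<exists>N. \<forall>j\<ge>N. is_zero_module (Tor j R A M))
          \<longrightarrow> (\<exists>N. \<forall>j\<ge>N. is_zero_module (Tor j R (quot_module (regular_module R) \<mm>) M)))"
proof -
  note loc = assms(3) and alg = assms(4) and perf = assms(6)
  have cR: "cring R" using loc by (simp add: local_ring_def)
  interpret R: noetherian_cring R by (intro noetherian_cring.intro assms(2) cR)
  interpret m: maximalideal \<mm> R using loc by (simp add: local_ring_def)
  have cA: "cring A" using perf by (simp add: perfectoid_def)
  interpret AA: cring A by (rule cA)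
  interpret A: algebra R A by (rule alg)
  let ?h = "\<lambda>r. r \<odot>\<^bsub>A\<^esub> \<one>\<^bsub>A\<^esub>"
  let ?K = "Idl\<^bsub>A\<^esub> (?h ` \<mm>)"
  have hc: "?h r \<in> carrier A" if "r \<in> carrier R" for r using that by simp
  have hm: "?h ` \<mm> \<subseteq> carrier A" using hc m.Icarr by blast
  have K: "ideal ?K A" by (rule AA.genideal_ideal[OF hm])
  have hK: "?h r \<in> ?K" if "r \<in> \<mm>" for r using AA.genideal_self[OF hm] that by blast
  have h_mult: "?h (r \<otimes>\<^bsub>R\<^esub> s) = ?h r \<otimes>\<^bsub>A\<^esub> ?h s" if "r \<in> carrier R" "s \<in> carrier R" for r s
    using that A.smult_assoc2[of r "\<one>\<^bsub>A\<^esub>" "?h s"] by (simp add: A.smult_assoc1)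
  have h_hom: "?h \<in> ring_hom R A"
    by (rule ring_hom_memI) (auto simp: h_mult A.smult_l_distr)
  interpret h: ring_hom_cring R A ?h by (intro ring_hom_cringI cR cA h_hom)
  have hp: "?h ([k] \<cdot>\<^bsub>R\<^esub> \<one>\<^bsub>R\<^esub>) = [k] \<cdot>\<^bsub>A\<^esub> \<one>\<^bsub>A\<^esub>" for k :: nat
    by (induction k) auto
  interpret PA: p_complete_ring A p
    using perf assms(1) cA by (intro p_complete_ring.intro p_base.intro p_base_axioms.intro p_complete_ring_axioms.intro)
      (auto simp: perfectoid_def)
  \<comment> \<open>Otherwise p would be invertible in R and 1 would lie in every p^k A;
    separatedness of A would force 1 = 0, against \<mm>A being proper.\<close>
  have pm: "[p] \<cdot>\<^bsub>R\<^esub> \<one>\<^bsub>R\<^esub> \<in> \<mm>"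
  proof (rule ccontr)
    assume "[p] \<cdot>\<^bsub>R\<^esub> \<one>\<^bsub>R\<^esub> \<notin> \<mm>"
    then have "[p] \<cdot>\<^bsub>R\<^esub> \<one>\<^bsub>R\<^esub> \<in> Units R" using R.local_unit[OF loc] by simp
    then obtain u where u: "u \<in> carrier R" "([p] \<cdot>\<^bsub>R\<^esub> \<one>\<^bsub>R\<^esub>) \<otimes>\<^bsub>R\<^esub> u = \<one>\<^bsub>R\<^esub>"
      by (metis R.Units_inv_closed R.Units_r_inv)
    have pu: "p_elem p A \<otimes>\<^bsub>A\<^esub> ?h u = \<one>\<^bsub>A\<^esub>"
      using h_mult[of "[p] \<cdot>\<^bsub>R\<^esub> \<one>\<^bsub>R\<^esub>" u] u hp[of p] by (simp add: p_elem_def)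
    have "PA.pcong k \<one>\<^bsub>A\<^esub> \<zero>\<^bsub>A\<^esub>" for k
    proof -
      have "p_elem p A [^]\<^bsub>A\<^esub> k \<otimes>\<^bsub>A\<^esub> ?h u [^]\<^bsub>A\<^esub> k = \<one>\<^bsub>A\<^esub>"
        using AA.nat_pow_distrib[of "p_elem p A" "?h u" k] pu u(1) hc by (simp add: AA.nat_pow_one)
      then show ?thesis unfolding PA.pcong_iff using u(1) hc
        by (intro conjI bexI[of _ "?h u [^]\<^bsub>A\<^esub> k"]) auto
    qed
    then have "\<one>\<^bsub>A\<^esub> = \<zero>\<^bsub>A\<^esub>" by (rule PA.pcong_separated)
    then have "\<one>\<^bsub>A\<^esub> \<in> ?K" using ideal.axioms(1)[OF K] additive_subgroup.zero_closed by fastforce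
    then show False using ideal.one_imp_carrier[OF K] assms(5) by blast
  qed
  have pK: "p_elem p A \<in> ?K" using hK[OF pm] hp[of p] by (simp add: p_elem_def)
  interpret SP: semiperfect_over A p ?K
    using perf K pK by (intro semiperfect_over.intro PA.p_base_axioms semiperfect_over_axioms.intro)
      (auto simp: perfectoid_def)
  obtain xs where xs: "length xs = n" "set xs \<subseteq> \<mm>"
    "\<And>Q. ideal Q R \<Longrightarrow> set xs \<subseteq> Q \<Longrightarrow> (\<And>y k. y \<in> carrier R \<Longrightarrow> y [^]\<^bsub>R\<^esub> (k::nat) \<in> Q \<Longrightarrow> y \<in> Q) \<Longrightarrow> \<mm> \<subseteq> Q"
    using R.parameters_radical[OF loc assms(7)] by metis
  obtain om where om: "compatible_roots A {\<zero>\<^bsub>A\<^esub>} p om"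
    "\<And>m a. a \<in> carrier A \<Longrightarrow> om m \<otimes>\<^bsub>A\<^esub> a \<in> {\<zero>\<^bsub>A\<^esub>} \<Longrightarrow> om (Suc m) \<otimes>\<^bsub>A\<^esub> a \<in> {\<zero>\<^bsub>A\<^esub>}"
    "SP.perfect_ideal (root_ideal A {\<zero>\<^bsub>A\<^esub>} om)"
    using SP.perfectoid_root_ideal[OF perf] by metis
  let ?J0 = "root_ideal A {\<zero>\<^bsub>A\<^esub>} om"
  have "set (map ?h xs) \<subseteq> SP.rad_K" using xs(2) hK SP.rad_K_superset by auto
  from exact_mod_adjoin_list[OF SP.semiperfect_over_axioms alg om(3) this, of M] obtain J where
    J: "SP.perfect_ideal J" "set (map ?h xs) \<subseteq> J"
    "\<And>s. (\<forall>i. s \<le> i \<and> i \<le> s + length xs \<longrightarrow> exact_mod R M A ?J0 i) \<Longrightarrow> exact_mod R M A J (s + length xs)"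
    by auto
  have JI: "ideal J A" and JK: "J \<subseteq> SP.rad_K"
    and Jp: "\<And>a. a \<in> carrier A \<Longrightarrow> a [^]\<^bsub>A\<^esub> p \<in> J \<Longrightarrow> a \<in> J"
    using J(1) by (simp_all add: SP.perfect_ideal_def)
  have J1: "\<one>\<^bsub>A\<^esub> \<notin> J"
  proof
    assume "\<one>\<^bsub>A\<^esub> \<in> J"
    then have "\<one>\<^bsub>A\<^esub> \<in> ?K" using SP.one_in_rad_K JK by blast
    then show False using ideal.one_imp_carrier[OF K] assms(5) by blast
  qed
  \<comment> \<open>Closure under p-th roots gives closure under all roots, because k \<le>
    p^k.\<close>
  have Jrad: "a \<in> J" if a: "a \<in> carrier A" "a [^]\<^bsub>A\<^esub> (k :: nat) \<in> J" for a k
  proof -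
    interpret J: ideal J A by (rule JI)
    have "k \<le> p ^ k" using power_gt_expt[of p k] prime_gt_1_nat[OF assms(1)] by simp
    then have "a [^]\<^bsub>A\<^esub> (p ^ k) = a [^]\<^bsub>A\<^esub> k \<otimes>\<^bsub>A\<^esub> a [^]\<^bsub>A\<^esub> (p ^ k - k)" using a(1) by (simp add: AA.nat_pow_mult)
    then have "a [^]\<^bsub>A\<^esub> (p ^ k) \<in> J" using J.I_r_closed[OF a(2)] a(1) by simp
    moreover have "a [^]\<^bsub>A\<^esub> (p ^ j) \<in> J \<Longrightarrow> a \<in> J" for j
    proof (induction j)
      case 0 then show ?case using a(1) by simp
    next
      case (Suc j)
      have "(a [^]\<^bsub>A\<^esub> (p ^ j)) [^]\<^bsub>A\<^esub> p \<in> J" using Suc.prems a(1) by (simp add: AA.nat_pow_pow mult.commute)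
      then have "a [^]\<^bsub>A\<^esub> (p ^ j) \<in> J" by (rule Jp[OF AA.nat_pow_closed[OF a(1)]])
      then show ?case by (rule Suc.IH)
    qed
    ultimately show ?thesis by blast
  qed
  have mJ: "?h r \<in> J" if "r \<in> \<mm>" for r
  proof -
    interpret J: ideal J A by (rule JI)
    \<comment> \<open>The contraction of J to R is a radical ideal containing the parameters, so it
      contains \<mm>.\<close>
    let ?Q = "{r \<in> carrier R. ?h r \<in> J}"
    have "ideal ?Q R"
    proof (rule idealI[OF R.ring_axioms])
      show "subgroup ?Q (add_monoid R)"
      proof (rule R.add.subgroupI)
        show "?Q \<noteq> {}" using J.zero_closed R.zero_closed h.hom_zero by force
        show "\<ominus>\<^bsub>R\<^esub> a \<in> ?Q" if "a \<in> ?Q" for a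
          using that J.a_inv_closed[of "?h a"] h.hom_a_inv[of a] by simp
        show "a \<oplus>\<^bsub>R\<^esub> b \<in> ?Q" if "a \<in> ?Q" "b \<in> ?Q" for a b
          using that J.a_closed[of "?h a" "?h b"] h.hom_add[of a b] by simp
      qed auto
      show "x \<otimes>\<^bsub>R\<^esub> a \<in> ?Q" if "a \<in> ?Q" "x \<in> carrier R" for a x
        using that J.I_l_closed[of "?h a" "?h x"] h_mult[of x a] hc[of x] by simp
      show "a \<otimes>\<^bsub>R\<^esub> x \<in> ?Q" if "a \<in> ?Q" "x \<in> carrier R" for a x
        using that J.I_r_closed[of "?h a" "?h x"] h_mult[of a x] hc[of x] by simp
    qed
    moreover have "set xs \<subseteq> ?Q" using J(2) xs(2) m.Icarr by auto
    moreover have "y \<in> ?Q" if "y \<in> carrier R" "y [^]\<^bsub>R\<^esub> (k::nat) \<in> ?Q" for y k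
      using that Jrad[of "?h y" k] hc h.hom_pow[of y k] by simp
    ultimately have "\<mm> \<subseteq> ?Q" by (rule xs(3))
    then show ?thesis using that by blast
  qed
  have main: "is_zero_module (Tor (s + n + 1) R (quot_module (regular_module R) \<mm>) M)"
    if T: "\<forall>i. s \<le> i \<and> i \<le> s + n + 1 \<longrightarrow> is_zero_module (Tor i R A M)" for s
  proof -
    have ex0: "exact_mod R M A {\<zero>\<^bsub>A\<^esub>} i" if "s \<le> i" "i \<le> s + n + 1" for i
      using T that is_zero_Tor_iff[OF A.module] by blast
    \<comment> \<open>Of the n + 2 degrees from s to s + n + 1, passing to \<open>?J0\<close> uses
      up degree s; the n parameters then reduce the remaining window to the degree s + n +
      1.\<close>
    have "exact_mod R M A ?J0 i" if i: "Suc s \<le> i" "i \<le> Suc s + n" for i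
    proof -
      obtain j where j: "i = Suc j" using i(1) by (cases i) auto
      show ?thesis unfolding j by (rule exact_mod_root_ideal[OF alg om(1,2)]) (use ex0 i j in auto)
    qed
    then have "exact_mod R M A J (Suc s + n)" using J(3)[of "Suc s"] xs(1) by simp
    then have exJ: "exact_mod R M A J (s + n + 1)" by simp
    show ?thesis
      by (rule is_zero_Tor_residue_field[OF alg m.is_ideal R.local_unit[OF loc] JI J1 mJ exJ])
  qed
  have "\<exists>N. \<forall>j\<ge>N. is_zero_module (Tor j R (quot_module (regular_module R) \<mm>) M)"
    if "\<forall>j\<ge>N. is_zero_module (Tor j R A M)" for N
  \<comment> \<open>Every j beyond this bound is s + n + 1 with s at least N.\<close>
  proof (intro exI[of _ "N + n + 1"] allI impI)
    fix j assume j: "N + n + 1 \<le> j"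
    have "is_zero_module (Tor ((j - n - 1) + n + 1) R (quot_module (regular_module R) \<mm>) M)"
      by (rule main) (use that j in auto)
    then show "is_zero_module (Tor j R (quot_module (regular_module R) \<mm>) M)" using j by simp
  qed
  then show ?thesis
    using main residue_field_char[OF m.maximalideal_axioms cR assms(1) pm] by blast
qed

end
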